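(* Let $k$ be an algebraically closed field of characteristic $0$, let $\mathbf{F}$ be a finite field, let $\mathcal{E}$ be an $\mathbf{F}$-linear semi-simple pre-Tannakian category, and let $\chi \colon \mathbf{F}^{\times} \to k^{\times}$ be a character. Then the category $k[\mathcal{E}]^{\sharp}_{\chi}$, with the tensor product $\underline{\otimes}$ induced from that of $\mathcal{E}$, is a $k$-linear semi-simple pre-Tannakian category.
   Context: Pre-Tannakian categories. Let $F$ be a field. An $F$-linear tensor category is an $F$-linear additive category equipped with an $F$-bilinear symmetric monoidal structure. It is pre-Tannakian if: (a) it is abelian and all objects have finite length; (b) all $\operatorname{Hom}$ spaces are finite dimensional over $F$; (c) it is rigid (every object has a dual); (d) $\operatorname{End}(\mathbf{1}) = F$, where $\mathbf{1}$ is the monoidal unit. It is semi-simple if every object is a finite direct sum of simple objects. Linearization. $k[\mathcal{E}]$ is the $k$-linear category with the same objects as $\mathcal{E}$ (an object $X$ is written $[X]$ when regarded in $k[\mathcal{E}]$), with $\operatorname{Hom}_{k[\mathcal{E}]}([X],[Y]) = k[\operatorname{Hom}_{\mathcal{E}}(X,Y)]$, the $k$-vector space with basis the set $\operatorname{Hom}_{\mathcal{E}}(X,Y)$ (the basis vector of $\varphi$ is written $[\varphi]$), and with $k$-bilinear composition satisfying $[\psi]\circ[\varphi] = [\psi\circ\varphi]$. The symmetric monoidal structure $\otimes$ of $\mathcal{E}$ induces a $k$-bilinear symmetric monoidal structure $\underline{\otimes}$ on $k[\mathcal{E}]$ with $[X]\,\underline{\otimes}\,[Y] = [X\otimes Y]$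 and $[\varphi]\,\underline{\otimes}\,[\psi]=[\varphi\otimes\psi]$. Envelope. $k[\mathcal{E}]^{\sharp}$ is the additive--Karoubi envelope of $k[\mathcal{E}]$: first form the additive envelope (objects are finite formal direct sums of objects, morphisms are matrices of morphisms), and then the Karoubi envelope (objects are pairs $(X,e)$, also written $eX$, with $e$ an idempotent endomorphism of $X$). The operation $\underline{\otimes}$ extends to a $k$-bilinear symmetric monoidal structure on $k[\mathcal{E}]^{\sharp}$. Idempotents. Let $q = \#\mathbf{F}$, let $k[\mathbf{F}]$ be the monoid algebra of the multiplicative monoid $(\mathbf{F},\cdot)$, and let $[a]$ be the basis element corresponding to $a\in\mathbf{F}$. The category $k[\mathcal{E}]^{\sharp}$ is naturally $k[\mathbf{F}]$-linear, with $[a]$ acting on $[X]$ by $[a\cdot \mathrm{id}_X]$. Put $$e_{\chi} = -\delta_{\chi}[0] + \frac{1}{q-1}\sum_{a\in\mathbf{F}^{\times}} \chi^{-1}(a)[a] \in k[\mathbf{F}],$$ where $\delta_\chi$ is $1$ if $\chi$ is trivial and $0$ otherwise; this is an idempotent. For an object $X$ of $k[\mathcal{E}]^{\sharp}$, $e_\chi X$ denotes the image of $e_\chi$ acting on $X$. The category $k[\mathcal{E}]^{\sharp}_{\chi}$ is the full subcategory of $k[\mathcal{E}]^{\sharp}$ on objects $X$ with $X = e_{\chi}X$ (i.e. $e_\chi$ acts as the identity on $X$). It is closed under $\underline{\otimes}$, and its monoidal unit is $e_\chi[\mathbf{1}]$, where $\mathbf{1}$ is the unit of $\mathcal{E}$.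 *)

theory Defs
  imports
    "HOL-Computational_Algebra.Computational_Algebra"
    "HOL-Library.Poly_Mapping"
    "Jordan_Normal_Form.Matrix"
begin

section \<open>Categories\<close>

text \<open>
  A category is given by a set of objects, a family of Hom sets and a composition. The Hom sets
  need not be disjoint, but the operations on morphisms do not depend on the choice of source and
  target objects. Every category whose Hom sets are pairwise disjoint is directly of this form.
\<close>

record ('o, 'm) category =
  Obj :: "'o set"
  Hom :: "'o \<Rightarrow> 'o \<Rightarrow> 'm set"
  idm :: "'o \<Rightarrow> 'm"
  cmp :: "'m \<Rightarrow> 'm \<Rightarrow> 'm"  (infixl "\<cdot>\<index>" 70)

locale category =
  fixes C :: "('o, 'm, 'x) category_scheme" (structure)
  assumes idm_in: "X \<in> Obj C \<Longrightarrow> idm C X \<in> Hom C X X"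
    and cmp_in: "\<lbrakk>X \<in> Obj C; Y \<in> Obj C; Z \<in> Obj C; f \<in> Hom C X Y; g \<in> Hom C Y Z\<rbrakk>
      \<Longrightarrow> g \<cdot> f \<in> Hom C X Z"
    and idm_left: "\<lbrakk>X \<in> Obj C; Y \<in> Obj C; f \<in> Hom C X Y\<rbrakk> \<Longrightarrow> idm C Y \<cdot> f = f"
    and idm_right: "\<lbrakk>X \<in> Obj C; Y \<in> Obj C; f \<in> Hom C X Y\<rbrakk> \<Longrightarrow> f \<cdot> idm C X = f"
    and cmp_assoc: "\<lbrakk>W \<in> Obj C; X \<in> Obj C; Y \<in> Obj C; Z \<in> Obj C;
        f \<in> Hom C W X; g \<in> Hom C X Y; h \<in> Hom C Y Z\<rbrakk>
      \<Longrightarrow> (h \<cdot> g) \<cdot> f = h \<cdot> (g \<cdot> f)"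

definition inverse_arrows :: "('o, 'm, 'x) category_scheme \<Rightarrow> 'o \<Rightarrow> 'o \<Rightarrow> 'm \<Rightarrow> 'm \<Rightarrow> bool" where
  "inverse_arrows C X Y f g \<longleftrightarrow> f \<in> Hom C X Y \<and> g \<in> Hom C Y X
     \<and> g \<cdot>\<^bsub>C\<^esub> f = idm C X \<and> f \<cdot>\<^bsub>C\<^esub> g = idm C Y"

definition is_iso :: "('o, 'm, 'x) category_scheme \<Rightarrow> 'o \<Rightarrow> 'o \<Rightarrow> 'm \<Rightarrow> bool" where
  "is_iso C X Y f \<longleftrightarrow> (\<exists>g. inverse_arrows C X Y f g)"

definition inv_arrow :: "('o, 'm, 'x) category_scheme \<Rightarrow> 'o \<Rightarrow> 'o \<Rightarrow> 'm \<Rightarrow> 'm" where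
  "inv_arrow C X Y f = (THE g. inverse_arrows C X Y f g)"

definition is_mono :: "('o, 'm, 'x) category_scheme \<Rightarrow> 'o \<Rightarrow> 'o \<Rightarrow> 'm \<Rightarrow> bool" where
  "is_mono C X Y f \<longleftrightarrow> f \<in> Hom C X Y
     \<and> (\<forall>T\<in>Obj C. \<forall>u\<in>Hom C T X. \<forall>v\<in>Hom C T X. f \<cdot>\<^bsub>C\<^esub> u = f \<cdot>\<^bsub>C\<^esub> v \<longrightarrow> u = v)"

definition is_epi :: "('o, 'm, 'x) category_scheme \<Rightarrow> 'o \<Rightarrow> 'o \<Rightarrow> 'm \<Rightarrow> bool" where
  "is_epi C X Y f \<longleftrightarrow> f \<in> Hom C X Y
     \<and> (\<forall>T\<in>Obj C. \<forall>u\<in>Hom C Y T. \<forall>v\<in>Hom C Y T. u \<cdot>\<^bsub>C\<^esub> f = v \<cdot>\<^bsub>C\<^esub> f \<longrightarrow> u = v)"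

definition zero_object :: "('o, 'm, 'x) category_scheme \<Rightarrow> 'o \<Rightarrow> bool" where
  "zero_object C Z \<longleftrightarrow> Z \<in> Obj C
     \<and> (\<forall>X\<in>Obj C. (\<exists>!f. f \<in> Hom C Z X) \<and> (\<exists>!f. f \<in> Hom C X Z))"

definition simple_object :: "('o, 'm, 'x) category_scheme \<Rightarrow> 'o \<Rightarrow> bool" where
  "simple_object C S \<longleftrightarrow> S \<in> Obj C \<and> \<not> zero_object C S
     \<and> (\<forall>Y\<in>Obj C. \<forall>i. is_mono C Y S i \<longrightarrow> zero_object C Y \<or> is_iso C Y S i)"


section \<open>Symmetric monoidal categories\<close>

record ('o, 'm) sm_category = "('o, 'm) category" +
  tenO :: "'o \<Rightarrow> 'o \<Rightarrow> 'o"  (infixl "\<otimes>\<^sub>o\<index>" 75)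
  tenM :: "'m \<Rightarrow> 'm \<Rightarrow> 'm"  (infixl "\<otimes>\<^sub>m\<index>" 75)
  unt :: "'o"
  asc :: "'o \<Rightarrow> 'o \<Rightarrow> 'o \<Rightarrow> 'm"
  lun :: "'o \<Rightarrow> 'm"
  run :: "'o \<Rightarrow> 'm"
  brd :: "'o \<Rightarrow> 'o \<Rightarrow> 'm"

locale symmetric_monoidal_category = category C
  for C :: "('o, 'm, 'x) sm_category_scheme" (structure) +
  assumes unt_in: "unt C \<in> Obj C"
    and tenO_in: "\<lbrakk>X \<in> Obj C; Y \<in> Obj C\<rbrakk> \<Longrightarrow> X \<otimes>\<^sub>o Y \<in> Obj C"
    and tenM_in: "\<lbrakk>X \<in> Obj C; Y \<in> Obj C; X' \<in> Obj C; Y' \<in> Obj C;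
        f \<in> Hom C X Y; f' \<in> Hom C X' Y'\<rbrakk>
      \<Longrightarrow> f \<otimes>\<^sub>m f' \<in> Hom C (X \<otimes>\<^sub>o X') (Y \<otimes>\<^sub>o Y')"
    and tenM_idm: "\<lbrakk>X \<in> Obj C; Y \<in> Obj C\<rbrakk> \<Longrightarrow> idm C X \<otimes>\<^sub>m idm C Y = idm C (X \<otimes>\<^sub>o Y)"
    and tenM_cmp: "\<lbrakk>X \<in> Obj C; Y \<in> Obj C; Z \<in> Obj C; X' \<in> Obj C; Y' \<in> Obj C; Z' \<in> Obj C;
        f \<in> Hom C X Y; g \<in> Hom C Y Z; f' \<in> Hom C X' Y'; g' \<in> Hom C Y' Z'\<rbrakk>
      \<Longrightarrow> (g \<cdot> f) \<otimes>\<^sub>m (g' \<cdot> f') = (g \<otimes>\<^sub>m g') \<cdot> (f \<otimes>\<^sub>m f')"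
    and asc_iso: "\<lbrakk>X \<in> Obj C; Y \<in> Obj C; Z \<in> Obj C\<rbrakk>
      \<Longrightarrow> is_iso C ((X \<otimes>\<^sub>o Y) \<otimes>\<^sub>o Z) (X \<otimes>\<^sub>o (Y \<otimes>\<^sub>o Z)) (asc C X Y Z)"
    and asc_nat: "\<lbrakk>X \<in> Obj C; Y \<in> Obj C; Z \<in> Obj C; X' \<in> Obj C; Y' \<in> Obj C; Z' \<in> Obj C;
        f \<in> Hom C X X'; g \<in> Hom C Y Y'; h \<in> Hom C Z Z'\<rbrakk>
      \<Longrightarrow> asc C X' Y' Z' \<cdot> ((f \<otimes>\<^sub>m g) \<otimes>\<^sub>m h) = (f \<otimes>\<^sub>m (g \<otimes>\<^sub>m h)) \<cdot> asc C X Y Z"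
    and lun_iso: "X \<in> Obj C \<Longrightarrow> is_iso C (unt C \<otimes>\<^sub>o X) X (lun C X)"
    and lun_nat: "\<lbrakk>X \<in> Obj C; Y \<in> Obj C; f \<in> Hom C X Y\<rbrakk>
      \<Longrightarrow> lun C Y \<cdot> (idm C (unt C) \<otimes>\<^sub>m f) = f \<cdot> lun C X"
    and run_iso: "X \<in> Obj C \<Longrightarrow> is_iso C (X \<otimes>\<^sub>o unt C) X (run C X)"
    and run_nat: "\<lbrakk>X \<in> Obj C; Y \<in> Obj C; f \<in> Hom C X Y\<rbrakk>
      \<Longrightarrow> run C Y \<cdot> (f \<otimes>\<^sub>m idm C (unt C)) = f \<cdot> run C X"
    and pentagon: "\<lbrakk>W \<in> Obj C; X \<in> Obj C; Y \<in> Obj C; Z \<in> Obj C\<rbrakk>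
      \<Longrightarrow> asc C W X (Y \<otimes>\<^sub>o Z) \<cdot> asc C (W \<otimes>\<^sub>o X) Y Z
        = (idm C W \<otimes>\<^sub>m asc C X Y Z) \<cdot> asc C W (X \<otimes>\<^sub>o Y) Z \<cdot> (asc C W X Y \<otimes>\<^sub>m idm C Z)"
    and triangle: "\<lbrakk>X \<in> Obj C; Y \<in> Obj C\<rbrakk>
      \<Longrightarrow> (idm C X \<otimes>\<^sub>m lun C Y) \<cdot> asc C X (unt C) Y = run C X \<otimes>\<^sub>m idm C Y"
    and brd_in: "\<lbrakk>X \<in> Obj C; Y \<in> Obj C\<rbrakk> \<Longrightarrow> brd C X Y \<in> Hom C (X \<otimes>\<^sub>o Y) (Y \<otimes>\<^sub>o X)"
    and brd_nat: "\<lbrakk>X \<in> Obj C; Y \<in> Obj C; X' \<in> Obj C; Y' \<in> Obj C;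
        f \<in> Hom C X X'; g \<in> Hom C Y Y'\<rbrakk>
      \<Longrightarrow> brd C X' Y' \<cdot> (f \<otimes>\<^sub>m g) = (g \<otimes>\<^sub>m f) \<cdot> brd C X Y"
    and brd_sym: "\<lbrakk>X \<in> Obj C; Y \<in> Obj C\<rbrakk> \<Longrightarrow> brd C Y X \<cdot> brd C X Y = idm C (X \<otimes>\<^sub>o Y)"
    and hexagon: "\<lbrakk>X \<in> Obj C; Y \<in> Obj C; Z \<in> Obj C\<rbrakk>
      \<Longrightarrow> asc C Y Z X \<cdot> brd C X (Y \<otimes>\<^sub>o Z) \<cdot> asc C X Y Z
        = (idm C Y \<otimes>\<^sub>m brd C X Z) \<cdot> asc C Y X Z \<cdot> (brd C X Y \<otimes>\<^sub>m idm C Z)"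

definition is_dual :: "('o, 'm, 'x) sm_category_scheme \<Rightarrow> 'o \<Rightarrow> 'o \<Rightarrow> bool" where
  "is_dual C X D \<longleftrightarrow> D \<in> Obj C \<and>
     (\<exists>ev\<in>Hom C (D \<otimes>\<^sub>o\<^bsub>C\<^esub> X) (unt C). \<exists>coev\<in>Hom C (unt C) (X \<otimes>\<^sub>o\<^bsub>C\<^esub> D).
        run C X \<cdot>\<^bsub>C\<^esub> (idm C X \<otimes>\<^sub>m\<^bsub>C\<^esub> ev) \<cdot>\<^bsub>C\<^esub> asc C X D X \<cdot>\<^bsub>C\<^esub> (coev \<otimes>\<^sub>m\<^bsub>C\<^esub> idm C X)
          \<cdot>\<^bsub>C\<^esub> inv_arrow C (unt C \<otimes>\<^sub>o\<^bsub>C\<^esub> X) X (lun C X) = idm C X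
      \<and> lun C D \<cdot>\<^bsub>C\<^esub> (ev \<otimes>\<^sub>m\<^bsub>C\<^esub> idm C D)
          \<cdot>\<^bsub>C\<^esub> inv_arrow C ((D \<otimes>\<^sub>o\<^bsub>C\<^esub> X) \<otimes>\<^sub>o\<^bsub>C\<^esub> D) (D \<otimes>\<^sub>o\<^bsub>C\<^esub> (X \<otimes>\<^sub>o\<^bsub>C\<^esub> D)) (asc C D X D)
          \<cdot>\<^bsub>C\<^esub> (idm C D \<otimes>\<^sub>m\<^bsub>C\<^esub> coev) \<cdot>\<^bsub>C\<^esub> inv_arrow C (D \<otimes>\<^sub>o\<^bsub>C\<^esub> unt C) D (run C D) = idm C D)"


section \<open>Linear categories and tensor categories\<close>

record ('o, 'm, 's) tensor_category = "('o, 'm) sm_category" +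
  zeroM :: "'o \<Rightarrow> 'o \<Rightarrow> 'm"
  addM :: "'m \<Rightarrow> 'm \<Rightarrow> 'm"  (infixl "\<oplus>\<^sub>m\<index>" 65)
  scaleM :: "'s \<Rightarrow> 'm \<Rightarrow> 'm"  (infixr "*\<^sub>m\<index>" 76)

locale linear_category = category C
  for C :: "('o, 'm, 's::field, 'x) tensor_category_scheme" (structure) +
  assumes zer_in: "\<lbrakk>X \<in> Obj C; Y \<in> Obj C\<rbrakk> \<Longrightarrow> zeroM C X Y \<in> Hom C X Y"
    and add_in: "\<lbrakk>X \<in> Obj C; Y \<in> Obj C; f \<in> Hom C X Y; g \<in> Hom C X Y\<rbrakk> \<Longrightarrow> f \<oplus>\<^sub>m g \<in> Hom C X Y"
    and smul_in: "\<lbrakk>X \<in> Obj C; Y \<in> Obj C; f \<in> Hom C X Y\<rbrakk> \<Longrightarrow> a *\<^sub>m f \<in> Hom C X Y"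
    and add_assoc: "\<lbrakk>X \<in> Obj C; Y \<in> Obj C; f \<in> Hom C X Y; g \<in> Hom C X Y; h \<in> Hom C X Y\<rbrakk>
      \<Longrightarrow> (f \<oplus>\<^sub>m g) \<oplus>\<^sub>m h = f \<oplus>\<^sub>m (g \<oplus>\<^sub>m h)"
    and add_comm: "\<lbrakk>X \<in> Obj C; Y \<in> Obj C; f \<in> Hom C X Y; g \<in> Hom C X Y\<rbrakk> \<Longrightarrow> f \<oplus>\<^sub>m g = g \<oplus>\<^sub>m f"
    and zer_add: "\<lbrakk>X \<in> Obj C; Y \<in> Obj C; f \<in> Hom C X Y\<rbrakk> \<Longrightarrow> zeroM C X Y \<oplus>\<^sub>m f = f"
    and add_inv: "\<lbrakk>X \<in> Obj C; Y \<in> Obj C; f \<in> Hom C X Y\<rbrakk> \<Longrightarrow> \<exists>g\<in>Hom C X Y. g \<oplus>\<^sub>m f = zeroM C X Y"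
    and smul_one: "\<lbrakk>X \<in> Obj C; Y \<in> Obj C; f \<in> Hom C X Y\<rbrakk> \<Longrightarrow> 1 *\<^sub>m f = f"
    and smul_smul: "\<lbrakk>X \<in> Obj C; Y \<in> Obj C; f \<in> Hom C X Y\<rbrakk> \<Longrightarrow> a *\<^sub>m (b *\<^sub>m f) = (a * b) *\<^sub>m f"
    and smul_add_left: "\<lbrakk>X \<in> Obj C; Y \<in> Obj C; f \<in> Hom C X Y\<rbrakk>
      \<Longrightarrow> (a + b) *\<^sub>m f = a *\<^sub>m f \<oplus>\<^sub>m b *\<^sub>m f"
    and smul_add_right: "\<lbrakk>X \<in> Obj C; Y \<in> Obj C; f \<in> Hom C X Y; g \<in> Hom C X Y\<rbrakk>
      \<Longrightarrow> a *\<^sub>m (f \<oplus>\<^sub>m g) = a *\<^sub>m f \<oplus>\<^sub>m a *\<^sub>m g"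
    and cmp_add_left: "\<lbrakk>X \<in> Obj C; Y \<in> Obj C; Z \<in> Obj C;
        f \<in> Hom C X Y; g \<in> Hom C Y Z; g' \<in> Hom C Y Z\<rbrakk>
      \<Longrightarrow> (g \<oplus>\<^sub>m g') \<cdot> f = (g \<cdot> f) \<oplus>\<^sub>m (g' \<cdot> f)"
    and cmp_add_right: "\<lbrakk>X \<in> Obj C; Y \<in> Obj C; Z \<in> Obj C;
        f \<in> Hom C X Y; f' \<in> Hom C X Y; g \<in> Hom C Y Z\<rbrakk>
      \<Longrightarrow> g \<cdot> (f \<oplus>\<^sub>m f') = (g \<cdot> f) \<oplus>\<^sub>m (g \<cdot> f')"
    and cmp_smul_left: "\<lbrakk>X \<in> Obj C; Y \<in> Obj C; Z \<in> Obj C; f \<in> Hom C X Y; g \<in> Hom C Y Z\<rbrakk>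
      \<Longrightarrow> (a *\<^sub>m g) \<cdot> f = a *\<^sub>m (g \<cdot> f)"
    and cmp_smul_right: "\<lbrakk>X \<in> Obj C; Y \<in> Obj C; Z \<in> Obj C; f \<in> Hom C X Y; g \<in> Hom C Y Z\<rbrakk>
      \<Longrightarrow> g \<cdot> (a *\<^sub>m f) = a *\<^sub>m (g \<cdot> f)"

definition hom_sum :: "('o, 'm, 's, 'x) tensor_category_scheme \<Rightarrow> 'o \<Rightarrow> 'o \<Rightarrow> 'm list \<Rightarrow> 'm" where
  "hom_sum C X Y fs = foldr (addM C) fs (zeroM C X Y)"

definition is_direct_sum ::
    "('o, 'm, 's, 'x) tensor_category_scheme \<Rightarrow> 'o list \<Rightarrow> 'o \<Rightarrow> bool" where
  "is_direct_sum C Xs Y \<longleftrightarrow> set Xs \<subseteq> Obj C \<and> Y \<in> Obj C \<and>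
     (\<exists>i p. (\<forall>j<length Xs. i j \<in> Hom C (Xs ! j) Y \<and> p j \<in> Hom C Y (Xs ! j))
        \<and> (\<forall>j<length Xs. \<forall>l<length Xs.
             p l \<cdot>\<^bsub>C\<^esub> i j = (if j = l then idm C (Xs ! j) else zeroM C (Xs ! j) (Xs ! l)))
        \<and> hom_sum C Y Y (map (\<lambda>j. i j \<cdot>\<^bsub>C\<^esub> p j) [0..<length Xs]) = idm C Y)"

locale additive_category = linear_category C
  for C :: "('o, 'm, 's::field, 'x) tensor_category_scheme" (structure) +
  assumes zero_object_ex: "\<exists>Z. zero_object C Z"
    and direct_sum_ex: "\<lbrakk>X \<in> Obj C; Y \<in> Obj C\<rbrakk> \<Longrightarrow> \<exists>Z. is_direct_sum C [X, Y] Z"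

locale tensor_category = symmetric_monoidal_category C + additive_category C
  for C :: "('o, 'm, 's::field, 'x) tensor_category_scheme" (structure) +
  assumes tenM_add_left: "\<lbrakk>X \<in> Obj C; Y \<in> Obj C; X' \<in> Obj C; Y' \<in> Obj C;
        f \<in> Hom C X Y; g \<in> Hom C X Y; h \<in> Hom C X' Y'\<rbrakk>
      \<Longrightarrow> (f \<oplus>\<^sub>m g) \<otimes>\<^sub>m h = (f \<otimes>\<^sub>m h) \<oplus>\<^sub>m (g \<otimes>\<^sub>m h)"
    and tenM_add_right: "\<lbrakk>X \<in> Obj C; Y \<in> Obj C; X' \<in> Obj C; Y' \<in> Obj C;
        f \<in> Hom C X Y; g \<in> Hom C X' Y'; h \<in> Hom C X' Y'\<rbrakk>
      \<Longrightarrow> f \<otimes>\<^sub>m (g \<oplus>\<^sub>m h) = (f \<otimes>\<^sub>m g) \<oplus>\<^sub>m (f \<otimes>\<^sub>m h)"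
    and tenM_smul_left: "\<lbrakk>X \<in> Obj C; Y \<in> Obj C; X' \<in> Obj C; Y' \<in> Obj C;
        f \<in> Hom C X Y; g \<in> Hom C X' Y'\<rbrakk> \<Longrightarrow> (a *\<^sub>m f) \<otimes>\<^sub>m g = a *\<^sub>m (f \<otimes>\<^sub>m g)"
    and tenM_smul_right: "\<lbrakk>X \<in> Obj C; Y \<in> Obj C; X' \<in> Obj C; Y' \<in> Obj C;
        f \<in> Hom C X Y; g \<in> Hom C X' Y'\<rbrakk> \<Longrightarrow> f \<otimes>\<^sub>m (a *\<^sub>m g) = a *\<^sub>m (f \<otimes>\<^sub>m g)"


section \<open>Pre-Tannakian categories\<close>

text \<open>\<open>is_kernel C X Y f K i\<close>: the morphism \<open>i\<close> from \<open>K\<close> to \<open>X\<close> is a kernel of \<open>f\<close> from \<open>X\<close> to \<open>Y\<close>;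
  \<open>is_cokernel C X Y f Q p\<close>: the morphism \<open>p\<close> from \<open>Y\<close> to \<open>Q\<close> is a cokernel of \<open>f\<close>.\<close>

definition is_kernel ::
    "('o, 'm, 's, 'x) tensor_category_scheme \<Rightarrow> 'o \<Rightarrow> 'o \<Rightarrow> 'm \<Rightarrow> 'o \<Rightarrow> 'm \<Rightarrow> bool" where
  "is_kernel C X Y f K i \<longleftrightarrow> K \<in> Obj C \<and> i \<in> Hom C K X \<and> f \<cdot>\<^bsub>C\<^esub> i = zeroM C K Y
     \<and> (\<forall>T\<in>Obj C. \<forall>t\<in>Hom C T X. f \<cdot>\<^bsub>C\<^esub> t = zeroM C T Y
          \<longrightarrow> (\<exists>!u. u \<in> Hom C T K \<and> i \<cdot>\<^bsub>C\<^esub> u = t))"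

definition is_cokernel ::
    "('o, 'm, 's, 'x) tensor_category_scheme \<Rightarrow> 'o \<Rightarrow> 'o \<Rightarrow> 'm \<Rightarrow> 'o \<Rightarrow> 'm \<Rightarrow> bool" where
  "is_cokernel C X Y f Q p \<longleftrightarrow> Q \<in> Obj C \<and> p \<in> Hom C Y Q \<and> p \<cdot>\<^bsub>C\<^esub> f = zeroM C X Q
     \<and> (\<forall>T\<in>Obj C. \<forall>t\<in>Hom C Y T. t \<cdot>\<^bsub>C\<^esub> f = zeroM C X T
          \<longrightarrow> (\<exists>!u. u \<in> Hom C Q T \<and> u \<cdot>\<^bsub>C\<^esub> p = t))"

locale abelian_category = additive_category C
  for C :: "('o, 'm, 's::field, 'x) tensor_category_scheme" (structure) +
  assumes kernel_ex: "\<lbrakk>X \<in> Obj C; Y \<in> Obj C; f \<in> Hom C X Y\<rbrakk> \<Longrightarrow> \<exists>K i. is_kernel C X Y f K i"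
    and cokernel_ex: "\<lbrakk>X \<in> Obj C; Y \<in> Obj C; f \<in> Hom C X Y\<rbrakk> \<Longrightarrow> \<exists>Q p. is_cokernel C X Y f Q p"
    and mono_is_kernel: "\<lbrakk>X \<in> Obj C; Y \<in> Obj C; is_mono C X Y f\<rbrakk>
      \<Longrightarrow> \<exists>Z\<in>Obj C. \<exists>g\<in>Hom C Y Z. is_kernel C Y Z g X f"
    and epi_is_cokernel: "\<lbrakk>X \<in> Obj C; Y \<in> Obj C; is_epi C X Y f\<rbrakk>
      \<Longrightarrow> \<exists>Z\<in>Obj C. \<exists>g\<in>Hom C Z X. is_cokernel C Z X g Y f"

text \<open>An object has finite length iff it has a composition series. The second rule adds one simple
  subquotient by means of a short exact sequence \<open>0 \<rightarrow> Y \<rightarrow> X \<rightarrow> S \<rightarrow> 0\<close>.\<close>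

inductive finite_length :: "('o, 'm, 's, 'x) tensor_category_scheme \<Rightarrow> 'o \<Rightarrow> bool" for C where
  zero: "zero_object C X \<Longrightarrow> finite_length C X"
| extend: "\<lbrakk>finite_length C Y; simple_object C S; X \<in> Obj C;
      is_kernel C X S p Y i; is_cokernel C Y X i S p\<rbrakk> \<Longrightarrow> finite_length C X"

definition finite_dim_hom :: "('o, 'm, 's, 'x) tensor_category_scheme \<Rightarrow> 'o \<Rightarrow> 'o \<Rightarrow> bool" where
  "finite_dim_hom C X Y \<longleftrightarrow> (\<exists>bs. set bs \<subseteq> Hom C X Y \<and>
     (\<forall>f\<in>Hom C X Y. \<exists>cs. length cs = length bs \<and> f = hom_sum C X Y (map2 (scaleM C) cs bs)))"

locale pre_tannakian_category = tensor_category C + abelian_category C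
  for C :: "('o, 'm, 's::field, 'x) tensor_category_scheme" (structure) +
  assumes finite_lengths: "X \<in> Obj C \<Longrightarrow> finite_length C X"
    and finite_dim_homs: "\<lbrakk>X \<in> Obj C; Y \<in> Obj C\<rbrakk> \<Longrightarrow> finite_dim_hom C X Y"
    and rigid: "X \<in> Obj C \<Longrightarrow> \<exists>D. is_dual C X D"
    and end_unit: "bij_betw (\<lambda>a. a *\<^sub>m idm C (unt C)) UNIV (Hom C (unt C) (unt C))"

definition semisimple :: "('o, 'm, 's, 'x) tensor_category_scheme \<Rightarrow> bool" where
  "semisimple C \<longleftrightarrow>
     (\<forall>X\<in>Obj C. \<exists>Ss. (\<forall>S\<in>set Ss. simple_object C S) \<and> is_direct_sum C Ss X)"


section \<open>Linearization\<close>

text \<open>The bilinear extension of an operation on basis vectors.\<close>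

definition bilin_ext ::
    "('m \<Rightarrow> 'm \<Rightarrow> 'm) \<Rightarrow> ('m \<Rightarrow>\<^sub>0 'k::field) \<Rightarrow> ('m \<Rightarrow>\<^sub>0 'k) \<Rightarrow> ('m \<Rightarrow>\<^sub>0 'k)" where
  "bilin_ext op v w = (\<Sum>\<phi>\<in>Poly_Mapping.keys v. \<Sum>\<psi>\<in>Poly_Mapping.keys w.
     Poly_Mapping.single (op \<phi> \<psi>) (Poly_Mapping.lookup v \<phi> * Poly_Mapping.lookup w \<psi>))"

definition linearization ::
    "('o, 'm, 'x) sm_category_scheme \<Rightarrow> ('o, 'm \<Rightarrow>\<^sub>0 'k::field, 'k) tensor_category" where
  "linearization E =
    \<lparr>Obj = Obj E,
     Hom = (\<lambda>X Y. {v. Poly_Mapping.keys v \<subseteq> Hom E X Y}),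
     idm = (\<lambda>X. Poly_Mapping.single (idm E X) 1),
     cmp = bilin_ext (cmp E),
     tenO = tenO E,
     tenM = bilin_ext (tenM E),
     unt = unt E,
     asc = (\<lambda>X Y Z. Poly_Mapping.single (asc E X Y Z) 1),
     lun = (\<lambda>X. Poly_Mapping.single (lun E X) 1),
     run = (\<lambda>X. Poly_Mapping.single (run E X) 1),
     brd = (\<lambda>X Y. Poly_Mapping.single (brd E X Y) 1),
     zeroM = (\<lambda>X Y. 0),
     addM = (+),
     scaleM = (\<lambda>c. Poly_Mapping.map ((*) c))\<rparr>"


section \<open>Additive envelope\<close>

text \<open>A morphism between formal direct sums \<open>Xs\<close> and \<open>Ys\<close> carries its source and target; the
  matrix entry in row \<open>i\<close> and column \<open>j\<close> is a morphism from \<open>Xs ! j\<close> to \<open>Ys ! i\<close>.\<close>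

datatype ('o, 'm) mat_arrow =
  Mat_Arrow (src: "'o list") (entries: "'m mat") (tgt: "'o list")

definition mk_arrow :: "'o list \<Rightarrow> 'o list \<Rightarrow> (nat \<Rightarrow> nat \<Rightarrow> 'm) \<Rightarrow> ('o, 'm) mat_arrow" where
  "mk_arrow Xs Ys A = Mat_Arrow Xs (mat (length Ys) (length Xs) (\<lambda>(i, j). A i j)) Ys"

abbreviation entry :: "('o, 'm) mat_arrow \<Rightarrow> nat \<Rightarrow> nat \<Rightarrow> 'm" where
  "entry f i j \<equiv> entries f $$ (i, j)"

definition diag_arrow :: "('o, 'm, 's, 'x) tensor_category_scheme
    \<Rightarrow> 'o list \<Rightarrow> 'o list \<Rightarrow> 'm list \<Rightarrow> ('o, 'm) mat_arrow" where
  "diag_arrow C Xs Ys ds =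
     mk_arrow Xs Ys (\<lambda>i j. if i = j then ds ! i else zeroM C (Xs ! j) (Ys ! i))"

text \<open>The tensor product of lists distributes over the formal direct sums; its summands are ordered
  lexicographically, so the summand \<open>Xs ! i \<otimes> Ys ! j\<close> has index \<open>i * length Ys + j\<close>. With this
  ordering the associator and the unitors are diagonal.\<close>

definition ten_list :: "('o, 'm, 'x) sm_category_scheme \<Rightarrow> 'o list \<Rightarrow> 'o list \<Rightarrow> 'o list" where
  "ten_list C Xs Ys = [X \<otimes>\<^sub>o\<^bsub>C\<^esub> Y. X \<leftarrow> Xs, Y \<leftarrow> Ys]"

definition additive_envelope ::
    "('o, 'm, 's, 'x) tensor_category_scheme \<Rightarrow> ('o list, ('o, 'm) mat_arrow, 's) tensor_category" where
  "additive_envelope C =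
    \<lparr>Obj = lists (Obj C),
     Hom = (\<lambda>Xs Ys. {Mat_Arrow Xs A Ys | A. A \<in> carrier_mat (length Ys) (length Xs)
        \<and> (\<forall>i<length Ys. \<forall>j<length Xs. A $$ (i, j) \<in> Hom C (Xs ! j) (Ys ! i))}),
     idm = (\<lambda>Xs. diag_arrow C Xs Xs (map (idm C) Xs)),
     cmp = (\<lambda>g f. mk_arrow (src f) (tgt g) (\<lambda>i j.
        hom_sum C (src f ! j) (tgt g ! i)
          (map (\<lambda>l. entry g i l \<cdot>\<^bsub>C\<^esub> entry f l j) [0..<length (tgt f)]))),
     tenO = ten_list C,
     tenM = (\<lambda>f g. mk_arrow (ten_list C (src f) (src g)) (ten_list C (tgt f) (tgt g)) (\<lambda>i j.
        entry f (i div length (tgt g)) (j div length (src g))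
          \<otimes>\<^sub>m\<^bsub>C\<^esub> entry g (i mod length (tgt g)) (j mod length (src g)))),
     unt = [unt C],
     asc = (\<lambda>Xs Ys Zs. diag_arrow C
        (ten_list C (ten_list C Xs Ys) Zs) (ten_list C Xs (ten_list C Ys Zs))
        [asc C X Y Z. X \<leftarrow> Xs, Y \<leftarrow> Ys, Z \<leftarrow> Zs]),
     lun = (\<lambda>Xs. diag_arrow C (ten_list C [unt C] Xs) Xs (map (lun C) Xs)),
     run = (\<lambda>Xs. diag_arrow C (ten_list C Xs [unt C]) Xs (map (run C) Xs)),
     brd = (\<lambda>Xs Ys. mk_arrow (ten_list C Xs Ys) (ten_list C Ys Xs) (\<lambda>i j.
        if i div length Xs = j mod length Ys \<and> i mod length Xs = j div length Ys
        then brd C (Xs ! (j div length Ys)) (Ys ! (j mod length Ys))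
        else zeroM C (ten_list C Xs Ys ! j) (ten_list C Ys Xs ! i))),
     zeroM = (\<lambda>Xs Ys. mk_arrow Xs Ys (\<lambda>i j. zeroM C (Xs ! j) (Ys ! i))),
     addM = (\<lambda>f g. mk_arrow (src f) (tgt f) (\<lambda>i j. entry f i j \<oplus>\<^sub>m\<^bsub>C\<^esub> entry g i j)),
     scaleM = (\<lambda>c f. mk_arrow (src f) (tgt f) (\<lambda>i j. c *\<^sub>m\<^bsub>C\<^esub> entry f i j))\<rparr>"


section \<open>Karoubi envelope\<close>

text \<open>The identity of \<open>(X, e)\<close> is \<open>e\<close>, and the structure isomorphisms are those of \<open>C\<close> precomposed
  with the idempotent of their source.\<close>

definition karoubi_envelope ::
    "('o, 'm, 's, 'x) tensor_category_scheme \<Rightarrow> ('o \<times> 'm, 'm, 's) tensor_category" where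
  "karoubi_envelope C =
    \<lparr>Obj = {(X, e). X \<in> Obj C \<and> e \<in> Hom C X X \<and> e \<cdot>\<^bsub>C\<^esub> e = e},
     Hom = (\<lambda>(X, e) (Y, e'). {f \<in> Hom C X Y. e' \<cdot>\<^bsub>C\<^esub> f \<cdot>\<^bsub>C\<^esub> e = f}),
     idm = (\<lambda>(X, e). e),
     cmp = cmp C,
     tenO = (\<lambda>(X, e) (Y, e'). (X \<otimes>\<^sub>o\<^bsub>C\<^esub> Y, e \<otimes>\<^sub>m\<^bsub>C\<^esub> e')),
     tenM = tenM C,
     unt = (unt C, idm C (unt C)),
     asc = (\<lambda>(X, e) (Y, e') (Z, e''). asc C X Y Z \<cdot>\<^bsub>C\<^esub> ((e \<otimes>\<^sub>m\<^bsub>C\<^esub> e') \<otimes>\<^sub>m\<^bsub>C\<^esub> e'')),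
     lun = (\<lambda>(X, e). lun C X \<cdot>\<^bsub>C\<^esub> (idm C (unt C) \<otimes>\<^sub>m\<^bsub>C\<^esub> e)),
     run = (\<lambda>(X, e). run C X \<cdot>\<^bsub>C\<^esub> (e \<otimes>\<^sub>m\<^bsub>C\<^esub> idm C (unt C))),
     brd = (\<lambda>(X, e) (Y, e'). brd C X Y \<cdot>\<^bsub>C\<^esub> (e \<otimes>\<^sub>m\<^bsub>C\<^esub> e')),
     zeroM = (\<lambda>(X, e) (Y, e'). zeroM C X Y),
     addM = addM C,
     scaleM = scaleM C\<rparr>"

type_synonym ('o, 'm, 'k) env_obj = "'o list \<times> ('o, 'm \<Rightarrow>\<^sub>0 'k) mat_arrow"
type_synonym ('o, 'm, 'k) env_arrow = "('o, 'm \<Rightarrow>\<^sub>0 'k) mat_arrow"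

definition envelope :: "('o, 'm, 'x) sm_category_scheme
    \<Rightarrow> (('o, 'm, 'k::field) env_obj, ('o, 'm, 'k) env_arrow, 'k) tensor_category" where
  "envelope E = karoubi_envelope (additive_envelope (linearization E))"


section \<open>The subcategory attached to a character\<close>

text \<open>A character of the multiplicative group of a field, as a function on the whole field whose
  value at \<open>0\<close> is irrelevant.\<close>

definition is_character :: "('f::field \<Rightarrow> 'k::field) \<Rightarrow> bool" where
  "is_character \<chi> \<longleftrightarrow> (\<forall>a. a \<noteq> 0 \<longrightarrow> \<chi> a \<noteq> 0)
     \<and> (\<forall>a b. a \<noteq> 0 \<longrightarrow> b \<noteq> 0 \<longrightarrow> \<chi> (a * b) = \<chi> a * \<chi> b)"

definition chi_idem :: "('f::{field,finite} \<Rightarrow> 'k::field) \<Rightarrow> ('f \<Rightarrow>\<^sub>0 'k)" where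
  "chi_idem \<chi> =
     Poly_Mapping.single 0 (- (if \<forall>a. a \<noteq> 0 \<longrightarrow> \<chi> a = 1 then 1 else 0))
     + (\<Sum>a\<in>UNIV - {0}. Poly_Mapping.single a (1 / (of_nat (card (UNIV :: 'f set)) - 1) * inverse (\<chi> a)))"

text \<open>The endomorphism by which an element \<open>r\<close> of the monoid algebra acts on an object of the
  envelope. On \<open>[X]\<close> it is the linear combination of the morphisms \<open>[a \<cdot> id]\<close> with the
  coefficients of \<open>r\<close>, on a formal direct sum it is diagonal, and on \<open>(Xs, e)\<close> it is the composite
  of the latter with \<open>e\<close>.\<close>

definition monoid_algebra_act :: "('o, 'm, 'f::{field,finite}, 'x) tensor_category_scheme
    \<Rightarrow> ('f \<Rightarrow>\<^sub>0 'k::field) \<Rightarrow> ('o, 'm, 'k) env_obj \<Rightarrow> ('o, 'm, 'k) env_arrow" where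
  "monoid_algebra_act E r = (\<lambda>(Xs, e).
     diag_arrow (linearization E) Xs Xs
       (map (\<lambda>X. \<Sum>a\<in>UNIV. Poly_Mapping.single (a *\<^sub>m\<^bsub>E\<^esub> idm E X) (Poly_Mapping.lookup r a)) Xs)
     \<cdot>\<^bsub>additive_envelope (linearization E)\<^esub> e)"

text \<open>The unitors of the subcategory are those of the envelope precomposed with the inclusion of the
  unit \<open>e\<^sub>\<chi> \<one>\<close> into \<open>\<one>\<close>, which is \<open>e\<^sub>\<chi>\<close> itself.\<close>

definition chi_category :: "('o, 'm, 'f::{field,finite}, 'x) tensor_category_scheme
    \<Rightarrow> ('f \<Rightarrow> 'k::field) \<Rightarrow> (('o, 'm, 'k) env_obj, ('o, 'm, 'k) env_arrow, 'k) tensor_category" where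
  "chi_category E \<chi> =
     (let K = envelope E;
          act = monoid_algebra_act E (chi_idem \<chi>)
      in K\<lparr>Obj := {X \<in> Obj K. act X = idm K X},
           unt := (fst (unt K), act (unt K)),
           lun := (\<lambda>X. lun K X \<cdot>\<^bsub>K\<^esub> (act (unt K) \<otimes>\<^sub>m\<^bsub>K\<^esub> idm K X)),
           run := (\<lambda>X. run K X \<cdot>\<^bsub>K\<^esub> (idm K X \<otimes>\<^sub>m\<^bsub>K\<^esub> act (unt K)))\<rparr>)"

end

theory Submission
  imports Defs
begin

text \<open>The trace pairing of a semisimple pre-Tannakian category \<open>E\<close> is nondegenerate and vanishes on
  nilpotent endomorphisms. Over a finite field the Hom sets are finite, and a nilpotent element of the
  monoid algebra \<open>k[End X]\<close> has coefficient sum zero over every set of endomorphisms with prescribed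
  trace. If \<open>x\<close> in \<open>k[Hom X Y]\<close> has only nilpotent products \<open>yx\<close>, then its sums over all affine
  hyperplanes \<open>{f. tr (r f) = c}\<close> vanish, and inversion of the finite Radon transform gives \<open>x = 0\<close>.
  So \<open>k[E]\<close> has no nonzero nil one-sided ideals, and neither has its additive envelope. As the Hom
  spaces are finite-dimensional, the envelope is von Neumann regular (\<open>x = x y x\<close> is solvable). In the
  Karoubi envelope of such a category every morphism has a split kernel and a split image, and every
  object is a finite direct sum of objects with primitive idempotents, which are simple. Duals come
  from \<open>E\<close>. The idempotent \<open>e\<^sub>\<chi>\<close> is central, and it cuts out the summand where the endomorphisms of
  the unit are \<open>k\<close>.\<close>

section \<open>Categories with disjoint Hom sets\<close>

text \<open>The difficulty is that \<open>End X\<close> is a monoid and not a group, so Maschke's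
  theorem gives no information on its algebra. The function that tests whether \<open>tr f\<close>
  has a given value is unchanged under cyclic permutation, and also when \<open>f\<close> is
  replaced by \<open>f e\<close> for an idempotent power \<open>e\<close> of \<open>f\<close>. Hence
  it is constant on generalized conjugacy classes of the finite monoid. In characteristic 0 a
  nilpotent element has coefficient sum zero over each class: its action on spaces spanned by split
  embeddings, twisted by a group element, is nilpotent and has trace zero, and the resulting
  relations between class sums are triangular for a suitable rank. The invariance under
  \<open>f \<mapsto> f e\<close> rests on quasi-inverses in \<open>E\<close> itself. Regularity is
  therefore proved for an abstract linear category and used twice, for \<open>E\<close> and for the
  additive envelope of \<open>k[E]\<close>. It comes from a maximal family of orthogonal idempotents
  below some \<open>wx\<close>, without structure theory of algebras. The last part works with an
  arbitrary natural idempotent that is compatible with the tensor product.\<close>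

text \<open>With sources and targets given by functions, all typing conditions of compositions can be
  discharged by simplification. Tagging the morphisms reduces the general case to this one.\<close>

locale typed_category = category C for C :: "('o, 'm, 'x) category_scheme" (structure) +
  fixes dm cd :: "'m \<Rightarrow> 'o"
  assumes dm_Hom: "\<lbrakk>X \<in> Obj C; Y \<in> Obj C; f \<in> Hom C X Y\<rbrakk> \<Longrightarrow> dm f = X"
    and cd_Hom: "\<lbrakk>X \<in> Obj C; Y \<in> Obj C; f \<in> Hom C X Y\<rbrakk> \<Longrightarrow> cd f = Y"
    and dm_cmp [simp]: "dm (g \<cdot> f) = dm f" and cd_cmp [simp]: "cd (g \<cdot> f) = cd g"
    and dm_idm [simp]: "dm (idm C X) = X" and cd_idm [simp]: "cd (idm C X) = X"
begin

definition arr :: "'m \<Rightarrow> bool" where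
  "arr f \<longleftrightarrow> dm f \<in> Obj C \<and> cd f \<in> Obj C \<and> f \<in> Hom C (dm f) (cd f)"

lemma Hom_iff: "X \<in> Obj C \<Longrightarrow> Y \<in> Obj C \<Longrightarrow> f \<in> Hom C X Y \<longleftrightarrow> arr f \<and> dm f = X \<and> cd f = Y"
  by (auto simp: arr_def dm_Hom cd_Hom)

lemma arr_Obj [simp]: "arr f \<Longrightarrow> dm f \<in> Obj C" "arr f \<Longrightarrow> cd f \<in> Obj C"
  by (auto simp: arr_def)

lemma idm_arr [simp]:
  assumes "X \<in> Obj C"
  shows "arr (idm C X)"
  using idm_in[OF assms] Hom_iff[OF assms assms] by auto

lemma cmp_arr [simp]:
  assumes "arr f" "arr g" "cd f = dm g"
  shows "arr (g \<cdot> f)"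
proof -
  have "g \<cdot> f \<in> Hom C (dm f) (cd g)"
    by (rule cmp_in[of _ "dm g"]) (use assms[unfolded arr_def] in auto)
  then show "arr (g \<cdot> f)"
    using assms by (auto simp: Hom_iff)
qed

lemma cmp_idm [simp]:
  "arr f \<Longrightarrow> cd f = X \<Longrightarrow> idm C X \<cdot> f = f"
  "arr f \<Longrightarrow> dm f = X \<Longrightarrow> f \<cdot> idm C X = f"
  using idm_left[of "dm f" "cd f" f] idm_right[of "dm f" "cd f" f] unfolding arr_def by auto

lemma cmp_cmp [simp]:
  assumes "arr f" "arr g" "arr h" "cd f = dm g" "cd g = dm h"
  shows "(h \<cdot> g) \<cdot> f = h \<cdot> (g \<cdot> f)"
  by (rule cmp_assoc[of "dm f" "cd f" "cd g" "cd h"]) (use assms[unfolded arr_def] in auto)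

text \<open>As a simp rule \<open>cmp_cmp\<close> brackets every composite to the right, so an
  equation for \<open>a \<cdot> b\<close> no longer matches when a further factor \<open>r\<close>
  follows. Here such an equation is given a tail; many rules below exist in this second form for the
  same reason.\<close>

lemma cmp_ext:
  assumes "a \<cdot> b = c" "arr a" "arr b" "cd b = dm a" "arr r" "cd r = dm b"
  shows "a \<cdot> (b \<cdot> r) = c \<cdot> r"
  using assms by (metis cmp_cmp)

definition iso :: "'m \<Rightarrow> bool" where
  "iso f \<longleftrightarrow> arr f \<and> is_iso C (dm f) (cd f) f"

definition iv :: "'m \<Rightarrow> 'm" where
  "iv f = inv_arrow C (dm f) (cd f) f"

lemma isoI:
  assumes "X \<in> Obj C" "Y \<in> Obj C" "is_iso C X Y f"
  shows "iso f" "dm f = X" "cd f = Y"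
  using assms Hom_iff[OF assms(1,2)] unfolding iso_def is_iso_def inverse_arrows_def by auto

lemma inv_unique:
  assumes "arr f" "arr g" "dm g = cd f" "cd g = dm f" "g \<cdot> f = idm C (dm f)" "f \<cdot> g = idm C (cd f)"
  shows "iso f" "iv f = g"
proof -
  have 1: "inverse_arrows C (dm f) (cd f) f g"
    using assms by (auto simp: inverse_arrows_def Hom_iff)
  then show "iso f" using assms(1) by (auto simp: iso_def is_iso_def)
  have "h = g" if "inverse_arrows C (dm f) (cd f) f h" for h
  proof -
    have h: "arr h" "dm h = cd f" "cd h = dm f" "h \<cdot> f = idm C (dm f)"
      using that assms(1) by (auto simp: inverse_arrows_def Hom_iff)
    have "h = h \<cdot> (f \<cdot> g)" using h assms by simp
    also have "\<dots> = (h \<cdot> f) \<cdot> g" using h(1,2,3) assms(1-4) by simp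
    finally show ?thesis using h assms by simp
  qed
  then show "iv f = g" unfolding iv_def inv_arrow_def using 1 by blast
qed

lemma iso_inv [simp]:
  assumes "iso f"
  shows "arr f" "arr (iv f)" "dm (iv f) = cd f" "cd (iv f) = dm f"
    "iv f \<cdot> f = idm C (dm f)" "f \<cdot> iv f = idm C (cd f)"
proof -
  show a: "arr f" using assms by (simp add: iso_def)
  then obtain g where g: "arr g" "dm g = cd f" "cd g = dm f" "g \<cdot> f = idm C (dm f)" "f \<cdot> g = idm C (cd f)"
    using assms by (auto simp: iso_def is_iso_def inverse_arrows_def Hom_iff)
  have "iv f = g" using inv_unique[OF a g(1-5)] by simp
  then show "arr (iv f)" "dm (iv f) = cd f" "cd (iv f) = dm f"
    "iv f \<cdot> f = idm C (dm f)" "f \<cdot> iv f = idm C (cd f)" using g by auto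
qed

lemma iso_inv_cmp [simp]:
  assumes "iso f" "arr g"
  shows "cd g = dm f \<Longrightarrow> iv f \<cdot> (f \<cdot> g) = g" "cd g = cd f \<Longrightarrow> f \<cdot> (iv f \<cdot> g) = g"
  using assms by (auto simp flip: cmp_cmp)

lemma iso_cancel_left:
  "iso f \<Longrightarrow> f \<cdot> u = f \<cdot> v \<Longrightarrow> arr u \<Longrightarrow> arr v \<Longrightarrow> cd u = dm f \<Longrightarrow> cd v = dm f \<Longrightarrow> u = v"
  by (metis iso_inv_cmp(1))

lemma iso_cancel_right:
  assumes "iso f" "u \<cdot> f = v \<cdot> f" "arr u" "arr v" "dm u = cd f" "dm v = cd f"
  shows "u = v"
proof -
  have "(u \<cdot> f) \<cdot> iv f = (v \<cdot> f) \<cdot> iv f" using assms(2) by simp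
  then show ?thesis using assms(1,3-) by simp
qed

lemma iso_move:
  "iso f \<Longrightarrow> f \<cdot> u = v \<Longrightarrow> arr u \<Longrightarrow> cd u = dm f \<Longrightarrow> u = iv f \<cdot> v"
  by auto

lemma iso_iv [simp]: "iso f \<Longrightarrow> iso (iv f)"
  by (rule inv_unique[of _ f]) auto

end

section \<open>Coherence consequences of the monoidal axioms\<close>

locale typed_sm_category = symmetric_monoidal_category C + typed_category C dm cd
  for C :: "('o, 'm, 'x) sm_category_scheme" (structure) and dm cd +
  assumes dm_ten [simp]: "dm (f \<otimes>\<^sub>m g) = dm f \<otimes>\<^sub>o dm g" and cd_ten [simp]: "cd (f \<otimes>\<^sub>m g) = cd f \<otimes>\<^sub>o cd g"
    and dm_asc [simp]: "dm (asc C X Y Z) = (X \<otimes>\<^sub>o Y) \<otimes>\<^sub>o Z" and cd_asc [simp]: "cd (asc C X Y Z) = X \<otimes>\<^sub>o (Y \<otimes>\<^sub>o Z)"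
    and dm_lun [simp]: "dm (lun C X) = unt C \<otimes>\<^sub>o X" and cd_lun [simp]: "cd (lun C X) = X"
    and dm_run [simp]: "dm (run C X) = X \<otimes>\<^sub>o unt C" and cd_run [simp]: "cd (run C X) = X"
    and dm_brd [simp]: "dm (brd C X Y) = X \<otimes>\<^sub>o Y" and cd_brd [simp]: "cd (brd C X Y) = Y \<otimes>\<^sub>o X"
begin

abbreviation "I \<equiv> unt C"

lemma ten_arr [simp]:
  assumes "arr f" "arr g"
  shows "arr (f \<otimes>\<^sub>m g)"
proof -
  have "f \<otimes>\<^sub>m g \<in> Hom C (dm f \<otimes>\<^sub>o dm g) (cd f \<otimes>\<^sub>o cd g)"
    by (rule tenM_in) (use assms[unfolded arr_def] in auto)
  then show "arr (f \<otimes>\<^sub>m g)"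
    using assms by (auto simp: Hom_iff tenO_in)
qed

declare unt_in [simp] tenO_in [simp] tenM_idm [simp]

lemma ten_cmp:
  assumes "arr f" "arr g" "arr f'" "arr g'" "cd f = dm g" "cd f' = dm g'"
  shows "(g \<otimes>\<^sub>m g') \<cdot> (f \<otimes>\<^sub>m f') = (g \<cdot> f) \<otimes>\<^sub>m (g' \<cdot> f')"
  by (rule tenM_cmp[symmetric, of "dm f" "cd f" "cd g" "dm f'" "cd f'" "cd g'"])
    (use assms[unfolded arr_def] in auto)

lemma ten_cmp_ext:
  assumes "arr f" "arr g" "arr f'" "arr g'" "cd f = dm g" "cd f' = dm g'"
    "arr r" "cd r = dm f \<otimes>\<^sub>o dm f'"
  shows "(g \<otimes>\<^sub>m g') \<cdot> ((f \<otimes>\<^sub>m f') \<cdot> r) = ((g \<cdot> f) \<otimes>\<^sub>m (g' \<cdot> f')) \<cdot> r"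
  by (rule cmp_ext) (use assms in \<open>auto simp: ten_cmp\<close>)

lemma ten_idr:
  "arr f \<Longrightarrow> arr g \<Longrightarrow> cd f = dm g \<Longrightarrow> X \<in> Obj C \<Longrightarrow> (g \<cdot> f) \<otimes>\<^sub>m idm C X = (g \<otimes>\<^sub>m idm C X) \<cdot> (f \<otimes>\<^sub>m idm C X)"
  by (simp add: ten_cmp)

lemma ten_idl:
  "arr f \<Longrightarrow> arr g \<Longrightarrow> cd f = dm g \<Longrightarrow> X \<in> Obj C \<Longrightarrow> idm C X \<otimes>\<^sub>m (g \<cdot> f) = (idm C X \<otimes>\<^sub>m g) \<cdot> (idm C X \<otimes>\<^sub>m f)"
  by (simp add: ten_cmp)

lemma asc_iso' [simp]:
  assumes "X \<in> Obj C" "Y \<in> Obj C" "Z \<in> Obj C"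
  shows "iso (asc C X Y Z)"
  using isoI[OF _ _ asc_iso[OF assms]] assms by auto

lemma lun_iso' [simp]:
  assumes "X \<in> Obj C"
  shows "iso (lun C X)"
  using isoI[OF _ _ lun_iso[OF assms]] assms by auto

lemma run_iso' [simp]:
  assumes "X \<in> Obj C"
  shows "iso (run C X)"
  using isoI[OF _ _ run_iso[OF assms]] assms by auto

lemma brd_arr [simp]:
  assumes "X \<in> Obj C" "Y \<in> Obj C"
  shows "arr (brd C X Y)"
  using brd_in[OF assms] assms Hom_iff by auto

lemma asc_nat':
  assumes "arr f" "arr g" "arr h" "cd f = X'" "cd g = Y'" "cd h = Z'"
  shows "asc C X' Y' Z' \<cdot> ((f \<otimes>\<^sub>m g) \<otimes>\<^sub>m h) = (f \<otimes>\<^sub>m (g \<otimes>\<^sub>m h)) \<cdot> asc C (dm f) (dm g) (dm h)"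
  by (rule asc_nat) (use assms[unfolded arr_def] in auto)

lemma asc_nat_inv:
  assumes "arr f" "arr g" "arr h" "dm f = X" "dm g = Y" "dm h = Z"
  shows "((f \<otimes>\<^sub>m g) \<otimes>\<^sub>m h) \<cdot> iv (asc C X Y Z) = iv (asc C (cd f) (cd g) (cd h)) \<cdot> (f \<otimes>\<^sub>m (g \<otimes>\<^sub>m h))"
proof -
  have "asc C (cd f) (cd g) (cd h) \<cdot> (((f \<otimes>\<^sub>m g) \<otimes>\<^sub>m h) \<cdot> iv (asc C X Y Z))
    = (asc C (cd f) (cd g) (cd h) \<cdot> ((f \<otimes>\<^sub>m g) \<otimes>\<^sub>m h)) \<cdot> iv (asc C X Y Z)"
    using assms by (subst cmp_cmp) auto
  also have "\<dots> = (f \<otimes>\<^sub>m (g \<otimes>\<^sub>m h)) \<cdot> (asc C X Y Z \<cdot> iv (asc C X Y Z))"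
    using assms by (subst asc_nat') (auto simp del: iso_inv(6))
  also have "\<dots> = f \<otimes>\<^sub>m (g \<otimes>\<^sub>m h)" using assms by auto
  finally have *: "asc C (cd f) (cd g) (cd h) \<cdot> (((f \<otimes>\<^sub>m g) \<otimes>\<^sub>m h) \<cdot> iv (asc C X Y Z)) = f \<otimes>\<^sub>m (g \<otimes>\<^sub>m h)" .
  show ?thesis by (rule iso_move[OF _ *]) (use assms in auto)
qed

lemma lun_nat': "arr f \<Longrightarrow> cd f = Y \<Longrightarrow> lun C Y \<cdot> (idm C I \<otimes>\<^sub>m f) = f \<cdot> lun C (dm f)"
  unfolding arr_def by (rule lun_nat) auto

lemma run_nat': "arr f \<Longrightarrow> cd f = Y \<Longrightarrow> run C Y \<cdot> (f \<otimes>\<^sub>m idm C I) = f \<cdot> run C (dm f)"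
  unfolding arr_def by (rule run_nat) auto

lemma brd_nat':
  "arr f \<Longrightarrow> arr g \<Longrightarrow> cd f = X' \<Longrightarrow> cd g = Y' \<Longrightarrow> brd C X' Y' \<cdot> (f \<otimes>\<^sub>m g) = (g \<otimes>\<^sub>m f) \<cdot> brd C (dm f) (dm g)"
  unfolding arr_def by (rule brd_nat) auto

lemma pentagon':
  assumes "W \<in> Obj C" "X \<in> Obj C" "Y \<in> Obj C" "Z \<in> Obj C"
  shows "asc C W X (Y \<otimes>\<^sub>o Z) \<cdot> asc C (W \<otimes>\<^sub>o X) Y Z
        = (idm C W \<otimes>\<^sub>m asc C X Y Z) \<cdot> (asc C W (X \<otimes>\<^sub>o Y) Z \<cdot> (asc C W X Y \<otimes>\<^sub>m idm C Z))"
  using pentagon[OF assms] assms by simp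

lemma ten_iso [simp]:
  assumes "iso f" "iso g"
  shows "iso (f \<otimes>\<^sub>m g)" "iv (f \<otimes>\<^sub>m g) = iv f \<otimes>\<^sub>m iv g"
  using inv_unique[of "f \<otimes>\<^sub>m g" "iv f \<otimes>\<^sub>m iv g"] assms by (auto simp: ten_cmp)

lemma idm_iso [simp]: "X \<in> Obj C \<Longrightarrow> iso (idm C X)" "X \<in> Obj C \<Longrightarrow> iv (idm C X) = idm C X"
  using inv_unique[of "idm C X" "idm C X"] by auto

lemma cmp_iso [simp]:
  assumes "iso f" "iso g" "cd f = dm g"
  shows "iso (g \<cdot> f)" "iv (g \<cdot> f) = iv f \<cdot> iv g"
  using inv_unique[of "g \<cdot> f" "iv f \<cdot> iv g"] assms by auto

text \<open>Naturality of \<open>lun\<close> turns \<open>idm C I \<otimes>\<^sub>m f\<close> into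
  \<open>f\<close> up to invertible unitors. Together with the mirrored lemma this allows an
  identity to be proved after tensoring with the unit, where the pentagon and the triangle
  apply.\<close>

lemma unit_ten_faithful:
  assumes "idm C I \<otimes>\<^sub>m f = idm C I \<otimes>\<^sub>m g" "arr f" "arr g" "dm f = dm g" "cd f = cd g"
  shows "f = g"
proof (rule iso_cancel_right[of "lun C (dm f)"])
  show "f \<cdot> lun C (dm f) = g \<cdot> lun C (dm f)"
    using lun_nat'[of f "cd f"] lun_nat'[of g "cd f"] assms by simp
qed (use assms in auto)

lemma ten_unit_faithful:
  assumes "f \<otimes>\<^sub>m idm C I = g \<otimes>\<^sub>m idm C I" "arr f" "arr g" "dm f = dm g" "cd f = cd g"
  shows "f = g"
proof (rule iso_cancel_right[of "run C (dm f)"])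
  show "f \<cdot> run C (dm f) = g \<cdot> run C (dm f)"
    using run_nat'[of f "cd f"] run_nat'[of g "cd f"] assms by simp
qed (use assms in auto)

text \<open>Kelly's derivation: after tensoring with \<open>I\<close> on the left, the pentagon for
  \<open>I, I, X, Y\<close> and two triangles compare both sides up to the isomorphism
  \<open>?r\<close>, which is cancelled before the tensor factor \<open>I\<close> is
  removed.\<close>

lemma lun_ten:
  assumes [simp]: "X \<in> Obj C" "Y \<in> Obj C"
  shows "lun C (X \<otimes>\<^sub>o Y) \<cdot> asc C I X Y = lun C X \<otimes>\<^sub>m idm C Y"
proof -
  let ?r = "asc C I (I \<otimes>\<^sub>o X) Y \<cdot> (asc C I I X \<otimes>\<^sub>m idm C Y)"
  have "(idm C I \<otimes>\<^sub>m (lun C X \<otimes>\<^sub>m idm C Y)) \<cdot> ?r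
      = (asc C I X Y \<cdot> ((idm C I \<otimes>\<^sub>m lun C X) \<otimes>\<^sub>m idm C Y)) \<cdot> (asc C I I X \<otimes>\<^sub>m idm C Y)"
    by (subst asc_nat') auto
  also have "\<dots> = asc C I X Y \<cdot> (((idm C I \<otimes>\<^sub>m lun C X) \<cdot> asc C I I X) \<otimes>\<^sub>m idm C Y)"
    by (simp add: ten_idr)
  also have "\<dots> = asc C I X Y \<cdot> ((run C I \<otimes>\<^sub>m idm C X) \<otimes>\<^sub>m idm C Y)"
    by (simp only: triangle assms unt_in)
  also have "\<dots> = (run C I \<otimes>\<^sub>m idm C (X \<otimes>\<^sub>o Y)) \<cdot> asc C (I \<otimes>\<^sub>o I) X Y"
    by (subst asc_nat') auto
  also have "\<dots> = ((idm C I \<otimes>\<^sub>m lun C (X \<otimes>\<^sub>o Y)) \<cdot> asc C I I (X \<otimes>\<^sub>o Y)) \<cdot> asc C (I \<otimes>\<^sub>o I) X Y"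
    by (simp only: triangle assms unt_in tenO_in)
  also have "\<dots> = (idm C I \<otimes>\<^sub>m lun C (X \<otimes>\<^sub>o Y)) \<cdot> (asc C I I (X \<otimes>\<^sub>o Y) \<cdot> asc C (I \<otimes>\<^sub>o I) X Y)"
    by simp
  also have "\<dots> = (idm C I \<otimes>\<^sub>m lun C (X \<otimes>\<^sub>o Y)) \<cdot> ((idm C I \<otimes>\<^sub>m asc C I X Y) \<cdot> ?r)"
    by (simp only: pentagon' assms unt_in)
  also have "\<dots> = (idm C I \<otimes>\<^sub>m (lun C (X \<otimes>\<^sub>o Y) \<cdot> asc C I X Y)) \<cdot> ?r"
    by (simp add: ten_idl)
  finally have "idm C I \<otimes>\<^sub>m (lun C X \<otimes>\<^sub>m idm C Y) = idm C I \<otimes>\<^sub>m (lun C (X \<otimes>\<^sub>o Y) \<cdot> asc C I X Y)"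
    by (rule iso_cancel_right[rotated]) auto
  then show ?thesis by (rule unit_ten_faithful[symmetric]) auto
qed

text \<open>Mirror image of the previous argument, with the pentagon for \<open>X, Y, I, I\<close>;
  this time the common isomorphism stands on the left and the factor \<open>I\<close> is added on
  the right.\<close>

lemma run_ten:
  assumes [simp]: "X \<in> Obj C" "Y \<in> Obj C"
  shows "(idm C X \<otimes>\<^sub>m run C Y) \<cdot> asc C X Y I = run C (X \<otimes>\<^sub>o Y)"
proof -
  have "asc C X Y I \<cdot> (run C (X \<otimes>\<^sub>o Y) \<otimes>\<^sub>m idm C I)
      = asc C X Y I \<cdot> ((idm C (X \<otimes>\<^sub>o Y) \<otimes>\<^sub>m lun C I) \<cdot> asc C (X \<otimes>\<^sub>o Y) I I)"
    by (simp only: triangle assms unt_in tenO_in)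
  also have "\<dots> = (asc C X Y I \<cdot> ((idm C X \<otimes>\<^sub>m idm C Y) \<otimes>\<^sub>m lun C I)) \<cdot> asc C (X \<otimes>\<^sub>o Y) I I"
    by simp
  also have "\<dots> = (idm C X \<otimes>\<^sub>m (idm C Y \<otimes>\<^sub>m lun C I)) \<cdot> (asc C X Y (I \<otimes>\<^sub>o I) \<cdot> asc C (X \<otimes>\<^sub>o Y) I I)"
    by (subst asc_nat') auto
  also have "\<dots> = (idm C X \<otimes>\<^sub>m (idm C Y \<otimes>\<^sub>m lun C I)) \<cdot> ((idm C X \<otimes>\<^sub>m asc C Y I I) \<cdot> (asc C X (Y \<otimes>\<^sub>o I) I \<cdot> (asc C X Y I \<otimes>\<^sub>m idm C I)))"
    by (simp only: pentagon' assms unt_in)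
  also have "\<dots> = (idm C X \<otimes>\<^sub>m ((idm C Y \<otimes>\<^sub>m lun C I) \<cdot> asc C Y I I)) \<cdot> (asc C X (Y \<otimes>\<^sub>o I) I \<cdot> (asc C X Y I \<otimes>\<^sub>m idm C I))"
    by (simp add: ten_idl)
  also have "\<dots> = (idm C X \<otimes>\<^sub>m (run C Y \<otimes>\<^sub>m idm C I)) \<cdot> (asc C X (Y \<otimes>\<^sub>o I) I \<cdot> (asc C X Y I \<otimes>\<^sub>m idm C I))"
    by (simp only: triangle assms unt_in)
  also have "\<dots> = ((idm C X \<otimes>\<^sub>m (run C Y \<otimes>\<^sub>m idm C I)) \<cdot> asc C X (Y \<otimes>\<^sub>o I) I) \<cdot> (asc C X Y I \<otimes>\<^sub>m idm C I)"
    by simp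
  also have "\<dots> = (asc C X Y I \<cdot> ((idm C X \<otimes>\<^sub>m run C Y) \<otimes>\<^sub>m idm C I)) \<cdot> (asc C X Y I \<otimes>\<^sub>m idm C I)"
    by (subst asc_nat') auto
  also have "\<dots> = asc C X Y I \<cdot> (((idm C X \<otimes>\<^sub>m run C Y) \<cdot> asc C X Y I) \<otimes>\<^sub>m idm C I)"
    by (simp add: ten_idr)
  finally have "run C (X \<otimes>\<^sub>o Y) \<otimes>\<^sub>m idm C I = ((idm C X \<otimes>\<^sub>m run C Y) \<cdot> asc C X Y I) \<otimes>\<^sub>m idm C I"
    by (rule iso_cancel_left[rotated]) auto
  then show ?thesis by (rule ten_unit_faithful[symmetric]) auto
qed

text \<open>Naturality of \<open>lun\<close> along \<open>lun C I\<close> itself identifies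
  \<open>lun C (I \<otimes>\<^sub>o I)\<close> with
  \<open>idm C I \<otimes>\<^sub>m lun C I\<close>; then \<open>lun_ten\<close> and the triangle
  have the same left-hand side. In the duality computations a morphism into \<open>I\<close> can
  thus change from one unitor to the other.\<close>

lemma lun_run_unit: "lun C I = run C I"
proof -
  have "lun C I \<cdot> lun C (I \<otimes>\<^sub>o I) = lun C I \<cdot> (idm C I \<otimes>\<^sub>m lun C I)"
    by (subst lun_nat') auto
  then have 1: "lun C (I \<otimes>\<^sub>o I) = idm C I \<otimes>\<^sub>m lun C I"
    by (rule iso_cancel_left[rotated]) auto
  have "lun C I \<otimes>\<^sub>m idm C I = run C I \<otimes>\<^sub>m idm C I"
    using lun_ten[of I I] triangle[of I I] by (simp add: 1)
  then show ?thesis by (rule ten_unit_faithful) auto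
qed

end

section \<open>Dual pairs, transposition and the cyclic trace\<close>

context typed_sm_category
begin

text \<open>The predicate \<open>is_dual\<close> with evaluation and coevaluation as parameters, and
  with the zigzag composites bracketed to the right, which is the normal form of the simplifier
  here.\<close>

definition dual_pair :: "'o \<Rightarrow> 'o \<Rightarrow> 'm \<Rightarrow> 'm \<Rightarrow> bool" where
  "dual_pair X D ev co \<longleftrightarrow> X \<in> Obj C \<and> D \<in> Obj C
    \<and> arr ev \<and> dm ev = D \<otimes>\<^sub>o X \<and> cd ev = I \<and> arr co \<and> dm co = I \<and> cd co = X \<otimes>\<^sub>o D
    \<and> run C X \<cdot> ((idm C X \<otimes>\<^sub>m ev) \<cdot> (asc C X D X \<cdot> ((co \<otimes>\<^sub>m idm C X) \<cdot> iv (lun C X)))) = idm C X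
    \<and> lun C D \<cdot> ((ev \<otimes>\<^sub>m idm C D) \<cdot> (iv (asc C D X D) \<cdot> ((idm C D \<otimes>\<^sub>m co) \<cdot> iv (run C D)))) = idm C D"

lemma is_dual_iff: "X \<in> Obj C \<Longrightarrow> is_dual C X D \<longleftrightarrow> (\<exists>ev co. dual_pair X D ev co)"
proof -
  assume X [simp]: "X \<in> Obj C"
  have *: "run C X \<cdot> (idm C X \<otimes>\<^sub>m ev) \<cdot> asc C X D X \<cdot> (co \<otimes>\<^sub>m idm C X) \<cdot> iv (lun C X)
      = run C X \<cdot> ((idm C X \<otimes>\<^sub>m ev) \<cdot> (asc C X D X \<cdot> ((co \<otimes>\<^sub>m idm C X) \<cdot> iv (lun C X))))"
     "lun C D \<cdot> (ev \<otimes>\<^sub>m idm C D) \<cdot> iv (asc C D X D) \<cdot> (idm C D \<otimes>\<^sub>m co) \<cdot> iv (run C D)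
      = lun C D \<cdot> ((ev \<otimes>\<^sub>m idm C D) \<cdot> (iv (asc C D X D) \<cdot> ((idm C D \<otimes>\<^sub>m co) \<cdot> iv (run C D))))"
    if "D \<in> Obj C" "arr ev" "dm ev = D \<otimes>\<^sub>o X" "cd ev = I" "arr co" "dm co = I" "cd co = X \<otimes>\<^sub>o D" for ev co
    using that by simp_all
  have iv: "inv_arrow C (I \<otimes>\<^sub>o X) X (lun C X) = iv (lun C X)"
    "D \<in> Obj C \<Longrightarrow> inv_arrow C ((D \<otimes>\<^sub>o X) \<otimes>\<^sub>o D) (D \<otimes>\<^sub>o (X \<otimes>\<^sub>o D)) (asc C D X D) = iv (asc C D X D)"
    "D \<in> Obj C \<Longrightarrow> inv_arrow C (D \<otimes>\<^sub>o I) D (run C D) = iv (run C D)"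
    by (simp_all add: iv_def)
  show ?thesis
  proof
    assume "is_dual C X D"
    then obtain ev co where D: "D \<in> Obj C" and "ev \<in> Hom C (D \<otimes>\<^sub>o X) I" "co \<in> Hom C I (X \<otimes>\<^sub>o D)"
      and z: "run C X \<cdot> (idm C X \<otimes>\<^sub>m ev) \<cdot> asc C X D X \<cdot> (co \<otimes>\<^sub>m idm C X) \<cdot> iv (lun C X) = idm C X"
        "lun C D \<cdot> (ev \<otimes>\<^sub>m idm C D) \<cdot> iv (asc C D X D) \<cdot> (idm C D \<otimes>\<^sub>m co) \<cdot> iv (run C D) = idm C D"
      unfolding is_dual_def by (auto simp only: iv)
    then have t: "arr ev" "dm ev = D \<otimes>\<^sub>o X" "cd ev = I" "arr co" "dm co = I" "cd co = X \<otimes>\<^sub>o D"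
      by (simp_all add: Hom_iff)
    show "\<exists>ev co. dual_pair X D ev co"
      using z *[OF D t] D t unfolding dual_pair_def by (intro exI[of _ ev] exI[of _ co]) simp
  next
    assume "\<exists>ev co. dual_pair X D ev co"
    then obtain ev co where dp: "dual_pair X D ev co" by blast
    then have D: "D \<in> Obj C" and t: "arr ev" "dm ev = D \<otimes>\<^sub>o X" "cd ev = I" "arr co" "dm co = I" "cd co = X \<otimes>\<^sub>o D"
      unfolding dual_pair_def by blast+
    have "ev \<in> Hom C (D \<otimes>\<^sub>o X) I" "co \<in> Hom C I (X \<otimes>\<^sub>o D)" using D t by (simp_all add: Hom_iff)
    then show "is_dual C X D"
      unfolding is_dual_def iv(1) iv(2)[OF D] iv(3)[OF D]
      using D dp *[OF D t] unfolding dual_pair_def by metis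
  qed
qed

lemma dual_pairD:
  assumes "dual_pair X D ev co"
  shows "X \<in> Obj C" "D \<in> Obj C" "arr ev" "dm ev = D \<otimes>\<^sub>o X" "cd ev = I" "arr co" "dm co = I" "cd co = X \<otimes>\<^sub>o D"
    and "run C X \<cdot> ((idm C X \<otimes>\<^sub>m ev) \<cdot> (asc C X D X \<cdot> ((co \<otimes>\<^sub>m idm C X) \<cdot> iv (lun C X)))) = idm C X"
    and "lun C D \<cdot> ((ev \<otimes>\<^sub>m idm C D) \<cdot> (iv (asc C D X D) \<cdot> ((idm C D \<otimes>\<^sub>m co) \<cdot> iv (run C D)))) = idm C D"
  using assms unfolding dual_pair_def by blast+

lemma triangle_inv:
  assumes [simp]: "X \<in> Obj C" "Y \<in> Obj C"
  shows "asc C X I Y \<cdot> (iv (run C X) \<otimes>\<^sub>m idm C Y) = idm C X \<otimes>\<^sub>m iv (lun C Y)"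
proof -
  have "(idm C X \<otimes>\<^sub>m lun C Y) \<cdot> (asc C X I Y \<cdot> (iv (run C X) \<otimes>\<^sub>m idm C Y))
    = ((idm C X \<otimes>\<^sub>m lun C Y) \<cdot> asc C X I Y) \<cdot> (iv (run C X) \<otimes>\<^sub>m idm C Y)" by simp
  also have "\<dots> = (run C X \<otimes>\<^sub>m idm C Y) \<cdot> (iv (run C X) \<otimes>\<^sub>m idm C Y)" by (simp only: triangle assms)
  also have "\<dots> = idm C (X \<otimes>\<^sub>o Y)" by (simp add: ten_cmp)
  finally have "asc C X I Y \<cdot> (iv (run C X) \<otimes>\<^sub>m idm C Y) = iv (idm C X \<otimes>\<^sub>m lun C Y) \<cdot> idm C (X \<otimes>\<^sub>o Y)"
    by (intro iso_move) auto
  then show ?thesis by simp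
qed

text \<open>This is one half of the adjunction between tensoring with \<open>X\<close> and with
  \<open>D\<close>: the factor next to \<open>ev\<close> is the transpose of \<open>g\<close>, a
  morphism from \<open>A\<close> to \<open>D\<close>. By interchange \<open>g\<close> is moved to
  the front of the composite; what is left behind it is the zigzag identity of \<open>X\<close>
  tensored with \<open>A\<close>.\<close>

lemma dual_adj_left:
  assumes dp: "dual_pair X D ev co" and A [simp]: "A \<in> Obj C"
    and g [simp]: "arr g" "dm g = A \<otimes>\<^sub>o X" "cd g = I"
  shows "ev \<cdot> ((lun C D \<cdot> ((g \<otimes>\<^sub>m idm C D) \<cdot> (iv (asc C A X D) \<cdot> ((idm C A \<otimes>\<^sub>m co) \<cdot> iv (run C A))))) \<otimes>\<^sub>m idm C X) = g"
proof -
  note [simp] = dual_pairD(1-8)[OF dp]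
  note z = dual_pairD(9)[OF dp]
  let ?r4 = "iv (run C A) \<otimes>\<^sub>m idm C X"
  let ?r3 = "((idm C A \<otimes>\<^sub>m co) \<otimes>\<^sub>m idm C X) \<cdot> ?r4"
  let ?r2 = "(iv (asc C A X D) \<otimes>\<^sub>m idm C X) \<cdot> ?r3"
  let ?r1 = "((g \<otimes>\<^sub>m idm C D) \<otimes>\<^sub>m idm C X) \<cdot> ?r2"
  have "ev \<cdot> ((lun C D \<cdot> ((g \<otimes>\<^sub>m idm C D) \<cdot> (iv (asc C A X D) \<cdot> ((idm C A \<otimes>\<^sub>m co) \<cdot> iv (run C A))))) \<otimes>\<^sub>m idm C X)
      = ev \<cdot> ((lun C D \<otimes>\<^sub>m idm C X) \<cdot> ?r1)"
    by (simp add: ten_idr)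
  also have "\<dots> = ev \<cdot> ((lun C (D \<otimes>\<^sub>o X) \<cdot> asc C I D X) \<cdot> ?r1)"
    by (subst lun_ten) auto
  also have "\<dots> = (ev \<cdot> lun C (D \<otimes>\<^sub>o X)) \<cdot> (asc C I D X \<cdot> ?r1)" by simp
  also have "\<dots> = (lun C I \<cdot> (idm C I \<otimes>\<^sub>m ev)) \<cdot> (asc C I D X \<cdot> ?r1)" by (subst lun_nat') auto
  also have "\<dots> = lun C I \<cdot> ((idm C I \<otimes>\<^sub>m ev) \<cdot> ((asc C I D X \<cdot> ((g \<otimes>\<^sub>m idm C D) \<otimes>\<^sub>m idm C X)) \<cdot> ?r2))" by simp
  also have "\<dots> = lun C I \<cdot> ((idm C I \<otimes>\<^sub>m ev) \<cdot> (((g \<otimes>\<^sub>m idm C (D \<otimes>\<^sub>o X)) \<cdot> asc C (A \<otimes>\<^sub>o X) D X) \<cdot> ?r2))"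
    by (subst asc_nat') auto
  also have "\<dots> = lun C I \<cdot> (((idm C I \<otimes>\<^sub>m ev) \<cdot> (g \<otimes>\<^sub>m idm C (D \<otimes>\<^sub>o X))) \<cdot> (asc C (A \<otimes>\<^sub>o X) D X \<cdot> ?r2))" by simp
  also have "\<dots> = lun C I \<cdot> (((g \<otimes>\<^sub>m idm C I) \<cdot> (idm C (A \<otimes>\<^sub>o X) \<otimes>\<^sub>m ev)) \<cdot> (asc C (A \<otimes>\<^sub>o X) D X \<cdot> ?r2))"
    by (simp add: ten_cmp del: cmp_cmp)
  also have "\<dots> = (run C I \<cdot> (g \<otimes>\<^sub>m idm C I)) \<cdot> ((idm C (A \<otimes>\<^sub>o X) \<otimes>\<^sub>m ev) \<cdot> (asc C (A \<otimes>\<^sub>o X) D X \<cdot> ?r2))"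
    by (simp add: lun_run_unit)
  also have "\<dots> = (g \<cdot> run C (A \<otimes>\<^sub>o X)) \<cdot> ((idm C (A \<otimes>\<^sub>o X) \<otimes>\<^sub>m ev) \<cdot> (asc C (A \<otimes>\<^sub>o X) D X \<cdot> ?r2))"
    by (subst run_nat') auto
  also have "\<dots> = g \<cdot> (run C (A \<otimes>\<^sub>o X) \<cdot> ((idm C (A \<otimes>\<^sub>o X) \<otimes>\<^sub>m ev) \<cdot> (asc C (A \<otimes>\<^sub>o X) D X \<cdot> ?r2)))" by simp
  also have "run C (A \<otimes>\<^sub>o X) = (idm C A \<otimes>\<^sub>m run C X) \<cdot> asc C A X I" by (simp add: run_ten)
  also have "((idm C A \<otimes>\<^sub>m run C X) \<cdot> asc C A X I) \<cdot> ((idm C (A \<otimes>\<^sub>o X) \<otimes>\<^sub>m ev) \<cdot> (asc C (A \<otimes>\<^sub>o X) D X \<cdot> ?r2))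
      = (idm C A \<otimes>\<^sub>m run C X) \<cdot> ((asc C A X I \<cdot> ((idm C A \<otimes>\<^sub>m idm C X) \<otimes>\<^sub>m ev)) \<cdot> (asc C (A \<otimes>\<^sub>o X) D X \<cdot> ?r2))"
    by simp
  also have "\<dots> = (idm C A \<otimes>\<^sub>m run C X) \<cdot> (((idm C A \<otimes>\<^sub>m (idm C X \<otimes>\<^sub>m ev)) \<cdot> asc C A X (D \<otimes>\<^sub>o X)) \<cdot> (asc C (A \<otimes>\<^sub>o X) D X \<cdot> ?r2))"
    by (subst asc_nat') auto
  also have "\<dots> = (idm C A \<otimes>\<^sub>m run C X) \<cdot> ((idm C A \<otimes>\<^sub>m (idm C X \<otimes>\<^sub>m ev)) \<cdot> ((asc C A X (D \<otimes>\<^sub>o X) \<cdot> asc C (A \<otimes>\<^sub>o X) D X) \<cdot> ?r2))"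
    by simp
  also have "(asc C A X (D \<otimes>\<^sub>o X) \<cdot> asc C (A \<otimes>\<^sub>o X) D X) \<cdot> ?r2
     = ((idm C A \<otimes>\<^sub>m asc C X D X) \<cdot> (asc C A (X \<otimes>\<^sub>o D) X \<cdot> (asc C A X D \<otimes>\<^sub>m idm C X))) \<cdot> ?r2"
    by (subst pentagon') auto
  also have "\<dots> = (idm C A \<otimes>\<^sub>m asc C X D X) \<cdot> (asc C A (X \<otimes>\<^sub>o D) X \<cdot> ((asc C A X D \<otimes>\<^sub>m idm C X) \<cdot> ?r2))"
    by simp
  also have "(asc C A X D \<otimes>\<^sub>m idm C X) \<cdot> ?r2 = ?r3"
    by (simp add: ten_cmp_ext)
  also have "asc C A (X \<otimes>\<^sub>o D) X \<cdot> ?r3 = (asc C A (X \<otimes>\<^sub>o D) X \<cdot> ((idm C A \<otimes>\<^sub>m co) \<otimes>\<^sub>m idm C X)) \<cdot> ?r4" by simp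
  also have "\<dots> = ((idm C A \<otimes>\<^sub>m (co \<otimes>\<^sub>m idm C X)) \<cdot> asc C A I X) \<cdot> ?r4" by (subst asc_nat') auto
  also have "\<dots> = (idm C A \<otimes>\<^sub>m (co \<otimes>\<^sub>m idm C X)) \<cdot> (asc C A I X \<cdot> ?r4)" by simp
  also have "\<dots> = (idm C A \<otimes>\<^sub>m (co \<otimes>\<^sub>m idm C X)) \<cdot> (idm C A \<otimes>\<^sub>m iv (lun C X))" by (simp add: triangle_inv)
  also have "(idm C A \<otimes>\<^sub>m run C X) \<cdot> ((idm C A \<otimes>\<^sub>m (idm C X \<otimes>\<^sub>m ev)) \<cdot> ((idm C A \<otimes>\<^sub>m asc C X D X) \<cdot>
      ((idm C A \<otimes>\<^sub>m (co \<otimes>\<^sub>m idm C X)) \<cdot> (idm C A \<otimes>\<^sub>m iv (lun C X)))))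
    = idm C A \<otimes>\<^sub>m (run C X \<cdot> ((idm C X \<otimes>\<^sub>m ev) \<cdot> (asc C X D X \<cdot> ((co \<otimes>\<^sub>m idm C X) \<cdot> iv (lun C X)))))"
    by (simp add: ten_cmp)
  also have "\<dots> = idm C (A \<otimes>\<^sub>o X)" by (simp add: z)
  finally show ?thesis by simp
qed

text \<open>Here \<open>g\<close> is transposed into a morphism from \<open>Y\<close> to
  \<open>X\<close>, and the zigzag identity of \<open>D\<close> remains. The inverse associators
  call for \<open>asc_nat_inv\<close> and the inverted pentagon.\<close>

lemma dual_adj_right:
  assumes dp: "dual_pair X D ev co" and Y [simp]: "Y \<in> Obj C"
    and g [simp]: "arr g" "dm g = D \<otimes>\<^sub>o Y" "cd g = I"
  shows "ev \<cdot> (idm C D \<otimes>\<^sub>m (run C X \<cdot> ((idm C X \<otimes>\<^sub>m g) \<cdot> (asc C X D Y \<cdot> ((co \<otimes>\<^sub>m idm C Y) \<cdot> iv (lun C Y)))))) = g"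
proof -
  note [simp] = dual_pairD(1-8)[OF dp]
  note z = dual_pairD(10)[OF dp]
  let ?r4 = "idm C D \<otimes>\<^sub>m iv (lun C Y)"
  let ?r3 = "(idm C D \<otimes>\<^sub>m (co \<otimes>\<^sub>m idm C Y)) \<cdot> ?r4"
  let ?r2 = "(idm C D \<otimes>\<^sub>m asc C X D Y) \<cdot> ?r3"
  let ?r1 = "(idm C D \<otimes>\<^sub>m (idm C X \<otimes>\<^sub>m g)) \<cdot> ?r2"
  have r: "idm C D \<otimes>\<^sub>m run C X = run C (D \<otimes>\<^sub>o X) \<cdot> iv (asc C D X I)"
    by (simp flip: run_ten)
  have "ev \<cdot> (idm C D \<otimes>\<^sub>m (run C X \<cdot> ((idm C X \<otimes>\<^sub>m g) \<cdot> (asc C X D Y \<cdot> ((co \<otimes>\<^sub>m idm C Y) \<cdot> iv (lun C Y))))))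
      = ev \<cdot> ((idm C D \<otimes>\<^sub>m run C X) \<cdot> ?r1)"
    by (simp add: ten_idl)
  also have "\<dots> = (ev \<cdot> run C (D \<otimes>\<^sub>o X)) \<cdot> (iv (asc C D X I) \<cdot> ?r1)" by (simp add: r)
  also have "\<dots> = (run C I \<cdot> (ev \<otimes>\<^sub>m idm C I)) \<cdot> (iv (asc C D X I) \<cdot> ?r1)" by (subst run_nat') auto
  also have "\<dots> = run C I \<cdot> ((ev \<otimes>\<^sub>m idm C I) \<cdot> ((iv (asc C D X I) \<cdot> (idm C D \<otimes>\<^sub>m (idm C X \<otimes>\<^sub>m g))) \<cdot> ?r2))" by simp
  also have "iv (asc C D X I) \<cdot> (idm C D \<otimes>\<^sub>m (idm C X \<otimes>\<^sub>m g)) = (idm C (D \<otimes>\<^sub>o X) \<otimes>\<^sub>m g) \<cdot> iv (asc C D X (D \<otimes>\<^sub>o Y))"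
    using asc_nat_inv[of "idm C D" "idm C X" g D X "D \<otimes>\<^sub>o Y"] by simp
  also have "run C I \<cdot> ((ev \<otimes>\<^sub>m idm C I) \<cdot> (((idm C (D \<otimes>\<^sub>o X) \<otimes>\<^sub>m g) \<cdot> iv (asc C D X (D \<otimes>\<^sub>o Y))) \<cdot> ?r2))
    = run C I \<cdot> (((ev \<otimes>\<^sub>m idm C I) \<cdot> (idm C (D \<otimes>\<^sub>o X) \<otimes>\<^sub>m g)) \<cdot> (iv (asc C D X (D \<otimes>\<^sub>o Y)) \<cdot> ?r2))" by simp
  also have "\<dots> = run C I \<cdot> (((idm C I \<otimes>\<^sub>m g) \<cdot> (ev \<otimes>\<^sub>m idm C (D \<otimes>\<^sub>o Y))) \<cdot> (iv (asc C D X (D \<otimes>\<^sub>o Y)) \<cdot> ?r2))"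
    by (simp add: ten_cmp del: cmp_cmp)
  also have "\<dots> = (lun C I \<cdot> (idm C I \<otimes>\<^sub>m g)) \<cdot> ((ev \<otimes>\<^sub>m idm C (D \<otimes>\<^sub>o Y)) \<cdot> (iv (asc C D X (D \<otimes>\<^sub>o Y)) \<cdot> ?r2))"
    by (simp add: lun_run_unit)
  also have "\<dots> = (g \<cdot> lun C (D \<otimes>\<^sub>o Y)) \<cdot> ((ev \<otimes>\<^sub>m idm C (D \<otimes>\<^sub>o Y)) \<cdot> (iv (asc C D X (D \<otimes>\<^sub>o Y)) \<cdot> ?r2))"
    by (subst lun_nat') auto
  also have "lun C (D \<otimes>\<^sub>o Y) = (lun C D \<otimes>\<^sub>m idm C Y) \<cdot> iv (asc C I D Y)"
    by (simp flip: lun_ten)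
  also have "(g \<cdot> ((lun C D \<otimes>\<^sub>m idm C Y) \<cdot> iv (asc C I D Y))) \<cdot> ((ev \<otimes>\<^sub>m idm C (D \<otimes>\<^sub>o Y)) \<cdot> (iv (asc C D X (D \<otimes>\<^sub>o Y)) \<cdot> ?r2))
    = g \<cdot> ((lun C D \<otimes>\<^sub>m idm C Y) \<cdot> ((iv (asc C I D Y) \<cdot> (ev \<otimes>\<^sub>m (idm C D \<otimes>\<^sub>m idm C Y))) \<cdot> (iv (asc C D X (D \<otimes>\<^sub>o Y)) \<cdot> ?r2)))"
    by simp
  also have "iv (asc C I D Y) \<cdot> (ev \<otimes>\<^sub>m (idm C D \<otimes>\<^sub>m idm C Y)) = ((ev \<otimes>\<^sub>m idm C D) \<otimes>\<^sub>m idm C Y) \<cdot> iv (asc C (D \<otimes>\<^sub>o X) D Y)"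
    using asc_nat_inv[of ev "idm C D" "idm C Y" "D \<otimes>\<^sub>o X" D Y] by simp
  also have "(((ev \<otimes>\<^sub>m idm C D) \<otimes>\<^sub>m idm C Y) \<cdot> iv (asc C (D \<otimes>\<^sub>o X) D Y)) \<cdot> (iv (asc C D X (D \<otimes>\<^sub>o Y)) \<cdot> ?r2)
    = ((ev \<otimes>\<^sub>m idm C D) \<otimes>\<^sub>m idm C Y) \<cdot> (iv (asc C D X (D \<otimes>\<^sub>o Y) \<cdot> asc C (D \<otimes>\<^sub>o X) D Y) \<cdot> ?r2)" by simp
  also have "iv (asc C D X (D \<otimes>\<^sub>o Y) \<cdot> asc C (D \<otimes>\<^sub>o X) D Y) \<cdot> ?r2
    = ((iv (asc C D X D) \<otimes>\<^sub>m idm C Y) \<cdot> (iv (asc C D (X \<otimes>\<^sub>o D) Y) \<cdot> (idm C D \<otimes>\<^sub>m iv (asc C X D Y)))) \<cdot> ?r2"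
    by (subst pentagon') simp_all
  also have "\<dots> = (iv (asc C D X D) \<otimes>\<^sub>m idm C Y) \<cdot> (iv (asc C D (X \<otimes>\<^sub>o D) Y) \<cdot> ((idm C D \<otimes>\<^sub>m iv (asc C X D Y)) \<cdot> ?r2))"
    by simp
  also have "(idm C D \<otimes>\<^sub>m iv (asc C X D Y)) \<cdot> ?r2 = ?r3"
    by (simp add: ten_cmp_ext)
  also have "iv (asc C D (X \<otimes>\<^sub>o D) Y) \<cdot> ?r3 = (iv (asc C D (X \<otimes>\<^sub>o D) Y) \<cdot> (idm C D \<otimes>\<^sub>m (co \<otimes>\<^sub>m idm C Y))) \<cdot> ?r4" by simp
  also have "iv (asc C D (X \<otimes>\<^sub>o D) Y) \<cdot> (idm C D \<otimes>\<^sub>m (co \<otimes>\<^sub>m idm C Y)) = ((idm C D \<otimes>\<^sub>m co) \<otimes>\<^sub>m idm C Y) \<cdot> iv (asc C D I Y)"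
    using asc_nat_inv[of "idm C D" co "idm C Y" D I Y] by simp
  also have "(((idm C D \<otimes>\<^sub>m co) \<otimes>\<^sub>m idm C Y) \<cdot> iv (asc C D I Y)) \<cdot> ?r4 = ((idm C D \<otimes>\<^sub>m co) \<otimes>\<^sub>m idm C Y) \<cdot> (iv (asc C D I Y) \<cdot> ?r4)"
    by simp
  also have "iv (asc C D I Y) \<cdot> ?r4 = iv (run C D) \<otimes>\<^sub>m idm C Y"
    by (simp flip: triangle_inv)
  also have "(lun C D \<otimes>\<^sub>m idm C Y) \<cdot> (((ev \<otimes>\<^sub>m idm C D) \<otimes>\<^sub>m idm C Y) \<cdot> ((iv (asc C D X D) \<otimes>\<^sub>m idm C Y) \<cdot>
      (((idm C D \<otimes>\<^sub>m co) \<otimes>\<^sub>m idm C Y) \<cdot> (iv (run C D) \<otimes>\<^sub>m idm C Y))))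
    = (lun C D \<cdot> ((ev \<otimes>\<^sub>m idm C D) \<cdot> (iv (asc C D X D) \<cdot> ((idm C D \<otimes>\<^sub>m co) \<cdot> iv (run C D))))) \<otimes>\<^sub>m idm C Y"
    by (simp add: ten_cmp)
  also have "\<dots> = idm C (D \<otimes>\<^sub>o Y)" by (simp add: z)
  finally show ?thesis by simp
qed

text \<open>The coevaluation is universal in the same way as the evaluation: every \<open>k\<close>
  from \<open>I\<close> to \<open>X \<otimes>\<^sub>o B\<close> comes from \<open>co\<close> by a
  morphism from \<open>D\<close> to \<open>B\<close>, namely the contraction of \<open>k\<close>
  with \<open>ev\<close>.\<close>

lemma dual_adj_coev:
  assumes dp: "dual_pair X D ev co" and B [simp]: "B \<in> Obj C"
    and k [simp]: "arr k" "dm k = I" "cd k = X \<otimes>\<^sub>o B"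
  shows "(idm C X \<otimes>\<^sub>m (lun C B \<cdot> ((ev \<otimes>\<^sub>m idm C B) \<cdot> (iv (asc C D X B) \<cdot> ((idm C D \<otimes>\<^sub>m k) \<cdot> iv (run C D)))))) \<cdot> co = k"
proof -
  note [simp] = dual_pairD(1-8)[OF dp]
  note z = dual_pairD(9)[OF dp]
  let ?l1 = "idm C X \<otimes>\<^sub>m lun C B"
  let ?l2 = "idm C X \<otimes>\<^sub>m (ev \<otimes>\<^sub>m idm C B)"
  let ?l3 = "idm C X \<otimes>\<^sub>m iv (asc C D X B)"
  have r: "idm C X \<otimes>\<^sub>m iv (run C D) = asc C X D I \<cdot> iv (run C (X \<otimes>\<^sub>o D))"
  proof -
    have "iv (run C (X \<otimes>\<^sub>o D)) = iv (asc C X D I) \<cdot> (idm C X \<otimes>\<^sub>m iv (run C D))"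
      by (simp flip: run_ten)
    then show ?thesis by simp
  qed
  have ri: "iv (run C (X \<otimes>\<^sub>o D)) \<cdot> co = (co \<otimes>\<^sub>m idm C I) \<cdot> iv (run C I)"
  proof -
    have "run C (X \<otimes>\<^sub>o D) \<cdot> ((co \<otimes>\<^sub>m idm C I) \<cdot> iv (run C I)) = (run C (X \<otimes>\<^sub>o D) \<cdot> (co \<otimes>\<^sub>m idm C I)) \<cdot> iv (run C I)" by simp
    also have "\<dots> = (co \<cdot> run C I) \<cdot> iv (run C I)" by (subst run_nat') auto
    also have "\<dots> = co" by simp
    finally have "(co \<otimes>\<^sub>m idm C I) \<cdot> iv (run C I) = iv (run C (X \<otimes>\<^sub>o D)) \<cdot> co"
      by (intro iso_move) auto
    then show ?thesis by simp
  qed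
  have li: "(idm C I \<otimes>\<^sub>m k) \<cdot> iv (lun C I) = iv (lun C (X \<otimes>\<^sub>o B)) \<cdot> k"
  proof -
    have "lun C (X \<otimes>\<^sub>o B) \<cdot> ((idm C I \<otimes>\<^sub>m k) \<cdot> iv (lun C I)) = (lun C (X \<otimes>\<^sub>o B) \<cdot> (idm C I \<otimes>\<^sub>m k)) \<cdot> iv (lun C I)" by simp
    also have "\<dots> = (k \<cdot> lun C I) \<cdot> iv (lun C I)" by (subst lun_nat') auto
    also have "\<dots> = k" by simp
    finally show ?thesis by (intro iso_move) auto
  qed
  have "(idm C X \<otimes>\<^sub>m (lun C B \<cdot> ((ev \<otimes>\<^sub>m idm C B) \<cdot> (iv (asc C D X B) \<cdot> ((idm C D \<otimes>\<^sub>m k) \<cdot> iv (run C D)))))) \<cdot> co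
    = ?l1 \<cdot> (?l2 \<cdot> (?l3 \<cdot> ((idm C X \<otimes>\<^sub>m (idm C D \<otimes>\<^sub>m k)) \<cdot> ((idm C X \<otimes>\<^sub>m iv (run C D)) \<cdot> co))))"
    by (simp add: ten_idl)
  also have "(idm C X \<otimes>\<^sub>m iv (run C D)) \<cdot> co = asc C X D I \<cdot> ((co \<otimes>\<^sub>m idm C I) \<cdot> iv (run C I))"
    by (simp add: r ri)
  also have "(idm C X \<otimes>\<^sub>m (idm C D \<otimes>\<^sub>m k)) \<cdot> (asc C X D I \<cdot> ((co \<otimes>\<^sub>m idm C I) \<cdot> iv (run C I)))
    = ((idm C X \<otimes>\<^sub>m (idm C D \<otimes>\<^sub>m k)) \<cdot> asc C X D I) \<cdot> ((co \<otimes>\<^sub>m idm C I) \<cdot> iv (run C I))" by simp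
  also have "(idm C X \<otimes>\<^sub>m (idm C D \<otimes>\<^sub>m k)) \<cdot> asc C X D I = asc C X D (X \<otimes>\<^sub>o B) \<cdot> (idm C (X \<otimes>\<^sub>o D) \<otimes>\<^sub>m k)"
    using asc_nat'[of "idm C X" "idm C D" k X D "X \<otimes>\<^sub>o B"] by simp
  also have "(asc C X D (X \<otimes>\<^sub>o B) \<cdot> (idm C (X \<otimes>\<^sub>o D) \<otimes>\<^sub>m k)) \<cdot> ((co \<otimes>\<^sub>m idm C I) \<cdot> iv (run C I))
    = asc C X D (X \<otimes>\<^sub>o B) \<cdot> (((idm C (X \<otimes>\<^sub>o D) \<otimes>\<^sub>m k) \<cdot> (co \<otimes>\<^sub>m idm C I)) \<cdot> iv (run C I))" by simp
  also have "(idm C (X \<otimes>\<^sub>o D) \<otimes>\<^sub>m k) \<cdot> (co \<otimes>\<^sub>m idm C I) = (co \<otimes>\<^sub>m idm C (X \<otimes>\<^sub>o B)) \<cdot> (idm C I \<otimes>\<^sub>m k)"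
    by (simp add: ten_cmp)
  also have "((co \<otimes>\<^sub>m idm C (X \<otimes>\<^sub>o B)) \<cdot> (idm C I \<otimes>\<^sub>m k)) \<cdot> iv (run C I) = (co \<otimes>\<^sub>m idm C (X \<otimes>\<^sub>o B)) \<cdot> (iv (lun C (X \<otimes>\<^sub>o B)) \<cdot> k)"
    by (simp add: li flip: lun_run_unit)
  also have "iv (lun C (X \<otimes>\<^sub>o B)) = asc C I X B \<cdot> (iv (lun C X) \<otimes>\<^sub>m idm C B)"
  proof -
    have "iv (lun C X) \<otimes>\<^sub>m idm C B = iv (asc C I X B) \<cdot> iv (lun C (X \<otimes>\<^sub>o B))"
      using arg_cong[OF lun_ten[of X B], of iv] by simp
    then show ?thesis by simp
  qed
  also have "(co \<otimes>\<^sub>m idm C (X \<otimes>\<^sub>o B)) \<cdot> ((asc C I X B \<cdot> (iv (lun C X) \<otimes>\<^sub>m idm C B)) \<cdot> k)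
    = ((co \<otimes>\<^sub>m (idm C X \<otimes>\<^sub>m idm C B)) \<cdot> asc C I X B) \<cdot> ((iv (lun C X) \<otimes>\<^sub>m idm C B) \<cdot> k)" by simp
  also have "(co \<otimes>\<^sub>m (idm C X \<otimes>\<^sub>m idm C B)) \<cdot> asc C I X B = asc C (X \<otimes>\<^sub>o D) X B \<cdot> ((co \<otimes>\<^sub>m idm C X) \<otimes>\<^sub>m idm C B)"
    using asc_nat'[of co "idm C X" "idm C B" "X \<otimes>\<^sub>o D" X B] by simp
  also have "?l3 \<cdot> (asc C X D (X \<otimes>\<^sub>o B) \<cdot> ((asc C (X \<otimes>\<^sub>o D) X B \<cdot> ((co \<otimes>\<^sub>m idm C X) \<otimes>\<^sub>m idm C B)) \<cdot> ((iv (lun C X) \<otimes>\<^sub>m idm C B) \<cdot> k)))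
    = ?l3 \<cdot> ((asc C X D (X \<otimes>\<^sub>o B) \<cdot> asc C (X \<otimes>\<^sub>o D) X B) \<cdot> (((co \<otimes>\<^sub>m idm C X) \<otimes>\<^sub>m idm C B) \<cdot> ((iv (lun C X) \<otimes>\<^sub>m idm C B) \<cdot> k)))"
    by simp
  also have "\<dots> = (?l3 \<cdot> ((idm C X \<otimes>\<^sub>m asc C D X B) \<cdot> (asc C X (D \<otimes>\<^sub>o X) B \<cdot> (asc C X D X \<otimes>\<^sub>m idm C B))))
       \<cdot> (((co \<otimes>\<^sub>m idm C X) \<otimes>\<^sub>m idm C B) \<cdot> ((iv (lun C X) \<otimes>\<^sub>m idm C B) \<cdot> k))"
    by (subst pentagon') auto
  also have "?l3 \<cdot> ((idm C X \<otimes>\<^sub>m asc C D X B) \<cdot> (asc C X (D \<otimes>\<^sub>o X) B \<cdot> (asc C X D X \<otimes>\<^sub>m idm C B))) = asc C X (D \<otimes>\<^sub>o X) B \<cdot> (asc C X D X \<otimes>\<^sub>m idm C B)"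
    by (simp add: ten_cmp_ext)
  also have "?l2 \<cdot> ((asc C X (D \<otimes>\<^sub>o X) B \<cdot> (asc C X D X \<otimes>\<^sub>m idm C B)) \<cdot> (((co \<otimes>\<^sub>m idm C X) \<otimes>\<^sub>m idm C B) \<cdot> ((iv (lun C X) \<otimes>\<^sub>m idm C B) \<cdot> k)))
    = (?l2 \<cdot> asc C X (D \<otimes>\<^sub>o X) B) \<cdot> ((asc C X D X \<otimes>\<^sub>m idm C B) \<cdot> (((co \<otimes>\<^sub>m idm C X) \<otimes>\<^sub>m idm C B) \<cdot> ((iv (lun C X) \<otimes>\<^sub>m idm C B) \<cdot> k)))"
    by simp
  also have "?l2 \<cdot> asc C X (D \<otimes>\<^sub>o X) B = asc C X I B \<cdot> ((idm C X \<otimes>\<^sub>m ev) \<otimes>\<^sub>m idm C B)"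
    using asc_nat'[of "idm C X" ev "idm C B" X I B] by simp
  also have "?l1 \<cdot> ((asc C X I B \<cdot> ((idm C X \<otimes>\<^sub>m ev) \<otimes>\<^sub>m idm C B)) \<cdot> ((asc C X D X \<otimes>\<^sub>m idm C B) \<cdot> (((co \<otimes>\<^sub>m idm C X) \<otimes>\<^sub>m idm C B) \<cdot> ((iv (lun C X) \<otimes>\<^sub>m idm C B) \<cdot> k))))
    = (?l1 \<cdot> asc C X I B) \<cdot> (((idm C X \<otimes>\<^sub>m ev) \<otimes>\<^sub>m idm C B) \<cdot> ((asc C X D X \<otimes>\<^sub>m idm C B) \<cdot> (((co \<otimes>\<^sub>m idm C X) \<otimes>\<^sub>m idm C B) \<cdot> ((iv (lun C X) \<otimes>\<^sub>m idm C B) \<cdot> k))))"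
    by simp
  also have "?l1 \<cdot> asc C X I B = run C X \<otimes>\<^sub>m idm C B" by (rule triangle) auto
  also have "(run C X \<otimes>\<^sub>m idm C B) \<cdot> (((idm C X \<otimes>\<^sub>m ev) \<otimes>\<^sub>m idm C B) \<cdot> ((asc C X D X \<otimes>\<^sub>m idm C B) \<cdot> (((co \<otimes>\<^sub>m idm C X) \<otimes>\<^sub>m idm C B) \<cdot> ((iv (lun C X) \<otimes>\<^sub>m idm C B) \<cdot> k))))
    = ((run C X \<cdot> ((idm C X \<otimes>\<^sub>m ev) \<cdot> (asc C X D X \<cdot> ((co \<otimes>\<^sub>m idm C X) \<cdot> iv (lun C X))))) \<otimes>\<^sub>m idm C B) \<cdot> k"
    by (simp add: ten_idr)
  also have "\<dots> = k" by (simp add: z)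
  finally show ?thesis .
qed

text \<open>The transpose \<open>h\<close> can be defined by means of \<open>ev'\<close> or by means
  of \<open>co\<close>. Both formulas give the same composite, so one \<open>h\<close> satisfies
  both exchange laws; this is what lets a morphism slide around the loop of a trace.\<close>

lemma transpose_ex:
  assumes X: "dual_pair X D ev co" and Y: "dual_pair Y D' ev' co'"
    and f [simp]: "arr f" "dm f = X" "cd f = Y"
  obtains h where "arr h" "dm h = D'" "cd h = D" "ev' \<cdot> (idm C D' \<otimes>\<^sub>m f) = ev \<cdot> (h \<otimes>\<^sub>m idm C X)"
    "(f \<otimes>\<^sub>m idm C D) \<cdot> co = (idm C Y \<otimes>\<^sub>m h) \<cdot> co'"
proof -
  note [simp] = dual_pairD(1-8)[OF X] dual_pairD(1-8)[OF Y]
  let ?g = "ev' \<cdot> (idm C D' \<otimes>\<^sub>m f)"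
  let ?k = "(f \<otimes>\<^sub>m idm C D) \<cdot> co"
  let ?h = "lun C D \<cdot> ((?g \<otimes>\<^sub>m idm C D) \<cdot> (iv (asc C D' X D) \<cdot> ((idm C D' \<otimes>\<^sub>m co) \<cdot> iv (run C D'))))"
  have "((idm C D' \<otimes>\<^sub>m f) \<otimes>\<^sub>m idm C D) \<cdot> (iv (asc C D' X D) \<cdot> ((idm C D' \<otimes>\<^sub>m co) \<cdot> iv (run C D')))
    = (((idm C D' \<otimes>\<^sub>m f) \<otimes>\<^sub>m idm C D) \<cdot> iv (asc C D' X D)) \<cdot> ((idm C D' \<otimes>\<^sub>m co) \<cdot> iv (run C D'))" by simp
  also have "\<dots> = (iv (asc C D' Y D) \<cdot> (idm C D' \<otimes>\<^sub>m (f \<otimes>\<^sub>m idm C D))) \<cdot> ((idm C D' \<otimes>\<^sub>m co) \<cdot> iv (run C D'))"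
    by (subst asc_nat_inv) auto
  also have "\<dots> = iv (asc C D' Y D) \<cdot> ((idm C D' \<otimes>\<^sub>m ?k) \<cdot> iv (run C D'))"
    by (simp add: ten_idl)
  \<comment> \<open>Naturality of the associator has moved \<open>f\<close> from the evaluation to
    the coevaluation: \<open>?h\<close>, built from \<open>?g\<close>, is also the morphism that
    \<open>dual_adj_coev\<close> assigns to \<open>?k\<close>.\<close>
  finally have "?h = lun C D \<cdot> ((ev' \<otimes>\<^sub>m idm C D) \<cdot> (iv (asc C D' Y D) \<cdot> ((idm C D' \<otimes>\<^sub>m ?k) \<cdot> iv (run C D'))))"
    by (simp add: ten_idr)
  then have 1: "(idm C Y \<otimes>\<^sub>m ?h) \<cdot> co' = ?k"
    using dual_adj_coev[OF Y, of D ?k] by simp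
  have 2: "ev \<cdot> (?h \<otimes>\<^sub>m idm C X) = ?g"
    using dual_adj_left[OF X, of D' ?g] by simp
  show thesis by (rule that[of ?h]) (simp_all only: 1 2, simp_all)
qed

text \<open>Transposing \<open>ev \<cdot> (u \<otimes>\<^sub>m idm C X)\<close> back with
  \<open>co\<close> returns \<open>u\<close>, by the zigzag identity of \<open>D\<close>. Identities
  between morphisms into a dual can thus be checked under the evaluation.\<close>

lemma dual_ev_faithful:
  assumes dp: "dual_pair X D ev co" and [simp]: "arr h" "arr h'" "dm h = dm h'" "cd h = D" "cd h' = D"
    and eq: "ev \<cdot> (h \<otimes>\<^sub>m idm C X) = ev \<cdot> (h' \<otimes>\<^sub>m idm C X)"
  shows "h = h'"
proof -
  note [simp] = dual_pairD(1-8)[OF dp]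
  have *: "lun C D \<cdot> (((ev \<cdot> (u \<otimes>\<^sub>m idm C X)) \<otimes>\<^sub>m idm C D) \<cdot> (iv (asc C (dm u) X D) \<cdot> ((idm C (dm u) \<otimes>\<^sub>m co) \<cdot> iv (run C (dm u))))) = u"
    if [simp]: "arr u" "cd u = D" for u
  proof -
    have "lun C D \<cdot> (((ev \<cdot> (u \<otimes>\<^sub>m idm C X)) \<otimes>\<^sub>m idm C D) \<cdot> (iv (asc C (dm u) X D) \<cdot> ((idm C (dm u) \<otimes>\<^sub>m co) \<cdot> iv (run C (dm u)))))
      = lun C D \<cdot> ((ev \<otimes>\<^sub>m idm C D) \<cdot> ((((u \<otimes>\<^sub>m idm C X) \<otimes>\<^sub>m idm C D) \<cdot> iv (asc C (dm u) X D)) \<cdot> ((idm C (dm u) \<otimes>\<^sub>m co) \<cdot> iv (run C (dm u)))))"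
      by (simp add: ten_idr)
    also have "((u \<otimes>\<^sub>m idm C X) \<otimes>\<^sub>m idm C D) \<cdot> iv (asc C (dm u) X D) = iv (asc C D X D) \<cdot> (u \<otimes>\<^sub>m idm C (X \<otimes>\<^sub>o D))"
      using asc_nat_inv[of u "idm C X" "idm C D" "dm u" X D] by simp
    also have "(iv (asc C D X D) \<cdot> (u \<otimes>\<^sub>m idm C (X \<otimes>\<^sub>o D))) \<cdot> ((idm C (dm u) \<otimes>\<^sub>m co) \<cdot> iv (run C (dm u)))
      = iv (asc C D X D) \<cdot> (((u \<otimes>\<^sub>m idm C (X \<otimes>\<^sub>o D)) \<cdot> (idm C (dm u) \<otimes>\<^sub>m co)) \<cdot> iv (run C (dm u)))" by simp
    also have "(u \<otimes>\<^sub>m idm C (X \<otimes>\<^sub>o D)) \<cdot> (idm C (dm u) \<otimes>\<^sub>m co) = (idm C D \<otimes>\<^sub>m co) \<cdot> (u \<otimes>\<^sub>m idm C I)"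
      by (simp add: ten_cmp)
    also have "((idm C D \<otimes>\<^sub>m co) \<cdot> (u \<otimes>\<^sub>m idm C I)) \<cdot> iv (run C (dm u)) = (idm C D \<otimes>\<^sub>m co) \<cdot> (iv (run C D) \<cdot> u)"
    proof -
      have "run C D \<cdot> ((u \<otimes>\<^sub>m idm C I) \<cdot> iv (run C (dm u))) = (run C D \<cdot> (u \<otimes>\<^sub>m idm C I)) \<cdot> iv (run C (dm u))" by simp
      also have "\<dots> = u" by (subst run_nat') auto
      finally have "(u \<otimes>\<^sub>m idm C I) \<cdot> iv (run C (dm u)) = iv (run C D) \<cdot> u" by (intro iso_move) auto
      then show ?thesis by simp
    qed
    also have "lun C D \<cdot> ((ev \<otimes>\<^sub>m idm C D) \<cdot> (iv (asc C D X D) \<cdot> ((idm C D \<otimes>\<^sub>m co) \<cdot> (iv (run C D) \<cdot> u))))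
      = (lun C D \<cdot> ((ev \<otimes>\<^sub>m idm C D) \<cdot> (iv (asc C D X D) \<cdot> ((idm C D \<otimes>\<^sub>m co) \<cdot> iv (run C D))))) \<cdot> u" by simp
    also have "\<dots> = u" by (simp add: dual_pairD(10)[OF dp])
    finally show ?thesis .
  qed
  show ?thesis
    by (rule trans[OF *[OF assms(2,5), unfolded eq assms(4), symmetric] *[OF assms(3,6)]])
qed

text \<open>The morphism \<open>(f \<otimes>\<^sub>m idm C D) \<cdot> co\<close> is the name of
  \<open>f\<close>. Recovering \<open>f\<close> from it shows that a nonzero morphism has a nonzero
  name, as the nondegeneracy of the trace pairing requires.\<close>

lemma dual_co_retract:
  assumes dp: "dual_pair X D ev co" and [simp]: "arr f" "dm f = X"
  shows "run C (cd f) \<cdot> ((idm C (cd f) \<otimes>\<^sub>m ev) \<cdot> (asc C (cd f) D X \<cdot> ((((f \<otimes>\<^sub>m idm C D) \<cdot> co) \<otimes>\<^sub>m idm C X) \<cdot> iv (lun C X)))) = f"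
proof -
  note [simp] = dual_pairD(1-8)[OF dp]
  let ?r = "(co \<otimes>\<^sub>m idm C X) \<cdot> iv (lun C X)"
  have "run C (cd f) \<cdot> ((idm C (cd f) \<otimes>\<^sub>m ev) \<cdot> (asc C (cd f) D X \<cdot> ((((f \<otimes>\<^sub>m idm C D) \<cdot> co) \<otimes>\<^sub>m idm C X) \<cdot> iv (lun C X))))
    = run C (cd f) \<cdot> ((idm C (cd f) \<otimes>\<^sub>m ev) \<cdot> ((asc C (cd f) D X \<cdot> ((f \<otimes>\<^sub>m idm C D) \<otimes>\<^sub>m idm C X)) \<cdot> ?r))"
    by (simp add: ten_idr)
  also have "asc C (cd f) D X \<cdot> ((f \<otimes>\<^sub>m idm C D) \<otimes>\<^sub>m idm C X) = (f \<otimes>\<^sub>m idm C (D \<otimes>\<^sub>o X)) \<cdot> asc C X D X"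
    by (subst asc_nat') auto
  also have "(idm C (cd f) \<otimes>\<^sub>m ev) \<cdot> (((f \<otimes>\<^sub>m idm C (D \<otimes>\<^sub>o X)) \<cdot> asc C X D X) \<cdot> ?r)
    = (f \<otimes>\<^sub>m idm C I) \<cdot> ((idm C X \<otimes>\<^sub>m ev) \<cdot> (asc C X D X \<cdot> ?r))"
    by (simp add: ten_cmp_ext)
  also have "run C (cd f) \<cdot> ((f \<otimes>\<^sub>m idm C I) \<cdot> ((idm C X \<otimes>\<^sub>m ev) \<cdot> (asc C X D X \<cdot> ?r)))
    = (run C (cd f) \<cdot> (f \<otimes>\<^sub>m idm C I)) \<cdot> ((idm C X \<otimes>\<^sub>m ev) \<cdot> (asc C X D X \<cdot> ?r))" by simp
  also have "\<dots> = f \<cdot> (run C X \<cdot> ((idm C X \<otimes>\<^sub>m ev) \<cdot> (asc C X D X \<cdot> ?r)))"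
    by (subst run_nat') auto
  also have "\<dots> = f" by (simp add: dual_pairD(9)[OF dp])
  finally show ?thesis .
qed

text \<open>The factor \<open>f\<close> passes through the coevaluation as its transpose
  \<open>h\<close>, crosses the braiding by naturality, and reappears as \<open>f\<close> under the
  evaluation \<open>ev'\<close>.\<close>

lemma trace_cyclic:
  assumes X: "dual_pair X D ev co" and Y: "dual_pair Y D' ev' co'"
    and f [simp]: "arr f" "dm f = X" "cd f = Y" and g [simp]: "arr g" "dm g = Y" "cd g = X"
  shows "ev \<cdot> (brd C X D \<cdot> (((g \<cdot> f) \<otimes>\<^sub>m idm C D) \<cdot> co)) = ev' \<cdot> (brd C Y D' \<cdot> (((f \<cdot> g) \<otimes>\<^sub>m idm C D') \<cdot> co'))"
proof -
  note [simp] = dual_pairD(1-8)[OF X] dual_pairD(1-8)[OF Y]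
  obtain h where h [simp]: "arr h" "dm h = D'" "cd h = D"
    and 1: "ev' \<cdot> (idm C D' \<otimes>\<^sub>m f) = ev \<cdot> (h \<otimes>\<^sub>m idm C X)"
    and 2: "(f \<otimes>\<^sub>m idm C D) \<cdot> co = (idm C Y \<otimes>\<^sub>m h) \<cdot> co'"
    using transpose_ex[OF X Y f] by blast
  have "ev \<cdot> (brd C X D \<cdot> (((g \<cdot> f) \<otimes>\<^sub>m idm C D) \<cdot> co)) = ev \<cdot> (brd C X D \<cdot> ((g \<otimes>\<^sub>m idm C D) \<cdot> ((f \<otimes>\<^sub>m idm C D) \<cdot> co)))"
    by (simp add: ten_idr)
  also have "\<dots> = ev \<cdot> (brd C X D \<cdot> ((idm C X \<otimes>\<^sub>m h) \<cdot> ((g \<otimes>\<^sub>m idm C D') \<cdot> co')))"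
    by (simp add: 2 ten_cmp_ext)
  also have "\<dots> = ev \<cdot> ((brd C X D \<cdot> (idm C X \<otimes>\<^sub>m h)) \<cdot> ((g \<otimes>\<^sub>m idm C D') \<cdot> co'))" by simp
  also have "\<dots> = ev \<cdot> (((h \<otimes>\<^sub>m idm C X) \<cdot> brd C X D') \<cdot> ((g \<otimes>\<^sub>m idm C D') \<cdot> co'))"
    by (subst brd_nat') auto
  also have "\<dots> = (ev \<cdot> (h \<otimes>\<^sub>m idm C X)) \<cdot> (brd C X D' \<cdot> ((g \<otimes>\<^sub>m idm C D') \<cdot> co'))" by simp
  also have "\<dots> = ev' \<cdot> (((idm C D' \<otimes>\<^sub>m f) \<cdot> brd C X D') \<cdot> ((g \<otimes>\<^sub>m idm C D') \<cdot> co'))"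
    by (simp flip: 1)
  also have "(idm C D' \<otimes>\<^sub>m f) \<cdot> brd C X D' = brd C Y D' \<cdot> (f \<otimes>\<^sub>m idm C D')"
    by (subst brd_nat') auto
  also have "(brd C Y D' \<cdot> (f \<otimes>\<^sub>m idm C D')) \<cdot> ((g \<otimes>\<^sub>m idm C D') \<cdot> co') = brd C Y D' \<cdot> (((f \<cdot> g) \<otimes>\<^sub>m idm C D') \<cdot> co')"
    by (simp add: ten_cmp_ext)
  finally show ?thesis .
qed

text \<open>Every functional \<open>g\<close> on names is a trace: precomposed with the braiding,
  \<open>g\<close> is the evaluation of some \<open>r\<close> by \<open>dual_adj_right\<close>, and
  the two braidings cancel because the category is symmetric.\<close>

lemma trace_pairing:
  assumes dp: "dual_pair X D ev co" and Y [simp]: "Y \<in> Obj C"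
    and g [simp]: "arr g" "dm g = Y \<otimes>\<^sub>o D" "cd g = I"
  obtains r where "arr r" "dm r = Y" "cd r = X"
    "\<And>f. arr f \<Longrightarrow> dm f = X \<Longrightarrow> cd f = Y \<Longrightarrow>
      ev \<cdot> (brd C X D \<cdot> (((r \<cdot> f) \<otimes>\<^sub>m idm C D) \<cdot> co)) = g \<cdot> ((f \<otimes>\<^sub>m idm C D) \<cdot> co)"
proof -
  note [simp] = dual_pairD(1-8)[OF dp]
  let ?g = "g \<cdot> brd C D Y"
  obtain r where r [simp]: "arr r" "dm r = Y" "cd r = X" and er: "ev \<cdot> (idm C D \<otimes>\<^sub>m r) = ?g"
  proof
    let ?r = "run C X \<cdot> ((idm C X \<otimes>\<^sub>m ?g) \<cdot> (asc C X D Y \<cdot> ((co \<otimes>\<^sub>m idm C Y) \<cdot> iv (lun C Y))))"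
    show "ev \<cdot> (idm C D \<otimes>\<^sub>m ?r) = ?g" by (rule dual_adj_right[OF dp]) auto
  qed auto
  show thesis
  proof (rule that[of r])
    fix f assume [simp]: "arr f" "dm f = X" "cd f = Y"
    have "ev \<cdot> (brd C X D \<cdot> (((r \<cdot> f) \<otimes>\<^sub>m idm C D) \<cdot> co)) = ev \<cdot> ((brd C X D \<cdot> (r \<otimes>\<^sub>m idm C D)) \<cdot> ((f \<otimes>\<^sub>m idm C D) \<cdot> co))"
      by (simp add: ten_idr)
    also have "\<dots> = ev \<cdot> (((idm C D \<otimes>\<^sub>m r) \<cdot> brd C Y D) \<cdot> ((f \<otimes>\<^sub>m idm C D) \<cdot> co))"
      by (subst brd_nat') auto
    also have "\<dots> = (ev \<cdot> (idm C D \<otimes>\<^sub>m r)) \<cdot> (brd C Y D \<cdot> ((f \<otimes>\<^sub>m idm C D) \<cdot> co))" by simp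
    also have "\<dots> = g \<cdot> ((brd C D Y \<cdot> brd C Y D) \<cdot> ((f \<otimes>\<^sub>m idm C D) \<cdot> co))" by (simp add: er)
    also have "\<dots> = g \<cdot> ((f \<otimes>\<^sub>m idm C D) \<cdot> co)" by (subst brd_sym) auto
    finally show "ev \<cdot> (brd C X D \<cdot> (((r \<cdot> f) \<otimes>\<^sub>m idm C D) \<cdot> co)) = g \<cdot> ((f \<otimes>\<^sub>m idm C D) \<cdot> co)" .
  qed (use r in simp_all)
qed

end

section \<open>Semiprime linear categories are von Neumann regular\<close>

primrec cpow :: "('o, 'm, 'x) category_scheme \<Rightarrow> 'o \<Rightarrow> 'm \<Rightarrow> nat \<Rightarrow> 'm" where
  "cpow C X a 0 = idm C X"
| "cpow C X a (Suc n) = a \<cdot>\<^bsub>C\<^esub> cpow C X a n"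

text \<open>For the endomorphisms of one object, if they form a finite-dimensional algebra, this
  says that the Jacobson radical vanishes, since \<open>x\<close> lies in the radical exactly if all
  products \<open>y \<cdot> x\<close> are nilpotent. With \<open>y\<close> in the opposite Hom set
  the condition makes sense for morphisms between different objects.\<close>

definition semiprime :: "('o, 'm, 's, 'x) tensor_category_scheme \<Rightarrow> bool" where
  "semiprime C \<longleftrightarrow> (\<forall>X\<in>Obj C. \<forall>Y\<in>Obj C. \<forall>x\<in>Hom C X Y. x \<noteq> zeroM C X Y \<longrightarrow>
     (\<exists>y\<in>Hom C Y X. \<forall>n. cpow C X (y \<cdot>\<^bsub>C\<^esub> x) n \<noteq> zeroM C X X))"

definition regular :: "('o, 'm, 'x) category_scheme \<Rightarrow> bool" where
  "regular C \<longleftrightarrow> (\<forall>X\<in>Obj C. \<forall>Y\<in>Obj C. \<forall>x\<in>Hom C X Y. \<exists>y\<in>Hom C Y X. x \<cdot>\<^bsub>C\<^esub> (y \<cdot>\<^bsub>C\<^esub> x) = x)"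

text \<open>Gaussian elimination by induction on the equations: an unknown \<open>k\<close> with
  nonzero coefficient in \<open>t\<close> is eliminated from the other equations. Hom sets are
  carrier sets and not vector space types, so dimension counts are carried out with explicit
  coefficients.\<close>

lemma homogeneous_system:
  fixes c :: "'i \<Rightarrow> 'j \<Rightarrow> 'k::field"
  assumes "finite T" "finite S" "card T < card S"
  shows "\<exists>a. (\<exists>i\<in>S. a i \<noteq> 0) \<and> (\<forall>j\<in>T. (\<Sum>i\<in>S. a i * c i j) = 0)"
  using assms
proof (induction T arbitrary: S c rule: finite_induct)
  case empty
  then show ?case by (intro exI[of _ "\<lambda>_. 1"]) (auto simp: card_gt_0_iff)
next
  case (insert t T)
  show ?case
  proof (cases "\<forall>i\<in>S. c i t = 0")
    case True
    have "card T < card S" using insert by simp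
    from insert.IH[OF insert.prems(1) this, of c] True show ?thesis by auto
  next
    case False
    then obtain k where k: "k \<in> S" "c k t \<noteq> 0" by blast
    let ?S = "S - {k}"
    have "card T < card ?S" using insert k by simp
    from insert.IH[OF _ this, of "\<lambda>i j. c i j - c i t / c k t * c k j"] insert.prems(1)
    obtain a where a: "\<exists>i\<in>?S. a i \<noteq> 0"
      "\<And>j. j \<in> T \<Longrightarrow> (\<Sum>i\<in>?S. a i * (c i j - c i t / c k t * c k j)) = 0" by auto
    \<comment> \<open>The value of the eliminated unknown \<open>k\<close>, up to sign, is dictated
      by equation \<open>t\<close>.\<close>
    let ?s = "\<Sum>i\<in>?S. a i * (c i t / c k t)"
    let ?a = "a(k := - ?s)"
    have sum: "(\<Sum>i\<in>S. ?a i * c i j) = (\<Sum>i\<in>?S. a i * c i j) - ?s * c k j" for j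
      using k insert.prems(1) by (subst sum.remove[of _ k]) (auto intro!: sum.cong)
    have "(\<Sum>i\<in>S. ?a i * c i j) = 0" if "j \<in> insert t T" for j
    proof (cases "j = t")
      case True
      have "?s * c k t = (\<Sum>i\<in>?S. a i * c i t)" using k by (simp add: sum_distrib_right)
      then show ?thesis unfolding sum True by simp
    next
      case False
      then have "j \<in> T" using that by simp
      then show ?thesis unfolding sum using a(2)[of j]
        by (simp add: right_diff_distrib sum_subtractf sum_distrib_right mult.assoc)
    qed
    moreover have "\<exists>i\<in>S. ?a i \<noteq> 0" using a(1) by auto
    ultimately show ?thesis by blast
  qed
qed

section \<open>Linear algebra in Hom spaces\<close>

locale typed_linear_category = linear_category C + typed_category C dm cd
  for C :: "('o, 'm, 's::field, 'x) tensor_category_scheme" (structure) and dm cd +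
  assumes dm_add [simp]: "dm (f \<oplus>\<^sub>m g) = dm f" and cd_add [simp]: "cd (f \<oplus>\<^sub>m g) = cd f"
    and dm_smul [simp]: "dm (a *\<^sub>m f) = dm f" and cd_smul [simp]: "cd (a *\<^sub>m f) = cd f"
    and dm_zero [simp]: "dm (zeroM C X Y) = X" and cd_zero [simp]: "cd (zeroM C X Y) = Y"
begin

lemma zero_arr [simp]: "X \<in> Obj C \<Longrightarrow> Y \<in> Obj C \<Longrightarrow> arr (zeroM C X Y)"
  using zer_in[of X Y] Hom_iff by blast

lemma add_arr [simp]: "arr f \<Longrightarrow> arr g \<Longrightarrow> dm f = dm g \<Longrightarrow> cd f = cd g \<Longrightarrow> arr (f \<oplus>\<^sub>m g)"
  using add_in[of "dm f" "cd f" f g] Hom_iff[of "dm f" "cd f"] by simp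

lemma smul_arr [simp]: "arr f \<Longrightarrow> arr (a *\<^sub>m f)"
  using smul_in[of "dm f" "cd f" f a] Hom_iff[of "dm f" "cd f"] by simp

lemma lin_add:
  assumes "arr f" "arr g" "dm f = dm g" "cd f = cd g"
  shows add_comm': "f \<oplus>\<^sub>m g = g \<oplus>\<^sub>m f"
    and add_assoc': "arr h \<Longrightarrow> dm h = dm g \<Longrightarrow> cd h = cd g \<Longrightarrow> (f \<oplus>\<^sub>m g) \<oplus>\<^sub>m h = f \<oplus>\<^sub>m (g \<oplus>\<^sub>m h)"
  using add_comm[of "dm f" "cd f" f g] add_assoc[of "dm f" "cd f" f g h] assms Hom_iff[of "dm f" "cd f"] by auto

lemma add_left_comm':
  assumes "arr f" "arr g" "arr h" "dm f = dm g" "cd f = cd g" "dm h = dm g" "cd h = cd g"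
  shows "f \<oplus>\<^sub>m (g \<oplus>\<^sub>m h) = g \<oplus>\<^sub>m (f \<oplus>\<^sub>m h)"
  using assms add_assoc'[of f g h] add_assoc'[of g f h] add_comm'[of f g] by simp

lemmas add_ac' = add_assoc' add_comm' add_left_comm'

lemma zero_add [simp]: "arr f \<Longrightarrow> dm f = X \<Longrightarrow> cd f = Y \<Longrightarrow> zeroM C X Y \<oplus>\<^sub>m f = f"
  using zer_add[of "dm f" "cd f" f] Hom_iff[of "dm f" "cd f"] by auto

lemma add_zero [simp]: "arr f \<Longrightarrow> dm f = X \<Longrightarrow> cd f = Y \<Longrightarrow> f \<oplus>\<^sub>m zeroM C X Y = f"
  using add_comm'[of f "zeroM C X Y"] by auto

lemma add_cancel:
  assumes "f \<oplus>\<^sub>m h = g \<oplus>\<^sub>m h" "arr f" "arr g" "arr h" "dm f = dm h" "cd f = cd h" "dm g = dm h" "cd g = cd h"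
  shows "f = g"
proof -
  obtain k where k: "arr k" "dm k = dm h" "cd k = cd h" "k \<oplus>\<^sub>m h = zeroM C (dm h) (cd h)"
    using add_inv[of "dm h" "cd h" h] Hom_iff[of "dm h" "cd h"] assms(4) by auto
  then have z: "h \<oplus>\<^sub>m k = zeroM C (dm h) (cd h)" using add_comm'[of h k] assms by simp
  have "(u \<oplus>\<^sub>m h) \<oplus>\<^sub>m k = u" if "arr u" "dm u = dm h" "cd u = cd h" for u
    using that assms(4) k z by (simp add: add_assoc')
  note u = this
  have "f = (f \<oplus>\<^sub>m h) \<oplus>\<^sub>m k" by (rule u[symmetric]) (fact assms)+
  also have "\<dots> = (g \<oplus>\<^sub>m h) \<oplus>\<^sub>m k" by (simp only: assms(1))
  also have "\<dots> = g" by (rule u) (fact assms)+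
  finally show ?thesis .
qed

lemma smul_one' [simp]: "arr f \<Longrightarrow> 1 *\<^sub>m f = f"
  using smul_one[of "dm f" "cd f" f] Hom_iff[of "dm f" "cd f"] by auto

lemma smul_smul' [simp]: "arr f \<Longrightarrow> a *\<^sub>m (b *\<^sub>m f) = (a * b) *\<^sub>m f"
  using smul_smul[of "dm f" "cd f" f] Hom_iff[of "dm f" "cd f"] by auto

lemma smul_add_left': "arr f \<Longrightarrow> (a + b) *\<^sub>m f = a *\<^sub>m f \<oplus>\<^sub>m b *\<^sub>m f"
  using smul_add_left[of "dm f" "cd f" f] Hom_iff[of "dm f" "cd f"] by auto

lemma smul_add_right' [simp]:
  "arr f \<Longrightarrow> arr g \<Longrightarrow> dm f = dm g \<Longrightarrow> cd f = cd g \<Longrightarrow> a *\<^sub>m (f \<oplus>\<^sub>m g) = a *\<^sub>m f \<oplus>\<^sub>m a *\<^sub>m g"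
  using smul_add_right[of "dm f" "cd f" f g] Hom_iff[of "dm f" "cd f"] by auto

lemma cmp_add [simp]:
  "arr f \<Longrightarrow> arr g \<Longrightarrow> arr g' \<Longrightarrow> cd f = dm g \<Longrightarrow> dm g' = dm g \<Longrightarrow> cd g' = cd g
    \<Longrightarrow> (g \<oplus>\<^sub>m g') \<cdot> f = (g \<cdot> f) \<oplus>\<^sub>m (g' \<cdot> f)"
  "arr f \<Longrightarrow> arr f' \<Longrightarrow> arr g \<Longrightarrow> cd f = dm g \<Longrightarrow> dm f' = dm f \<Longrightarrow> cd f' = cd f
    \<Longrightarrow> g \<cdot> (f \<oplus>\<^sub>m f') = (g \<cdot> f) \<oplus>\<^sub>m (g \<cdot> f')"
  using cmp_add_left[of "dm f" "dm g" "cd g" f g g'] cmp_add_right[of "dm f" "dm g" "cd g" f f' g]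
    Hom_iff[of "dm f" "dm g"] Hom_iff[of "dm g" "cd g"] by auto

lemma cmp_smul [simp]:
  "arr f \<Longrightarrow> arr g \<Longrightarrow> cd f = dm g \<Longrightarrow> (a *\<^sub>m g) \<cdot> f = a *\<^sub>m (g \<cdot> f)"
  "arr f \<Longrightarrow> arr g \<Longrightarrow> cd f = dm g \<Longrightarrow> g \<cdot> (a *\<^sub>m f) = a *\<^sub>m (g \<cdot> f)"
  using cmp_smul_left[of "dm f" "dm g" "cd g" f g a] cmp_smul_right[of "dm f" "dm g" "cd g" f g a]
    Hom_iff[of "dm f" "dm g"] Hom_iff[of "dm g" "cd g"] by auto

lemma zero_smul [simp]: "arr f \<Longrightarrow> 0 *\<^sub>m f = zeroM C (dm f) (cd f)"
proof (rule add_cancel[of _ f])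
  assume [simp]: "arr f"
  have "0 *\<^sub>m f \<oplus>\<^sub>m f = 0 *\<^sub>m f \<oplus>\<^sub>m 1 *\<^sub>m f" by simp
  also have "\<dots> = (0 + 1) *\<^sub>m f" by (rule smul_add_left'[symmetric]) simp
  finally show "0 *\<^sub>m f \<oplus>\<^sub>m f = zeroM C (dm f) (cd f) \<oplus>\<^sub>m f" by simp
qed auto

lemma cmp_zero [simp]:
  "arr f \<Longrightarrow> cd f = X \<Longrightarrow> Y \<in> Obj C \<Longrightarrow> zeroM C X Y \<cdot> f = zeroM C (dm f) Y"
  "arr f \<Longrightarrow> dm f = Y \<Longrightarrow> X \<in> Obj C \<Longrightarrow> f \<cdot> zeroM C X Y = zeroM C X (cd f)"
proof -
  assume [simp]: "arr f" "cd f = X" "Y \<in> Obj C"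
  then have [simp]: "X \<in> Obj C" using arr_Obj(2)[of f] by simp
  have "zeroM C X Y \<cdot> f = (0 *\<^sub>m zeroM C X Y) \<cdot> f" by simp
  also have "\<dots> = 0 *\<^sub>m (zeroM C X Y \<cdot> f)" by (subst cmp_smul) auto
  finally show "zeroM C X Y \<cdot> f = zeroM C (dm f) Y" by simp
next
  assume [simp]: "arr f" "dm f = Y" "X \<in> Obj C"
  then have [simp]: "Y \<in> Obj C" using arr_Obj(1)[of f] by simp
  have "f \<cdot> zeroM C X Y = f \<cdot> (0 *\<^sub>m zeroM C X Y)" by simp
  also have "\<dots> = 0 *\<^sub>m (f \<cdot> zeroM C X Y)" by (subst cmp_smul) auto
  finally show "f \<cdot> zeroM C X Y = zeroM C X (cd f)" by simp
qed

lemma smul_zero [simp]: "X \<in> Obj C \<Longrightarrow> Y \<in> Obj C \<Longrightarrow> a *\<^sub>m zeroM C X Y = zeroM C X Y"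
  using smul_smul'[of "zeroM C X Y" a 0] zero_smul[of "zeroM C X Y"] by simp

definition sub :: "'m \<Rightarrow> 'm \<Rightarrow> 'm"  (infixl "\<ominus>\<^sub>m" 65) where
  "f \<ominus>\<^sub>m g = f \<oplus>\<^sub>m (- 1) *\<^sub>m g"

lemma sub_typ [simp]: "dm (f \<ominus>\<^sub>m g) = dm f" "cd (f \<ominus>\<^sub>m g) = cd f"
  "arr f \<Longrightarrow> arr g \<Longrightarrow> dm f = dm g \<Longrightarrow> cd f = cd g \<Longrightarrow> arr (f \<ominus>\<^sub>m g)"
  by (simp_all add: sub_def)

lemma sub_self [simp]: "arr f \<Longrightarrow> f \<ominus>\<^sub>m f = zeroM C (dm f) (cd f)"
  using smul_add_left'[of f 1 "- 1"] by (simp add: sub_def)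

lemma sub_zero [simp]: "arr f \<Longrightarrow> dm f = X \<Longrightarrow> cd f = Y \<Longrightarrow> f \<ominus>\<^sub>m zeroM C X Y = f"
  using arr_Obj[of f] by (auto simp: sub_def)

lemma sub_eq_zero:
  assumes "f \<ominus>\<^sub>m g = zeroM C X Y" "arr f" "arr g" "dm f = X" "dm g = X" "cd f = Y" "cd g = Y"
  shows "f = g"
proof -
  have "f \<oplus>\<^sub>m (- 1) *\<^sub>m g = g \<oplus>\<^sub>m (- 1) *\<^sub>m g"
    using assms sub_self[of g] by (auto simp: sub_def)
  then show ?thesis by (rule add_cancel) (use assms in auto)
qed

lemma sub_add_cancel [simp]:
  assumes "arr f" "arr g" "dm f = dm g" "cd f = cd g"
  shows "(f \<ominus>\<^sub>m g) \<oplus>\<^sub>m g = f" "g \<oplus>\<^sub>m (f \<ominus>\<^sub>m g) = f"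
proof -
  have *: "(- 1) *\<^sub>m g \<oplus>\<^sub>m g = zeroM C (dm g) (cd g)"
    using assms sub_self[of g] add_comm'[of "(- 1) *\<^sub>m g" g] by (simp add: sub_def)
  show 1: "(f \<ominus>\<^sub>m g) \<oplus>\<^sub>m g = f" using assms by (simp add: sub_def add_assoc' *)
  have "g \<oplus>\<^sub>m (f \<ominus>\<^sub>m g) = (f \<ominus>\<^sub>m g) \<oplus>\<^sub>m g" by (rule add_comm') (use assms in auto)
  with 1 show "g \<oplus>\<^sub>m (f \<ominus>\<^sub>m g) = f" by (rule trans[rotated])
qed

lemma cmp_sub [simp]:
  "arr f \<Longrightarrow> arr g \<Longrightarrow> arr g' \<Longrightarrow> cd f = dm g \<Longrightarrow> dm g' = dm g \<Longrightarrow> cd g' = cd g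
    \<Longrightarrow> (g \<ominus>\<^sub>m g') \<cdot> f = (g \<cdot> f) \<ominus>\<^sub>m (g' \<cdot> f)"
  "arr f \<Longrightarrow> arr f' \<Longrightarrow> arr g \<Longrightarrow> cd f = dm g \<Longrightarrow> dm f' = dm f \<Longrightarrow> cd f' = cd f
    \<Longrightarrow> g \<cdot> (f \<ominus>\<^sub>m f') = (g \<cdot> f) \<ominus>\<^sub>m (g \<cdot> f')"
  by (simp_all add: sub_def)

definition endo :: "'o \<Rightarrow> 'm \<Rightarrow> bool" where
  "endo X f \<longleftrightarrow> arr f \<and> dm f = X \<and> cd f = X"

lemma endoD: "endo X f \<Longrightarrow> arr f \<and> dm f = X \<and> cd f = X \<and> X \<in> Obj C"
  using arr_Obj(1)[of f] by (auto simp: endo_def)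

lemma hom_sum_Cons: "hom_sum C X Y (f # fs) = f \<oplus>\<^sub>m hom_sum C X Y fs"
  and hom_sum_Nil: "hom_sum C X Y [] = zeroM C X Y"
  by (simp_all add: hom_sum_def)

lemma hom_sum_typ:
  assumes "X \<in> Obj C" "Y \<in> Obj C" "\<And>f. f \<in> set fs \<Longrightarrow> arr f \<and> dm f = X \<and> cd f = Y"
  shows "arr (hom_sum C X Y fs) \<and> dm (hom_sum C X Y fs) = X \<and> cd (hom_sum C X Y fs) = Y"
  using assms(3) by (induction fs) (use assms(1,2) in \<open>auto simp: hom_sum_Cons hom_sum_Nil\<close>)

lemma hom_sum_append:
  assumes "X \<in> Obj C" "Y \<in> Obj C" "\<And>f. f \<in> set fs \<union> set gs \<Longrightarrow> arr f \<and> dm f = X \<and> cd f = Y"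
  shows "hom_sum C X Y (fs @ gs) = hom_sum C X Y fs \<oplus>\<^sub>m hom_sum C X Y gs"
  using assms(3)
proof (induction fs)
  case Nil
  then show ?case using hom_sum_typ[OF assms(1,2), of gs] by (simp add: hom_sum_Nil)
next
  case (Cons a fs)
  then show ?case using hom_sum_typ[OF assms(1,2), of gs] hom_sum_typ[OF assms(1,2), of fs]
    by (simp add: hom_sum_Cons add_assoc')
qed

text \<open>Sums over an initial segment of the natural numbers, for induction on their length.
  Since \<open>hom_sum\<close> folds a list from the right, splitting off the last summand in
  \<open>csum_Suc\<close> rests on associativity and hence on the typing predicate
  \<open>fam\<close>.\<close>

definition csum :: "'o \<Rightarrow> 'o \<Rightarrow> (nat \<Rightarrow> 'm) \<Rightarrow> nat \<Rightarrow> 'm" where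
  "csum X Y f n = hom_sum C X Y (map f [0..<n])"

definition fam :: "'o \<Rightarrow> 'o \<Rightarrow> (nat \<Rightarrow> 'm) \<Rightarrow> nat \<Rightarrow> bool" where
  "fam X Y f n \<longleftrightarrow> X \<in> Obj C \<and> Y \<in> Obj C \<and> (\<forall>i<n. arr (f i) \<and> dm (f i) = X \<and> cd (f i) = Y)"

lemma csum_0 [simp]: "csum X Y f 0 = zeroM C X Y" by (simp add: csum_def hom_sum_Nil)

lemma fam_mono: "fam X Y f (Suc n) \<Longrightarrow> fam X Y f n"
  by (auto simp: fam_def)

lemma csum_Suc: "fam X Y f (Suc n) \<Longrightarrow> csum X Y f (Suc n) = csum X Y f n \<oplus>\<^sub>m f n"
proof -
  assume f: "fam X Y f (Suc n)"
  have "hom_sum C X Y (map f [0..<n] @ [f n]) = hom_sum C X Y (map f [0..<n]) \<oplus>\<^sub>m hom_sum C X Y [f n]"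
    by (rule hom_sum_append) (use f in \<open>auto simp: fam_def\<close>)
  also have "hom_sum C X Y [f n] = f n" using f by (simp add: fam_def hom_sum_Cons hom_sum_Nil)
  finally show ?thesis by (simp add: csum_def)
qed

lemma csum_typ:
  assumes "fam X Y f n"
  shows "arr (csum X Y f n)" "dm (csum X Y f n) = X" "cd (csum X Y f n) = Y"
proof -
  have "\<And>h. h \<in> set (map f [0..<n]) \<Longrightarrow> arr h \<and> dm h = X \<and> cd h = Y"
    using assms by (auto simp: fam_def)
  from hom_sum_typ[of X Y "map f [0..<n]", OF _ _ this] show "arr (csum X Y f n)" "dm (csum X Y f n) = X" "cd (csum X Y f n) = Y"
    using assms by (auto simp: csum_def fam_def)
qed

lemma csum_cong: "(\<And>i. i < n \<Longrightarrow> f i = g i) \<Longrightarrow> csum X Y f n = csum X Y g n"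
  unfolding csum_def by (intro arg_cong[of _ _ "hom_sum C X Y"]) auto

lemma csum_zero:
  assumes "X \<in> Obj C" "Y \<in> Obj C"
  shows "csum X Y (\<lambda>_. zeroM C X Y) n = zeroM C X Y"
  by (induction n) (use assms in \<open>auto simp: csum_Suc fam_def\<close>)

lemma csum_add:
  assumes "fam X Y f n" "fam X Y g n"
  shows "csum X Y (\<lambda>i. f i \<oplus>\<^sub>m g i) n = csum X Y f n \<oplus>\<^sub>m csum X Y g n"
  using assms
proof (induction n)
  case (Suc n)
  have f: "fam X Y (\<lambda>i. f i \<oplus>\<^sub>m g i) (Suc n)" using Suc.prems by (auto simp: fam_def)
  note m = fam_mono[OF Suc.prems(1)] fam_mono[OF Suc.prems(2)]
  have "arr (f n) \<and> dm (f n) = X \<and> cd (f n) = Y" "arr (g n) \<and> dm (g n) = X \<and> cd (g n) = Y"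
    using Suc.prems by (auto simp: fam_def)
  then show ?case using csum_typ[OF m(1)] csum_typ[OF m(2)] Suc.IH[OF m]
    by (simp add: csum_Suc[OF f] csum_Suc[OF Suc.prems(1)] csum_Suc[OF Suc.prems(2)] add_ac')
qed (auto simp: fam_def)

lemma csum_cmp_left:
  assumes "fam X Y f n" "arr h" "dm h = Y"
  shows "h \<cdot> csum X Y f n = csum X (cd h) (\<lambda>i. h \<cdot> f i) n"
  using assms(1)
proof (induction n)
  case (Suc n)
  have f: "fam X (cd h) (\<lambda>i. h \<cdot> f i) (Suc n)" using Suc.prems assms by (auto simp: fam_def)
  note m = fam_mono[OF Suc.prems(1)]
  have "arr (f n) \<and> dm (f n) = X \<and> cd (f n) = Y" using Suc.prems by (auto simp: fam_def)
  then show ?case using csum_typ[OF m(1)] Suc.IH[OF m] assms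
    by (simp add: csum_Suc[OF f] csum_Suc[OF Suc.prems(1)])
qed (use assms in \<open>auto simp: fam_def\<close>)

lemma csum_cmp_right:
  assumes "fam X Y f n" "arr h" "cd h = X"
  shows "csum X Y f n \<cdot> h = csum (dm h) Y (\<lambda>i. f i \<cdot> h) n"
  using assms(1)
proof (induction n)
  case (Suc n)
  have f: "fam (dm h) Y (\<lambda>i. f i \<cdot> h) (Suc n)" using Suc.prems assms by (auto simp: fam_def)
  note m = fam_mono[OF Suc.prems(1)]
  have "arr (f n) \<and> dm (f n) = X \<and> cd (f n) = Y" using Suc.prems by (auto simp: fam_def)
  then show ?case using csum_typ[OF m(1)] Suc.IH[OF m] assms
    by (simp add: csum_Suc[OF f] csum_Suc[OF Suc.prems(1)])
qed (use assms in \<open>auto simp: fam_def\<close>)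

lemma csum_smul:
  assumes "fam X Y f n"
  shows "a *\<^sub>m csum X Y f n = csum X Y (\<lambda>i. a *\<^sub>m f i) n"
  using assms
proof (induction n)
  case (Suc n)
  have f: "fam X Y (\<lambda>i. a *\<^sub>m f i) (Suc n)" using Suc.prems by (auto simp: fam_def)
  note m = fam_mono[OF Suc.prems(1)]
  have "arr (f n) \<and> dm (f n) = X \<and> cd (f n) = Y" using Suc.prems by (auto simp: fam_def)
  then show ?case using csum_typ[OF m(1)] Suc.IH[OF m]
    by (simp add: csum_Suc[OF f] csum_Suc[OF Suc.prems(1)])
qed (auto simp: fam_def)

lemma csum_smul_sum:
  assumes "arr f"
  shows "csum (dm f) (cd f) (\<lambda>i. a i *\<^sub>m f) n = (\<Sum>i<n. a i) *\<^sub>m f"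
proof (induction n)
  case (Suc n)
  then show ?case using assms smul_add_left'[of f "\<Sum>i<n. a i" "a n"]
    by (subst csum_Suc) (auto simp: fam_def)
qed (use assms in auto)

lemma csum_swap:
  assumes "\<And>i. i < m \<Longrightarrow> fam X Y (f i) n" "X \<in> Obj C" "Y \<in> Obj C"
  shows "csum X Y (\<lambda>i. csum X Y (f i) n) m = csum X Y (\<lambda>j. csum X Y (\<lambda>i. f i j) m) n"
  using assms(1)
proof (induction m)
  case 0
  then show ?case using assms(2,3) by (simp add: csum_zero)
next
  case (Suc m)
  have 1: "fam X Y (\<lambda>i. csum X Y (f i) n) (Suc m)"
    using Suc.prems assms(2,3) csum_typ unfolding fam_def[of _ _ "\<lambda>i. csum X Y (f i) n"] by blast
  have 2: "fam X Y (\<lambda>i. f i j) (Suc m)" if "j < n" for j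
    using Suc.prems assms(2,3) that by (auto simp: fam_def)
  have 3: "fam X Y (\<lambda>j. csum X Y (\<lambda>i. f i j) m) n"
    using csum_typ[OF fam_mono[OF 2]] assms(2,3) unfolding fam_def[of _ _ _ n] by blast
  have "csum X Y (\<lambda>j. csum X Y (\<lambda>i. f i j) (Suc m)) n = csum X Y (\<lambda>j. csum X Y (\<lambda>i. f i j) m \<oplus>\<^sub>m f m j) n"
    by (rule csum_cong) (use csum_Suc[OF 2] in auto)
  also have "\<dots> = csum X Y (\<lambda>j. csum X Y (\<lambda>i. f i j) m) n \<oplus>\<^sub>m csum X Y (f m) n"
    by (rule csum_add[OF 3]) (use Suc.prems in auto)
  finally show ?case using Suc by (simp add: csum_Suc[OF 1])
qed

lemma csum_delta:
  assumes "fam X Y f n" "k < n" "\<And>i. i < n \<Longrightarrow> i \<noteq> k \<Longrightarrow> f i = zeroM C X Y"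
  shows "csum X Y f n = f k"
  using assms
proof (induction n)
  case (Suc n)
  have o: "X \<in> Obj C" "Y \<in> Obj C" using Suc.prems(1) by (auto simp: fam_def)
  have n: "arr (f n) \<and> dm (f n) = X \<and> cd (f n) = Y" using Suc.prems(1) by (auto simp: fam_def)
  show ?case
  proof (cases "k = n")
    case True
    have "csum X Y f n = csum X Y (\<lambda>_. zeroM C X Y) n"
      using Suc.prems(3) True by (intro csum_cong) auto
    then show ?thesis using csum_Suc[OF Suc.prems(1)] True n o by (simp add: csum_zero)
  next
    case False
    then have "csum X Y f n = f k" using Suc fam_mono by auto
    then show ?thesis using csum_Suc[OF Suc.prems(1)] False Suc.prems n csum_typ[OF fam_mono[OF Suc.prems(1)]] by auto
  qed
qed simp

text \<open>A family longer than a spanning list is dependent, by \<open>homogeneous_system\<close>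
  applied to the coordinates. The bound \<open>N\<close> depends on the Hom space alone, which
  yields uniform bounds for families of idempotents and for the degree of a relation between
  powers.\<close>

lemma linear_dependence:
  assumes fd: "finite_dim_hom C X Y" and o: "X \<in> Obj C" "Y \<in> Obj C"
  obtains N where "\<And>f n. fam X Y f n \<Longrightarrow> N < n \<Longrightarrow>
    \<exists>a. (\<exists>i<n. a i \<noteq> 0) \<and> csum X Y (\<lambda>i. a i *\<^sub>m f i) n = zeroM C X Y"
proof -
  obtain bs where bs: "set bs \<subseteq> Hom C X Y" and
    sp: "\<And>f. f \<in> Hom C X Y \<Longrightarrow> \<exists>cs. length cs = length bs \<and> f = hom_sum C X Y (map2 (scaleM C) cs bs)"
    using fd unfolding finite_dim_hom_def by blast
  define N where "N = length bs"
  have bt: "arr (bs ! j) \<and> dm (bs ! j) = X \<and> cd (bs ! j) = Y" if "j < N" for j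
  proof -
    have "bs ! j \<in> Hom C X Y" using bs nth_mem[of j bs] that unfolding N_def by blast
    then show ?thesis using Hom_iff[OF o] by blast
  qed
  show thesis
  proof
    fix f n assume f: "fam X Y f n" and "N < n"
    have "\<exists>c. f i = csum X Y (\<lambda>j. c j *\<^sub>m bs ! j) N" if "i < n" for i
    proof -
      have "f i \<in> Hom C X Y" using f that Hom_iff[OF o] by (auto simp: fam_def)
      then obtain cs where cs: "length cs = length bs" "f i = hom_sum C X Y (map2 (scaleM C) cs bs)"
        using sp by blast
      have "map2 (scaleM C) cs bs = map (\<lambda>j. cs ! j *\<^sub>m bs ! j) [0..<N]"
        using cs(1) by (intro nth_equalityI) (auto simp: N_def)
      then show ?thesis unfolding csum_def cs(2) by (intro exI[of _ "\<lambda>j. cs ! j"]) simp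
    qed
    then obtain c where c: "\<And>i. i < n \<Longrightarrow> f i = csum X Y (\<lambda>j. c i j *\<^sub>m bs ! j) N" by metis
    obtain a where a: "\<exists>i<n. a i \<noteq> 0" "\<And>j. j < N \<Longrightarrow> (\<Sum>i<n. a i * c i j) = 0"
      using homogeneous_system[of "{..<N}" "{..<n}" c] \<open>N < n\<close> by auto
    have fm: "fam X Y (\<lambda>j. d j *\<^sub>m bs ! j) N" for d using bt o by (auto simp: fam_def)
    have "csum X Y (\<lambda>i. a i *\<^sub>m f i) n = csum X Y (\<lambda>i. csum X Y (\<lambda>j. (a i * c i j) *\<^sub>m bs ! j) N) n"
    proof (rule csum_cong)
      fix i assume "i < n"
      then have "a i *\<^sub>m f i = a i *\<^sub>m csum X Y (\<lambda>j. c i j *\<^sub>m bs ! j) N" using c by simp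
      also have "\<dots> = csum X Y (\<lambda>j. a i *\<^sub>m (c i j *\<^sub>m bs ! j)) N" by (rule csum_smul[OF fm])
      also have "\<dots> = csum X Y (\<lambda>j. (a i * c i j) *\<^sub>m bs ! j) N" by (rule csum_cong) (use bt in simp)
      finally show "a i *\<^sub>m f i = csum X Y (\<lambda>j. (a i * c i j) *\<^sub>m bs ! j) N" .
    qed
    also have "\<dots> = csum X Y (\<lambda>j. csum X Y (\<lambda>i. (a i * c i j) *\<^sub>m bs ! j) n) N"
      by (rule csum_swap[OF fm o])
    also have "\<dots> = csum X Y (\<lambda>j. zeroM C X Y) N"
    proof (rule csum_cong)
      fix j assume j: "j < N"
      show "csum X Y (\<lambda>i. (a i * c i j) *\<^sub>m bs ! j) n = zeroM C X Y"
        using csum_smul_sum[of "bs ! j" "\<lambda>i. a i * c i j" n] bt[OF j] a(2)[OF j] by simp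
    qed
    also have "\<dots> = zeroM C X Y" using o by (rule csum_zero)
    finally show "\<exists>a. (\<exists>i<n. a i \<noteq> 0) \<and> csum X Y (\<lambda>i. a i *\<^sub>m f i) n = zeroM C X Y" using a(1) by blast
  qed
qed

section \<open>Orthogonal idempotents, Fitting's lemma and regularity\<close>

definition orth :: "'o \<Rightarrow> 'm \<Rightarrow> 'm list \<Rightarrow> bool" where
  "orth X g es \<longleftrightarrow> (\<forall>e\<in>set es. endo X e \<and> e \<noteq> zeroM C X X \<and> e \<cdot> e = e \<and> g \<cdot> e = e \<and> e \<cdot> g = e)
     \<and> sorted_wrt (\<lambda>e e'. e \<cdot> e' = zeroM C X X \<and> e' \<cdot> e = zeroM C X X) es"

text \<open>Nonzero orthogonal idempotents are linearly independent, because multiplying a relation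
  by one of them isolates its coefficient. The bound does not depend on the idempotent
  \<open>g\<close> above the family, so \<open>g\<close> may vary in maximality arguments.\<close>

lemma orth_bound:
  assumes "finite_dim_hom C X X" "X \<in> Obj C"
  obtains N where "\<And>g es. orth X g es \<Longrightarrow> length es \<le> N"
proof -
  obtain N where N: "\<And>f n. fam X X f n \<Longrightarrow> N < n \<Longrightarrow>
      \<exists>a. (\<exists>i<n. a i \<noteq> 0) \<and> csum X X (\<lambda>i. a i *\<^sub>m f i) n = zeroM C X X"
    using linear_dependence[OF assms(1) assms(2) assms(2)] by blast
  have "length es \<le> N" if "orth X g es" for g es
  proof (rule ccontr)
    assume "\<not> length es \<le> N"
    let ?n = "length es"
    have t: "arr (es ! i) \<and> dm (es ! i) = X \<and> cd (es ! i) = X \<and> es ! i \<noteq> zeroM C X X \<and> es ! i \<cdot> es ! i = es ! i"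
      if "i < ?n" for i
      using \<open>orth X g es\<close> nth_mem[OF that] unfolding orth_def by (auto dest: endoD)
    have z: "es ! i \<cdot> es ! j = zeroM C X X" if "i < ?n" "j < ?n" "i \<noteq> j" for i j
      using \<open>orth X g es\<close> that unfolding orth_def sorted_wrt_iff_nth_less by (metis linorder_neqE_nat)
    have "fam X X ((!) es) ?n" using t assms by (auto simp: fam_def)
    then obtain a k where k: "k < ?n" "a k \<noteq> 0" and s: "csum X X (\<lambda>i. a i *\<^sub>m es ! i) ?n = zeroM C X X"
      using N[of "(!) es" ?n] \<open>\<not> length es \<le> N\<close> by auto
    have f: "fam X X (\<lambda>i. a i *\<^sub>m es ! i) ?n" using t assms by (auto simp: fam_def)
    have "es ! k \<cdot> csum X X (\<lambda>i. a i *\<^sub>m es ! i) ?n = csum X X (\<lambda>i. es ! k \<cdot> (a i *\<^sub>m es ! i)) ?n"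
      using csum_cmp_left[OF f, of "es ! k"] t[OF k(1)] by simp
    also have "\<dots> = es ! k \<cdot> (a k *\<^sub>m es ! k)"
      by (rule csum_delta) (use t k z assms in \<open>auto simp: fam_def\<close>)
    also have "\<dots> = a k *\<^sub>m es ! k" using t[OF k(1)] by simp
    finally have "a k *\<^sub>m es ! k = zeroM C X X" using s t[OF k(1)] assms by simp
    then have "inverse (a k) *\<^sub>m (a k *\<^sub>m es ! k) = zeroM C X X" using assms by simp
    then show False using t[OF k(1)] k(2) by simp
  qed
  then show thesis by (rule that)
qed

abbreviation "pw \<equiv> cpow C"

lemma pw_typ [simp]: "dm (pw X a n) = (if n = 0 then X else dm (pw X a n))"
  "endo X a \<Longrightarrow> arr (pw X a n)" "endo X a \<Longrightarrow> dm (pw X a n) = X" "endo X a \<Longrightarrow> cd (pw X a n) = X"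
proof -
  assume "endo X a"
  then have "arr (pw X a n) \<and> dm (pw X a n) = X \<and> cd (pw X a n) = X"
    by (induction n) (auto dest: endoD)
  then show "arr (pw X a n)" "dm (pw X a n) = X" "cd (pw X a n) = X" by auto
qed simp

declare pw_typ(1) [simp del]

lemma pw_endo [simp]: "endo X a \<Longrightarrow> endo X (pw X a n)"
  using pw_typ(2-4)[of X a n] by (simp add: endo_def)

lemma pw_commute:
  assumes "endo X a" "endo X b" "a \<cdot> b = b \<cdot> a"
  shows "a \<cdot> pw X b n = pw X b n \<cdot> a"
proof (induction n)
  case (Suc n)
  note t = endoD[OF assms(1)] endoD[OF assms(2)] pw_typ(2-4)[OF assms(2), of n]
  have "a \<cdot> (b \<cdot> pw X b n) = (a \<cdot> b) \<cdot> pw X b n" using t by simp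
  also have "\<dots> = b \<cdot> (a \<cdot> pw X b n)" using t assms(3) by simp
  also have "\<dots> = b \<cdot> pw X b n \<cdot> a" using t Suc by simp
  finally show ?case by simp
qed (use endoD[OF assms(1)] in simp)

lemma pw_add: "endo X a \<Longrightarrow> pw X a (m + n) = pw X a m \<cdot> pw X a n"
  by (induction m) (use endoD[of X a] in auto)

text \<open>Finite dimension gives a polynomial relation for \<open>a\<close>. Dividing by its
  lowest nonzero coefficient expresses \<open>pw X a r\<close> through higher powers, and
  \<open>b\<close> is a polynomial in \<open>a\<close>, hence commutes with it.\<close>

lemma fitting:
  assumes fd: "finite_dim_hom C X X" and a: "endo X a"
  obtains r b where "endo X b" "a \<cdot> b = b \<cdot> a" "pw X a r = pw X a (Suc r) \<cdot> b"
proof -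
  note at [simp] = endoD[OF a]
  note pt [simp] = pw_typ(2-4)[OF a]
  have o: "X \<in> Obj C" by simp
  let ?ev = "\<lambda>c n. csum X X (\<lambda>i. c i *\<^sub>m pw X a i) n"
  have f: "fam X X (\<lambda>i. c i *\<^sub>m pw X a i) n" for c n by (auto simp: fam_def)
  note ct [simp] = csum_typ[OF f]
  have horner: "?ev c (Suc n) = c 0 *\<^sub>m idm C X \<oplus>\<^sub>m a \<cdot> ?ev (\<lambda>i. c (Suc i)) n" for c n
  proof (induction n)
    case 0
    show ?case by (subst csum_Suc[OF f]) simp
  next
    case (Suc n)
    have "?ev c (Suc (Suc n)) = ?ev c (Suc n) \<oplus>\<^sub>m c (Suc n) *\<^sub>m pw X a (Suc n)" by (rule csum_Suc[OF f])
    also have "\<dots> = c 0 *\<^sub>m idm C X \<oplus>\<^sub>m a \<cdot> (?ev (\<lambda>i. c (Suc i)) n \<oplus>\<^sub>m c (Suc n) *\<^sub>m pw X a n)"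
      by (simp add: Suc add_assoc')
    also have "?ev (\<lambda>i. c (Suc i)) n \<oplus>\<^sub>m c (Suc n) *\<^sub>m pw X a n = ?ev (\<lambda>i. c (Suc i)) (Suc n)"
      by (rule csum_Suc[OF f, symmetric])
    finally show ?case .
  qed
  have ev_comm: "a \<cdot> ?ev c n = ?ev c n \<cdot> a" for c n
    using csum_cmp_left[OF f, of a c n] csum_cmp_right[OF f, of a c n] pw_commute[OF a a refl] by simp
  \<comment> \<open>The exponent \<open>s\<close> counts the vanishing low coefficients that have
    been stripped off by Horner's scheme; at the first nonzero one the relation is solved for
    \<open>pw X a s\<close>.\<close>
  have main: "\<exists>r b. endo X b \<and> a \<cdot> b = b \<cdot> a \<and> pw X a r = pw X a (Suc r) \<cdot> b"
    if "\<exists>i<n. c i \<noteq> 0" "pw X a s \<cdot> ?ev c n = zeroM C X X" for n c s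
    using that
  proof (induction n arbitrary: c s)
    case (Suc n)
    let ?q = "?ev (\<lambda>i. c (Suc i)) n"
    have sh: "pw X a s \<cdot> (a \<cdot> ?q) = pw X a (Suc s) \<cdot> ?q"
      using pw_commute[OF a a refl, of s] by (simp flip: cmp_cmp)
    have eq: "c 0 *\<^sub>m pw X a s \<oplus>\<^sub>m pw X a (Suc s) \<cdot> ?q = zeroM C X X"
      using Suc.prems(2) unfolding horner by (simp add: sh)
    show ?case
    proof (cases "c 0 = 0")
      case True
      have "pw X a (Suc s) \<cdot> ?q = zeroM C X X" using eq True by simp
      moreover have "\<exists>i<n. c (Suc i) \<noteq> 0" using Suc.prems(1) True by (metis less_Suc_eq_0_disj)
      ultimately show ?thesis using Suc.IH[of "\<lambda>i. c (Suc i)" "Suc s"] by blast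
    next
      case False
      have "c 0 *\<^sub>m pw X a s \<ominus>\<^sub>m (- 1) *\<^sub>m (pw X a (Suc s) \<cdot> ?q) = zeroM C X X"
        using eq by (simp add: sub_def)
      then have "c 0 *\<^sub>m pw X a s = (- 1) *\<^sub>m (pw X a (Suc s) \<cdot> ?q)"
        by (rule sub_eq_zero) auto
      then have "inverse (c 0) *\<^sub>m (c 0 *\<^sub>m pw X a s) = inverse (c 0) *\<^sub>m ((- 1) *\<^sub>m (pw X a (Suc s) \<cdot> ?q))" by simp
      then have "pw X a s = pw X a (Suc s) \<cdot> ((- inverse (c 0)) *\<^sub>m ?q)" using False by simp
      moreover have "endo X ((- inverse (c 0)) *\<^sub>m ?q)" by (simp add: endo_def)
      ultimately show ?thesis using ev_comm
        by (intro exI[of _ s] exI[of _ "(- inverse (c 0)) *\<^sub>m ?q"]) simp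
    qed
  qed simp
  obtain N where N: "\<And>f n. fam X X f n \<Longrightarrow> N < n \<Longrightarrow>
      \<exists>a. (\<exists>i<n. a i \<noteq> 0) \<and> csum X X (\<lambda>i. a i *\<^sub>m f i) n = zeroM C X X"
    using linear_dependence[OF fd o o] by blast
  have "fam X X (pw X a) (Suc N)" by (auto simp: fam_def)
  from N[OF this lessI] obtain c where c: "\<exists>i<Suc N. c i \<noteq> 0" "?ev c (Suc N) = zeroM C X X" by blast
  have "pw X a 0 \<cdot> ?ev c (Suc N) = zeroM C X X" using c(2) by simp
  from main[OF c(1) this] show thesis using that by blast
qed

text \<open>By \<open>fitting\<close>, \<open>a\<close> is invertible on the image of a high power,
  and \<open>e = pw X b m \<cdot> pw X a m\<close> is the projection onto that image. It is nonzero
  as \<open>pw X a m \<cdot> e = pw X a m\<close>, and it has the form \<open>c \<cdot> a\<close>: a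
  left ideal that is not nil contains a nonzero idempotent.\<close>

lemma nonnilpotent_idempotent:
  assumes fd: "finite_dim_hom C X X" and a: "endo X a" and nn: "\<And>n. pw X a n \<noteq> zeroM C X X"
  obtains c where "endo X c" "(c \<cdot> a) \<cdot> (c \<cdot> a) = c \<cdot> a" "c \<cdot> a \<noteq> zeroM C X X"
proof -
  obtain r b where b: "endo X b" and ab: "a \<cdot> b = b \<cdot> a" and r: "pw X a r = pw X a (Suc r) \<cdot> b"
    using fitting[OF fd a] by blast
  note [simp] = endoD[OF a] endoD[OF b] pw_typ(2-4)[OF a] pw_typ(2-4)[OF b]
  have shift: "pw X a (n + r) = pw X a (Suc (n + r)) \<cdot> b" for n
  proof -
    have "pw X a (n + r) = pw X a n \<cdot> pw X a r" by (rule pw_add[OF a])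
    also have "\<dots> = pw X a n \<cdot> (pw X a (Suc r) \<cdot> b)" by (simp only: r)
    also have "\<dots> = (pw X a n \<cdot> pw X a (Suc r)) \<cdot> b" by simp
    also have "pw X a n \<cdot> pw X a (Suc r) = pw X a (n + Suc r)" by (rule pw_add[OF a, symmetric])
    finally show ?thesis by simp
  qed
  have red: "pw X a (n + r) = pw X a (j + (n + r)) \<cdot> pw X b j" for n j
  proof (induction j)
    case (Suc j)
    have "pw X a (j + (n + r)) \<cdot> pw X b j = (pw X a (Suc ((j + n) + r)) \<cdot> b) \<cdot> pw X b j"
      using shift[of "j + n"] by (simp add: add.assoc)
    then show ?case using Suc by (simp add: add.assoc)
  qed simp
  \<comment> \<open>The exponent is at least 1, so that a factor \<open>a\<close> can be split off
    on the right of \<open>e\<close>.\<close>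
  define m where "m = Suc r"
  have m: "pw X a m = pw X a (m + m) \<cdot> pw X b m" using red[of 1 m] by (simp add: m_def)
  have comm: "pw X b m \<cdot> pw X a n = pw X a n \<cdot> pw X b m" for n
    using pw_commute[of X "pw X b m" a n] pw_commute[OF a b ab, of m] b a by simp
  define e where "e = pw X b m \<cdot> pw X a m"
  have ea: "e = (pw X b m \<cdot> pw X a r) \<cdot> a"
    using pw_commute[OF a a refl, of r] by (simp add: e_def m_def)
  have ee: "e \<cdot> e = e"
  proof -
    have "e \<cdot> e = pw X b m \<cdot> (pw X a m \<cdot> (pw X b m \<cdot> pw X a m))" by (simp add: e_def)
    also have "pw X b m \<cdot> pw X a m = pw X a m \<cdot> pw X b m" by (rule comm)
    also have "pw X a m \<cdot> (pw X a m \<cdot> pw X b m) = pw X a m"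
      using m pw_add[OF a, of m m] by simp
    finally show ?thesis by (simp add: e_def)
  qed
  have "pw X a m \<cdot> e = pw X a m"
    using m pw_add[OF a, of m m] comm[of m] by (simp add: e_def)
  then have "e \<noteq> zeroM C X X" using nn[of m] by auto
  then show thesis using ee unfolding ea
    by (intro that[of "pw X b m \<cdot> pw X a r"]) (auto simp: endo_def)
qed

text \<open>Among all \<open>w\<close> for which \<open>w \<cdot> x\<close> is idempotent, one is
  taken with the longest orthogonal family below \<open>w \<cdot> x\<close>; the maximum exists by
  \<open>orth_bound\<close>. If \<open>x \<cdot> (w \<cdot> x)\<close> differs from
  \<open>x\<close>, the difference \<open>x'\<close> is nonzero, so some left multiple of
  \<open>x'\<close> is a nonzero idempotent. After a correction it can be added to the family,
  against maximality.\<close>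

theorem semiprime_imp_regular:
  assumes sp: "semiprime C" and fd: "\<And>X. X \<in> Obj C \<Longrightarrow> finite_dim_hom C X X"
  shows "regular C"
  unfolding regular_def
proof (intro ballI)
  fix X Y x assume X [simp]: "X \<in> Obj C" and Y [simp]: "Y \<in> Obj C" and "x \<in> Hom C X Y"
  then have x [simp]: "arr x" "dm x = X" "cd x = Y" using Hom_iff[OF X Y] by auto
  obtain N where N: "\<And>g es. orth X g es \<Longrightarrow> length es \<le> N"
    using orth_bound[OF fd[OF X] X] by blast
  let ?P = "\<lambda>n. \<exists>w es. arr w \<and> dm w = Y \<and> cd w = X \<and> w \<cdot> (x \<cdot> (w \<cdot> x)) = w \<cdot> x \<and> orth X (w \<cdot> x) es \<and> length es = n"
  have "?P 0"
    by (intro exI[of _ "zeroM C Y X"] exI[of _ "[]"]) (auto simp: orth_def)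
  moreover have "\<And>n. ?P n \<Longrightarrow> n \<le> N" using N by blast
  ultimately obtain n where "?P n" and mx: "\<And>m. ?P m \<Longrightarrow> m \<le> n"
    using Nat.ex_has_greatest_nat[of ?P 0 N] by blast
  then obtain w es where w [simp]: "arr w" "dm w = Y" "cd w = X" and
    ww: "w \<cdot> (x \<cdot> (w \<cdot> x)) = w \<cdot> x" and es: "orth X (w \<cdot> x) es" "length es = n" by blast
  define g where "g = w \<cdot> x"
  have g [simp]: "arr g" "dm g = X" "cd g = X" by (simp_all add: g_def)
  have gg [simp]: "g \<cdot> g = g" using ww by (simp add: g_def)
  have ggr [simp]: "g \<cdot> (g \<cdot> h) = g \<cdot> h" if "arr h" "cd h = X" for h
    using that by (simp flip: cmp_cmp)
  define x' where "x' = x \<ominus>\<^sub>m x \<cdot> g"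
  have x't [simp]: "arr x'" "dm x' = X" "cd x' = Y" by (simp_all add: x'_def)
  have x'g: "x' \<cdot> g = zeroM C X Y" by (simp add: x'_def)
  show "\<exists>y\<in>Hom C Y X. x \<cdot> (y \<cdot> x) = x"
  proof (cases "x' = zeroM C X Y")
    case True
    then have "x = x \<cdot> g" unfolding x'_def by (rule sub_eq_zero) auto
    then show ?thesis using Hom_iff[OF Y X] by (intro bexI[of _ w]) (auto simp: g_def)
  next
    case False
    have "x' \<in> Hom C X Y" using Hom_iff[OF X Y] by simp
    then obtain y where "y \<in> Hom C Y X" and nn: "\<And>n. pw X (y \<cdot> x') n \<noteq> zeroM C X X"
      using sp False X Y unfolding semiprime_def by blast
    then have y [simp]: "arr y" "dm y = Y" "cd y = X" using Hom_iff[OF Y X] by auto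
    have "endo X (y \<cdot> x')" by (simp add: endo_def)
    from nonnilpotent_idempotent[OF fd[OF X] this nn]
    obtain c where c: "endo X c" and ci: "(c \<cdot> (y \<cdot> x')) \<cdot> (c \<cdot> (y \<cdot> x')) = c \<cdot> (y \<cdot> x')"
      and cn: "c \<cdot> (y \<cdot> x') \<noteq> zeroM C X X" by blast
    note [simp] = endoD[OF c]
    define d where "d = c \<cdot> (y \<cdot> x')"
    have d [simp]: "arr d" "dm d = X" "cd d = X" by (simp_all add: d_def)
    have dd [simp]: "d \<cdot> d = d" using ci by (simp add: d_def)
    have ddr [simp]: "d \<cdot> (d \<cdot> h) = d \<cdot> h" if "arr h" "cd h = X" for h
      using that by (simp flip: cmp_cmp)
    have dg [simp]: "d \<cdot> g = zeroM C X X" using x'g by (simp add: d_def)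
    have dgr [simp]: "d \<cdot> (g \<cdot> h) = zeroM C (dm h) X" if "arr h" "cd h = X" for h
    proof -
      have "d \<cdot> (g \<cdot> h) = (d \<cdot> g) \<cdot> h" by (subst cmp_cmp) (use that in auto)
      also have "\<dots> = zeroM C X X \<cdot> h" by (simp only: dg)
      finally show ?thesis using that by simp
    qed
    \<comment> \<open>So far only \<open>d \<cdot> g\<close> vanishes. Subtracting
      \<open>g \<cdot> d\<close> makes \<open>g\<close> annihilate the idempotent from the other
      side too, and \<open>d \<cdot> e = d\<close> keeps it nonzero.\<close>
    define e where "e = d \<ominus>\<^sub>m g \<cdot> d"
    have e [simp]: "arr e" "dm e = X" "cd e = X" by (simp_all add: e_def)
    have ee [simp]: "e \<cdot> e = e" by (simp add: e_def)
    have eg [simp]: "e \<cdot> g = zeroM C X X" by (simp add: e_def)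
    have ge [simp]: "g \<cdot> e = zeroM C X X" by (simp add: e_def)
    have "d \<cdot> e = d" by (simp add: e_def)
    then have e0: "e \<noteq> zeroM C X X" using cn d_def by auto
    \<comment> \<open>The factors are chosen so that \<open>w' \<cdot> x = e\<close>: as
      \<open>x' = (idm C Y \<ominus>\<^sub>m x \<cdot> w) \<cdot> x\<close>, the idempotent
      \<open>e\<close> is a left multiple of \<open>x\<close> and not only of
      \<open>x'\<close>.\<close>
    define w' where "w' = (c \<ominus>\<^sub>m g \<cdot> c) \<cdot> (y \<cdot> (idm C Y \<ominus>\<^sub>m x \<cdot> w))"
    have w' [simp]: "arr w'" "dm w' = Y" "cd w' = X" by (simp_all add: w'_def)
    have x'_eq: "x' = (idm C Y \<ominus>\<^sub>m x \<cdot> w) \<cdot> x" by (simp add: x'_def g_def)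
    have ew: "e = w' \<cdot> x"
    proof -
      have "e = (c \<ominus>\<^sub>m g \<cdot> c) \<cdot> (y \<cdot> x')" by (simp add: e_def d_def)
      also have "\<dots> = w' \<cdot> x" by (simp del: cmp_sub add: x'_eq w'_def)
      finally show ?thesis .
    qed
    have sum: "(w \<oplus>\<^sub>m w') \<cdot> x = g \<oplus>\<^sub>m e" by (simp add: ew g_def)
    have oe: "orth X ((w \<oplus>\<^sub>m w') \<cdot> x) (e # es)"
      unfolding sum orth_def
    proof (intro conjI ballI)
      have *: "endo X h \<and> h \<noteq> zeroM C X X \<and> h \<cdot> h = h \<and> g \<cdot> h = h \<and> h \<cdot> g = h" if "h \<in> set es" for h
        using es(1) that unfolding orth_def g_def by blast
      have z: "e \<cdot> h = zeroM C X X \<and> h \<cdot> e = zeroM C X X" if "h \<in> set es" for h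
      proof -
        note [simp] = endoD[OF conjunct1[OF *[OF that]]]
        have "e \<cdot> h = e \<cdot> (g \<cdot> h)" using *[OF that] by simp
        also have "\<dots> = (e \<cdot> g) \<cdot> h" by (subst cmp_cmp) auto
        finally have 1: "e \<cdot> h = zeroM C X X" by (simp only: eg) simp
        have "h \<cdot> e = (h \<cdot> g) \<cdot> e" using *[OF that] by simp
        also have "\<dots> = h \<cdot> (g \<cdot> e)" by (subst cmp_cmp) auto
        finally have "h \<cdot> e = zeroM C X X" by (simp only: ge) simp
        with 1 show ?thesis by simp
      qed
      show "sorted_wrt (\<lambda>e e'. e \<cdot> e' = zeroM C X X \<and> e' \<cdot> e = zeroM C X X) (e # es)"
        using es(1) z unfolding orth_def by auto
      fix h assume h: "h \<in> set (e # es)"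
      then have th: "endo X h" using * by (auto simp: endo_def)
      note [simp] = endoD[OF th]
      show "endo X h" by (fact th)
      show "h \<noteq> zeroM C X X" "h \<cdot> h = h" using h * e0 by auto
      show "(g \<oplus>\<^sub>m e) \<cdot> h = h" "h \<cdot> (g \<oplus>\<^sub>m e) = h" using h * z by auto
    qed
    have idem: "(g \<oplus>\<^sub>m e) \<cdot> (g \<oplus>\<^sub>m e) = g \<oplus>\<^sub>m e" by simp
    have "?P (Suc n)"
    proof (intro exI conjI)
      show "orth X ((w \<oplus>\<^sub>m w') \<cdot> x) (e # es)" by (fact oe)
      have "(w \<oplus>\<^sub>m w') \<cdot> (x \<cdot> ((w \<oplus>\<^sub>m w') \<cdot> x)) = ((w \<oplus>\<^sub>m w') \<cdot> x) \<cdot> ((w \<oplus>\<^sub>m w') \<cdot> x)"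
        by (subst cmp_cmp) auto
      also have "\<dots> = (w \<oplus>\<^sub>m w') \<cdot> x" unfolding sum by (rule idem)
      finally show "(w \<oplus>\<^sub>m w') \<cdot> (x \<cdot> ((w \<oplus>\<^sub>m w') \<cdot> x)) = (w \<oplus>\<^sub>m w') \<cdot> x" .
    qed (use es in auto)
    then show ?thesis using mx by fastforce
  qed
qed

end

section \<open>Disjoint Hom sets\<close>

text \<open>Composition takes the source of one factor and the target of the other without comparing
  the objects in the middle, so the source and target equations of \<open>typed_category\<close>
  hold without typing conditions.\<close>

definition tag :: "('o, 'm, 's, 'x) tensor_category_scheme \<Rightarrow> ('o, 'o \<times> 'm \<times> 'o, 's) tensor_category" where
  "tag C =
    \<lparr>Obj = Obj C,
     Hom = (\<lambda>X Y. {(X, f, Y) | f. f \<in> Hom C X Y}),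
     idm = (\<lambda>X. (X, idm C X, X)),
     cmp = (\<lambda>g f. (fst f, fst (snd g) \<cdot>\<^bsub>C\<^esub> fst (snd f), snd (snd g))),
     tenO = tenO C,
     tenM = (\<lambda>f g. (fst f \<otimes>\<^sub>o\<^bsub>C\<^esub> fst g, fst (snd f) \<otimes>\<^sub>m\<^bsub>C\<^esub> fst (snd g), snd (snd f) \<otimes>\<^sub>o\<^bsub>C\<^esub> snd (snd g))),
     unt = unt C,
     asc = (\<lambda>X Y Z. ((X \<otimes>\<^sub>o\<^bsub>C\<^esub> Y) \<otimes>\<^sub>o\<^bsub>C\<^esub> Z, asc C X Y Z, X \<otimes>\<^sub>o\<^bsub>C\<^esub> (Y \<otimes>\<^sub>o\<^bsub>C\<^esub> Z))),
     lun = (\<lambda>X. (unt C \<otimes>\<^sub>o\<^bsub>C\<^esub> X, lun C X, X)),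
     run = (\<lambda>X. (X \<otimes>\<^sub>o\<^bsub>C\<^esub> unt C, run C X, X)),
     brd = (\<lambda>X Y. (X \<otimes>\<^sub>o\<^bsub>C\<^esub> Y, brd C X Y, Y \<otimes>\<^sub>o\<^bsub>C\<^esub> X)),
     zeroM = (\<lambda>X Y. (X, zeroM C X Y, Y)),
     addM = (\<lambda>f g. (fst f, fst (snd f) \<oplus>\<^sub>m\<^bsub>C\<^esub> fst (snd g), snd (snd f))),
     scaleM = (\<lambda>a f. (fst f, a *\<^sub>m\<^bsub>C\<^esub> fst (snd f), snd (snd f)))\<rparr>"

lemma tag_simps [simp]:
  "Obj (tag C) = Obj C" "unt (tag C) = unt C" "tenO (tag C) = tenO C"
  "idm (tag C) X = (X, idm C X, X)"
  "(Y', g, Z) \<cdot>\<^bsub>tag C\<^esub> (X, f, Y) = (X, g \<cdot>\<^bsub>C\<^esub> f, Z)"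
  "(X, f, Y) \<otimes>\<^sub>m\<^bsub>tag C\<^esub> (X', g, Z) = (X \<otimes>\<^sub>o\<^bsub>C\<^esub> X', f \<otimes>\<^sub>m\<^bsub>C\<^esub> g, Y \<otimes>\<^sub>o\<^bsub>C\<^esub> Z)"
  "asc (tag C) X Y Z = ((X \<otimes>\<^sub>o\<^bsub>C\<^esub> Y) \<otimes>\<^sub>o\<^bsub>C\<^esub> Z, asc C X Y Z, X \<otimes>\<^sub>o\<^bsub>C\<^esub> (Y \<otimes>\<^sub>o\<^bsub>C\<^esub> Z))"
  "lun (tag C) X = (unt C \<otimes>\<^sub>o\<^bsub>C\<^esub> X, lun C X, X)"
  "run (tag C) X = (X \<otimes>\<^sub>o\<^bsub>C\<^esub> unt C, run C X, X)"
  "brd (tag C) X Y = (X \<otimes>\<^sub>o\<^bsub>C\<^esub> Y, brd C X Y, Y \<otimes>\<^sub>o\<^bsub>C\<^esub> X)"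
  "zeroM (tag C) X Y = (X, zeroM C X Y, Y)"
  "(X, f, Y) \<oplus>\<^sub>m\<^bsub>tag C\<^esub> (X', g, Y') = (X, f \<oplus>\<^sub>m\<^bsub>C\<^esub> g, Y)"
  "a *\<^sub>m\<^bsub>tag C\<^esub> (X, f, Y) = (X, a *\<^sub>m\<^bsub>C\<^esub> f, Y)"
  "f' \<in> Hom (tag C) X Y \<longleftrightarrow> (\<exists>f. f' = (X, f, Y) \<and> f \<in> Hom C X Y)"
  by (auto simp: tag_def)

lemma tag_typ:
  "fst (g \<cdot>\<^bsub>tag C\<^esub> f) = fst f" "snd (snd (g \<cdot>\<^bsub>tag C\<^esub> f)) = snd (snd g)"
  "fst (f \<otimes>\<^sub>m\<^bsub>tag C\<^esub> g) = fst f \<otimes>\<^sub>o\<^bsub>C\<^esub> fst g" "snd (snd (f \<otimes>\<^sub>m\<^bsub>tag C\<^esub> g)) = snd (snd f) \<otimes>\<^sub>o\<^bsub>C\<^esub> snd (snd g)"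
  "fst (f \<oplus>\<^sub>m\<^bsub>tag C\<^esub> g) = fst f" "snd (snd (f \<oplus>\<^sub>m\<^bsub>tag C\<^esub> g)) = snd (snd f)"
  "fst (a *\<^sub>m\<^bsub>tag C\<^esub> f) = fst f" "snd (snd (a *\<^sub>m\<^bsub>tag C\<^esub> f)) = snd (snd f)"
  by (auto simp: tag_def)

lemma inverse_arrows_tag:
  "inverse_arrows (tag C) X Y (X', f, Y') g' \<longleftrightarrow> (\<exists>g. X' = X \<and> Y' = Y \<and> g' = (Y, g, X) \<and> inverse_arrows C X Y f g)"
  by (auto simp: inverse_arrows_def)

lemma is_iso_tag: "is_iso C X Y f \<Longrightarrow> is_iso (tag C) X Y (X, f, Y)"
  unfolding is_iso_def inverse_arrows_tag by blast

lemma hom_sum_tag: "hom_sum (tag C) X Y (map (\<lambda>f. (X, f, Y)) fs) = (X, hom_sum C X Y fs, Y)"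
  by (induction fs) (auto simp: hom_sum_def)

context category
begin

lemma inverse_arrows_unique:
  assumes o: "X \<in> Obj C" "Y \<in> Obj C" and g: "inverse_arrows C X Y f g" and h: "inverse_arrows C X Y f h"
  shows "h = g"
proof -
  have t: "f \<in> Hom C X Y" "g \<in> Hom C Y X" "h \<in> Hom C Y X" using g h by (auto simp: inverse_arrows_def)
  have "(g \<cdot> f) \<cdot> h = g \<cdot> (f \<cdot> h)" by (rule cmp_assoc[OF o(2,1,2,1) t(3,1,2)])
  moreover have "g \<cdot> f = idm C X" "f \<cdot> h = idm C Y" using g h by (auto simp: inverse_arrows_def)
  ultimately show ?thesis using idm_left[OF o(2,1) t(3)] idm_right[OF o(2,1) t(2)] by simp
qed

lemma inv_arrow_eq:
  assumes "X \<in> Obj C" "Y \<in> Obj C" "inverse_arrows C X Y f g"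
  shows "inv_arrow C X Y f = g"
  unfolding inv_arrow_def by (rule the_equality[where a = g]) (use assms inverse_arrows_unique in blast)+

end

locale typed_tensor_category = tensor_category C + typed_sm_category C dm cd + typed_linear_category C dm cd
  for C :: "('o, 'm, 's::field, 'x) tensor_category_scheme" (structure) and dm cd

lemma typed_tensor_category_tag:
  fixes C :: "('o, 'm, 's::field, 'x) tensor_category_scheme" (structure)
  assumes "tensor_category C"
  shows "typed_tensor_category (tag C) fst (\<lambda>f. snd (snd f))"
proof -
  interpret tensor_category C by fact
  have cat: "category (tag C)"
  proof (unfold_locales, goal_cases)
    case 1 then show ?case by (auto intro: idm_in)
  next
    case 2 then show ?case by (auto intro: cmp_in)
  next
    case 3 then show ?case by (auto simp: idm_left)
  next
    case 4 then show ?case by (auto simp: idm_right)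
  next
    case 5 then show ?case by (auto simp: cmp_assoc)
  qed
  have sm: "symmetric_monoidal_category (tag C)"
  proof (intro symmetric_monoidal_category.intro cat, unfold_locales, goal_cases)
    case 1 then show ?case by (simp add: unt_in)
  next
    case 2 then show ?case by (simp add: tenO_in)
  next
    case 3 then show ?case by (auto intro: tenM_in)
  next
    case 4 then show ?case by (auto simp: tenM_idm)
  next
    case 5 then show ?case by (auto simp: tenM_cmp)
  next
    case 6 then show ?case using is_iso_tag[OF asc_iso] by simp
  next
    case 7 then show ?case by (auto simp: asc_nat)
  next
    case 8 then show ?case using is_iso_tag[OF lun_iso] by simp
  next
    case 9 then show ?case by (auto simp: lun_nat)
  next
    case 10 then show ?case using is_iso_tag[OF run_iso] by simp
  next
    case 11 then show ?case by (auto simp: run_nat)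
  next
    case 12 then show ?case by (auto simp: pentagon)
  next
    case 13 then show ?case by (auto simp: triangle)
  next
    case 14 then show ?case by (auto intro: brd_in)
  next
    case 15 then show ?case by (auto simp: brd_nat)
  next
    case 16 then show ?case by (auto simp: brd_sym)
  next
    case 17 then show ?case by (auto simp: hexagon)
  qed
  have lin: "linear_category (tag C)"
  proof (intro linear_category.intro cat, unfold_locales, goal_cases)
    case 1 then show ?case by (auto intro: zer_in)
  next
    case 2 then show ?case by (auto intro: add_in)
  next
    case 3 then show ?case by (auto intro: smul_in)
  next
    case 4 then show ?case by (auto simp: add_assoc)
  next
    case 5 then show ?case by (auto simp: add_comm)
  next
    case 6 then show ?case by (auto simp: zer_add)
  next
    case (7 X Y f)
    then obtain f0 where f0: "f = (X, f0, Y)" "f0 \<in> Hom C X Y" by auto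
    then obtain g where "g \<in> Hom C X Y" "g \<oplus>\<^sub>m f0 = zeroM C X Y" using add_inv[of X Y f0] 7 by auto
    then show ?case using f0 by (intro bexI[of _ "(X, g, Y)"]) auto
  next
    case 8 then show ?case by (auto simp: smul_one)
  next
    case 9 then show ?case by (auto simp: smul_smul)
  next
    case 10 then show ?case by (auto simp: smul_add_left)
  next
    case 11 then show ?case by (auto simp: smul_add_right)
  next
    case 12 then show ?case by (auto simp: cmp_add_left)
  next
    case 13 then show ?case by (auto simp: cmp_add_right)
  next
    case 14 then show ?case by (auto simp: cmp_smul_left)
  next
    case 15 then show ?case by (auto simp: cmp_smul_right)
  qed
  have add: "additive_category (tag C)"
  proof (intro additive_category.intro lin, unfold_locales, goal_cases)
    case 1
    obtain Z where Z: "zero_object C Z" using zero_object_ex by blast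
    have Z1: "Z \<in> Obj C" "\<And>X. X \<in> Obj C \<Longrightarrow> \<exists>!f. f \<in> Hom C Z X" "\<And>X. X \<in> Obj C \<Longrightarrow> \<exists>!f. f \<in> Hom C X Z"
      using Z unfolding zero_object_def by simp_all
    have u: "\<exists>!f. f \<in> Hom (tag C) A B" if e: "\<exists>!f. f \<in> Hom C A B" for A B
    proof -
      obtain f where f: "f \<in> Hom C A B" "\<And>g. g \<in> Hom C A B \<Longrightarrow> g = f" using e by blast
      show ?thesis
      proof (rule ex1I[of _ "(A, f, B)"])
        fix g' assume "g' \<in> Hom (tag C) A B"
        then obtain g where "g' = (A, g, B)" "g \<in> Hom C A B" by auto
        then show "g' = (A, f, B)" using f(2)[of g] by simp
      qed (use f(1) in simp)
    qed
    have w: "\<exists>!f. f \<in> Hom (tag C) Z X" "\<exists>!f. f \<in> Hom (tag C) X Z" if X: "X \<in> Obj C" for X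
      by (rule u[OF Z1(2)[OF X]], rule u[OF Z1(3)[OF X]])
    have "zero_object (tag C) Z" unfolding zero_object_def tag_simps(1)
      by (intro conjI ballI Z1(1) w)
    then show ?case by blast
  next
    case XY: (2 X Y)
    then obtain Z where Z: "is_direct_sum C [X, Y] Z" using direct_sum_ex by auto
    then obtain i p where ip: "Z \<in> Obj C"
      "\<forall>j<length [X, Y]. i j \<in> Hom C ([X, Y] ! j) Z \<and> p j \<in> Hom C Z ([X, Y] ! j)"
      "\<forall>j<length [X, Y]. \<forall>l<length [X, Y]. p l \<cdot> i j = (if j = l then idm C ([X, Y] ! j) else zeroM C ([X, Y] ! j) ([X, Y] ! l))"
      "hom_sum C Z Z (map (\<lambda>j. i j \<cdot> p j) [0..<length [X, Y]]) = idm C Z"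
      unfolding is_direct_sum_def by blast
    let ?i = "\<lambda>j. ([X, Y] ! j, i j, Z)" and ?p = "\<lambda>j. (Z, p j, [X, Y] ! j)"
    have 1: "hom_sum (tag C) Z Z (map (\<lambda>j. ?i j \<cdot>\<^bsub>tag C\<^esub> ?p j) [0..<length [X, Y]]) = idm (tag C) Z"
      using hom_sum_tag[of C Z Z "map (\<lambda>j. i j \<cdot> p j) [0..<length [X, Y]]"] ip(4) by (simp add: comp_def)
    have 2: "\<forall>j<length [X, Y]. ?i j \<in> Hom (tag C) ([X, Y] ! j) Z \<and> ?p j \<in> Hom (tag C) Z ([X, Y] ! j)"
      using ip(2) by simp
    have 3: "\<forall>j<length [X, Y]. \<forall>l<length [X, Y]. ?p l \<cdot>\<^bsub>tag C\<^esub> ?i j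
        = (if j = l then idm (tag C) ([X, Y] ! j) else zeroM (tag C) ([X, Y] ! j) ([X, Y] ! l))"
      using ip(3) by simp
    have 4: "set [X, Y] \<subseteq> Obj (tag C)" "Z \<in> Obj (tag C)" using ip(1) XY by simp_all
    have "is_direct_sum (tag C) [X, Y] Z"
      unfolding is_direct_sum_def by (intro conjI exI[of _ ?i] exI[of _ ?p] 1 2 3 4)
    then show ?case by blast
  qed
  have ten: "tensor_category (tag C)"
  proof (intro tensor_category.intro sm add, unfold_locales, goal_cases)
    case 1 then show ?case by (auto simp: tenM_add_left)
  next
    case 2 then show ?case by (auto simp: tenM_add_right)
  next
    case 3 then show ?case by (auto simp: tenM_smul_left)
  next
    case 4 then show ?case by (auto simp: tenM_smul_right)
  qed
  interpret t: tensor_category "tag C" by (rule ten)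
  show ?thesis
    by unfold_locales (auto simp: tag_typ)
qed

lemma finite_dim_hom_tag:
  assumes "finite_dim_hom C X Y"
  shows "finite_dim_hom (tag C) X Y"
proof -
  obtain bs where bs: "set bs \<subseteq> Hom C X Y"
    "\<And>f. f \<in> Hom C X Y \<Longrightarrow> \<exists>cs. length cs = length bs \<and> f = hom_sum C X Y (map2 (scaleM C) cs bs)"
    using assms unfolding finite_dim_hom_def by blast
  have m: "map2 (scaleM (tag C)) cs (map (\<lambda>f. (X, f, Y)) bs) = map (\<lambda>f. (X, f, Y)) (map2 (scaleM C) cs bs)" for cs
    by (simp add: zip_map2 case_prod_beta)
  show ?thesis unfolding finite_dim_hom_def
  proof (intro exI[of _ "map (\<lambda>f. (X, f, Y)) bs"] conjI ballI)
    fix f' assume "f' \<in> Hom (tag C) X Y"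
    then obtain f where f: "f' = (X, f, Y)" "f \<in> Hom C X Y" by auto
    then obtain cs where "length cs = length bs" "f = hom_sum C X Y (map2 (scaleM C) cs bs)" using bs(2) by blast
    then show "\<exists>cs. length cs = length (map (\<lambda>f. (X, f, Y)) bs) \<and> f' = hom_sum (tag C) X Y (map2 (scaleM (tag C)) cs (map (\<lambda>f. (X, f, Y)) bs))"
      unfolding m hom_sum_tag f(1) by auto
  qed (use bs(1) in auto)
qed

text \<open>A strict monoidal functor carries zigzag identities to zigzag identities. Since Hom sets
  may overlap, \<open>\<phi>\<close> takes source and target as arguments. Its functor laws are
  stated without typing conditions, so a whole composite can be folded into the image of one
  morphism by rewriting. The applications are tagging, the linearization and one-element
  lists.\<close>

lemma is_dual_functor:
  fixes C :: "('o, 'm, 'x) sm_category_scheme" (structure) and C' :: "('p, 'n, 'y) sm_category_scheme"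
    and \<Phi> :: "'o \<Rightarrow> 'p" and \<phi> :: "'o \<Rightarrow> 'o \<Rightarrow> 'm \<Rightarrow> 'n"
  assumes "symmetric_monoidal_category C" "symmetric_monoidal_category C'"
    and ob: "\<And>X. X \<in> Obj C \<Longrightarrow> \<Phi> X \<in> Obj C'"
    and hm: "\<And>X Y f. X \<in> Obj C \<Longrightarrow> Y \<in> Obj C \<Longrightarrow> f \<in> Hom C X Y \<Longrightarrow> \<phi> X Y f \<in> Hom C' (\<Phi> X) (\<Phi> Y)"
    and pi: "\<And>X. \<phi> X X (idm C X) = idm C' (\<Phi> X)"
    and pc: "\<And>X Y Z f g. \<phi> X Z (g \<cdot> f) = \<phi> Y Z g \<cdot>\<^bsub>C'\<^esub> \<phi> X Y f"
    and to: "\<And>X Y. \<Phi> (X \<otimes>\<^sub>o Y) = \<Phi> X \<otimes>\<^sub>o\<^bsub>C'\<^esub> \<Phi> Y"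
    and tm: "\<And>X Y X' Y' f g. \<phi> (X \<otimes>\<^sub>o X') (Y \<otimes>\<^sub>o Y') (f \<otimes>\<^sub>m g) = \<phi> X Y f \<otimes>\<^sub>m\<^bsub>C'\<^esub> \<phi> X' Y' g"
    and un: "\<Phi> (unt C) = unt C'"
    and as: "\<And>X Y Z. \<phi> ((X \<otimes>\<^sub>o Y) \<otimes>\<^sub>o Z) (X \<otimes>\<^sub>o (Y \<otimes>\<^sub>o Z)) (asc C X Y Z) = asc C' (\<Phi> X) (\<Phi> Y) (\<Phi> Z)"
    and lu: "\<And>X. \<phi> (unt C \<otimes>\<^sub>o X) X (lun C X) = lun C' (\<Phi> X)"
    and ru: "\<And>X. \<phi> (X \<otimes>\<^sub>o unt C) X (run C X) = run C' (\<Phi> X)"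
    and X: "X \<in> Obj C" and dual: "is_dual C X D"
  shows "is_dual C' (\<Phi> X) (\<Phi> D)"
proof -
  interpret symmetric_monoidal_category C by fact
  interpret c: symmetric_monoidal_category C' by fact
  have D: "D \<in> Obj C" using dual unfolding is_dual_def by blast
  have inv: "inv_arrow C' (\<Phi> A) (\<Phi> B) (\<phi> A B f) = \<phi> B A (inv_arrow C A B f)"
    if AB: "A \<in> Obj C" "B \<in> Obj C" "is_iso C A B f" for A B f
  proof -
    obtain g where g: "inverse_arrows C A B f g" using AB(3) unfolding is_iso_def by blast
    have "inverse_arrows C' (\<Phi> A) (\<Phi> B) (\<phi> A B f) (\<phi> B A g)"
      using g hm AB(1,2) pi unfolding inverse_arrows_def by (metis pc)
    then show ?thesis using inv_arrow_eq[OF AB(1,2) g] c.inv_arrow_eq[of "\<Phi> A" "\<Phi> B"] ob AB(1,2) by simp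
  qed
  obtain ev co where ev: "ev \<in> Hom C (D \<otimes>\<^sub>o X) (unt C)" and co: "co \<in> Hom C (unt C) (X \<otimes>\<^sub>o D)"
    and z: "run C X \<cdot> (idm C X \<otimes>\<^sub>m ev) \<cdot> asc C X D X \<cdot> (co \<otimes>\<^sub>m idm C X) \<cdot> inv_arrow C (unt C \<otimes>\<^sub>o X) X (lun C X) = idm C X"
     "lun C D \<cdot> (ev \<otimes>\<^sub>m idm C D) \<cdot> inv_arrow C ((D \<otimes>\<^sub>o X) \<otimes>\<^sub>o D) (D \<otimes>\<^sub>o (X \<otimes>\<^sub>o D)) (asc C D X D)
          \<cdot> (idm C D \<otimes>\<^sub>m co) \<cdot> inv_arrow C (D \<otimes>\<^sub>o unt C) D (run C D) = idm C D"
    using dual unfolding is_dual_def by blast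
  have l: "inv_arrow C' (\<Phi> (unt C \<otimes>\<^sub>o X)) (\<Phi> X) (\<phi> (unt C \<otimes>\<^sub>o X) X (lun C X)) = \<phi> X (unt C \<otimes>\<^sub>o X) (inv_arrow C (unt C \<otimes>\<^sub>o X) X (lun C X))"
    by (rule inv) (simp_all add: X tenO_in unt_in lun_iso)
  have r: "inv_arrow C' (\<Phi> (D \<otimes>\<^sub>o unt C)) (\<Phi> D) (\<phi> (D \<otimes>\<^sub>o unt C) D (run C D)) = \<phi> D (D \<otimes>\<^sub>o unt C) (inv_arrow C (D \<otimes>\<^sub>o unt C) D (run C D))"
    by (rule inv) (simp_all add: D tenO_in unt_in run_iso)
  have a: "inv_arrow C' (\<Phi> ((D \<otimes>\<^sub>o X) \<otimes>\<^sub>o D)) (\<Phi> (D \<otimes>\<^sub>o (X \<otimes>\<^sub>o D))) (\<phi> ((D \<otimes>\<^sub>o X) \<otimes>\<^sub>o D) (D \<otimes>\<^sub>o (X \<otimes>\<^sub>o D)) (asc C D X D))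
     = \<phi> (D \<otimes>\<^sub>o (X \<otimes>\<^sub>o D)) ((D \<otimes>\<^sub>o X) \<otimes>\<^sub>o D) (inv_arrow C ((D \<otimes>\<^sub>o X) \<otimes>\<^sub>o D) (D \<otimes>\<^sub>o (X \<otimes>\<^sub>o D)) (asc C D X D))"
    by (rule inv) (simp_all add: D X tenO_in asc_iso)
  let ?ev = "\<phi> (D \<otimes>\<^sub>o X) (unt C) ev" and ?co = "\<phi> (unt C) (X \<otimes>\<^sub>o D) co"
  have 1: "run C' (\<Phi> X) \<cdot>\<^bsub>C'\<^esub> (idm C' (\<Phi> X) \<otimes>\<^sub>m\<^bsub>C'\<^esub> ?ev) \<cdot>\<^bsub>C'\<^esub> asc C' (\<Phi> X) (\<Phi> D) (\<Phi> X) \<cdot>\<^bsub>C'\<^esub> (?co \<otimes>\<^sub>m\<^bsub>C'\<^esub> idm C' (\<Phi> X))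
      \<cdot>\<^bsub>C'\<^esub> inv_arrow C' (\<Phi> (unt C \<otimes>\<^sub>o X)) (\<Phi> X) (lun C' (\<Phi> X)) = idm C' (\<Phi> X)"
    unfolding l[unfolded lu] ru[symmetric] pi[symmetric] as[symmetric] tm[symmetric] pc[symmetric] z(1) ..
  have 2: "lun C' (\<Phi> D) \<cdot>\<^bsub>C'\<^esub> (?ev \<otimes>\<^sub>m\<^bsub>C'\<^esub> idm C' (\<Phi> D)) \<cdot>\<^bsub>C'\<^esub> inv_arrow C' (\<Phi> ((D \<otimes>\<^sub>o X) \<otimes>\<^sub>o D)) (\<Phi> (D \<otimes>\<^sub>o (X \<otimes>\<^sub>o D))) (asc C' (\<Phi> D) (\<Phi> X) (\<Phi> D))
      \<cdot>\<^bsub>C'\<^esub> (idm C' (\<Phi> D) \<otimes>\<^sub>m\<^bsub>C'\<^esub> ?co) \<cdot>\<^bsub>C'\<^esub> inv_arrow C' (\<Phi> (D \<otimes>\<^sub>o unt C)) (\<Phi> D) (run C' (\<Phi> D)) = idm C' (\<Phi> D)"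
    unfolding a[unfolded as] r[unfolded ru] lu[symmetric] pi[symmetric] tm[symmetric] pc[symmetric] z(2) ..
  have "?ev \<in> Hom C' (\<Phi> D \<otimes>\<^sub>o\<^bsub>C'\<^esub> \<Phi> X) (unt C')" "?co \<in> Hom C' (unt C') (\<Phi> X \<otimes>\<^sub>o\<^bsub>C'\<^esub> \<Phi> D)"
    using hm[OF _ _ ev] hm[OF _ _ co] X D by (simp_all add: tenO_in unt_in to un)
  then show ?thesis unfolding is_dual_def using 1 2 ob[OF D] unfolding to un by blast
qed

lemma is_dual_tag:
  assumes "tensor_category C" "is_dual C X D" "X \<in> Obj C"
  shows "is_dual (tag C) X D"
proof -
  interpret tensor_category C by fact
  interpret t: typed_tensor_category "tag C" fst "\<lambda>f. snd (snd f)"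
    by (rule typed_tensor_category_tag) fact
  show ?thesis
    by (rule is_dual_functor[where \<Phi> = "\<lambda>X. X" and \<phi> = "\<lambda>X Y f. (X, f, Y)", OF symmetric_monoidal_category_axioms
          t.symmetric_monoidal_category_axioms _ _ _ _ _ _ _ _ _ _ assms(3,2)]) simp_all
qed

section \<open>Semisimple abelian categories are regular\<close>

context pre_tannakian_category
begin

lemma typed_tag: "typed_tensor_category (tag C) fst (\<lambda>f. snd (snd f))"
  by (rule typed_tensor_category_tag) unfold_locales

text \<open>The kernel of \<open>f\<close> is a subobject of the simple object \<open>S\<close>. It
  is not all of \<open>S\<close> because \<open>f\<close> is nonzero, so it is zero and
  \<open>f\<close> is a monomorphism. As \<open>simple_object\<close> speaks of monomorphisms into
  the object, simplicity of \<open>T\<close> then makes \<open>f\<close> invertible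
  directly.\<close>

lemma schur_lemma:
  assumes S: "simple_object C S" and T: "simple_object C T" and f: "f \<in> Hom C S T" and nz: "f \<noteq> zeroM C S T"
  shows "is_iso C S T f"
proof -
  interpret t: typed_tensor_category "tag C" fst "\<lambda>f. snd (snd f)"
    by (rule typed_tag)
  have o: "S \<in> Obj C" "T \<in> Obj C" using S T by (auto simp: simple_object_def)
  obtain K i where K: "is_kernel C S T f K i" using kernel_ex[OF o f] by blast
  then have Ko: "K \<in> Obj C" and i: "i \<in> Hom C K S" and fi: "f \<cdot> i = zeroM C K T"
    and ker: "\<And>Z z. Z \<in> Obj C \<Longrightarrow> z \<in> Hom C Z S \<Longrightarrow> f \<cdot> z = zeroM C Z T \<Longrightarrow> \<exists>!u. u \<in> Hom C Z K \<and> i \<cdot> u = z"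
    by (auto simp: is_kernel_def)
  have t1: "t.arr (S, f, T)" "t.arr (K, i, S)" using o f i Ko by (auto simp: t.arr_def)
  have "is_mono C K S i"
    unfolding is_mono_def
  proof (intro conjI ballI impI)
    fix Z u v assume Z: "Z \<in> Obj C" "u \<in> Hom C Z K" "v \<in> Hom C Z K" and e: "i \<cdot> u = i \<cdot> v"
    have "i \<cdot> u \<in> Hom C Z S" by (rule cmp_in[OF Z(1) Ko o(1) Z(2) i])
    moreover have "f \<cdot> (i \<cdot> u) = zeroM C Z T"
    proof -
      have "t.arr (Z, u, K)" using Z Ko by (auto simp: t.arr_def)
      then have "((S, f, T) \<cdot>\<^bsub>tag C\<^esub> (K, i, S)) \<cdot>\<^bsub>tag C\<^esub> (Z, u, K) = (S, f, T) \<cdot>\<^bsub>tag C\<^esub> ((K, i, S) \<cdot>\<^bsub>tag C\<^esub> (Z, u, K))"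
        using t1 by (intro t.cmp_cmp) auto
      moreover have "(K, zeroM C K T, T) \<cdot>\<^bsub>tag C\<^esub> (Z, u, K) = (Z, zeroM C Z T, T)"
        using t.cmp_zero(1)[of "(Z, u, K)" K T] \<open>t.arr (Z, u, K)\<close> o by simp
      ultimately show ?thesis using fi by simp
    qed
    ultimately show "u = v" using ker[OF Z(1)] Z e by metis
  qed (rule i)
  then have "zero_object C K \<or> is_iso C K S i" using S Ko by (auto simp: simple_object_def)
  moreover have "\<not> is_iso C K S i"
  proof
    assume "is_iso C K S i"
    then obtain g where g: "g \<in> Hom C S K" "i \<cdot> g = idm C S" by (auto simp: is_iso_def inverse_arrows_def)
    have tg: "t.arr (S, g, K)" using g o Ko by (auto simp: t.arr_def)
    have "((S, f, T) \<cdot>\<^bsub>tag C\<^esub> (K, i, S)) \<cdot>\<^bsub>tag C\<^esub> (S, g, K) = (S, f, T) \<cdot>\<^bsub>tag C\<^esub> ((K, i, S) \<cdot>\<^bsub>tag C\<^esub> (S, g, K))"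
      using t1 tg by (intro t.cmp_cmp) auto
    moreover have "(K, zeroM C K T, T) \<cdot>\<^bsub>tag C\<^esub> (S, g, K) = (S, zeroM C S T, T)"
      using t.cmp_zero(1)[of "(S, g, K)" K T] tg o by simp
    ultimately show False using fi g nz idm_right[OF o f] by simp
  qed
  ultimately have Kz: "zero_object C K" by blast
  have "is_mono C S T f"
    unfolding is_mono_def
  proof (intro conjI ballI impI)
    fix Z u v assume Z: "Z \<in> Obj C" "u \<in> Hom C Z S" "v \<in> Hom C Z S" and e: "f \<cdot> u = f \<cdot> v"
    have tz: "t.arr (Z, u, S)" "t.arr (Z, v, S)" using Z o by (auto simp: t.arr_def)
    let ?d = "t.sub (Z, u, S) (Z, v, S)"
    have d: "t.arr ?d" "fst ?d = Z" "snd (snd ?d) = S" using tz by simp_all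
    then obtain d where dd: "?d = (Z, d, S)" "d \<in> Hom C Z S" using t.arr_def[of ?d] by auto
    have "(S, f, T) \<cdot>\<^bsub>tag C\<^esub> ?d = t.sub ((S, f, T) \<cdot>\<^bsub>tag C\<^esub> (Z, u, S)) ((S, f, T) \<cdot>\<^bsub>tag C\<^esub> (Z, v, S))"
      by (rule t.cmp_sub(2)) (use tz t1 in auto)
    also have "\<dots> = (Z, zeroM C Z T, T)"
      using e t.sub_self[of "(S, f, T) \<cdot>\<^bsub>tag C\<^esub> (Z, v, S)"] t.cmp_arr[OF tz(2) t1(1)] by simp
    finally have "f \<cdot> d = zeroM C Z T" unfolding dd by simp
    then obtain w where w: "w \<in> Hom C Z K" "i \<cdot> w = d" using ker[OF Z(1) dd(2)] by blast
    have "w = zeroM C Z K" using Kz Z(1) w(1) zer_in[OF Z(1) Ko] unfolding zero_object_def by blast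
    then have "(Z, d, S) = (K, i, S) \<cdot>\<^bsub>tag C\<^esub> zeroM (tag C) Z K" using w by simp
    also have "\<dots> = zeroM (tag C) Z S" using t.cmp_zero(2)[of "(K, i, S)" K Z] t1 Z by simp
    finally have "?d = zeroM (tag C) Z S" by (simp only: dd)
    then have "(Z, u, S) = (Z, v, S)" by (rule t.sub_eq_zero) (use tz in auto)
    then show "u = v" by simp
  qed (rule f)
  then have "zero_object C S \<or> is_iso C S T f" using T o by (auto simp: simple_object_def)
  then show ?thesis using S by (auto simp: simple_object_def)
qed

lemma typed_direct_sum:
  assumes "is_direct_sum C Ss X"
  obtains i p where "\<And>j. j < length Ss \<Longrightarrow> i j \<in> Hom (tag C) (Ss ! j) X \<and> p j \<in> Hom (tag C) X (Ss ! j)"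
    "\<And>j. j < length Ss \<Longrightarrow> p j \<cdot>\<^bsub>tag C\<^esub> i j = idm (tag C) (Ss ! j)"
    "hom_sum (tag C) X X (map (\<lambda>j. i j \<cdot>\<^bsub>tag C\<^esub> p j) [0..<length Ss]) = idm (tag C) X"
proof -
  obtain i p where ip: "\<forall>j<length Ss. i j \<in> Hom C (Ss ! j) X \<and> p j \<in> Hom C X (Ss ! j)"
      "\<forall>j<length Ss. \<forall>l<length Ss. p l \<cdot> i j = (if j = l then idm C (Ss ! j) else zeroM C (Ss ! j) (Ss ! l))"
      "hom_sum C X X (map (\<lambda>j. i j \<cdot> p j) [0..<length Ss]) = idm C X"
      using assms unfolding is_direct_sum_def by blast
  show thesis
  proof (rule that[of "\<lambda>j. (Ss ! j, i j, X)" "\<lambda>j. (X, p j, Ss ! j)"])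
    show "hom_sum (tag C) X X (map (\<lambda>j. (Ss ! j, i j, X) \<cdot>\<^bsub>tag C\<^esub> (X, p j, Ss ! j)) [0..<length Ss]) = idm (tag C) X"
      using hom_sum_tag[of C X X "map (\<lambda>j. i j \<cdot> p j) [0..<length Ss]"] ip(3) by (simp add: comp_def)
  qed (use ip in auto)
qed

text \<open>Some component of \<open>x\<close> between simple summands is nonzero and, by Schur's
  lemma, invertible. Sending its inverse back along the summands gives a \<open>y\<close> such that
  the product of \<open>y\<close> and \<open>x\<close> fixes the nonzero inclusion
  \<open>i j\<close>; so no power of this product vanishes.\<close>

lemma semiprime_tag:
  assumes ss: "semisimple C"
  shows "semiprime (tag C)"
  unfolding semiprime_def
proof (intro ballI impI)
  interpret t: typed_tensor_category "tag C" fst "\<lambda>f. snd (snd f)" by (rule typed_tag)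
  fix X Y x assume X: "X \<in> Obj (tag C)" and Y: "Y \<in> Obj (tag C)" and "x \<in> Hom (tag C) X Y"
    and nz: "x \<noteq> zeroM (tag C) X Y"
  then have x: "t.arr x" "fst x = X" "snd (snd x) = Y" using t.Hom_iff[OF X Y] by auto
  obtain Ss where Ss: "\<And>S. S \<in> set Ss \<Longrightarrow> simple_object C S" "is_direct_sum C Ss X"
    using ss X unfolding semisimple_def tag_simps(1) by meson
  obtain Ts where Ts: "\<And>S. S \<in> set Ts \<Longrightarrow> simple_object C S" "is_direct_sum C Ts Y"
    using ss Y unfolding semisimple_def tag_simps(1) by meson
  have So: "Ss ! j \<in> Obj (tag C)" if "j < length Ss" for j
    using Ss(1)[OF nth_mem[OF that]] by (simp add: simple_object_def)
  have To: "Ts ! j \<in> Obj (tag C)" if "j < length Ts" for j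
    using Ts(1)[OF nth_mem[OF that]] by (simp add: simple_object_def)
  obtain i p where ip: "\<And>j. j < length Ss \<Longrightarrow> i j \<in> Hom (tag C) (Ss ! j) X \<and> p j \<in> Hom (tag C) X (Ss ! j)"
    "\<And>j. j < length Ss \<Longrightarrow> p j \<cdot>\<^bsub>tag C\<^esub> i j = idm (tag C) (Ss ! j)"
    "hom_sum (tag C) X X (map (\<lambda>j. i j \<cdot>\<^bsub>tag C\<^esub> p j) [0..<length Ss]) = idm (tag C) X"
    using typed_direct_sum[OF Ss(2)] by blast
  obtain k q where kq: "\<And>j. j < length Ts \<Longrightarrow> k j \<in> Hom (tag C) (Ts ! j) Y \<and> q j \<in> Hom (tag C) Y (Ts ! j)"
    "\<And>j. j < length Ts \<Longrightarrow> q j \<cdot>\<^bsub>tag C\<^esub> k j = idm (tag C) (Ts ! j)"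
    "hom_sum (tag C) Y Y (map (\<lambda>j. k j \<cdot>\<^bsub>tag C\<^esub> q j) [0..<length Ts]) = idm (tag C) Y"
    using typed_direct_sum[OF Ts(2)] by blast
  have it: "t.arr (i j)" "fst (i j) = Ss ! j" "snd (snd (i j)) = X" "t.arr (p j)" "fst (p j) = X" "snd (snd (p j)) = Ss ! j"
    if "j < length Ss" for j
    using ip(1)[OF that] t.Hom_iff[OF So[OF that] X] t.Hom_iff[OF X So[OF that]] by blast+
  have kt: "t.arr (k j)" "fst (k j) = Ts ! j" "snd (snd (k j)) = Y" "t.arr (q j)" "fst (q j) = Y" "snd (snd (q j)) = Ts ! j"
    if "j < length Ts" for j
    using kq(1)[OF that] t.Hom_iff[OF To[OF that] Y] t.Hom_iff[OF Y To[OF that]] by blast+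
  note [simp del] = tag_simps and [simp] = x X Y
  have "\<exists>j<length Ss. \<exists>l<length Ts. q l \<cdot>\<^bsub>tag C\<^esub> (x \<cdot>\<^bsub>tag C\<^esub> i j) \<noteq> zeroM (tag C) (Ss ! j) (Ts ! l)"
  proof (rule ccontr)
    assume "\<not> ?thesis"
    then have z: "q l \<cdot>\<^bsub>tag C\<^esub> (x \<cdot>\<^bsub>tag C\<^esub> i j) = zeroM (tag C) (Ss ! j) (Ts ! l)" if "j < length Ss" "l < length Ts" for j l
      using that by blast
    have xi: "x \<cdot>\<^bsub>tag C\<^esub> i j = zeroM (tag C) (Ss ! j) Y" if j: "j < length Ss" for j
    proof -
      note [simp] = it[OF j] So[OF j]
      have f: "t.fam Y Y (\<lambda>l. k l \<cdot>\<^bsub>tag C\<^esub> q l) (length Ts)" using kt by (auto simp: t.fam_def)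
      have "x \<cdot>\<^bsub>tag C\<^esub> i j = t.csum Y Y (\<lambda>l. k l \<cdot>\<^bsub>tag C\<^esub> q l) (length Ts) \<cdot>\<^bsub>tag C\<^esub> (x \<cdot>\<^bsub>tag C\<^esub> i j)"
        using kq(3) by (simp add: t.csum_def)
      also have "\<dots> = t.csum (Ss ! j) Y (\<lambda>l. (k l \<cdot>\<^bsub>tag C\<^esub> q l) \<cdot>\<^bsub>tag C\<^esub> (x \<cdot>\<^bsub>tag C\<^esub> i j)) (length Ts)"
        by (subst t.csum_cmp_right[OF f]) auto
      also have "\<dots> = t.csum (Ss ! j) Y (\<lambda>l. zeroM (tag C) (Ss ! j) Y) (length Ts)"
      proof (rule t.csum_cong)
        fix l assume l: "l < length Ts"
        have "(k l \<cdot>\<^bsub>tag C\<^esub> q l) \<cdot>\<^bsub>tag C\<^esub> (x \<cdot>\<^bsub>tag C\<^esub> i j) = k l \<cdot>\<^bsub>tag C\<^esub> (q l \<cdot>\<^bsub>tag C\<^esub> (x \<cdot>\<^bsub>tag C\<^esub> i j))"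
          by (rule t.cmp_cmp) (use kt[OF l] in auto)
        also have "\<dots> = zeroM (tag C) (Ss ! j) Y" unfolding z[OF j l] using kt[OF l] by simp
        finally show "(k l \<cdot>\<^bsub>tag C\<^esub> q l) \<cdot>\<^bsub>tag C\<^esub> (x \<cdot>\<^bsub>tag C\<^esub> i j) = zeroM (tag C) (Ss ! j) Y" .
      qed
      also have "\<dots> = zeroM (tag C) (Ss ! j) Y" by (rule t.csum_zero) auto
      finally show ?thesis .
    qed
    have f: "t.fam X X (\<lambda>l. i l \<cdot>\<^bsub>tag C\<^esub> p l) (length Ss)" using it by (auto simp: t.fam_def)
    have "x = x \<cdot>\<^bsub>tag C\<^esub> t.csum X X (\<lambda>l. i l \<cdot>\<^bsub>tag C\<^esub> p l) (length Ss)"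
      using ip(3) by (simp add: t.csum_def)
    also have "\<dots> = t.csum X Y (\<lambda>l. x \<cdot>\<^bsub>tag C\<^esub> (i l \<cdot>\<^bsub>tag C\<^esub> p l)) (length Ss)"
      by (subst t.csum_cmp_left[OF f]) auto
    also have "\<dots> = t.csum X Y (\<lambda>l. zeroM (tag C) X Y) (length Ss)"
    proof (rule t.csum_cong)
      fix l assume l: "l < length Ss"
      have "x \<cdot>\<^bsub>tag C\<^esub> (i l \<cdot>\<^bsub>tag C\<^esub> p l) = (x \<cdot>\<^bsub>tag C\<^esub> i l) \<cdot>\<^bsub>tag C\<^esub> p l"
        by (rule t.cmp_cmp[symmetric]) (use it[OF l] in auto)
      also have "\<dots> = zeroM (tag C) X Y" unfolding xi[OF l] using it[OF l] by simp
      finally show "x \<cdot>\<^bsub>tag C\<^esub> (i l \<cdot>\<^bsub>tag C\<^esub> p l) = zeroM (tag C) X Y" .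
    qed
    also have "\<dots> = zeroM (tag C) X Y" by (rule t.csum_zero) auto
    finally show False using nz by simp
  qed
  then obtain j l where j: "j < length Ss" and l: "l < length Ts"
    and c0: "q l \<cdot>\<^bsub>tag C\<^esub> (x \<cdot>\<^bsub>tag C\<^esub> i j) \<noteq> zeroM (tag C) (Ss ! j) (Ts ! l)" by blast
  note [simp] = it[OF j] kt[OF l] So[OF j] To[OF l]
  let ?c = "q l \<cdot>\<^bsub>tag C\<^esub> (x \<cdot>\<^bsub>tag C\<^esub> i j)"
  have "?c \<in> Hom (tag C) (Ss ! j) (Ts ! l)" by (simp add: t.Hom_iff)
  then obtain c where c: "?c = (Ss ! j, c, Ts ! l)" "c \<in> Hom C (Ss ! j) (Ts ! l)" by (auto simp: tag_simps)
  have "is_iso C (Ss ! j) (Ts ! l) c"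
    by (rule schur_lemma[OF Ss(1) Ts(1)]) (use j l c c0 in \<open>auto simp: tag_simps\<close>)
  then obtain d where d: "d \<in> Hom C (Ts ! l) (Ss ! j)" "d \<cdot> c = idm C (Ss ! j)" by (auto simp: is_iso_def inverse_arrows_def)
  define d' where "d' = (Ts ! l, d, Ss ! j)"
  have "d' \<in> Hom (tag C) (Ts ! l) (Ss ! j)" using d by (simp add: d'_def tag_simps)
  then have [simp]: "t.arr d'" "fst d' = Ts ! l" "snd (snd d') = Ss ! j" by (simp_all add: t.Hom_iff)
  have dc: "d' \<cdot>\<^bsub>tag C\<^esub> ?c = idm (tag C) (Ss ! j)" unfolding c d'_def using d by (simp add: tag_simps)
  define y where "y = i j \<cdot>\<^bsub>tag C\<^esub> (d' \<cdot>\<^bsub>tag C\<^esub> q l)"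
  have y [simp]: "t.arr y" "fst y = Y" "snd (snd y) = X" by (simp_all add: y_def)
  have e: "t.endo X (y \<cdot>\<^bsub>tag C\<^esub> x)" by (simp add: t.endo_def)
  have yi: "(y \<cdot>\<^bsub>tag C\<^esub> x) \<cdot>\<^bsub>tag C\<^esub> i j = i j"
    using dc by (simp add: y_def)
  have pi: "t.pw X (y \<cdot>\<^bsub>tag C\<^esub> x) n \<cdot>\<^bsub>tag C\<^esub> i j = i j" for n
  proof (induction n)
    case (Suc n)
    note [simp] = t.pw_typ(2-4)[OF e]
    have "t.pw X (y \<cdot>\<^bsub>tag C\<^esub> x) (Suc n) \<cdot>\<^bsub>tag C\<^esub> i j = (y \<cdot>\<^bsub>tag C\<^esub> x) \<cdot>\<^bsub>tag C\<^esub> (t.pw X (y \<cdot>\<^bsub>tag C\<^esub> x) n \<cdot>\<^bsub>tag C\<^esub> i j)"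
      unfolding cpow.simps by (rule t.cmp_cmp) auto
    also have "\<dots> = i j" unfolding Suc by (rule yi)
    finally show ?case .
  qed simp
  show "\<exists>y\<in>Hom (tag C) Y X. \<forall>n. t.pw X (y \<cdot>\<^bsub>tag C\<^esub> x) n \<noteq> zeroM (tag C) X X"
  proof (intro bexI[of _ y] allI notI)
    fix n assume "t.pw X (y \<cdot>\<^bsub>tag C\<^esub> x) n = zeroM (tag C) X X"
    with pi[of n] have "i j = zeroM (tag C) (Ss ! j) X" by simp
    then have "?c = q l \<cdot>\<^bsub>tag C\<^esub> (x \<cdot>\<^bsub>tag C\<^esub> zeroM (tag C) (Ss ! j) X)" by (rule arg_cong)
    also have "\<dots> = zeroM (tag C) (Ss ! j) (Ts ! l)" by simp
    finally show False using c0 by simp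
  qed (simp add: t.Hom_iff)
qed

text \<open>Regularity of \<open>C\<close> itself supplies quasi-inverses for two purposes: for
  nilpotent endomorphisms in \<open>trc_nilpotent\<close> and for names of morphisms in
  \<open>trc_nondegenerate\<close>.\<close>

lemma regular_tag: "semisimple C \<Longrightarrow> regular (tag C)"
proof -
  assume "semisimple C"
  interpret t: typed_tensor_category "tag C" fst "\<lambda>f. snd (snd f)" by (rule typed_tag)
  show ?thesis
    by (rule t.semiprime_imp_regular[OF semiprime_tag[OF \<open>semisimple C\<close>]])
      (intro finite_dim_hom_tag finite_dim_homs, simp_all)
qed

end

section \<open>The trace\<close>

context typed_tensor_category
begin

lemma ten_add:
  "arr f \<Longrightarrow> arr g \<Longrightarrow> arr h \<Longrightarrow> dm f = dm g \<Longrightarrow> cd f = cd g \<Longrightarrow> (f \<oplus>\<^sub>m g) \<otimes>\<^sub>m h = (f \<otimes>\<^sub>m h) \<oplus>\<^sub>m (g \<otimes>\<^sub>m h)"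
  "arr f \<Longrightarrow> arr g \<Longrightarrow> arr h \<Longrightarrow> dm f = dm g \<Longrightarrow> cd f = cd g \<Longrightarrow> h \<otimes>\<^sub>m (f \<oplus>\<^sub>m g) = (h \<otimes>\<^sub>m f) \<oplus>\<^sub>m (h \<otimes>\<^sub>m g)"
  using tenM_add_left[of "dm f" "cd f" "dm h" "cd h" f g h] tenM_add_right[of "dm h" "cd h" "dm f" "cd f" h f g]
  by (auto simp: Hom_iff)

lemma ten_smul:
  "arr f \<Longrightarrow> arr h \<Longrightarrow> (a *\<^sub>m f) \<otimes>\<^sub>m h = a *\<^sub>m (f \<otimes>\<^sub>m h)"
  "arr f \<Longrightarrow> arr h \<Longrightarrow> h \<otimes>\<^sub>m (a *\<^sub>m f) = a *\<^sub>m (h \<otimes>\<^sub>m f)"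
  using tenM_smul_left[of "dm f" "cd f" "dm h" "cd h" f h a] tenM_smul_right[of "dm h" "cd h" "dm f" "cd f" h f a]
  by (auto simp: Hom_iff)

definition trc :: "'o \<Rightarrow> 'o \<Rightarrow> 'm \<Rightarrow> 'm \<Rightarrow> 'm \<Rightarrow> 'm" where
  "trc X D ev co f = ev \<cdot> (brd C X D \<cdot> ((f \<otimes>\<^sub>m idm C D) \<cdot> co))"

context
  fixes X D ev co
  assumes dp: "dual_pair X D ev co"
begin

lemma trc_typ: "endo X f \<Longrightarrow> endo I (trc X D ev co f)"
  using dual_pairD[OF dp] by (auto simp: trc_def endo_def)

lemma trc_add:
  assumes "endo X f" "endo X g"
  shows "trc X D ev co (f \<oplus>\<^sub>m g) = trc X D ev co f \<oplus>\<^sub>m trc X D ev co g"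
proof -
  note [simp] = dual_pairD(1-8)[OF dp] endoD[OF assms(1)] endoD[OF assms(2)]
  show ?thesis by (simp add: trc_def ten_add)
qed

lemma trc_smul:
  assumes "endo X f"
  shows "trc X D ev co (a *\<^sub>m f) = a *\<^sub>m trc X D ev co f"
proof -
  note [simp] = dual_pairD(1-8)[OF dp] endoD[OF assms(1)]
  show ?thesis by (simp add: trc_def ten_smul)
qed

lemma trc_zero: "trc X D ev co (zeroM C X X) = zeroM C I I"
proof -
  note [simp] = dual_pairD(1-8)[OF dp]
  have "endo X (zeroM C X X)" by (simp add: endo_def)
  from trc_smul[OF this, of 0] endoD[OF trc_typ[OF this]] show ?thesis by simp
qed

lemma trc_comm:
  assumes "endo X f" "endo X g"
  shows "trc X D ev co (f \<cdot> g) = trc X D ev co (g \<cdot> f)"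
  unfolding trc_def by (rule trace_cyclic[OF dp dp]) (use endoD[OF assms(1)] endoD[OF assms(2)] in auto)

text \<open>If \<open>a = aba\<close>, then \<open>a\<close> and \<open>aab\<close> have the same trace, and \<open>aab\<close> has a smaller nilpotency
  degree.\<close>

lemma trc_nilpotent:
  assumes reg: "regular C"
  shows "endo X a \<Longrightarrow> pw X a (Suc n) = zeroM C X X \<Longrightarrow> trc X D ev co a = zeroM C I I"
proof (induction n arbitrary: a)
  case 0
  then have "a = zeroM C X X" using endoD[OF 0(1)] by simp
  then show ?case using trc_zero by simp
next
  case (Suc n)
  note [simp] = dual_pairD(1-8)[OF dp] and a [simp] = endoD[OF Suc.prems(1)] and pt [simp] = pw_typ(2-4)[OF Suc.prems(1)]
  have "a \<in> Hom C X X" by (simp add: Hom_iff)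
  then obtain b where "b \<in> Hom C X X" and aba: "a \<cdot> (b \<cdot> a) = a"
    using reg dual_pairD(1)[OF dp] unfolding regular_def by blast
  then have b [simp]: "arr b" "dm b = X" "cd b = X" by (simp_all add: Hom_iff)
  let ?m = "a \<cdot> (a \<cdot> b)"
  have m: "endo X ?m" "endo X (a \<cdot> b)" by (simp_all add: endo_def)
  have ext: "a \<cdot> (b \<cdot> (a \<cdot> r)) = a \<cdot> r" if "arr r" "cd r = X" for r
  proof -
    have "a \<cdot> (b \<cdot> (a \<cdot> r)) = (a \<cdot> (b \<cdot> a)) \<cdot> r" using that by simp
    then show ?thesis by (simp only: aba)
  qed
  have pm: "pw X ?m (Suc k) = pw X a (Suc (Suc k)) \<cdot> b" for k
  proof (induction k)
    case (Suc k)
    have "pw X ?m (Suc (Suc k)) = ?m \<cdot> (pw X a (Suc (Suc k)) \<cdot> b)" unfolding cpow.simps(2)[of _ _ _ "Suc k"] Suc ..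
    also have "\<dots> = a \<cdot> (a \<cdot> (b \<cdot> (a \<cdot> (a \<cdot> (pw X a k \<cdot> b)))))" by simp
    also have "\<dots> = pw X a (Suc (Suc (Suc k))) \<cdot> b" by (subst ext) auto
    finally show ?case .
  qed simp
  have "pw X ?m (Suc n) = zeroM C X X" unfolding pm Suc.prems(2) by simp
  then have z: "trc X D ev co ?m = zeroM C I I" by (rule Suc.IH[OF m(1)])
  have "trc X D ev co ((a \<cdot> b) \<cdot> a) = trc X D ev co ?m"
    by (rule trc_comm[OF m(2) Suc.prems(1)])
  then show ?case using z aba by simp
qed

text \<open>The difference \<open>?v\<close> of \<open>a\<close> and \<open>a \<cdot> e\<close> is
  nilpotent: \<open>e\<close> commutes with \<open>a\<close>, so the powers of \<open>?v\<close> are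
  those of \<open>a\<close> minus those of \<open>a \<cdot> e\<close>, and they cancel at the
  exponent \<open>Suc n\<close>, where the power of \<open>a\<close> is \<open>e\<close> itself. So
  the trace sees only the part on which \<open>a\<close> is invertible.\<close>

lemma trc_stable:
  assumes reg: "regular C" and a: "endo X a" and e: "e = pw X a (Suc n)" and ee: "e \<cdot> e = e"
  shows "trc X D ev co (a \<cdot> e) = trc X D ev co a"
proof -
  note [simp] = dual_pairD(1-8)[OF dp] and at [simp] = endoD[OF a] and pt [simp] = pw_typ(2-4)[OF a]
  have e_endo: "endo X e" unfolding e by (rule pw_endo[OF a])
  note [simp] = endoD[OF e_endo]
  have ea: "e \<cdot> a = a \<cdot> e" unfolding e using pw_commute[OF a a refl, of "Suc n"] by simp
  have ear: "e \<cdot> (a \<cdot> r) = a \<cdot> (e \<cdot> r)" if "arr r" "cd r = X" for r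
  proof -
    have "e \<cdot> (a \<cdot> r) = (e \<cdot> a) \<cdot> r" using that by simp
    also have "\<dots> = a \<cdot> (e \<cdot> r)" unfolding ea using that by simp
    finally show ?thesis .
  qed
  let ?v = "a \<ominus>\<^sub>m a \<cdot> e"
  have v: "endo X ?v" by (simp add: endo_def)
  have ae: "endo X (a \<cdot> e)" by (simp add: endo_def)
  have pe: "e \<cdot> pw X a k = pw X a k \<cdot> e" for k using pw_commute[OF e_endo a ea] by simp
  have per: "e \<cdot> (pw X a k \<cdot> e) = pw X a k \<cdot> e" for k
  proof -
    have "e \<cdot> (pw X a k \<cdot> e) = (e \<cdot> pw X a k) \<cdot> e" by simp
    also have "\<dots> = pw X a k \<cdot> (e \<cdot> e)" unfolding pe by simp
    finally show ?thesis by (simp only: ee)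
  qed
  have pv: "pw X ?v (Suc k) = pw X a (Suc k) \<ominus>\<^sub>m pw X a (Suc k) \<cdot> e" for k
  proof (induction k)
    case (Suc k)
    have "pw X ?v (Suc (Suc k)) = ?v \<cdot> (pw X a (Suc k) \<ominus>\<^sub>m pw X a (Suc k) \<cdot> e)"
      unfolding cpow.simps(2)[of _ _ _ "Suc k"] Suc ..
    also have "\<dots> = ?v \<cdot> pw X a (Suc k) \<ominus>\<^sub>m ?v \<cdot> (pw X a (Suc k) \<cdot> e)"
      by (rule cmp_sub(2)) auto
    also have "?v \<cdot> (pw X a (Suc k) \<cdot> e) = zeroM C X X"
      by (simp add: per ear)
    also have "?v \<cdot> pw X a (Suc k) = pw X a (Suc (Suc k)) \<ominus>\<^sub>m pw X a (Suc (Suc k)) \<cdot> e"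
      by (simp add: ear pe)
    finally show ?case by simp
  qed simp
  have "pw X ?v (Suc n) = zeroM C X X" unfolding pv e[symmetric] ee by simp
  then have "trc X D ev co ?v = zeroM C I I" by (rule trc_nilpotent[OF reg v])
  moreover have "trc X D ev co (?v \<oplus>\<^sub>m a \<cdot> e) = trc X D ev co ?v \<oplus>\<^sub>m trc X D ev co (a \<cdot> e)"
    by (rule trc_add[OF v ae])
  ultimately show ?thesis using endoD[OF trc_typ[OF ae]] by simp
qed

text \<open>The name \<open>?u\<close> of \<open>f\<close> is nonzero by
  \<open>dual_co_retract\<close>. A quasi-inverse \<open>g\<close> of \<open>?u\<close> gives a
  nonzero endomorphism \<open>g \<cdot> ?u\<close> of the unit, and \<open>trace_pairing\<close>
  writes it as the trace of some \<open>r \<cdot> f\<close>.\<close>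

lemma trc_nondegenerate:
  assumes reg: "regular C" and f [simp]: "arr f" "dm f = X" and nz: "f \<noteq> zeroM C X (cd f)"
  obtains r where "arr r" "dm r = cd f" "cd r = X" "trc X D ev co (r \<cdot> f) \<noteq> zeroM C I I"
proof -
  note [simp] = dual_pairD(1-8)[OF dp]
  let ?Y = "cd f"
  let ?u = "(f \<otimes>\<^sub>m idm C D) \<cdot> co"
  have u0: "?u \<noteq> zeroM C I (?Y \<otimes>\<^sub>o D)"
  proof
    assume u: "?u = zeroM C I (?Y \<otimes>\<^sub>o D)"
    have z: "zeroM C I (?Y \<otimes>\<^sub>o D) \<otimes>\<^sub>m idm C X = zeroM C (I \<otimes>\<^sub>o X) ((?Y \<otimes>\<^sub>o D) \<otimes>\<^sub>o X)"
      using ten_smul(1)[of "zeroM C I (?Y \<otimes>\<^sub>o D)" "idm C X" 0] by simp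
    have "f = run C ?Y \<cdot> ((idm C ?Y \<otimes>\<^sub>m ev) \<cdot> (asc C ?Y D X \<cdot> ((?u \<otimes>\<^sub>m idm C X) \<cdot> iv (lun C X))))"
      using dual_co_retract[OF dp f] by simp
    also have "\<dots> = zeroM C X ?Y" unfolding u z by simp
    finally show False using nz by simp
  qed
  have "?u \<in> Hom C I (?Y \<otimes>\<^sub>o D)" by (simp add: Hom_iff)
  then obtain g where "g \<in> Hom C (?Y \<otimes>\<^sub>o D) I" and ugu: "?u \<cdot> (g \<cdot> ?u) = ?u"
    using reg unfolding regular_def by (metis unt_in tenO_in dual_pairD(2)[OF dp] arr_Obj(2)[OF f(1)])
  then have g [simp]: "arr g" "dm g = ?Y \<otimes>\<^sub>o D" "cd g = I" by (simp_all add: Hom_iff)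
  obtain r where r: "arr r" "dm r = ?Y" "cd r = X" and tr: "trc X D ev co (r \<cdot> f) = g \<cdot> ?u"
    using trace_pairing[OF dp _ g] f unfolding trc_def by (metis arr_Obj(2))
  have "g \<cdot> ?u \<noteq> zeroM C I I"
  proof
    assume "g \<cdot> ?u = zeroM C I I"
    then have "?u \<cdot> zeroM C I I = ?u" using ugu by (simp only:)
    then show False using u0 by simp
  qed
  then show thesis using r tr by (intro that[of r]) auto
qed

end

end

context pre_tannakian_category
begin

lemma cpow_tag: "cpow (tag C) X (X, f, X) n = (X, cpow C X f n, X)"
  by (induction n) auto

text \<open>Identifying endomorphisms of the unit with scalars removes the tags and the chosen duals
  from view. The remaining argument uses the trace only through these properties: linearity,
  cyclicity, invariance under passage to the stable part, and nondegeneracy.\<close>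

theorem trace_functional:
  assumes ss: "semisimple C"
  obtains t :: "'o \<Rightarrow> 'm \<Rightarrow> 's" where
    "\<And>X f g. X \<in> Obj C \<Longrightarrow> f \<in> Hom C X X \<Longrightarrow> g \<in> Hom C X X \<Longrightarrow> t X (f \<oplus>\<^sub>m g) = t X f + t X g"
    "\<And>X f a. X \<in> Obj C \<Longrightarrow> f \<in> Hom C X X \<Longrightarrow> t X (a *\<^sub>m f) = a * t X f"
    "\<And>X f g. X \<in> Obj C \<Longrightarrow> f \<in> Hom C X X \<Longrightarrow> g \<in> Hom C X X \<Longrightarrow> t X (f \<cdot> g) = t X (g \<cdot> f)"
    "\<And>X f n. X \<in> Obj C \<Longrightarrow> f \<in> Hom C X X \<Longrightarrow> cpow C X f (Suc n) \<cdot> cpow C X f (Suc n) = cpow C X f (Suc n)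
       \<Longrightarrow> t X (f \<cdot> cpow C X f (Suc n)) = t X f"
    "\<And>X Y f. X \<in> Obj C \<Longrightarrow> Y \<in> Obj C \<Longrightarrow> f \<in> Hom C X Y \<Longrightarrow> f \<noteq> zeroM C X Y \<Longrightarrow> \<exists>g\<in>Hom C Y X. t X (g \<cdot> f) \<noteq> 0"
proof -
  interpret t: typed_tensor_category "tag C" fst "\<lambda>f. snd (snd f)" by (rule typed_tag)
  note reg = regular_tag[OF ss]
  have "\<exists>D ev co. t.dual_pair X D ev co" if X: "X \<in> Obj C" for X
  proof -
    obtain D where "is_dual C X D" using rigid[OF X] by blast
    then have "is_dual (tag C) X D" by (rule is_dual_tag[OF _ _ X, rotated]) unfold_locales
    then obtain ev co where "t.dual_pair X D ev co" using t.is_dual_iff[of X D] X by auto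
    then show ?thesis by blast
  qed
  then obtain D ev co where dp: "\<And>X. X \<in> Obj C \<Longrightarrow> t.dual_pair X (D X) (ev X) (co X)" by metis
  let ?tr = "\<lambda>X f. t.trc X (D X) (ev X) (co X) (X, f, X)"
  let ?h = "\<lambda>a. a *\<^sub>m idm C (unt C)"
  define s where "s X f = inv_into UNIV ?h (fst (snd (?tr X f)))" for X f
  have inj: "inj ?h" and surj: "range ?h = Hom C (unt C) (unt C)" using end_unit by (auto simp: bij_betw_def)
  have endo: "t.endo X (X, f, X)" if "X \<in> Obj C" "f \<in> Hom C X X" for X f
    using that by (auto simp: t.endo_def t.arr_def)
  have tr: "?tr X f = (unt C, ?h (s X f), unt C)" if "X \<in> Obj C" "f \<in> Hom C X X" for X f
  proof -
    have e: "t.endo (unt C) (?tr X f)" using t.trc_typ[OF dp[OF that(1)] endo[OF that]] by simp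
    then have "?tr X f \<in> Hom (tag C) (unt C) (unt C)" using t.endoD[OF e] t.Hom_iff[of "unt C" "unt C"] by simp
    then obtain u where u: "?tr X f = (unt C, u, unt C)" "u \<in> Hom C (unt C) (unt C)" by auto
    have "?h (inv_into UNIV ?h u) = u" by (rule f_inv_into_f[of u ?h UNIV]) (use surj u in simp)
    then have "?h (s X f) = u" unfolding s_def u by simp
    with u show ?thesis by simp
  qed
  have id1: "idm C (unt C) \<in> Hom C (unt C) (unt C)" by (rule idm_in) (rule unt_in)
  have h0: "?h 0 = zeroM C (unt C) (unt C)"
    using t.zero_smul[of "(unt C, idm C (unt C), unt C)"] t.idm_arr[of "unt C"] unt_in by simp
  show thesis
  proof (rule that[of s])
    fix X f g assume X: "X \<in> Obj C" and f: "f \<in> Hom C X X" and g: "g \<in> Hom C X X"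
    have "?tr X (f \<oplus>\<^sub>m g) = ?tr X f \<oplus>\<^sub>m\<^bsub>tag C\<^esub> ?tr X g"
      using t.trc_add[OF dp[OF X] endo[OF X f] endo[OF X g]] by simp
    then have "?h (s X (f \<oplus>\<^sub>m g)) = ?h (s X f + s X g)"
      unfolding tr[OF X f] tr[OF X g] tr[OF X add_in[OF X X f g]]
      using smul_add_left[OF unt_in unt_in id1] by simp
    then show "s X (f \<oplus>\<^sub>m g) = s X f + s X g" using inj by (simp add: inj_def)
    have "?tr X (f \<cdot> g) = ?tr X (g \<cdot> f)"
      using t.trc_comm[OF dp[OF X] endo[OF X f] endo[OF X g]] by simp
    then show "s X (f \<cdot> g) = s X (g \<cdot> f)" unfolding s_def by simp
  next
    fix X f a assume X: "X \<in> Obj C" and f: "f \<in> Hom C X X"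
    have "?tr X (a *\<^sub>m f) = a *\<^sub>m\<^bsub>tag C\<^esub> ?tr X f"
      using t.trc_smul[OF dp[OF X] endo[OF X f]] by simp
    then have "?h (s X (a *\<^sub>m f)) = ?h (a * s X f)"
      unfolding tr[OF X f] tr[OF X smul_in[OF X X f]]
      using smul_smul[OF unt_in unt_in id1] by simp
    then show "s X (a *\<^sub>m f) = a * s X f" using inj by (simp add: inj_def)
  next
    fix X f n assume X: "X \<in> Obj C" and f: "f \<in> Hom C X X"
      and e: "cpow C X f (Suc n) \<cdot> cpow C X f (Suc n) = cpow C X f (Suc n)"
    have "?tr X (f \<cdot> cpow C X f (Suc n)) = ?tr X f"
      using t.trc_stable[OF dp[OF X] reg endo[OF X f] refl, of n] e unfolding cpow_tag by simp
    then show "s X (f \<cdot> cpow C X f (Suc n)) = s X f" unfolding s_def by simp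
  next
    fix X Y f assume X: "X \<in> Obj C" and Y: "Y \<in> Obj C" and f: "f \<in> Hom C X Y" and nz: "f \<noteq> zeroM C X Y"
    have a: "t.arr (X, f, Y)" using X Y f by (auto simp: t.arr_def)
    obtain r where r: "t.arr r" "fst r = Y" "snd (snd r) = X"
      and n0: "t.trc X (D X) (ev X) (co X) (r \<cdot>\<^bsub>tag C\<^esub> (X, f, Y)) \<noteq> zeroM (tag C) (unt C) (unt C)"
      using t.trc_nondegenerate[OF dp[OF X] reg a] nz by auto
    then obtain g where g: "r = (Y, g, X)" "g \<in> Hom C Y X" using t.arr_def[of r] by auto
    have gf: "g \<cdot> f \<in> Hom C X X" by (rule cmp_in[OF X Y X f g(2)])
    have "?h (s X (g \<cdot> f)) \<noteq> ?h 0" using n0 tr[OF X gf] g h0 by simp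
    then have "s X (g \<cdot> f) \<noteq> 0" by metis
    then show "\<exists>g\<in>Hom C Y X. s X (g \<cdot> f) \<noteq> 0" using g(2) by blast
  qed
qed

end

section \<open>Nilpotent elements of monoid algebras\<close>

text \<open>Matrices are functions on an arbitrary finite index set, because they will be indexed by
  elements of a monoid.\<close>

primrec mat_pow :: "'i set \<Rightarrow> ('i \<Rightarrow> 'i \<Rightarrow> 'k::field) \<Rightarrow> nat \<Rightarrow> 'i \<Rightarrow> 'i \<Rightarrow> 'k" where
  "mat_pow I N 0 = (\<lambda>i j. if i = j then 1 else 0)"
| "mat_pow I N (Suc n) = (\<lambda>i j. \<Sum>l\<in>I. N i l * mat_pow I N n l j)"

text \<open>By induction on the size: a nilpotent matrix kills a nonzero vector \<open>a\<close>, and passing to the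
  quotient by \<open>a\<close> does not change the trace.\<close>

lemma nilpotent_trace:
  fixes N :: "'i \<Rightarrow> 'i \<Rightarrow> 'k::field"
  assumes "finite I" "\<And>i j. i \<in> I \<Longrightarrow> j \<in> I \<Longrightarrow> mat_pow I N n i j = 0"
  shows "(\<Sum>i\<in>I. N i i) = 0"
  using assms
proof (induction "card I" arbitrary: I N)
  case 0
  then show ?case by simp
next
  case (Suc c)
  then obtain i0 where i0: "i0 \<in> I" by fastforce
  define P where "P n \<longleftrightarrow> (\<forall>i\<in>I. \<forall>j\<in>I. mat_pow I N n i j = 0)" for n
  have "P n" using Suc.prems unfolding P_def by blast
  moreover have "\<not> P 0" using i0 by (auto simp: P_def)
  ultimately obtain m where "\<not> P m" "P (Suc m)"
    using ex_least_nat_less[of P n] by auto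
  then have m: "\<not> (\<forall>i\<in>I. \<forall>j\<in>I. mat_pow I N m i j = 0)" "\<And>i j. i \<in> I \<Longrightarrow> j \<in> I \<Longrightarrow> mat_pow I N (Suc m) i j = 0"
    unfolding P_def by blast+
  then obtain k j where kj: "k \<in> I" "j \<in> I" "mat_pow I N m k j \<noteq> 0" by blast
  \<comment> \<open>A nonzero column of the last nonvanishing power, scaled to have entry 1 at
    \<open>k\<close>; hence \<open>N\<close> kills it.\<close>
  define a where "a i = mat_pow I N m i j / mat_pow I N m k j" for i
  have ak: "a k = 1" using kj by (simp add: a_def)
  have Na: "(\<Sum>l\<in>I. N i l * a l) = 0" if "i \<in> I" for i
  proof -
    have "(\<Sum>l\<in>I. N i l * a l) = mat_pow I N (Suc m) i j / mat_pow I N m k j"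
      by (simp add: a_def sum_divide_distrib)
    then show ?thesis using m(2)[OF that kj(2)] by simp
  qed
  let ?I = "I - {k}"
  \<comment> \<open>As \<open>a k = 1\<close>, the basis vectors other than that of \<open>k\<close>
    form a basis of the quotient by \<open>a\<close>, and \<open>N'\<close> is the matrix induced by
    \<open>N\<close> in this basis.\<close>
  define N' where "N' i j = N i j - a i * N k j" for i j
  have N'a: "(\<Sum>l\<in>?I. N' i l * a l) = - N' i k" if "i \<in> I" for i
  proof -
    have "(\<Sum>l\<in>I. N' i l * a l) = (\<Sum>l\<in>I. N i l * a l) - a i * (\<Sum>l\<in>I. N k l * a l)"
      by (simp add: N'_def left_diff_distrib sum_subtractf sum_distrib_left mult.assoc)
    also have "\<dots> = 0" using Na that kj by simp
    finally have "(\<Sum>l\<in>I. N' i l * a l) = 0" .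
    then show ?thesis using Suc.prems(1) kj(1) ak by (simp add: sum.remove[of I k] eq_neg_iff_add_eq_0 add.commute)
  qed
  have pow: "mat_pow ?I N' n i j = mat_pow I N n i j - a i * mat_pow I N n k j" if "i \<in> ?I" "j \<in> ?I" for n i j
    using that
  proof (induction n arbitrary: i)
    case 0
    then show ?case by auto
  next
    case (Suc n)
    let ?M = "mat_pow I N n"
    have "mat_pow ?I N' (Suc n) i j = (\<Sum>l\<in>?I. N' i l * (?M l j - a l * ?M k j))"
      using Suc by simp
    also have "\<dots> = (\<Sum>l\<in>?I. N' i l * ?M l j) - (\<Sum>l\<in>?I. N' i l * a l) * ?M k j"
      by (simp add: right_diff_distrib sum_subtractf sum_distrib_right mult.assoc)
    also have "\<dots> = (\<Sum>l\<in>?I. N' i l * ?M l j) + N' i k * ?M k j"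
      using N'a[of i] Suc.prems by simp
    also have "\<dots> = (\<Sum>l\<in>I. N' i l * ?M l j)"
      using \<open>finite I\<close> kj(1) by (simp add: sum.remove[of I k])
    also have "\<dots> = mat_pow I N (Suc n) i j - a i * mat_pow I N (Suc n) k j"
      by (simp add: N'_def left_diff_distrib sum_subtractf sum_distrib_left mult.assoc)
    finally show ?case .
  qed
  have "(\<Sum>i\<in>?I. N' i i) = 0"
  proof (rule Suc.hyps(1)[of ?I N'])
    show "c = card ?I" using Suc.hyps(2) Suc.prems(1) kj(1) by simp
    show "finite ?I" using Suc.prems(1) by simp
    show "mat_pow ?I N' n i j = 0" if "i \<in> ?I" "j \<in> ?I" for i j
      using pow[OF that] Suc.prems(2) that kj(1) by simp
  qed
  moreover have "(\<Sum>i\<in>?I. N' i i) = (\<Sum>i\<in>?I. N i i) - (\<Sum>i\<in>?I. N k i * a i)"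
    by (simp add: N'_def sum_subtractf mult.commute)
  moreover have "(\<Sum>i\<in>?I. N k i * a i) = - N k k"
    using Na[OF kj(1)] Suc.prems(1) kj(1) ak by (simp add: sum.remove[of I k] eq_neg_iff_add_eq_0 add.commute)
  ultimately show ?case using Suc.prems(1) kj(1) by (simp add: sum.remove[of I k] add.commute)
qed

section \<open>Finite monoids and generalized conjugacy\<close>

locale finite_monoid =
  fixes M :: "'a set" and mul :: "'a \<Rightarrow> 'a \<Rightarrow> 'a"  (infixl "\<diamondop>" 70) and one :: 'a
  assumes fin: "finite M"
    and one_in [simp]: "one \<in> M"
    and mul_in [simp]: "\<And>a b. a \<in> M \<Longrightarrow> b \<in> M \<Longrightarrow> a \<diamondop> b \<in> M"
    and assoc [simp]: "\<And>a b c. a \<in> M \<Longrightarrow> b \<in> M \<Longrightarrow> c \<in> M \<Longrightarrow> (a \<diamondop> b) \<diamondop> c = a \<diamondop> (b \<diamondop> c)"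
    and one_left [simp]: "\<And>a. a \<in> M \<Longrightarrow> one \<diamondop> a = a"
    and one_right [simp]: "\<And>a. a \<in> M \<Longrightarrow> a \<diamondop> one = a"
begin

primrec mpow :: "'a \<Rightarrow> nat \<Rightarrow> 'a" where
  "mpow a 0 = one"
| "mpow a (Suc n) = a \<diamondop> mpow a n"

lemma mpow_in [simp]: "a \<in> M \<Longrightarrow> mpow a n \<in> M"
  by (induction n) auto

lemma mpow_add: "a \<in> M \<Longrightarrow> mpow a (m + n) = mpow a m \<diamondop> mpow a n"
  by (induction m) auto

lemma mpow_comm: "a \<in> M \<Longrightarrow> a \<diamondop> mpow a n = mpow a n \<diamondop> a"
  using mpow_add[of a n 1] by simp

text \<open>By the pigeonhole principle the powers of \<open>a\<close> are eventually periodic. A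
  positive multiple of the period that lies beyond the preperiod is the exponent of an idempotent
  power.\<close>

lemma idempotent_power:
  assumes a: "a \<in> M"
  shows "\<exists>n. mpow a (Suc n) \<diamondop> mpow a (Suc n) = mpow a (Suc n)"
proof -
  have "\<not> inj_on (mpow a) {..card M}"
  proof
    assume "inj_on (mpow a) {..card M}"
    then have "card {..card M} \<le> card M"
      by (rule card_inj_on_le) (use a fin in auto)
    then show False by simp
  qed
  then obtain i j where "i \<noteq> j" "mpow a i = mpow a j" by (auto simp: inj_on_def)
  then obtain i p where ip: "mpow a i = mpow a (i + Suc p)"
    by (metis less_imp_Suc_add linorder_neqE_nat add_Suc_right)
  have shift: "mpow a (i + m) = mpow a (i + m + Suc p * q)" for m q
  proof (induction q)
    case (Suc q)
    have "mpow a (i + m + Suc p * Suc q) = mpow a ((i + Suc p) + (m + Suc p * q))" by (simp add: algebra_simps)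
    also have "\<dots> = mpow a (i + Suc p) \<diamondop> mpow a (m + Suc p * q)" by (rule mpow_add[OF a])
    also have "mpow a (i + Suc p) = mpow a i" by (rule ip[symmetric])
    also have "mpow a i \<diamondop> mpow a (m + Suc p * q) = mpow a (i + (m + Suc p * q))" by (rule mpow_add[OF a, symmetric])
    also have "\<dots> = mpow a (i + m)" using Suc by (simp add: add.assoc)
    finally show ?case by (rule sym)
  qed simp
  \<comment> \<open>The factor \<open>Suc i\<close> makes this multiple of the period
    \<open>Suc p\<close> larger than the preperiod \<open>i\<close>.\<close>
  obtain n where n: "Suc p * Suc i = Suc n" by simp
  have "i + (Suc n - i) = Suc n" using n[symmetric] by simp
  with shift[of "Suc n - i" "Suc i"] have "mpow a (Suc n) = mpow a (Suc n + Suc n)"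
    by (simp only: n)
  then have "mpow a (Suc n) = mpow a (Suc n) \<diamondop> mpow a (Suc n)" by (simp only: mpow_add[OF a])
  then show ?thesis by metis
qed

lemma mul_ext: "a \<diamondop> b = c \<Longrightarrow> a \<in> M \<Longrightarrow> b \<in> M \<Longrightarrow> r \<in> M \<Longrightarrow> a \<diamondop> (b \<diamondop> r) = c \<diamondop> r"
  by (metis assoc)

text \<open>\<open>stable a e b c\<close>: \<open>e\<close> is an idempotent power of \<open>a\<close>, and \<open>b = ae\<close> is invertible in the monoid
  \<open>eMe\<close> with inverse \<open>c\<close>.\<close>

definition stable :: "'a \<Rightarrow> 'a \<Rightarrow> 'a \<Rightarrow> 'a \<Rightarrow> bool" where
  "stable a e b c \<longleftrightarrow> e \<in> M \<and> b \<in> M \<and> c \<in> M \<and> e \<diamondop> e = e \<and> (\<exists>n. e = mpow a (Suc n))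
     \<and> b = a \<diamondop> e \<and> b = e \<diamondop> a \<and> e \<diamondop> b = b \<and> b \<diamondop> e = b \<and> e \<diamondop> c = c \<and> c \<diamondop> e = c \<and> b \<diamondop> c = e \<and> c \<diamondop> b = e"

lemma stable_ex:
  assumes a [simp]: "a \<in> M"
  shows "\<exists>e b c. stable a e b c"
proof -
  obtain n where n: "mpow a (Suc n) \<diamondop> mpow a (Suc n) = mpow a (Suc n)" using idempotent_power[OF a] by blast
  define e where "e = mpow a (Suc n)"
  define q where "q = mpow a n"
  have M [simp]: "e \<in> M" "q \<in> M" unfolding e_def q_def by (auto simp del: mpow.simps)
  have ee: "e \<diamondop> e = e" using n by (simp only: e_def)
  have ea: "e \<diamondop> a = a \<diamondop> e" unfolding e_def by (rule mpow_comm[symmetric]) simp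
  have eq: "e \<diamondop> q = q \<diamondop> e" unfolding e_def q_def by (simp only: mpow_add[OF a, symmetric] add.commute)
  have aq: "a \<diamondop> q = e" "q \<diamondop> a = e" unfolding e_def q_def using mpow_comm[OF a, of n] by simp_all
  note r = ee ea eq aq mul_ext[OF ee] mul_ext[OF ea] mul_ext[OF eq] mul_ext[OF aq(1)] mul_ext[OF aq(2)]
  have "stable a e (a \<diamondop> e) (q \<diamondop> e)"
  proof -
    have 1: "e \<diamondop> (a \<diamondop> e) = a \<diamondop> e" "(a \<diamondop> e) \<diamondop> e = a \<diamondop> e" "e \<diamondop> (q \<diamondop> e) = q \<diamondop> e" "(q \<diamondop> e) \<diamondop> e = q \<diamondop> e"
      by (simp_all add: r)
    have 2: "(a \<diamondop> e) \<diamondop> (q \<diamondop> e) = e" by (simp add: r)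
    have 3: "(q \<diamondop> e) \<diamondop> (a \<diamondop> e) = e" by (simp add: r)
    have 4: "\<exists>n. e = mpow a (Suc n)" by (rule exI[of _ n]) (rule e_def)
    have 5: "a \<diamondop> e \<in> M" "q \<diamondop> e \<in> M" by simp_all
    show ?thesis unfolding stable_def by (intro conjI M ee refl ea[symmetric] 1 2 3 4 5)
  qed
  then show ?thesis by blast
qed

text \<open>The three components are picked together, so that \<open>E a\<close>, \<open>A a\<close>
  and \<open>B a\<close> belong to the same instance of \<open>stable\<close>: an idempotent power,
  the stable part of \<open>a\<close>, and the inverse of the latter.\<close>

definition "core a = (SOME ebc. stable a (fst ebc) (fst (snd ebc)) (snd (snd ebc)))"
definition "E a = fst (core a)"
definition "A a = fst (snd (core a))"
definition "B a = snd (snd (core a))"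

lemma stable: "a \<in> M \<Longrightarrow> stable a (E a) (A a) (B a)"
proof -
  assume "a \<in> M"
  then obtain e b c where "stable a e b c" using stable_ex by blast
  then have "stable a (fst (e, b, c)) (fst (snd (e, b, c))) (snd (snd (e, b, c)))" by simp
  then show ?thesis unfolding E_def A_def B_def core_def by (rule someI)
qed

lemma core_simps [simp]:
  assumes "a \<in> M"
  shows "E a \<in> M" "A a \<in> M" "B a \<in> M" "E a \<diamondop> E a = E a" "a \<diamondop> E a = A a" "E a \<diamondop> a = A a" "E a \<diamondop> A a = A a"
    "A a \<diamondop> E a = A a" "E a \<diamondop> B a = B a" "B a \<diamondop> E a = B a" "A a \<diamondop> B a = E a" "B a \<diamondop> A a = E a"
  using stable[OF assms] unfolding stable_def by auto

lemma core_ext [simp]: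
  assumes "a \<in> M" "r \<in> M"
  shows "E a \<diamondop> (E a \<diamondop> r) = E a \<diamondop> r" "a \<diamondop> (E a \<diamondop> r) = A a \<diamondop> r" "E a \<diamondop> (a \<diamondop> r) = A a \<diamondop> r"
    "E a \<diamondop> (A a \<diamondop> r) = A a \<diamondop> r" "A a \<diamondop> (E a \<diamondop> r) = A a \<diamondop> r" "E a \<diamondop> (B a \<diamondop> r) = B a \<diamondop> r"
    "B a \<diamondop> (E a \<diamondop> r) = B a \<diamondop> r" "A a \<diamondop> (B a \<diamondop> r) = E a \<diamondop> r" "B a \<diamondop> (A a \<diamondop> r) = E a \<diamondop> r"
  using assms by (simp_all add: mul_ext)

text \<open>In the Karoubi envelope of the monoid, seen as a category with one object, these are the
  split monomorphisms from the object \<open>E a\<close> to the object \<open>one\<close>.\<close>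

definition embs :: "'a \<Rightarrow> 'a set" where
  "embs a = {i\<in>M. i \<diamondop> E a = i \<and> (\<exists>j\<in>M. j \<diamondop> i = E a)}"

text \<open>The embeddings along which \<open>b\<close> restricts to \<open>A a\<close>.
  Equivalently, they are the fixed points of left multiplication by \<open>b\<close> combined with
  right multiplication by the inverse \<open>B a\<close>.\<close>

definition fixes_emb :: "'a \<Rightarrow> 'a \<Rightarrow> 'a set" where
  "fixes_emb a b = {i\<in>embs a. b \<diamondop> i = i \<diamondop> A a}"

text \<open>The elements \<open>u\<close> and \<open>v\<close> are mutually inverse isomorphisms
  between the objects \<open>E a\<close> and \<open>E b\<close> of the Karoubi envelope, and they
  carry \<open>A a\<close> to \<open>A b\<close>. For a group this is ordinary conjugacy; in general
  only the stable parts are compared.\<close>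

definition conjg :: "'a \<Rightarrow> 'a \<Rightarrow> bool" where
  "conjg a b \<longleftrightarrow> (\<exists>u\<in>M. \<exists>v\<in>M. u \<diamondop> E a = u \<and> E b \<diamondop> u = u \<and> v \<diamondop> E b = v \<and> E a \<diamondop> v = v
     \<and> v \<diamondop> u = E a \<and> u \<diamondop> v = E b \<and> A b \<diamondop> u = u \<diamondop> A a)"

lemma conjg_refl: "a \<in> M \<Longrightarrow> conjg a a"
  unfolding conjg_def by (intro bexI[of _ "E a"]) auto

lemma conjg_sym:
  assumes "conjg a b" "a \<in> M" "b \<in> M"
  shows "conjg b a"
proof -
  obtain u v where uv: "u \<in> M" "v \<in> M" "u \<diamondop> E a = u" "E b \<diamondop> u = u" "v \<diamondop> E b = v" "E a \<diamondop> v = v"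
     "v \<diamondop> u = E a" "u \<diamondop> v = E b" "A b \<diamondop> u = u \<diamondop> A a" using assms(1) unfolding conjg_def by blast
  have "v \<diamondop> A b = v \<diamondop> (A b \<diamondop> (u \<diamondop> v))" using uv assms by simp
  also have "\<dots> = v \<diamondop> ((A b \<diamondop> u) \<diamondop> v)" using uv(1,2) assms by simp
  also have "\<dots> = (v \<diamondop> u) \<diamondop> (A a \<diamondop> v)" using uv(1,2,9) assms by simp
  also have "\<dots> = A a \<diamondop> v" using uv(1,2,7) assms by simp
  finally show ?thesis unfolding conjg_def using uv by (intro bexI[of _ v] bexI[of _ u]) auto
qed

lemma conjg_trans:
  assumes "conjg a b" "conjg b c" "a \<in> M" "b \<in> M" "c \<in> M"
  shows "conjg a c"
proof -
  obtain u v where uv: "u \<in> M" "v \<in> M" "u \<diamondop> E a = u" "E b \<diamondop> u = u" "v \<diamondop> E b = v" "E a \<diamondop> v = v"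
     "v \<diamondop> u = E a" "u \<diamondop> v = E b" "A b \<diamondop> u = u \<diamondop> A a" using assms(1) unfolding conjg_def by blast
  obtain u' v' where uv': "u' \<in> M" "v' \<in> M" "u' \<diamondop> E b = u'" "E c \<diamondop> u' = u'" "v' \<diamondop> E c = v'" "E b \<diamondop> v' = v'"
     "v' \<diamondop> u' = E b" "u' \<diamondop> v' = E c" "A c \<diamondop> u' = u' \<diamondop> A b" using assms(2) unfolding conjg_def by blast
  note e = mul_ext[OF uv(3)] mul_ext[OF uv(4)] mul_ext[OF uv(5)] mul_ext[OF uv(6)] mul_ext[OF uv(7)] mul_ext[OF uv(8)]
    mul_ext[OF uv(9)] mul_ext[OF uv'(3)] mul_ext[OF uv'(4)] mul_ext[OF uv'(5)] mul_ext[OF uv'(6)] mul_ext[OF uv'(7)]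
    mul_ext[OF uv'(8)] mul_ext[OF uv'(9)]
  show ?thesis unfolding conjg_def
    by (intro bexI[of _ "u' \<diamondop> u"] bexI[of _ "v \<diamondop> v'"] conjI) (use assms uv uv' e in simp_all)
qed

text \<open>Since \<open>i\<close> intertwines \<open>a\<close> with \<open>A c\<close>, it
  intertwines the power \<open>E a\<close> of \<open>a\<close> with the corresponding power
  \<open>p\<close> of \<open>A c\<close>. Cancelling \<open>i\<close> shows that \<open>p\<close> is
  idempotent, and an idempotent of a group is the identity, here \<open>E c\<close>. So
  \<open>i\<close> factors through the stable part of \<open>a\<close>.\<close>

lemma fixes_emb_stable:
  assumes i: "i \<in> fixes_emb c a" and c [simp]: "c \<in> M" and a [simp]: "a \<in> M"
  shows "E a \<diamondop> i = i" "A a \<diamondop> i = i \<diamondop> A c"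
proof -
  obtain j where iM [simp]: "i \<in> M" and ie: "i \<diamondop> E c = i" and jM [simp]: "j \<in> M" and ji: "j \<diamondop> i = E c"
    and ai: "a \<diamondop> i = i \<diamondop> A c"
    using i by (auto simp: fixes_emb_def embs_def)
  have pow: "mpow a n \<diamondop> i = i \<diamondop> mpow (A c) n" for n
  proof (induction n)
    case (Suc n)
    have "mpow a (Suc n) \<diamondop> i = a \<diamondop> (i \<diamondop> mpow (A c) n)" using Suc by simp
    also have "\<dots> = (a \<diamondop> i) \<diamondop> mpow (A c) n" by simp
    also have "\<dots> = i \<diamondop> (A c \<diamondop> mpow (A c) n)" by (simp add: ai)
    finally show ?case by simp
  qed simp
  have ep: "E c \<diamondop> (mpow (A c) n \<diamondop> E c) = mpow (A c) n \<diamondop> E c" for n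
    by (induction n) auto
  have inv: "mpow (B c) n \<diamondop> (mpow (A c) n \<diamondop> E c) = E c" for n
  proof (induction n)
    case (Suc n)
    have "mpow (B c) (Suc n) = mpow (B c) n \<diamondop> B c" using mpow_comm[of "B c" n] by simp
    then have "mpow (B c) (Suc n) \<diamondop> (mpow (A c) (Suc n) \<diamondop> E c) = mpow (B c) n \<diamondop> (E c \<diamondop> (mpow (A c) n \<diamondop> E c))"
      by simp
    then show ?case using Suc ep by simp
  qed simp
  obtain n where n: "E a = mpow a (Suc n)" using stable[OF a] unfolding stable_def by blast
  define p where "p = mpow (A c) (Suc n)"
  define r where "r = mpow (B c) (Suc n)"
  have M [simp]: "p \<in> M" "r \<in> M" unfolding p_def r_def by (auto simp del: mpow.simps)
  have p: "E a \<diamondop> i = i \<diamondop> p" unfolding n p_def by (rule pow)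
  have pe: "p \<diamondop> E c = p" unfolding p_def using mpow_comm[of "A c" n] by simp
  have ep: "E c \<diamondop> p = p" unfolding p_def by simp
  have rp: "r \<diamondop> p = E c" using inv[of "Suc n"] pe unfolding p_def r_def by simp
  have "i \<diamondop> p = E a \<diamondop> i" by (simp only: p)
  also have "\<dots> = E a \<diamondop> (E a \<diamondop> i)" by simp
  also have "\<dots> = E a \<diamondop> (i \<diamondop> p)" by (simp only: p)
  also have "\<dots> = (E a \<diamondop> i) \<diamondop> p" by simp
  also have "\<dots> = i \<diamondop> (p \<diamondop> p)" unfolding p by simp
  finally have "j \<diamondop> (i \<diamondop> p) = j \<diamondop> (i \<diamondop> (p \<diamondop> p))" by (rule arg_cong)
  then have pp: "p \<diamondop> p = p" by (simp add: mul_ext[OF ji] ep mul_ext[OF ep])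
  have "p = E c \<diamondop> p" by (simp add: ep)
  also have "\<dots> = (r \<diamondop> p) \<diamondop> p" by (simp only: rp)
  also have "\<dots> = r \<diamondop> (p \<diamondop> p)" by simp
  also have "\<dots> = E c" by (simp only: pp rp)
  finally show e: "E a \<diamondop> i = i" using p ie by simp
  have "A a \<diamondop> i = a \<diamondop> (E a \<diamondop> i)" by simp
  then show "A a \<diamondop> i = i \<diamondop> A c" by (simp only: e ai)
qed

lemma E_fixes: "a \<in> M \<Longrightarrow> E a \<in> fixes_emb a a"
  unfolding fixes_emb_def embs_def by (intro CollectI conjI bexI[of _ "E a"]) simp_all

text \<open>The embedding \<open>E a\<close> is itself a fixed point. These positive numbers are the
  diagonal entries of the triangular system solved in \<open>nilpotent_trace_zero\<close>.\<close>

lemma card_fixes_self: "a \<in> M \<Longrightarrow> card (fixes_emb a a) > 0"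
proof -
  assume "a \<in> M"
  moreover have "finite (fixes_emb a a)" using fin by (simp add: fixes_emb_def embs_def)
  ultimately show ?thesis using E_fixes[of a] by (auto simp: card_gt_0_iff)
qed

text \<open>Left multiplication by the isomorphism \<open>u\<close> transports the embeddings. It is
  injective because they lie in the image of \<open>E a\<close> by \<open>fixes_emb_stable\<close>,
  where \<open>v\<close> inverts it.\<close>

lemma card_fixes_le:
  assumes "conjg a b" and [simp]: "a \<in> M" "b \<in> M" "c \<in> M"
  shows "card (fixes_emb c a) \<le> card (fixes_emb c b)"
proof -
  obtain u v where uv: "u \<in> M" "v \<in> M" "u \<diamondop> E a = u" "E b \<diamondop> u = u" "v \<diamondop> E b = v" "E a \<diamondop> v = v"
     "v \<diamondop> u = E a" "u \<diamondop> v = E b" "A b \<diamondop> u = u \<diamondop> A a" using assms(1) unfolding conjg_def by blast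
  note [simp] = uv(1,2)
  show ?thesis
  proof (rule card_inj_on_le[where f = "\<lambda>i. u \<diamondop> i"])
    show "finite (fixes_emb c b)" using fin by (simp add: fixes_emb_def embs_def)
    show "inj_on (\<lambda>i. u \<diamondop> i) (fixes_emb c a)"
    proof (rule inj_on_inverseI[where g = "\<lambda>i. v \<diamondop> i"])
      fix i assume i: "i \<in> fixes_emb c a"
      then have "i \<in> M" by (simp add: fixes_emb_def embs_def)
      then show "v \<diamondop> (u \<diamondop> i) = i" using fixes_emb_stable[OF i] mul_ext[OF uv(7)] by simp
    qed
    show "(\<lambda>i. u \<diamondop> i) ` fixes_emb c a \<subseteq> fixes_emb c b"
    proof clarify
      fix i assume i: "i \<in> fixes_emb c a"
      then obtain j where [simp]: "i \<in> M" "i \<diamondop> E c = i" "j \<in> M" and ji: "j \<diamondop> i = E c" and ai: "a \<diamondop> i = i \<diamondop> A c"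
        by (auto simp: fixes_emb_def embs_def)
      have "(j \<diamondop> v) \<diamondop> (u \<diamondop> i) = E c"
        using mul_ext[OF uv(7)] fixes_emb_stable[OF i] ji by simp
      moreover have "b \<diamondop> (u \<diamondop> i) = (u \<diamondop> i) \<diamondop> A c"
      proof -
        have "b \<diamondop> (u \<diamondop> i) = b \<diamondop> ((E b \<diamondop> u) \<diamondop> i)" by (simp only: uv(4))
        also have "\<dots> = (A b \<diamondop> u) \<diamondop> i" by simp
        also have "\<dots> = u \<diamondop> (A a \<diamondop> i)" unfolding uv(9) by simp
        also have "\<dots> = (u \<diamondop> i) \<diamondop> A c" using fixes_emb_stable[OF i] by simp
        finally show ?thesis .
      qed
      ultimately show "u \<diamondop> i \<in> fixes_emb c b" unfolding fixes_emb_def embs_def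
        by (intro CollectI conjI bexI[of _ "j \<diamondop> v"]) auto
    qed
  qed
qed

lemma card_fixes_eq: "conjg a b \<Longrightarrow> a \<in> M \<Longrightarrow> b \<in> M \<Longrightarrow> c \<in> M \<Longrightarrow> card (fixes_emb c a) = card (fixes_emb c b)"
  by (intro order.antisym card_fixes_le) (auto intro: conjg_sym)

text \<open>The size of the right ideal generated by \<open>E a\<close>, a numerical substitute for
  the rank of an idempotent.\<close>

definition rank :: "'a \<Rightarrow> nat" where
  "rank a = card {m\<in>M. E a \<diamondop> m = m}"

text \<open>Left multiplication by \<open>i\<close> embeds the right ideal of \<open>E c\<close>
  into that of \<open>E a\<close>. If both have the same size, \<open>E a\<close> is of the form
  \<open>i \<diamondop> m\<close>, so that \<open>i\<close> is invertible and conjugates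
  \<open>c\<close> to \<open>a\<close>. The numbers of fixed embeddings therefore form a matrix that
  is triangular with respect to the rank.\<close>

lemma fixes_emb_rank:
  assumes i: "i \<in> fixes_emb c a" and [simp]: "c \<in> M" "a \<in> M"
  shows "conjg c a \<or> rank c < rank a"
proof -
  obtain j where [simp]: "i \<in> M" "j \<in> M" and ie: "i \<diamondop> E c = i" and ji: "j \<diamondop> i = E c"
    using i by (auto simp: fixes_emb_def embs_def)
  note st = fixes_emb_stable[OF i assms(2,3)]
  let ?S = "\<lambda>a. {m\<in>M. E a \<diamondop> m = m}"
  have inj: "inj_on (\<lambda>m. i \<diamondop> m) (?S c)"
    by (rule inj_on_inverseI[where g = "\<lambda>m. j \<diamondop> m"]) (auto simp: mul_ext[OF ji])
  have sub: "(\<lambda>m. i \<diamondop> m) ` ?S c \<subseteq> ?S a"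
    using mul_ext[OF st(1)] by auto
  have fS: "finite (?S a)" using fin by simp
  have le: "rank c \<le> rank a" unfolding rank_def by (rule card_inj_on_le[OF inj sub fS])
  show ?thesis
  proof (cases "rank c = rank a")
    case True
    then have "card ((\<lambda>m. i \<diamondop> m) ` ?S c) = card (?S a)"
      unfolding rank_def by (simp add: card_image[OF inj])
    then have "(\<lambda>m. i \<diamondop> m) ` ?S c = ?S a" by (rule card_subset_eq[OF fS sub])
    moreover have "E a \<in> ?S a" by simp
    ultimately have "E a \<in> (\<lambda>m. i \<diamondop> m) ` ?S c" by (simp only:)
    then obtain m where [simp]: "m \<in> M" and m: "E c \<diamondop> m = m" and im: "i \<diamondop> m = E a" by auto
    have mi: "m \<diamondop> i = E c"
    proof -
      have "m \<diamondop> i = (E c \<diamondop> m) \<diamondop> i" by (simp only: m)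
      also have "\<dots> = ((j \<diamondop> i) \<diamondop> m) \<diamondop> i" by (simp only: ji)
      also have "\<dots> = j \<diamondop> ((i \<diamondop> m) \<diamondop> i)" by simp
      also have "\<dots> = E c" by (simp only: im st(1) ji)
      finally show ?thesis .
    qed
    have "conjg c a" unfolding conjg_def
      by (intro bexI[of _ i] bexI[of _ "m \<diamondop> E a"] conjI)
        (use ie st mi in \<open>simp_all add: mul_ext[OF m] mul_ext[OF im]\<close>)
    then show ?thesis ..
  qed (use le in simp)
qed

text \<open>Stability reduces the claim to the stable parts. There \<open>A a\<close> equals
  \<open>A a \<diamondop> (v \<diamondop> u)\<close>, and rotating \<open>u\<close> to the front
  turns this into \<open>A b\<close>.\<close>

lemma conjg_trace:
  assumes "conjg a b" and [simp]: "a \<in> M" "b \<in> M"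
    and tr: "\<And>x y. x \<in> M \<Longrightarrow> y \<in> M \<Longrightarrow> f (x \<diamondop> y) = f (y \<diamondop> x)"
    and st: "\<And>x. x \<in> M \<Longrightarrow> f x = f (A x)"
  shows "f a = f b"
proof -
  obtain u v where uv: "u \<in> M" "v \<in> M" "u \<diamondop> E a = u" "E b \<diamondop> u = u" "v \<diamondop> E b = v" "E a \<diamondop> v = v"
     "v \<diamondop> u = E a" "u \<diamondop> v = E b" "A b \<diamondop> u = u \<diamondop> A a" using assms(1) unfolding conjg_def by blast
  note [simp] = uv(1,2)
  have "f a = f (A a)" by (rule st) simp
  also have "A a = A a \<diamondop> (v \<diamondop> u)" by (simp add: uv(7))
  also have "\<dots> = (A a \<diamondop> v) \<diamondop> u" by simp
  also have "f \<dots> = f (u \<diamondop> (A a \<diamondop> v))" by (rule tr) auto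
  also have "u \<diamondop> (A a \<diamondop> v) = (u \<diamondop> A a) \<diamondop> v" by simp
  also have "\<dots> = A b \<diamondop> (u \<diamondop> v)" unfolding uv(9)[symmetric] by simp
  also have "\<dots> = A b" by (simp add: uv(8))
  also have "f (A b) = f b" by (rule st[symmetric]) simp
  finally show ?thesis .
qed

section \<open>Class sums of a nilpotent element\<close>

context
  fixes z :: "'a \<Rightarrow> 'k::field_char_0" and Z :: "nat \<Rightarrow> 'a \<Rightarrow> 'k"
  assumes Z0: "\<And>F. (\<Sum>x\<in>M. Z 0 x * F x) = F one"
    and ZS: "\<And>n F. (\<Sum>x\<in>M. Z (Suc n) x * F x) = (\<Sum>x\<in>M. \<Sum>y\<in>M. z x * Z n y * F (x \<diamondop> y))"
    and Znil: "\<exists>n. \<forall>x\<in>M. Z n x = 0"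
begin

text \<open>The function \<open>z\<close> is an element of the monoid algebra and \<open>Z n\<close>
  holds the coefficients of its powers, described by pairing with functions \<open>F\<close>. On the
  span of the embeddings of \<open>c\<close>, \<open>z\<close> acts by left multiplication, with
  products that are no longer embeddings set to zero. The matrix \<open>N\<close> is this action
  combined with the inverse of \<open>A c\<close> on the right. Its powers are computed from
  \<open>Z n\<close>, so it is nilpotent, and its trace is the sum in question.\<close>

lemma nilpotent_fixes:
  assumes c [simp]: "c \<in> M"
  shows "(\<Sum>x\<in>M. z x * of_nat (card (fixes_emb c x))) = 0"
proof -
  let ?I = "embs c"
  have fI: "finite ?I" using fin by (simp add: embs_def)
  have IM: "i \<in> M" if "i \<in> ?I" for i using that by (simp add: embs_def)
  have Ie: "i \<diamondop> E c = i" if "i \<in> ?I" for i using that by (simp add: embs_def)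
  define N where "N l i = (\<Sum>x\<in>M. z x * of_bool (x \<diamondop> i = l \<diamondop> A c))" for l i
  \<comment> \<open>The product of two matrix entries: at most one intermediate embedding
    \<open>j\<close> contributes, the one obtained by solving the second equation with the inverse
    \<open>B c\<close>.\<close>
  have key: "(\<Sum>j\<in>?I. of_bool (x \<diamondop> j = l \<diamondop> A c) * of_bool (y \<diamondop> i = j \<diamondop> mpow (A c) n))
      = (of_bool ((x \<diamondop> y) \<diamondop> i = l \<diamondop> mpow (A c) (Suc n)) :: 'k)"
    if lI: "l \<in> ?I" and iI: "i \<in> ?I" and [simp]: "x \<in> M" "y \<in> M" for l i x y n
  proof -
    note [simp] = IM[OF lI] IM[OF iI]
    obtain k where [simp]: "k \<in> M" and kl: "k \<diamondop> l = E c" using lI unfolding embs_def by blast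
    let ?j = "y \<diamondop> (i \<diamondop> mpow (B c) n)"
    have ec: "E c \<diamondop> (mpow (A c) n \<diamondop> E c) = mpow (A c) n \<diamondop> E c" "E c \<diamondop> (mpow (B c) n \<diamondop> E c) = mpow (B c) n \<diamondop> E c" for n
      by (induction n) auto
    have AB: "mpow (A c) n \<diamondop> (mpow (B c) n \<diamondop> E c) = E c" for n
    proof (induction n)
      case (Suc n)
      have "mpow (A c) (Suc n) = mpow (A c) n \<diamondop> A c" using mpow_comm[of "A c" n] by simp
      then show ?case using Suc ec by simp
    qed simp
    have BA: "mpow (B c) n \<diamondop> (mpow (A c) n \<diamondop> E c) = E c" for n
    proof (induction n)
      case (Suc n)
      have "mpow (B c) (Suc n) = mpow (B c) n \<diamondop> B c" using mpow_comm[of "B c" n] by simp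
      then show ?case using Suc ec by simp
    qed simp
    have comm: "E c \<diamondop> mpow (A c) n = mpow (A c) n \<diamondop> E c" "E c \<diamondop> mpow (B c) n = mpow (B c) n \<diamondop> E c" for n
    proof -
      show "E c \<diamondop> mpow (A c) n = mpow (A c) n \<diamondop> E c"
      proof (induction n)
        case (Suc n)
        then show ?case using core_ext(5)[of c "mpow (A c) n"] by simp
      qed simp
      show "E c \<diamondop> mpow (B c) n = mpow (B c) n \<diamondop> E c"
      proof (induction n)
        case (Suc n)
        then show ?case using core_ext(7)[of c "mpow (B c) n"] by simp
      qed simp
    qed
    have uniq: "j = ?j" if "j \<in> ?I" "y \<diamondop> i = j \<diamondop> mpow (A c) n" for j
    proof -
      note [simp] = IM[OF that(1)]
      have "?j = (y \<diamondop> i) \<diamondop> mpow (B c) n" by simp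
      also have "\<dots> = (y \<diamondop> (i \<diamondop> E c)) \<diamondop> mpow (B c) n" using Ie[OF \<open>i \<in> ?I\<close>] by simp
      also have "\<dots> = (y \<diamondop> i) \<diamondop> (E c \<diamondop> mpow (B c) n)" by simp
      also have "\<dots> = j \<diamondop> (mpow (A c) n \<diamondop> (mpow (B c) n \<diamondop> E c))" unfolding that(2) comm by simp
      also have "\<dots> = j" using AB Ie[OF that(1)] by simp
      finally show ?thesis by simp
    qed
    show ?thesis
    proof (cases "(x \<diamondop> y) \<diamondop> i = l \<diamondop> mpow (A c) (Suc n)")
      case True
      have yi: "y \<diamondop> i = ?j \<diamondop> mpow (A c) n"
      proof -
        have "?j \<diamondop> mpow (A c) n = y \<diamondop> ((i \<diamondop> E c) \<diamondop> (mpow (B c) n \<diamondop> mpow (A c) n))" using Ie[OF \<open>i \<in> ?I\<close>] by simp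
        also have "\<dots> = y \<diamondop> (i \<diamondop> ((E c \<diamondop> mpow (B c) n) \<diamondop> mpow (A c) n))" by simp
        also have "\<dots> = y \<diamondop> (i \<diamondop> (mpow (B c) n \<diamondop> (E c \<diamondop> mpow (A c) n)))" by (subst comm(2)) simp
        also have "\<dots> = y \<diamondop> (i \<diamondop> (mpow (B c) n \<diamondop> (mpow (A c) n \<diamondop> E c)))" by (simp only: comm)
        also have "\<dots> = y \<diamondop> i" using BA Ie[OF \<open>i \<in> ?I\<close>] by simp
        finally show ?thesis by simp
      qed
      have xj: "x \<diamondop> ?j = l \<diamondop> A c"
      proof -
        have "x \<diamondop> ?j = ((x \<diamondop> y) \<diamondop> i) \<diamondop> mpow (B c) n" by simp
        also have "\<dots> = l \<diamondop> (A c \<diamondop> ((E c \<diamondop> mpow (A c) n) \<diamondop> mpow (B c) n))" unfolding True by simp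
        also have "\<dots> = l \<diamondop> (A c \<diamondop> (mpow (A c) n \<diamondop> (E c \<diamondop> mpow (B c) n)))" by (subst comm(1)) simp
        also have "\<dots> = l \<diamondop> (A c \<diamondop> (mpow (A c) n \<diamondop> (mpow (B c) n \<diamondop> E c)))" by (simp only: comm)
        also have "\<dots> = l \<diamondop> A c" using AB by simp
        finally show ?thesis .
      qed
      have "?j \<diamondop> E c = y \<diamondop> (i \<diamondop> (E c \<diamondop> mpow (B c) n))" by (simp only: comm) simp
      also have "\<dots> = y \<diamondop> ((i \<diamondop> E c) \<diamondop> mpow (B c) n)" by simp
      also have "\<dots> = ?j" using Ie[OF \<open>i \<in> ?I\<close>] by simp
      finally have je: "?j \<diamondop> E c = ?j" .
      \<comment> \<open>The left inverse \<open>k\<close> of \<open>l\<close> yields a left inverse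
        of \<open>?j\<close>. Hence the intermediate element is an embedding, and nothing is lost by
        setting other products to zero.\<close>
      have "(B c \<diamondop> (k \<diamondop> x)) \<diamondop> ?j = B c \<diamondop> (k \<diamondop> (x \<diamondop> ?j))" by simp
      also have "\<dots> = B c \<diamondop> ((k \<diamondop> l) \<diamondop> A c)" unfolding xj by simp
      also have "\<dots> = E c" by (simp add: kl)
      finally have kj: "(B c \<diamondop> (k \<diamondop> x)) \<diamondop> ?j = E c" .
      have "?j \<in> M" "B c \<diamondop> (k \<diamondop> x) \<in> M" by simp_all
      then have jI: "?j \<in> ?I" unfolding embs_def using je kj by blast
      have "(\<Sum>j\<in>?I. of_bool (x \<diamondop> j = l \<diamondop> A c) * of_bool (y \<diamondop> i = j \<diamondop> mpow (A c) n)) = (\<Sum>j\<in>?I. if j = ?j then 1 else 0 :: 'k)"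
      proof (intro sum.cong refl)
        fix j assume j: "j \<in> ?I"
        show "of_bool (x \<diamondop> j = l \<diamondop> A c) * of_bool (y \<diamondop> i = j \<diamondop> mpow (A c) n) = (if j = ?j then 1 else 0 :: 'k)"
        proof (cases "j = ?j")
          case True
          have "(x \<diamondop> ?j = l \<diamondop> A c) = True" "(y \<diamondop> i = ?j \<diamondop> mpow (A c) n) = True"
            using xj yi by blast+
          then show ?thesis by (simp only: True) simp
        next
          case False
          then have "\<not> (y \<diamondop> i = j \<diamondop> mpow (A c) n)" using uniq[OF j] by blast
          then show ?thesis using False by simp
        qed
      qed
      then show ?thesis using True jI fI by simp
    next
      case False
      have "of_bool (x \<diamondop> j = l \<diamondop> A c) * of_bool (y \<diamondop> i = j \<diamondop> mpow (A c) n) = (0::'k)" if j: "j \<in> ?I" for j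
      proof (rule ccontr)
        assume "of_bool (x \<diamondop> j = l \<diamondop> A c) * of_bool (y \<diamondop> i = j \<diamondop> mpow (A c) n) \<noteq> (0::'k)"
        then have 1: "x \<diamondop> j = l \<diamondop> A c" and 2: "y \<diamondop> i = j \<diamondop> mpow (A c) n" by (auto split: if_splits)
        note [simp] = IM[OF j]
        have "(x \<diamondop> y) \<diamondop> i = (x \<diamondop> j) \<diamondop> mpow (A c) n" using 2 by simp
        also have "\<dots> = l \<diamondop> mpow (A c) (Suc n)" unfolding 1 by simp
        finally show False using False by simp
      qed
      then have "(\<Sum>j\<in>?I. of_bool (x \<diamondop> j = l \<diamondop> A c) * of_bool (y \<diamondop> i = j \<diamondop> mpow (A c) n)) = (0::'k)"
        by (intro sum.neutral) blast
      with False show ?thesis by simp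
    qed
  qed
  have pow: "mat_pow ?I N n l i = (\<Sum>x\<in>M. Z n x * of_bool (x \<diamondop> i = l \<diamondop> mpow (A c) n))" if "l \<in> ?I" "i \<in> ?I" for n l i
    using that
  proof (induction n arbitrary: l)
    case 0
    then show ?case using Z0[of "\<lambda>x. of_bool (x \<diamondop> i = l)"] IM by auto
  next
    case (Suc n)
    have "mat_pow ?I N (Suc n) l i = (\<Sum>j\<in>?I. N l j * (\<Sum>y\<in>M. Z n y * of_bool (y \<diamondop> i = j \<diamondop> mpow (A c) n)))"
      using Suc by simp
    also have "\<dots> = (\<Sum>j\<in>?I. \<Sum>x\<in>M. \<Sum>y\<in>M. z x * Z n y * (of_bool (x \<diamondop> j = l \<diamondop> A c) * of_bool (y \<diamondop> i = j \<diamondop> mpow (A c) n)))"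
      unfolding N_def sum_product by (intro sum.cong refl) (simp only: mult_ac)
    also have "\<dots> = (\<Sum>x\<in>M. \<Sum>y\<in>M. \<Sum>j\<in>?I. z x * Z n y * (of_bool (x \<diamondop> j = l \<diamondop> A c) * of_bool (y \<diamondop> i = j \<diamondop> mpow (A c) n)))"
      by (subst sum.swap, rule sum.cong[OF refl], subst sum.swap, rule refl)
    also have "\<dots> = (\<Sum>x\<in>M. \<Sum>y\<in>M. z x * Z n y * of_bool ((x \<diamondop> y) \<diamondop> i = l \<diamondop> mpow (A c) (Suc n)))"
      by (intro sum.cong refl) (simp only: sum_distrib_left[symmetric] key[OF Suc.prems])
    also have "\<dots> = (\<Sum>x\<in>M. Z (Suc n) x * of_bool (x \<diamondop> i = l \<diamondop> mpow (A c) (Suc n)))"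
      by (rule ZS[symmetric])
    finally show ?case .
  qed
  obtain n where n: "\<forall>x\<in>M. Z n x = 0" using Znil by blast
  have "(\<Sum>i\<in>?I. N i i) = 0"
    by (rule nilpotent_trace[OF fI, of N n]) (simp add: pow n)
  moreover have "(\<Sum>i\<in>?I. N i i) = (\<Sum>x\<in>M. z x * (\<Sum>i\<in>?I. of_bool (x \<diamondop> i = i \<diamondop> A c)))"
    unfolding N_def by (subst sum.swap) (simp add: sum_distrib_left)
  moreover have "(\<Sum>i\<in>?I. of_bool (x \<diamondop> i = i \<diamondop> A c)) = (of_nat (card (fixes_emb c x)) :: 'k)" for x
    using fI by (simp add: fixes_emb_def of_bool_def sum.If_cases Int_def)
  ultimately show ?thesis by simp
qed

text \<open>A function constant on conjugacy classes is summed class by class. Any union of classes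
  is allowed for \<open>S\<close>, because the induction below applies the lemma to the elements of
  larger rank.\<close>

lemma sum_classes:
  assumes S: "S \<subseteq> M" and closed: "\<And>x y. x \<in> S \<Longrightarrow> y \<in> M \<Longrightarrow> conjg x y \<Longrightarrow> y \<in> S"
    and g: "\<And>x y. x \<in> S \<Longrightarrow> y \<in> M \<Longrightarrow> conjg x y \<Longrightarrow> g y = g x"
    and zero: "\<And>x. x \<in> S \<Longrightarrow> (\<Sum>y | y \<in> M \<and> conjg x y. z y) = 0"
  shows "(\<Sum>x\<in>S. z x * g x) = 0"
proof -
  have fS: "finite S" using S fin finite_subset by blast
  let ?k = "\<lambda>x. {y\<in>M. conjg x y}"
  have "(\<Sum>x\<in>S. z x * g x) = (\<Sum>Y\<in>?k ` S. \<Sum>x | x \<in> S \<and> ?k x = Y. z x * g x)"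
    by (rule sum.group[symmetric]) (use fS in auto)
  also have "\<dots> = (\<Sum>Y\<in>?k ` S. 0)"
  proof (rule sum.cong[OF refl])
    fix Y assume "Y \<in> ?k ` S"
    then obtain x0 where x0: "x0 \<in> S" "Y = ?k x0" by blast
    have x0M: "x0 \<in> M" using x0 S by blast
    have "{x \<in> S. ?k x = Y} = ?k x0"
    proof (intro equalityI subsetI)
      fix x assume "x \<in> {x \<in> S. ?k x = Y}"
      then have "x \<in> S" "?k x = ?k x0" using x0(2) by auto
      then have "x \<in> ?k x0" using S conjg_refl[of x] by blast
      then show "x \<in> ?k x0" .
    next
      fix x assume x: "x \<in> ?k x0"
      then have "x \<in> S" using closed x0 by blast
      moreover have "?k x = ?k x0"
        using x x0M conjg_trans conjg_sym by blast
      ultimately show "x \<in> {x \<in> S. ?k x = Y}" using x0 by simp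
    qed
    then have "(\<Sum>x | x \<in> S \<and> ?k x = Y. z x * g x) = (\<Sum>x\<in>?k x0. z x * g x0)"
      using g[OF x0(1)] by (intro sum.cong) auto
    also have "\<dots> = 0" using zero[OF x0(1)] by (simp flip: sum_distrib_right)
    finally show "(\<Sum>x | x \<in> S \<and> ?k x = Y. z x * g x) = 0" .
  qed
  finally show ?thesis by simp
qed

text \<open>Conjugate elements have fixed embeddings in both directions, and each of them gives an
  inequality between the sizes of the two right ideals.\<close>

lemma conjg_rank:
  assumes "conjg a b" "a \<in> M" "b \<in> M"
  shows "rank a = rank b"
proof (rule ccontr)
  assume ne: "rank a \<noteq> rank b"
  have *: "rank a \<le> rank b" if "conjg a b" "a \<in> M" "b \<in> M" for a b
  proof -
    have "card (fixes_emb a b) > 0" using card_fixes_self[of a] card_fixes_eq[of a b a] that by simp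
    then obtain i where i: "i \<in> fixes_emb a b" by (auto simp: card_gt_0_iff)
    then obtain j where [simp]: "i \<in> M" "j \<in> M" and ji: "j \<diamondop> i = E a" by (auto simp: fixes_emb_def embs_def)
    note st = fixes_emb_stable[OF i that(2,3)]
    show ?thesis unfolding rank_def
    proof (rule card_inj_on_le[where f = "\<lambda>m. i \<diamondop> m"])
      show "inj_on (\<lambda>m. i \<diamondop> m) {m \<in> M. E a \<diamondop> m = m}"
        by (rule inj_on_inverseI[where g = "\<lambda>m. j \<diamondop> m"]) (auto simp: mul_ext[OF ji])
      show "(\<lambda>m. i \<diamondop> m) ` {m \<in> M. E a \<diamondop> m = m} \<subseteq> {m \<in> M. E b \<diamondop> m = m}"
        using mul_ext[OF st(1)] that by auto
    qed (use fin in simp)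
  qed
  show False using *[OF assms] *[OF conjg_sym[OF assms]] assms ne by simp
qed

text \<open>It suffices that the coefficients of \<open>z\<close> sum to zero on each conjugacy
  class. This is shown by downward induction on the rank: in the relation of
  \<open>nilpotent_fixes\<close> for \<open>x\<close>, only the class of \<open>x\<close> and
  elements of larger rank contribute, and the latter cancel by the induction hypothesis. The
  remaining factor is a positive integer, invertible in characteristic 0.\<close>

theorem nilpotent_trace_zero:
  assumes tr: "\<And>x y. x \<in> M \<Longrightarrow> y \<in> M \<Longrightarrow> f (x \<diamondop> y) = f (y \<diamondop> x)"
    and st: "\<And>x. x \<in> M \<Longrightarrow> f x = f (A x)"
  shows "(\<Sum>x\<in>M. z x * f x) = 0"
proof (rule sum_classes)
  fix x assume "x \<in> M"
  then show "(\<Sum>y | y \<in> M \<and> conjg x y. z y) = 0"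
  proof (induction "card M - rank x" arbitrary: x rule: less_induct)
    case less
    note x [simp] = less.prems
    let ?c = "\<lambda>y. of_nat (card (fixes_emb x y)) :: 'k"
    let ?K = "{y\<in>M. conjg x y}"
    let ?S = "{y\<in>M. rank x < rank y}"
    have rk: "rank y \<le> card M" for y unfolding rank_def by (rule card_mono) (use fin in auto)
    have "(\<Sum>y\<in>?S. z y * ?c y) = 0"
    proof (rule sum_classes)
      fix y assume y: "y \<in> ?S"
      then show "(\<Sum>v | v \<in> M \<and> conjg y v. z v) = 0"
        using less.hyps[of y] rk[of y] by auto
    next
      fix y v assume "y \<in> ?S" "v \<in> M" "conjg y v"
      then show "v \<in> ?S" "?c v = ?c y" using conjg_rank[of y v] card_fixes_eq[of y v x] by auto
    qed auto
    moreover have "(\<Sum>y\<in>?K. z y * ?c y) = ?c x * (\<Sum>y\<in>?K. z y)"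
    proof -
      have "?c y = ?c x" if "y \<in> ?K" for y using card_fixes_eq[of x y x] that by simp
      then show ?thesis by (simp add: sum_distrib_left mult.commute)
    qed
    moreover have "(\<Sum>y\<in>M. z y * ?c y) = (\<Sum>y\<in>?K. z y * ?c y) + (\<Sum>y\<in>?S. z y * ?c y)"
    proof -
      have "(\<Sum>y\<in>M. z y * ?c y) = (\<Sum>y\<in>?K \<union> ?S. z y * ?c y)"
      proof (rule sum.mono_neutral_right)
        show "\<forall>y\<in>M - (?K \<union> ?S). z y * ?c y = 0"
        proof
          fix y assume y: "y \<in> M - (?K \<union> ?S)"
          have "fixes_emb x y = {}" using fixes_emb_rank[of _ x y] y by auto
          then show "z y * ?c y = 0" by simp
        qed
      qed (use fin in auto)
      also have "\<dots> = (\<Sum>y\<in>?K. z y * ?c y) + (\<Sum>y\<in>?S. z y * ?c y)"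
        by (rule sum.union_disjoint) (use fin conjg_rank[of x] in auto)
      finally show ?thesis .
    qed
    ultimately have "?c x * (\<Sum>y\<in>?K. z y) = 0" using nilpotent_fixes[OF x] by simp
    moreover have "?c x \<noteq> 0" using card_fixes_self[OF x] by simp
    ultimately show ?case by simp
  qed
next
  fix x y assume xy: "x \<in> M" "y \<in> M" "conjg x y"
  have "f x = f y" by (rule conjg_trace[OF xy(3,1,2) tr st])
  then show "f y = f x" by simp
qed auto

end

end

section \<open>Linearization\<close>

abbreviation "pm_single \<equiv> Poly_Mapping.single"
abbreviation "pm_keys \<equiv> Poly_Mapping.keys"
abbreviation "pm_lookup \<equiv> Poly_Mapping.lookup"

lemma lookup_scale: "pm_lookup (Poly_Mapping.map ((*) c) v) x = c * pm_lookup (v :: 'm \<Rightarrow>\<^sub>0 'k::field) x"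
  by (simp add: map.rep_eq when_def)

lemma keys_scale: "pm_keys (Poly_Mapping.map ((*) c) (v :: 'm \<Rightarrow>\<^sub>0 'k::field)) \<subseteq> pm_keys v"
  by (auto simp: lookup_scale simp flip: lookup_not_eq_zero_eq_in_keys)

lemma poly_mapping_sum_single: "v = (\<Sum>x\<in>pm_keys v. pm_single x (pm_lookup v x))"
proof (rule poly_mapping_eqI)
  fix x
  have "pm_lookup (\<Sum>x\<in>pm_keys v. pm_single x (pm_lookup v x)) x = (\<Sum>y\<in>pm_keys v. if y = x then pm_lookup v y else 0)"
    by (simp add: lookup_sum lookup_single when_def)
  then show "pm_lookup v x = pm_lookup (\<Sum>x\<in>pm_keys v. pm_single x (pm_lookup v x)) x"
    by (simp add: in_keys_iff)
qed

text \<open>Enlarging the index sets adds only zero terms; over a common index set the additivity of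
  \<open>bilin_ext\<close> can be read off.\<close>

lemma bilin_ext_superset:
  assumes "finite S" "pm_keys v \<subseteq> S" "finite T" "pm_keys w \<subseteq> T"
  shows "bilin_ext op v w = (\<Sum>x\<in>S. \<Sum>y\<in>T. pm_single (op x y) (pm_lookup v x * pm_lookup w y))"
proof -
  have "bilin_ext op v w = (\<Sum>x\<in>pm_keys v. \<Sum>y\<in>T. pm_single (op x y) (pm_lookup v x * pm_lookup w y))"
    unfolding bilin_ext_def
    by (intro sum.cong refl sum.mono_neutral_left) (use assms in \<open>auto simp: in_keys_iff\<close>)
  also have "\<dots> = (\<Sum>x\<in>S. \<Sum>y\<in>T. pm_single (op x y) (pm_lookup v x * pm_lookup w y))"
    by (intro sum.mono_neutral_left) (use assms in \<open>auto simp: in_keys_iff\<close>)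
  finally show ?thesis .
qed

lemma bilin_ext_add_left: "bilin_ext op (v + v') w = bilin_ext op v w + bilin_ext op v' w"
proof -
  let ?S = "pm_keys v \<union> pm_keys v'"
  have k: "pm_keys (v + v') \<subseteq> ?S" by (rule Poly_Mapping.keys_add)
  show ?thesis
    by (subst (1 2 3) bilin_ext_superset[of ?S _ "pm_keys w"])
      (use k in \<open>auto simp: lookup_add distrib_right single_add sum.distrib\<close>)
qed

lemma bilin_ext_add_right: "bilin_ext op v (w + w') = bilin_ext op v w + bilin_ext op v w'"
proof -
  let ?S = "pm_keys w \<union> pm_keys w'"
  have k: "pm_keys (w + w') \<subseteq> ?S" by (rule Poly_Mapping.keys_add)
  show ?thesis
    by (subst (1 2 3) bilin_ext_superset[of "pm_keys v" _ ?S])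
      (use k in \<open>auto simp: lookup_add distrib_left single_add sum.distrib\<close>)
qed

lemma bilin_ext_zero [simp]: "bilin_ext op 0 w = 0" "bilin_ext op v 0 = 0"
  by (simp_all add: bilin_ext_def)

lemma bilin_ext_single [simp]: "bilin_ext op (pm_single a c) (pm_single b d) = pm_single (op a b) (c * d)"
  by (subst bilin_ext_superset[of "{a}" _ "{b}"]) auto

lemma single_scale [simp]: "Poly_Mapping.map ((*) c) (pm_single x d) = pm_single x (c * d :: 'k::field)"
  by (rule poly_mapping_eqI) (simp add: lookup_scale lookup_single when_def)

lemma scale_add: "Poly_Mapping.map ((*) c) (v + w) = Poly_Mapping.map ((*) c) v + Poly_Mapping.map ((*) (c :: 'k::field)) w"
  by (rule poly_mapping_eqI) (simp add: lookup_scale lookup_add distrib_left)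

lemma bilin_ext_keys:
  assumes "\<And>x y. x \<in> pm_keys v \<Longrightarrow> y \<in> pm_keys w \<Longrightarrow> op x y \<in> S"
  shows "pm_keys (bilin_ext op v w) \<subseteq> S"
proof -
  have "pm_keys (bilin_ext op v w) \<subseteq> (\<Union>x\<in>pm_keys v. pm_keys (\<Sum>y\<in>pm_keys w. pm_single (op x y) (pm_lookup v x * pm_lookup w y)))"
    unfolding bilin_ext_def by (rule keys_sum)
  also have "\<dots> \<subseteq> (\<Union>x\<in>pm_keys v. \<Union>y\<in>pm_keys w. pm_keys (pm_single (op x y) (pm_lookup v x * pm_lookup w y)))"
    by (intro UN_mono keys_sum order_refl)
  also have "\<dots> \<subseteq> S" using assms by (auto split: if_splits)
  finally show ?thesis .
qed

text \<open>Multiples of basis vectors together with additivity determine the maps. Agreement is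
  asked for only on the keys of \<open>v\<close>, so that the typing of \<open>v\<close> is
  available for each basis vector. In this way the axioms of the linearization are reduced to those
  of the underlying category.\<close>

lemma lin_ext:
  fixes F G :: "('m \<Rightarrow>\<^sub>0 'k::field) \<Rightarrow> 'b::ab_group_add"
  assumes "\<And>v w. F (v + w) = F v + F w" "\<And>v w. G (v + w) = G v + G w"
    and "\<And>x c. x \<in> pm_keys v \<Longrightarrow> F (pm_single x c) = G (pm_single x c)"
  shows "F v = G v"
proof -
  have 0: "H 0 = 0" if "\<And>v w. H (v + w) = H v + H w" for H :: "('m \<Rightarrow>\<^sub>0 'k) \<Rightarrow> 'b"
    using that[of 0 0] by simp
  have s: "H (\<Sum>x\<in>S. f x) = (\<Sum>x\<in>S. H (f x))" if "\<And>v w. H (v + w) = H v + H w" "finite S"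
    for H :: "('m \<Rightarrow>\<^sub>0 'k) \<Rightarrow> 'b" and S and f :: "'m \<Rightarrow> ('m \<Rightarrow>\<^sub>0 'k)"
    using that(2) by (induction S rule: finite_induct) (simp_all add: 0[OF that(1)] that(1))
  have "F (\<Sum>x\<in>pm_keys v. pm_single x (pm_lookup v x)) = G (\<Sum>x\<in>pm_keys v. pm_single x (pm_lookup v x))"
    unfolding s[OF assms(1) finite_keys] s[OF assms(2) finite_keys] by (rule sum.cong) (use assms(3) in auto)
  then show ?thesis by (simp only: poly_mapping_sum_single[symmetric])
qed

lemma lin_ext2:
  fixes F G :: "('m \<Rightarrow>\<^sub>0 'k::field) \<Rightarrow> ('m \<Rightarrow>\<^sub>0 'k) \<Rightarrow> 'b::ab_group_add"
  assumes "\<And>v v' w. F (v + v') w = F v w + F v' w" "\<And>v w w'. F v (w + w') = F v w + F v w'"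
    "\<And>v v' w. G (v + v') w = G v w + G v' w" "\<And>v w w'. G v (w + w') = G v w + G v w'"
    and "\<And>x c y d. x \<in> pm_keys v \<Longrightarrow> y \<in> pm_keys w \<Longrightarrow> F (pm_single x c) (pm_single y d) = G (pm_single x c) (pm_single y d)"
  shows "F v w = G v w"
  by (rule lin_ext[of "\<lambda>v. F v w" "\<lambda>v. G v w"], rule assms, rule assms,
      rule lin_ext, rule assms, rule assms, rule assms)

lemma lin_ext3:
  fixes F G :: "('m \<Rightarrow>\<^sub>0 'k::field) \<Rightarrow> ('m \<Rightarrow>\<^sub>0 'k) \<Rightarrow> ('m \<Rightarrow>\<^sub>0 'k) \<Rightarrow> 'b::ab_group_add"
  assumes "\<And>v v' w u. F (v + v') w u = F v w u + F v' w u" "\<And>v w w' u. F v (w + w') u = F v w u + F v w' u"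
    "\<And>v w u u'. F v w (u + u') = F v w u + F v w u'"
    "\<And>v v' w u. G (v + v') w u = G v w u + G v' w u" "\<And>v w w' u. G v (w + w') u = G v w u + G v w' u"
    "\<And>v w u u'. G v w (u + u') = G v w u + G v w u'"
    and "\<And>x c y d z e. x \<in> pm_keys v \<Longrightarrow> y \<in> pm_keys w \<Longrightarrow> z \<in> pm_keys u \<Longrightarrow>
      F (pm_single x c) (pm_single y d) (pm_single z e) = G (pm_single x c) (pm_single y d) (pm_single z e)"
  shows "F v w u = G v w u"
  by (rule lin_ext[of "\<lambda>v. F v w u" "\<lambda>v. G v w u"], rule assms, rule assms,
      rule lin_ext2, rule assms, rule assms, rule assms, rule assms, rule assms)

lemma lin_ext4:
  fixes F G :: "('m \<Rightarrow>\<^sub>0 'k::field) \<Rightarrow> ('m \<Rightarrow>\<^sub>0 'k) \<Rightarrow> ('m \<Rightarrow>\<^sub>0 'k) \<Rightarrow> ('m \<Rightarrow>\<^sub>0 'k) \<Rightarrow> 'b::ab_group_add"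
  assumes "\<And>v v' w u t. F (v + v') w u t = F v w u t + F v' w u t" "\<And>v w w' u t. F v (w + w') u t = F v w u t + F v w' u t"
    "\<And>v w u u' t. F v w (u + u') t = F v w u t + F v w u' t" "\<And>v w u t t'. F v w u (t + t') = F v w u t + F v w u t'"
    "\<And>v v' w u t. G (v + v') w u t = G v w u t + G v' w u t" "\<And>v w w' u t. G v (w + w') u t = G v w u t + G v w' u t"
    "\<And>v w u u' t. G v w (u + u') t = G v w u t + G v w u' t" "\<And>v w u t t'. G v w u (t + t') = G v w u t + G v w u t'"
    and "\<And>x c y d z e a b. x \<in> pm_keys v \<Longrightarrow> y \<in> pm_keys w \<Longrightarrow> z \<in> pm_keys u \<Longrightarrow> a \<in> pm_keys t \<Longrightarrow>
      F (pm_single x c) (pm_single y d) (pm_single z e) (pm_single a b) = G (pm_single x c) (pm_single y d) (pm_single z e) (pm_single a b)"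
  shows "F v w u t = G v w u t"
  by (rule lin_ext[of "\<lambda>v. F v w u t" "\<lambda>v. G v w u t"], rule assms, rule assms,
      rule lin_ext3, rule assms, rule assms, rule assms, rule assms, rule assms, rule assms, rule assms)

text \<open>In the linearization the operations are biadditive without typing conditions, so that matrices
  can be multiplied with sums in one abelian group.\<close>

locale enriched_category = symmetric_monoidal_category C + linear_category C
  for C :: "('o, 'm::ab_group_add, 's::field, 'x) tensor_category_scheme" (structure) +
  assumes zeroM_eq: "zeroM C X Y = 0" and addM_eq: "addM C = (+)"
    and cmp_add_l: "(g + g') \<cdot> f = g \<cdot> f + g' \<cdot> f" and cmp_add_r: "g \<cdot> (f + f') = g \<cdot> f + g \<cdot> f'"
    and ten_add_l: "(f + f') \<otimes>\<^sub>m g = f \<otimes>\<^sub>m g + f' \<otimes>\<^sub>m g" and ten_add_r: "f \<otimes>\<^sub>m (g + g') = f \<otimes>\<^sub>m g + f \<otimes>\<^sub>m g'"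
    and scale_add_r: "c *\<^sub>m (f + g) = c *\<^sub>m f + c *\<^sub>m g"
    and scale_cmp_l: "(c *\<^sub>m g) \<cdot> f = c *\<^sub>m (g \<cdot> f)" and scale_cmp_r: "g \<cdot> (c *\<^sub>m f) = c *\<^sub>m (g \<cdot> f)"
    and scale_ten_l: "(c *\<^sub>m f) \<otimes>\<^sub>m g = c *\<^sub>m (f \<otimes>\<^sub>m g)" and scale_ten_r: "f \<otimes>\<^sub>m (c *\<^sub>m g) = c *\<^sub>m (f \<otimes>\<^sub>m g)"

lemma linearization_simps [simp]:
  "Obj (linearization E) = Obj E" "tenO (linearization E) = tenO E" "unt (linearization E) = unt E"
  "idm (linearization E) X = pm_single (idm E X) 1"
  "cmp (linearization E) = bilin_ext (cmp E)" "tenM (linearization E) = bilin_ext (tenM E)"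
  "asc (linearization E) X Y Z = pm_single (asc E X Y Z) 1" "lun (linearization E) X = pm_single (lun E X) 1"
  "run (linearization E) X = pm_single (run E X) 1" "brd (linearization E) X Y = pm_single (brd E X Y) 1"
  "zeroM (linearization E) X Y = 0" "addM (linearization E) = (+)"
  "scaleM (linearization E) c = Poly_Mapping.map ((*) c)"
  "v \<in> Hom (linearization E) X Y \<longleftrightarrow> pm_keys v \<subseteq> Hom E X Y"
  by (simp_all add: linearization_def)

lemmas bilin_add = bilin_ext_add_left bilin_ext_add_right

lemma linearization_iso:
  assumes "is_iso E X Y f"
  shows "is_iso (linearization E) X Y (pm_single f 1)"
proof -
  obtain g where "inverse_arrows E X Y f g" using assms unfolding is_iso_def by blast
  then have "inverse_arrows (linearization E) X Y (pm_single f 1) (pm_single g 1)"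
    by (simp add: inverse_arrows_def)
  then show ?thesis unfolding is_iso_def by blast
qed

context symmetric_monoidal_category
begin

lemma linearization_category: "category (linearization C)"
proof (unfold_locales, goal_cases)
  case 1 then show ?case by (simp add: idm_in)
next
  case (2 X Y Z f g)
  then show ?case by (auto intro!: bilin_ext_keys cmp_in[of X Y Z])
next
  case (3 X Y f)
  show ?case unfolding linearization_simps
    by (rule lin_ext[where G = "\<lambda>f. f"]) (use 3 in \<open>auto simp: bilin_add idm_left\<close>)
next
  case (4 X Y f)
  show ?case unfolding linearization_simps
    by (rule lin_ext[where G = "\<lambda>f. f"]) (use 4 in \<open>auto simp: bilin_add idm_right\<close>)
next
  case (5 W X Y Z f g h)
  show ?case unfolding linearization_simps
    by (rule lin_ext3[where F = "\<lambda>f g h. bilin_ext (cmp C) (bilin_ext (cmp C) h g) f"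
          and G = "\<lambda>f g h. bilin_ext (cmp C) h (bilin_ext (cmp C) g f)"])
      (use 5 in \<open>auto simp: bilin_add cmp_assoc[of W X Y Z] subset_iff mult_ac\<close>)
qed

lemma linearization_symmetric_monoidal: "symmetric_monoidal_category (linearization C)"
proof (intro symmetric_monoidal_category.intro linearization_category, unfold_locales, goal_cases)
  case 1 then show ?case by (simp add: unt_in)
next
  case 2 then show ?case by (simp add: tenO_in)
next
  case (3 X Y X' Y' f f') then show ?case by (auto intro!: bilin_ext_keys tenM_in[of X Y X' Y'])
next
  case 4 then show ?case by (simp add: tenM_idm)
next
  case (5 X Y Z X' Y' Z' f g f' g')
  show ?case unfolding linearization_simps
    by (rule lin_ext4[where F = "\<lambda>f g f' g'. bilin_ext (tenM C) (bilin_ext (cmp C) g f) (bilin_ext (cmp C) g' f')"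
          and G = "\<lambda>f g f' g'. bilin_ext (cmp C) (bilin_ext (tenM C) g g') (bilin_ext (tenM C) f f')"])
      (use 5 in \<open>auto simp: bilin_add tenM_cmp[of X Y Z X' Y' Z'] subset_iff mult_ac\<close>)
next
  case 6 then show ?case using linearization_iso[OF asc_iso] by simp
next
  case (7 X Y Z X' Y' Z' f g h)
  show ?case unfolding linearization_simps
    by (rule lin_ext3[where F = "\<lambda>f g h. bilin_ext (cmp C) (pm_single (asc C X' Y' Z') 1) (bilin_ext (tenM C) (bilin_ext (tenM C) f g) h)"
          and G = "\<lambda>f g h. bilin_ext (cmp C) (bilin_ext (tenM C) f (bilin_ext (tenM C) g h)) (pm_single (asc C X Y Z) 1)"])
      (use 7 in \<open>auto simp: bilin_add asc_nat[of X Y Z X' Y' Z'] subset_iff mult_ac\<close>)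
next
  case 8 then show ?case using linearization_iso[OF lun_iso] by simp
next
  case (9 X Y f)
  show ?case unfolding linearization_simps
    by (rule lin_ext) (use 9 in \<open>auto simp: bilin_add lun_nat[of X Y] subset_iff\<close>)
next
  case 10 then show ?case using linearization_iso[OF run_iso] by simp
next
  case (11 X Y f)
  show ?case unfolding linearization_simps
    by (rule lin_ext) (use 11 in \<open>auto simp: bilin_add run_nat[of X Y] subset_iff\<close>)
next
  case 12 then show ?case by (simp add: pentagon)
next
  case 13 then show ?case by (simp add: triangle)
next
  case 14 then show ?case by (simp add: brd_in)
next
  case (15 X Y X' Y' f g)
  show ?case unfolding linearization_simps
    by (rule lin_ext2[where F = "\<lambda>f g. bilin_ext (cmp C) (pm_single (brd C X' Y') 1) (bilin_ext (tenM C) f g)"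
          and G = "\<lambda>f g. bilin_ext (cmp C) (bilin_ext (tenM C) g f) (pm_single (brd C X Y) 1)"])
      (use 15 in \<open>auto simp: bilin_add brd_nat[of X Y X' Y'] subset_iff mult_ac\<close>)
next
  case 16 then show ?case by (simp add: brd_sym)
next
  case 17 then show ?case by (simp add: hexagon)
qed

lemma bilin_ext_scale:
  "bilin_ext op (Poly_Mapping.map ((*) c) v) w = Poly_Mapping.map ((*) c) (bilin_ext op v w)"
  "bilin_ext op v (Poly_Mapping.map ((*) c) w) = Poly_Mapping.map ((*) c) (bilin_ext op v w)"
  by (rule lin_ext2[where v = v and w = w and F = "\<lambda>v w. bilin_ext op (Poly_Mapping.map ((*) c) v) w" and G = "\<lambda>v w. Poly_Mapping.map ((*) c) (bilin_ext op v w)"];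
      auto simp: bilin_add scale_add mult_ac)
    (rule lin_ext2[where v = v and w = w and F = "\<lambda>v w. bilin_ext op v (Poly_Mapping.map ((*) c) w)" and G = "\<lambda>v w. Poly_Mapping.map ((*) c) (bilin_ext op v w)"];
      auto simp: bilin_add scale_add mult_ac)

lemma linearization_linear: "linear_category (linearization C)"
proof (intro linear_category.intro linearization_category, unfold_locales, goal_cases)
  case 2 then show ?case using Poly_Mapping.keys_add by (fastforce simp del: Poly_Mapping.keys_add)
next
  case 3 then show ?case using keys_scale by fastforce
next
  case (7 X Y f) then show ?case by (intro bexI[of _ "- f"]) auto
qed (auto simp: bilin_add bilin_ext_scale scale_add add.assoc intro: poly_mapping_eqI simp: lookup_scale lookup_add distrib_right)

lemma linearization_enriched: "enriched_category (linearization C)"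
proof -
  interpret L: symmetric_monoidal_category "linearization C" by (rule linearization_symmetric_monoidal)
  interpret L: linear_category "linearization C" by (rule linearization_linear)
  show ?thesis by unfold_locales (auto simp: bilin_add bilin_ext_scale scale_add)
qed

end

section \<open>The linearization is semiprime\<close>

text \<open>Pairing a product with a function \<open>F\<close> avoids comparing single coefficients.
  In this form the powers of an element are handed to \<open>nilpotent_trace_zero\<close>.\<close>

lemma sum_bilin_ext:
  assumes "finite S" "pm_keys v \<subseteq> S" "finite T" "pm_keys w \<subseteq> T" "finite M" "\<And>x y. x \<in> S \<Longrightarrow> y \<in> T \<Longrightarrow> op x y \<in> M"
  shows "(\<Sum>m\<in>M. pm_lookup (bilin_ext op v w) m * F m) = (\<Sum>x\<in>S. \<Sum>y\<in>T. pm_lookup v x * pm_lookup w y * F (op x y))"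
proof -
  have "(\<Sum>m\<in>M. pm_lookup (bilin_ext op v w) m * F m)
    = (\<Sum>m\<in>M. \<Sum>x\<in>S. \<Sum>y\<in>T. (if op x y = m then pm_lookup v x * pm_lookup w y * F m else 0))"
    unfolding bilin_ext_superset[OF assms(1-4)] lookup_sum sum_distrib_right
    by (intro sum.cong refl) (simp add: lookup_single when_def)
  also have "\<dots> = (\<Sum>x\<in>S. \<Sum>y\<in>T. \<Sum>m\<in>M. (if op x y = m then pm_lookup v x * pm_lookup w y * F m else 0))"
    by (subst sum.swap, rule sum.cong[OF refl], rule sum.swap)
  also have "\<dots> = (\<Sum>x\<in>S. \<Sum>y\<in>T. pm_lookup v x * pm_lookup w y * F (op x y))"
    by (intro sum.cong refl) (simp add: assms(5,6))
  finally show ?thesis .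
qed

context pre_tannakian_category
begin

lemma finite_Hom:
  assumes "finite (UNIV :: 's set)" "X \<in> Obj C" "Y \<in> Obj C"
  shows "finite (Hom C X Y)"
proof -
  obtain bs where bs: "\<And>f. f \<in> Hom C X Y \<Longrightarrow> \<exists>cs. length cs = length bs \<and> f = hom_sum C X Y (map2 (scaleM C) cs bs)"
    using finite_dim_homs[OF assms(2,3)] unfolding finite_dim_hom_def by blast
  have "finite {cs. set cs \<subseteq> (UNIV :: 's set) \<and> length cs = length bs}"
    by (rule finite_lists_length_eq) (rule assms)
  then have "finite ((\<lambda>cs. hom_sum C X Y (map2 (scaleM C) cs bs)) ` {cs. set cs \<subseteq> UNIV \<and> length cs = length bs})"
    by (rule finite_imageI)
  moreover have "Hom C X Y \<subseteq> (\<lambda>cs. hom_sum C X Y (map2 (scaleM C) cs bs)) ` {cs. set cs \<subseteq> UNIV \<and> length cs = length bs}"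
    using bs by fastforce
  ultimately show ?thesis by (rule finite_subset[rotated])
qed

text \<open>Every hyperplane of \<open>Hom Y X\<close> meets the lines in the same number of points, so a function on
  \<open>Hom X Y\<close> is determined by its sums over the fibres of the functionals \<open>f \<mapsto> t (r f)\<close>.\<close>

lemma radon_injective:
  fixes x :: "'m \<Rightarrow> 'k::field_char_0" and t :: "'m \<Rightarrow> 's"
  assumes fin: "finite (UNIV :: 's set)" and X: "X \<in> Obj C" and Y: "Y \<in> Obj C"
    and tadd: "\<And>f g. f \<in> Hom C X X \<Longrightarrow> g \<in> Hom C X X \<Longrightarrow> t (f \<oplus>\<^sub>m g) = t f + t g"
    and tsmul: "\<And>f a. f \<in> Hom C X X \<Longrightarrow> t (a *\<^sub>m f) = a * t f"
    and nd: "\<And>f. f \<in> Hom C X Y \<Longrightarrow> f \<noteq> zeroM C X Y \<Longrightarrow> \<exists>g\<in>Hom C Y X. t (g \<cdot> f) \<noteq> 0"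
    and x: "\<And>r c. r \<in> Hom C Y X \<Longrightarrow> (\<Sum>f\<in>Hom C X Y. x f * of_bool (t (r \<cdot> f) = c)) = 0"
    and f0: "f0 \<in> Hom C X Y"
  shows "x f0 = 0"
proof -
  interpret t: typed_tensor_category "tag C" fst "\<lambda>f. snd (snd f)" by (rule typed_tag)
  let ?H = "Hom C Y X" and ?G = "Hom C X Y"
  have fH: "finite ?H" and fG: "finite ?G" using finite_Hom[OF fin] X Y by auto
  have tarr: "t.arr (A, f, B)" if "A \<in> Obj C" "B \<in> Obj C" "f \<in> Hom C A B" for A B f
    using that by (auto simp: t.arr_def)
  define q where "q = card (UNIV :: 's set)"
  have q: "q > 1"
  proof -
    have "card {0, 1 :: 's} \<le> q" unfolding q_def by (rule card_mono) (use fin in auto)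
    then show ?thesis by simp
  qed
  have fibre: "q * card {r\<in>?H. t (r \<cdot> f) = t (r \<cdot> f0)} = card ?H" if f: "f \<in> ?G" "f \<noteq> f0" for f
  proof -
    define d where "d = f \<oplus>\<^sub>m (- 1) *\<^sub>m f0"
    have s: "(- 1) *\<^sub>m f0 \<in> ?G" by (rule smul_in[OF X Y f0])
    have d: "d \<in> ?G" unfolding d_def by (rule add_in[OF X Y f(1) s])
    have d0: "d \<noteq> zeroM C X Y"
    proof
      assume "d = zeroM C X Y"
      then have "t.sub (X, f, Y) (X, f0, Y) = zeroM (tag C) X Y" by (simp add: t.sub_def d_def)
      then have "(X, f, Y) = (X, f0, Y)" by (rule t.sub_eq_zero) (use tarr X Y f f0 in auto)
      then show False using f by simp
    qed
    have td: "t (r \<cdot> d) = t (r \<cdot> f) - t (r \<cdot> f0)" if r: "r \<in> ?H" for r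
    proof -
      have rf: "r \<cdot> f \<in> Hom C X X" "r \<cdot> f0 \<in> Hom C X X" using cmp_in[OF X Y X] f f0 r by auto
      have "r \<cdot> d = r \<cdot> f \<oplus>\<^sub>m (- 1) *\<^sub>m (r \<cdot> f0)"
        unfolding d_def by (simp add: cmp_add_right[OF X Y X f(1) s r] cmp_smul_right[OF X Y X f0 r])
      then show ?thesis using tadd[OF rf(1) smul_in[OF X X rf(2)]] tsmul[OF rf(2)] by simp
    qed
    obtain r1 where r1: "r1 \<in> ?H" "t (r1 \<cdot> d) \<noteq> 0" using nd[OF d d0] by blast
    let ?K = "\<lambda>c. {r\<in>?H. t (r \<cdot> d) = c}"
    \<comment> \<open>Adding a suitable multiple of \<open>r1\<close> moves the fibre over
      \<open>b\<close> into the fibre over \<open>c\<close>, so all fibres have the same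
      size.\<close>
    have le: "card (?K b) \<le> card (?K c)" for b c
    proof (rule card_inj_on_le)
      let ?a = "(c - b) / t (r1 \<cdot> d)"
      have s: "?a *\<^sub>m r1 \<in> ?H" by (rule smul_in[OF Y X r1(1)])
      show "inj_on (\<lambda>r. r \<oplus>\<^sub>m ?a *\<^sub>m r1) (?K b)"
      proof (rule inj_onI)
        fix r r' assume "r \<in> ?K b" "r' \<in> ?K b" and e: "r \<oplus>\<^sub>m ?a *\<^sub>m r1 = r' \<oplus>\<^sub>m ?a *\<^sub>m r1"
        then have "t.arr (Y, r, X)" "t.arr (Y, r', X)" "t.arr (Y, ?a *\<^sub>m r1, X)" using tarr X Y s by auto
        moreover have "(Y, r, X) \<oplus>\<^sub>m\<^bsub>tag C\<^esub> (Y, ?a *\<^sub>m r1, X) = (Y, r', X) \<oplus>\<^sub>m\<^bsub>tag C\<^esub> (Y, ?a *\<^sub>m r1, X)"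
          using e by simp
        ultimately have "(Y, r, X) = (Y, r', X)" by (intro t.add_cancel[of "(Y, r, X)" "(Y, ?a *\<^sub>m r1, X)"]) auto
        then show "r = r'" by simp
      qed
      show "(\<lambda>r. r \<oplus>\<^sub>m ?a *\<^sub>m r1) ` ?K b \<subseteq> ?K c"
      proof clarify
        fix r assume r: "r \<in> ?H" and b: "b = t (r \<cdot> d)"
        have rd: "r \<cdot> d \<in> Hom C X X" "r1 \<cdot> d \<in> Hom C X X" using cmp_in[OF X Y X d] r r1 by auto
        have "(r \<oplus>\<^sub>m ?a *\<^sub>m r1) \<cdot> d = r \<cdot> d \<oplus>\<^sub>m ?a *\<^sub>m (r1 \<cdot> d)"
          by (simp add: cmp_add_left[OF X Y X d r s] cmp_smul_left[OF X Y X d r1(1)])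
        then have "t ((r \<oplus>\<^sub>m ?a *\<^sub>m r1) \<cdot> d) = t (r \<cdot> d) + ?a * t (r1 \<cdot> d)"
          using tadd[OF rd(1) smul_in[OF X X rd(2)]] tsmul[OF rd(2)] by simp
        also have "\<dots> = c" using r1(2) b by simp
        finally have "t ((r \<oplus>\<^sub>m ?a *\<^sub>m r1) \<cdot> d) = c" .
        moreover have "r \<oplus>\<^sub>m ?a *\<^sub>m r1 \<in> ?H" by (rule add_in[OF Y X r s])
        ultimately show "r \<oplus>\<^sub>m ((c - t (r \<cdot> d)) / t (r1 \<cdot> d)) *\<^sub>m r1 \<in> ?H
            \<and> t ((r \<oplus>\<^sub>m ((c - t (r \<cdot> d)) / t (r1 \<cdot> d)) *\<^sub>m r1) \<cdot> d) = c" unfolding b by simp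
      qed
    qed (use fH in simp)
    then have eq: "card (?K c) = card (?K 0)" for c by (meson order.antisym)
    have "card ?H = card (\<Union>c\<in>UNIV. ?K c)" by (rule arg_cong[of _ _ card]) auto
    also have "\<dots> = (\<Sum>c\<in>UNIV. card (?K c))"
      by (rule card_UN_disjoint) (use fin fH in auto)
    also have "\<dots> = (\<Sum>c\<in>(UNIV :: 's set). card (?K 0))" by (rule sum.cong[OF refl eq])
    also have "\<dots> = q * card (?K 0)" by (simp add: q_def)
    also have "?K 0 = {r\<in>?H. t (r \<cdot> f) = t (r \<cdot> f0)}" using td by auto
    finally show ?thesis by simp
  qed
  let ?N = "of_nat (card ?H) :: 'k"
  define k where "k = ?N / of_nat q"
  have cnt: "(of_nat (card {r\<in>?H. t (r \<cdot> f) = t (r \<cdot> f0)}) :: 'k) = (if f = f0 then ?N else k)" if "f \<in> ?G" for f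
  proof (cases "f = f0")
    case False
    then have "?N = of_nat (q * card {r\<in>?H. t (r \<cdot> f) = t (r \<cdot> f0)})" using fibre[OF that] by simp
    then show ?thesis using False q by (simp add: k_def)
  qed simp
  have z: "zeroM C Y X \<in> ?H" by (rule zer_in[OF Y X])
  have total: "(\<Sum>f\<in>?G. x f) = 0"
  proof -
    have "(\<Sum>f\<in>?G. x f) = (\<Sum>f\<in>?G. x f * (\<Sum>c\<in>UNIV. of_bool (t (zeroM C Y X \<cdot> f) = c)))"
      using fin by (simp add: of_bool_def)
    also have "\<dots> = (\<Sum>c\<in>UNIV. \<Sum>f\<in>?G. x f * of_bool (t (zeroM C Y X \<cdot> f) = c))"
      unfolding sum_distrib_left by (rule sum.swap)
    also have "\<dots> = 0" using x[OF z] by simp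
    finally show ?thesis .
  qed
  \<comment> \<open>The fibres through \<open>f0\<close> are added up over all \<open>r\<close>: the
    point \<open>f0\<close> is counted every time, each other point for a fraction
    \<open>1/q\<close> of the \<open>r\<close>. The constant part drops out by \<open>total\<close>,
    which is the case of zero \<open>r\<close> summed over all values \<open>c\<close>.\<close>
  have "0 = (\<Sum>r\<in>?H. \<Sum>f\<in>?G. x f * of_bool (t (r \<cdot> f) = t (r \<cdot> f0)))" using x by simp
  also have "\<dots> = (\<Sum>f\<in>?G. x f * (\<Sum>r\<in>?H. of_bool (t (r \<cdot> f) = t (r \<cdot> f0))))"
    unfolding sum_distrib_left by (rule sum.swap)
  also have "\<dots> = (\<Sum>f\<in>?G. x f * (if f = f0 then ?N else k))"
    by (intro sum.cong refl arg_cong2[of _ _ _ _ "(*)"])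
      (use fH in \<open>simp add: of_bool_def sum.If_cases Int_def flip: cnt\<close>)
  also have "\<dots> = (\<Sum>f\<in>?G. x f * k + (if f = f0 then x f * (?N - k) else 0))"
    by (intro sum.cong) (auto simp: algebra_simps)
  also have "\<dots> = x f0 * (?N - k)"
    using f0 fG total by (simp add: sum.distrib flip: sum_distrib_right)
  finally have "x f0 * (?N - k) = 0" by simp
  moreover have "?N - k \<noteq> 0"
  proof -
    have "card ?H > 0" using fH z by (auto simp: card_gt_0_iff)
    moreover have "(of_nat q :: 'k) \<noteq> 1" using q by (metis of_nat_1 of_nat_eq_iff less_irrefl)
    ultimately show ?thesis using q by (simp add: k_def field_simps)
  qed
  ultimately show ?thesis by simp
qed

text \<open>If the assertion fails, every product with the nonzero \<open>x\<close> as right factor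
  is nilpotent. The basis vectors \<open>pm_single r 1\<close> already suffice as left factors: they
  give the coefficient sums of \<open>x\<close> over the sets of \<open>f\<close> for which the
  trace of \<open>r \<cdot> f\<close> has a given value, and \<open>radon_injective\<close>
  applies.\<close>

theorem linearization_semiprime:
  assumes fin: "finite (UNIV :: 's set)" and ss: "semisimple C"
  shows "semiprime (linearization C :: ('o, 'm \<Rightarrow>\<^sub>0 'k::field_char_0, 'k) tensor_category)"
    (is "semiprime ?L")
  unfolding semiprime_def
proof (intro ballI impI)
  fix X Y x assume X: "X \<in> Obj ?L" and Y: "Y \<in> Obj ?L" and xH: "x \<in> Hom ?L X Y" and x0: "x \<noteq> zeroM ?L X Y"
  note [simp] = X[simplified] Y[simplified]
  obtain t where t:
    "\<And>X f g. X \<in> Obj C \<Longrightarrow> f \<in> Hom C X X \<Longrightarrow> g \<in> Hom C X X \<Longrightarrow> t X (f \<oplus>\<^sub>m g) = t X f + t X g"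
    "\<And>X f a. X \<in> Obj C \<Longrightarrow> f \<in> Hom C X X \<Longrightarrow> t X (a *\<^sub>m f) = a * t X f"
    "\<And>X f g. X \<in> Obj C \<Longrightarrow> f \<in> Hom C X X \<Longrightarrow> g \<in> Hom C X X \<Longrightarrow> t X (f \<cdot> g) = t X (g \<cdot> f)"
    "\<And>X f n. X \<in> Obj C \<Longrightarrow> f \<in> Hom C X X \<Longrightarrow> cpow C X f (Suc n) \<cdot> cpow C X f (Suc n) = cpow C X f (Suc n)
       \<Longrightarrow> t X (f \<cdot> cpow C X f (Suc n)) = t X f"
    "\<And>X Y f. X \<in> Obj C \<Longrightarrow> Y \<in> Obj C \<Longrightarrow> f \<in> Hom C X Y \<Longrightarrow> f \<noteq> zeroM C X Y \<Longrightarrow> \<exists>g\<in>Hom C Y X. t X (g \<cdot> f) \<noteq> 0"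
    using trace_functional[OF ss] by blast
  have fM: "finite (Hom C X X)" and fH: "finite (Hom C X Y)" using finite_Hom[OF fin] by auto
  interpret M: finite_monoid "Hom C X X" "cmp C" "idm C X"
    by unfold_locales (auto simp: fM idm_in idm_left[of X X] idm_right[of X X] cmp_in[of X X X] cmp_assoc[of X X X X])
  have mp: "M.mpow a n = cpow C X a n" for a n by (induction n) auto
  show "\<exists>y\<in>Hom ?L Y X. \<forall>n. cpow ?L X (y \<cdot>\<^bsub>?L\<^esub> x) n \<noteq> zeroM ?L X X"
  proof (rule ccontr)
    assume "\<not> ?thesis"
    then have nil: "\<exists>n. cpow ?L X (y \<cdot>\<^bsub>?L\<^esub> x) n = 0" if "y \<in> Hom ?L Y X" for y
      using that by auto
    have zero: "(\<Sum>f\<in>Hom C X Y. pm_lookup x f * of_bool (t X (r \<cdot> f) = c)) = 0" if r: "r \<in> Hom C Y X" for r c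
    proof -
      let ?z = "bilin_ext (cmp C) (pm_single r 1) x :: 'm \<Rightarrow>\<^sub>0 'k"
      have zk: "pm_keys ?z \<subseteq> Hom C X X"
        by (rule bilin_ext_keys) (use r xH in \<open>auto intro: cmp_in[of X Y X]\<close>)
      have pk: "pm_keys (cpow ?L X ?z n) \<subseteq> Hom C X X" for n
        by (induction n) (use zk in \<open>auto simp: idm_in intro!: bilin_ext_keys cmp_in[of X X X]\<close>)
      let ?f = "\<lambda>g. of_bool (t X g = c) :: 'k"
      have "(\<Sum>g\<in>Hom C X X. pm_lookup ?z g * ?f g) = 0"
      proof (rule M.nilpotent_trace_zero[where Z = "\<lambda>n. pm_lookup (cpow ?L X ?z n)"])
        fix F :: "'m \<Rightarrow> 'k"
        show "(\<Sum>g\<in>Hom C X X. pm_lookup (cpow ?L X ?z 0) g * F g) = F (idm C X)"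
          using fM by (simp add: lookup_single when_def if_distrib[of "\<lambda>a. a * _"] idm_in cong: if_cong)
        fix n
        show "(\<Sum>g\<in>Hom C X X. pm_lookup (cpow ?L X ?z (Suc n)) g * F g)
          = (\<Sum>g\<in>Hom C X X. \<Sum>h\<in>Hom C X X. pm_lookup ?z g * pm_lookup (cpow ?L X ?z n) h * F (g \<cdot> h))"
          unfolding cpow.simps linearization_simps
          by (rule sum_bilin_ext) (use fM zk pk in auto)
      next
        have "pm_single r 1 \<in> Hom ?L Y X" using r by simp
        then obtain n where "cpow ?L X ?z n = 0" using nil by fastforce
        then show "\<exists>n. \<forall>g\<in>Hom C X X. pm_lookup (cpow ?L X ?z n) g = 0" by (intro exI[of _ n]) simp
      next
        fix g assume g: "g \<in> Hom C X X"
        \<comment> \<open>Since \<open>M.E g\<close> is an idempotent power of \<open>g\<close>, the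
          stability of the trace is exactly the stability premise of the theorem on monoids.\<close>
        obtain n where "M.E g = cpow C X g (Suc n)"
          using M.stable[OF g] unfolding M.stable_def mp by blast
        then show "?f g = ?f (M.A g)"
          using t(4)[of X g n] M.core_simps(4,5)[OF g] g by simp
      qed (use t(3)[of X] in simp)
      also have "(\<Sum>g\<in>Hom C X X. pm_lookup ?z g * ?f g) = (\<Sum>p\<in>{r}. \<Sum>f\<in>Hom C X Y. pm_lookup (pm_single r 1) p * pm_lookup x f * ?f (p \<cdot> f))"
        by (rule sum_bilin_ext) (use fM fH r xH in \<open>auto intro: cmp_in[of X Y X]\<close>)
      finally show ?thesis by simp
    qed
    have "x = 0"
    proof (rule poly_mapping_eqI)
      fix f
      show "pm_lookup x f = pm_lookup 0 f"
      proof (cases "f \<in> Hom C X Y")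
        case True
        have "pm_lookup x f = 0"
          by (rule radon_injective[OF fin _ _ t(1)[of X] t(2)[of X] t(5)[of X Y] zero True]) simp_all
        then show ?thesis by simp
      next
        case False
        then have "f \<notin> pm_keys x" using xH by auto
        then show ?thesis by (simp add: in_keys_iff)
      qed
    qed
    then show False using x0 by simp
  qed
qed

end

section \<open>Additive envelope\<close>

lemma concat_uniform:
  assumes "\<And>xs. xs \<in> set xss \<Longrightarrow> length xs = m"
  shows "length (concat xss) = length xss * m"
    and "k < length xss * m \<Longrightarrow> concat xss ! k = xss ! (k div m) ! (k mod m)"
proof -
  show "length (concat xss) = length xss * m"
    using assms by (induction xss) auto
  show "k < length xss * m \<Longrightarrow> concat xss ! k = xss ! (k div m) ! (k mod m)"
    using assms
  proof (induction xss arbitrary: k)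
    case (Cons xs xss)
    then have l: "length xs = m" by simp
    show ?case
    proof (cases "k < m")
      case True
      then show ?thesis using l by (simp add: nth_append)
    next
      case False
      then have m: "0 < m" using Cons.prems(1) by (cases m) auto
      have "concat (xs # xss) ! k = concat xss ! (k - m)" using False l by (simp add: nth_append)
      also have "\<dots> = xss ! ((k - m) div m) ! ((k - m) mod m)"
        by (rule Cons.IH) (use Cons.prems False in auto)
      finally show ?thesis using False m by (simp add: le_div_geq le_mod_geq)
    qed
  qed simp
qed

text \<open>A summand of a threefold product has three digits in mixed radix. By these rules both
  bracketings of the product order the triples in the same way, which is why the associator is
  diagonal.\<close>

lemma index_simps:
  "(j::nat) div (y * z) = j div z div y" "(j mod (y * z)) div z = (j div z) mod y" "(j mod (y * z)) mod z = j mod z"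
proof -
  show "j div (y * z) = j div z div y" by (metis div_mult2_eq mult.commute)
  show "(j mod (y * z)) div z = (j div z) mod y"
    using mod_mult2_eq[of j z y] by (cases "z = 0") (simp_all add: mult.commute)
  show "(j mod (y * z)) mod z = j mod z"
    by (simp add: mod_mod_cancel)
qed

lemma index_less:
  "(j::nat) < x * y \<Longrightarrow> j div y < x" "(j::nat) < x * y \<Longrightarrow> j mod y < y"
  by (simp_all add: less_mult_imp_div_less) (cases "y = 0"; simp)

lemma index_pair: "a < x \<Longrightarrow> b < y \<Longrightarrow> a * y + b < x * (y::nat)"
  by (metis add_less_cancel_left add.commute less_le_trans mult_Suc mult_le_mono1 Suc_leI)

lemma index_eq: "(i::nat) div y = j div y \<Longrightarrow> i mod y = j mod y \<Longrightarrow> i = j"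
  by (metis div_mult_mod_eq)

lemma index_unique:
  assumes "b < y"
  shows "(i::nat) = a * y + b \<longleftrightarrow> i div y = a \<and> i mod y = b"
proof
  assume "i = a * y + b"
  then show "i div y = a \<and> i mod y = b"
    using assms div_mult_self1[of y b a] mod_mult_self1[of b a y] by (simp add: add.commute)
next
  assume "i div y = a \<and> i mod y = b"
  then show "i = a * y + b" using div_mult_mod_eq[of i y] by simp
qed

lemma index_pair_simps [simp]:
  assumes "b < y"
  shows "(a * y + b) div y = a" "(a * y + b) mod y = (b::nat)"
  using index_unique[OF assms, of "a * y + b" a] by simp_all

lemma sum_lessThan_add:
  fixes f :: "nat \<Rightarrow> 'a::comm_monoid_add"
  shows "(\<Sum>l<n + m. f l) = (\<Sum>l<n. f l) + (\<Sum>b<m. f (n + b))"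
  by (induction m) (simp_all add: add.assoc)

lemma sum_index: "(\<Sum>l<x * y. f l) = (\<Sum>a<x. \<Sum>b<(y::nat). f (a * y + b))"
proof (induction x)
  case (Suc x)
  have "(\<Sum>l<Suc x * y. f l) = (\<Sum>l<x * y + y. f l)" by (simp add: add.commute)
  also have "\<dots> = (\<Sum>l<x * y. f l) + (\<Sum>b<y. f (x * y + b))"
    by (rule sum_lessThan_add)
  finally show ?case using Suc by simp
qed simp

lemma mk_arrow_simps [simp]:
  "src (mk_arrow Xs Ys F) = Xs" "tgt (mk_arrow Xs Ys F) = Ys"
  "i < length Ys \<Longrightarrow> j < length Xs \<Longrightarrow> entry (mk_arrow Xs Ys F) i j = F i j"
  by (simp_all add: mk_arrow_def)

lemma mk_arrow_eqI:
  "(\<And>i j. i < length Ys \<Longrightarrow> j < length Xs \<Longrightarrow> F i j = G i j) \<Longrightarrow> mk_arrow Xs Ys F = mk_arrow Xs Ys G"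
  unfolding mk_arrow_def by (auto intro!: eq_matI)

lemma mk_arrow_eqD:
  assumes "mk_arrow Xs Ys F = mk_arrow Xs Ys G" "i < length Ys" "j < length Xs"
  shows "F i j = G i j"
  using assms(1) mk_arrow_simps(3)[OF assms(2,3), of F] mk_arrow_simps(3)[OF assms(2,3), of G] by simp

section \<open>Matrices over a category with biadditive operations\<close>

context enriched_category
begin

abbreviation "AE \<equiv> additive_envelope C"

definition mor :: "'o list \<Rightarrow> 'o list \<Rightarrow> (nat \<Rightarrow> nat \<Rightarrow> 'm) \<Rightarrow> bool" where
  "mor Xs Ys F \<longleftrightarrow> (\<forall>i<length Ys. \<forall>j<length Xs. F i j \<in> Hom C (Xs ! j) (Ys ! i))"

definition dg :: "'o list \<Rightarrow> 'o list \<Rightarrow> (nat \<Rightarrow> 'm) \<Rightarrow> ('o, 'm) mat_arrow" where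
  "dg Xs Ys d = mk_arrow Xs Ys (\<lambda>i j. if i = j then d j else 0)"

text \<open>Monomial matrices, not monomorphisms: column \<open>j\<close> has its only entry in row
  \<open>\<pi> j\<close>. Diagonal matrices belong to the identity map of indices and the braiding
  permutes the summands, so the hexagon becomes a computation with index maps.\<close>

definition mono :: "'o list \<Rightarrow> 'o list \<Rightarrow> (nat \<Rightarrow> nat) \<Rightarrow> (nat \<Rightarrow> 'm) \<Rightarrow> ('o, 'm) mat_arrow" where
  "mono Xs Ys \<pi> d = mk_arrow Xs Ys (\<lambda>i j. if i = \<pi> j then d j else 0)"

lemma Hom_AE: "f \<in> Hom AE Xs Ys \<longleftrightarrow> (\<exists>F. f = mk_arrow Xs Ys F \<and> mor Xs Ys F)"
proof
  assume "f \<in> Hom AE Xs Ys"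
  then obtain M where M: "f = Mat_Arrow Xs M Ys" "M \<in> carrier_mat (length Ys) (length Xs)"
    "\<forall>i<length Ys. \<forall>j<length Xs. M $$ (i, j) \<in> Hom C (Xs ! j) (Ys ! i)"
    by (auto simp: additive_envelope_def)
  have "f = mk_arrow Xs Ys (\<lambda>i j. M $$ (i, j))"
    using M(1,2) unfolding mk_arrow_def by (auto intro!: eq_matI)
  then show "\<exists>F. f = mk_arrow Xs Ys F \<and> mor Xs Ys F" using M(3) unfolding mor_def by blast
qed (auto simp: additive_envelope_def mk_arrow_def mor_def)

lemma Hom_AE_mk [simp]: "mk_arrow Xs Ys F \<in> Hom AE Xs Ys \<longleftrightarrow> mor Xs Ys F"
proof
  assume "mk_arrow Xs Ys F \<in> Hom AE Xs Ys"
  then obtain G where "mk_arrow Xs Ys F = mk_arrow Xs Ys G" "mor Xs Ys G" using Hom_AE by blast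
  then show "mor Xs Ys F" using mk_arrow_eqD unfolding mor_def by fastforce
qed (use Hom_AE in blast)

lemma cmp_zero_raw [simp]: "0 \<cdot> f = 0" "f \<cdot> 0 = 0"
  using cmp_add_l[of 0 0 f] cmp_add_r[of f 0 0] by simp_all

lemma ten_zero_raw [simp]: "0 \<otimes>\<^sub>m f = 0" "f \<otimes>\<^sub>m 0 = 0"
  using ten_add_l[of 0 0 f] ten_add_r[of f 0 0] by simp_all

lemma cmp_sum_l: "(\<Sum>i\<in>S. g i) \<cdot> f = (\<Sum>i\<in>S. g i \<cdot> f)"
  by (induction S rule: infinite_finite_induct) (simp_all add: cmp_add_l)

lemma cmp_sum_r: "f \<cdot> (\<Sum>i\<in>S. g i) = (\<Sum>i\<in>S. f \<cdot> g i)"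
  by (induction S rule: infinite_finite_induct) (simp_all add: cmp_add_r)

lemma ten_sum_l: "(\<Sum>i\<in>S. g i) \<otimes>\<^sub>m f = (\<Sum>i\<in>S. g i \<otimes>\<^sub>m f)"
  by (induction S rule: infinite_finite_induct) (simp_all add: ten_add_l)

lemma ten_sum_r: "f \<otimes>\<^sub>m (\<Sum>i\<in>S. g i) = (\<Sum>i\<in>S. f \<otimes>\<^sub>m g i)"
  by (induction S rule: infinite_finite_induct) (simp_all add: ten_add_r)

lemma scale_zero_raw [simp]: "c *\<^sub>m 0 = 0"
  using scale_add_r[of c 0 0] by simp

lemma scale_sum_r: "c *\<^sub>m (\<Sum>i\<in>S. g i) = (\<Sum>i\<in>S. c *\<^sub>m g i)"
  by (induction S rule: infinite_finite_induct) (simp_all add: scale_add_r)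

lemma Hom_zero [simp]: "X \<in> Obj C \<Longrightarrow> Y \<in> Obj C \<Longrightarrow> 0 \<in> Hom C X Y"
  using zer_in[of X Y] by (simp add: zeroM_eq)

lemma Hom_add: "X \<in> Obj C \<Longrightarrow> Y \<in> Obj C \<Longrightarrow> f \<in> Hom C X Y \<Longrightarrow> g \<in> Hom C X Y \<Longrightarrow> f + g \<in> Hom C X Y"
  using add_in[of X Y f g] by (simp add: addM_eq)

lemma Hom_sum: "X \<in> Obj C \<Longrightarrow> Y \<in> Obj C \<Longrightarrow> (\<And>i. i \<in> S \<Longrightarrow> f i \<in> Hom C X Y) \<Longrightarrow> (\<Sum>i\<in>S. f i) \<in> Hom C X Y"
  by (induction S rule: infinite_finite_induct) (auto intro: Hom_add)

lemma hom_sum_eq: "hom_sum C X Y (map f [0..<n]) = (\<Sum>l<n. f l)"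
  by (simp add: hom_sum_def zeroM_eq addM_eq sum_list.eq_foldr[symmetric] interv_sum_list_conv_sum_set_nat atLeast0LessThan)

lemma Obj_AE: "Xs \<in> Obj AE \<longleftrightarrow> set Xs \<subseteq> Obj C"
  by (auto simp: additive_envelope_def)

lemma Obj_nth: "Xs \<in> Obj AE \<Longrightarrow> i < length Xs \<Longrightarrow> Xs ! i \<in> Obj C"
  by (auto simp: Obj_AE)

lemma cmp_AE:
  "mk_arrow Ys Zs G \<cdot>\<^bsub>AE\<^esub> mk_arrow Xs Ys F = mk_arrow Xs Zs (\<lambda>i j. \<Sum>l<length Ys. G i l \<cdot> F l j)"
  by (auto simp: additive_envelope_def hom_sum_eq intro!: mk_arrow_eqI sum.cong)

lemma ten_list_length [simp]: "length (ten_list C Xs Ys) = length Xs * length Ys"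
  unfolding ten_list_def by (subst concat_uniform[where m = "length Ys"]) auto

lemma ten_list_nth [simp]:
  assumes "k < length Xs * length Ys"
  shows "ten_list C Xs Ys ! k = Xs ! (k div length Ys) \<otimes>\<^sub>o Ys ! (k mod length Ys)"
proof -
  have "ten_list C Xs Ys ! k = map (\<lambda>X. map (\<lambda>Y. X \<otimes>\<^sub>o Y) Ys) Xs ! (k div length Ys) ! (k mod length Ys)"
    unfolding ten_list_def by (rule concat_uniform(2)) (use assms in auto)
  then show ?thesis using index_less[OF assms] by simp
qed

lemma ten_list_Obj: "set Xs \<subseteq> Obj C \<Longrightarrow> set Ys \<subseteq> Obj C \<Longrightarrow> set (ten_list C Xs Ys) \<subseteq> Obj C"
  by (auto simp: ten_list_def subset_iff intro: tenO_in)

lemma ten_AE: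
  "mk_arrow Xs Xs' F \<otimes>\<^sub>m\<^bsub>AE\<^esub> mk_arrow Ys Ys' G = mk_arrow (ten_list C Xs Ys) (ten_list C Xs' Ys')
    (\<lambda>i j. F (i div length Ys') (j div length Ys) \<otimes>\<^sub>m G (i mod length Ys') (j mod length Ys))"
  by (auto simp: additive_envelope_def index_less intro!: mk_arrow_eqI)

lemma diag_AE: "diag_arrow C Xs Ys ds = dg Xs Ys ((!) ds)"
  by (auto simp: diag_arrow_def dg_def zeroM_eq intro!: mk_arrow_eqI)

lemma dg_cong: "(\<And>j. j < length Xs \<Longrightarrow> d j = d' j) \<Longrightarrow> dg Xs Ys d = dg Xs Ys d'"
  unfolding dg_def by (rule mk_arrow_eqI) auto

lemma idm_AE: "idm AE Xs = dg Xs Xs (\<lambda>j. idm C (Xs ! j))"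
proof -
  have "idm AE Xs = dg Xs Xs ((!) (map (idm C) Xs))" by (simp add: additive_envelope_def diag_AE)
  also have "\<dots> = dg Xs Xs (\<lambda>j. idm C (Xs ! j))" by (rule dg_cong) simp
  finally show ?thesis .
qed

lemma dg_cmp_left:
  "length Ys = length Zs \<Longrightarrow> dg Ys Zs d \<cdot>\<^bsub>AE\<^esub> mk_arrow Xs Ys F = mk_arrow Xs Zs (\<lambda>i j. d i \<cdot> F i j)"
  unfolding dg_def cmp_AE
  by (rule mk_arrow_eqI) (simp add: if_distrib[of "\<lambda>x. x \<cdot> _"] cong: if_cong)

lemma dg_cmp_right:
  "length Xs = length Ys \<Longrightarrow> mk_arrow Ys Zs F \<cdot>\<^bsub>AE\<^esub> dg Xs Ys d = mk_arrow Xs Zs (\<lambda>i j. F i j \<cdot> d j)"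
  unfolding dg_def cmp_AE
  by (rule mk_arrow_eqI) (simp add: if_distrib[of "\<lambda>x. _ \<cdot> x"] cong: if_cong)

lemma dg_dg:
  "length Xs = length Ys \<Longrightarrow> length Ys = length Zs \<Longrightarrow> dg Ys Zs d' \<cdot>\<^bsub>AE\<^esub> dg Xs Ys d = dg Xs Zs (\<lambda>j. d' j \<cdot> d j)"
  by (subst (2) dg_def, subst dg_cmp_left) (auto simp: dg_def intro!: mk_arrow_eqI)

lemma dg_ten:
  assumes "length Xs = length Xs'" "length Ys = length Ys'"
  shows "dg Xs Xs' d \<otimes>\<^sub>m\<^bsub>AE\<^esub> dg Ys Ys' d' = dg (ten_list C Xs Ys) (ten_list C Xs' Ys') (\<lambda>j. d (j div length Ys) \<otimes>\<^sub>m d' (j mod length Ys))"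
  unfolding dg_def ten_AE using assms by (auto intro!: mk_arrow_eqI dest: index_eq)

lemma dg_Hom:
  assumes "Xs \<in> Obj AE" "Ys \<in> Obj AE" "\<And>j. j < length Xs \<Longrightarrow> j < length Ys \<Longrightarrow> d j \<in> Hom C (Xs ! j) (Ys ! j)"
  shows "dg Xs Ys d \<in> Hom AE Xs Ys"
  unfolding dg_def Hom_AE_mk mor_def using assms Obj_nth by auto

lemma dg_iso:
  assumes "Xs \<in> Obj AE" "Ys \<in> Obj AE" "length Xs = length Ys"
    "\<And>j. j < length Xs \<Longrightarrow> is_iso C (Xs ! j) (Ys ! j) (d j)"
  shows "is_iso AE Xs Ys (dg Xs Ys d)"
proof -
  obtain e where e: "\<And>j. j < length Xs \<Longrightarrow> inverse_arrows C (Xs ! j) (Ys ! j) (d j) (e j)"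
    using assms(4) unfolding is_iso_def by metis
  have "inverse_arrows AE Xs Ys (dg Xs Ys d) (dg Ys Xs e)"
    unfolding inverse_arrows_def idm_AE using assms e
    by (auto intro!: dg_Hom dg_cong simp: dg_dg inverse_arrows_def)
  then show ?thesis unfolding is_iso_def by blast
qed

lemma mono_cmp:
  assumes "\<And>j. j < length Xs \<Longrightarrow> \<pi> j < length Ys"
  shows "mono Ys Zs \<pi>' d' \<cdot>\<^bsub>AE\<^esub> mono Xs Ys \<pi> d = mono Xs Zs (\<lambda>j. \<pi>' (\<pi> j)) (\<lambda>j. d' (\<pi> j) \<cdot> d j)"
  unfolding mono_def cmp_AE
  by (rule mk_arrow_eqI) (use assms in \<open>simp add: if_distrib[of "\<lambda>x. _ \<cdot> x"] cong: if_cong\<close>)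

lemma mono_cmp_right:
  assumes "\<And>j. j < length Xs \<Longrightarrow> \<pi> j < length Ys"
  shows "mk_arrow Ys Zs F \<cdot>\<^bsub>AE\<^esub> mono Xs Ys \<pi> d = mk_arrow Xs Zs (\<lambda>i j. F i (\<pi> j) \<cdot> d j)"
  unfolding mono_def cmp_AE
  by (rule mk_arrow_eqI) (use assms in \<open>simp add: if_distrib[of "\<lambda>x. _ \<cdot> x"] cong: if_cong\<close>)

text \<open>A monomial matrix acts from the left by permuting rows, so the row index is pulled back
  along the inverse \<open>\<rho>\<close> of \<open>\<pi>\<close>.\<close>

lemma mono_cmp_left:
  assumes "\<And>i l. i < length Zs \<Longrightarrow> l < length Ys \<Longrightarrow> i = \<pi> l \<longleftrightarrow> l = \<rho> i" "\<And>i. i < length Zs \<Longrightarrow> \<rho> i < length Ys"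
  shows "mono Ys Zs \<pi> d \<cdot>\<^bsub>AE\<^esub> mk_arrow Xs Ys F = mk_arrow Xs Zs (\<lambda>i j. d (\<rho> i) \<cdot> F (\<rho> i) j)"
  unfolding mono_def cmp_AE
proof (rule mk_arrow_eqI)
  fix i j assume ij: "i < length Zs" "j < length Xs"
  have "(\<Sum>l<length Ys. (if i = \<pi> l then d l else 0) \<cdot> F l j) = (\<Sum>l<length Ys. if l = \<rho> i then d l \<cdot> F l j else 0)"
    by (rule sum.cong) (use assms(1)[OF ij(1)] in auto)
  then show "(\<Sum>l<length Ys. (if i = \<pi> l then d l else 0) \<cdot> F l j) = d (\<rho> i) \<cdot> F (\<rho> i) j"
    using assms(2)[OF ij(1)] by simp
qed

lemma mono_ten:
  assumes "\<And>j. j < length Ys \<Longrightarrow> \<pi>' j < length Ys'"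
  shows "mono Xs Xs' \<pi> d \<otimes>\<^sub>m\<^bsub>AE\<^esub> mono Ys Ys' \<pi>' d' = mono (ten_list C Xs Ys) (ten_list C Xs' Ys')
    (\<lambda>j. \<pi> (j div length Ys) * length Ys' + \<pi>' (j mod length Ys)) (\<lambda>j. d (j div length Ys) \<otimes>\<^sub>m d' (j mod length Ys))"
  unfolding mono_def ten_AE
proof (rule mk_arrow_eqI)
  fix i j assume ij: "i < length (ten_list C Xs' Ys')" "j < length (ten_list C Xs Ys)"
  have p: "\<pi>' (j mod length Ys) < length Ys'" using assms index_less[of j "length Xs"] ij by simp
  have "i = \<pi> (j div length Ys) * length Ys' + \<pi>' (j mod length Ys)
      \<longleftrightarrow> i div length Ys' = \<pi> (j div length Ys) \<and> i mod length Ys' = \<pi>' (j mod length Ys)"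
    by (rule index_unique[OF p])
  then show "(if i div length Ys' = \<pi> (j div length Ys) then d (j div length Ys) else 0) \<otimes>\<^sub>m
     (if i mod length Ys' = \<pi>' (j mod length Ys) then d' (j mod length Ys) else 0)
    = (if i = \<pi> (j div length Ys) * length Ys' + \<pi>' (j mod length Ys) then d (j div length Ys) \<otimes>\<^sub>m d' (j mod length Ys) else 0)"
    by simp
qed

lemma mono_eqI:
  "(\<And>j. j < length Xs \<Longrightarrow> \<pi> j = \<pi>' j \<and> d j = d' j) \<Longrightarrow> mono Xs Ys \<pi> d = mono Xs Ys \<pi>' d'"
  unfolding mono_def by (rule mk_arrow_eqI) auto

lemma dg_mono: "dg Xs Ys d = mono Xs Ys (\<lambda>j. j) d"
  by (simp add: dg_def mono_def)

definition adiag :: "'o list \<Rightarrow> 'o list \<Rightarrow> 'o list \<Rightarrow> nat \<Rightarrow> 'm" where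
  "adiag Xs Ys Zs j = asc C (Xs ! (j div length Zs div length Ys)) (Ys ! ((j div length Zs) mod length Ys)) (Zs ! (j mod length Zs))"

lemma asc_AE: "asc AE Xs Ys Zs = dg (ten_list C (ten_list C Xs Ys) Zs) (ten_list C Xs (ten_list C Ys Zs)) (adiag Xs Ys Zs)"
proof -
  let ?l = "[asc C X Y Z. X \<leftarrow> Xs, Y \<leftarrow> Ys, Z \<leftarrow> Zs]"
  have "asc AE Xs Ys Zs = dg (ten_list C (ten_list C Xs Ys) Zs) (ten_list C Xs (ten_list C Ys Zs)) ((!) ?l)"
    by (simp add: additive_envelope_def diag_AE)
  also have "\<dots> = dg (ten_list C (ten_list C Xs Ys) Zs) (ten_list C Xs (ten_list C Ys Zs)) (adiag Xs Ys Zs)"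
  proof (rule dg_cong)
    fix j assume "j < length (ten_list C (ten_list C Xs Ys) Zs)"
    then have j: "j < length Xs * (length Ys * length Zs)" by (simp add: mult.assoc)
    have li: "length (concat (map (\<lambda>Y. map (asc C X Y) Zs) Ys)) = length Ys * length Zs" for X
      by (subst concat_uniform[where m = "length Zs"]) auto
    have nth: "concat (map (\<lambda>Y. map (asc C X Y) Zs) Ys) ! k = asc C X (Ys ! (k div length Zs)) (Zs ! (k mod length Zs))"
      if "k < length Ys * length Zs" for X k
      by (subst concat_uniform(2)[where m = "length Zs"]) (use that index_less[OF that] in auto)
    have "?l ! j = map (\<lambda>X. concat (map (\<lambda>Y. map (asc C X Y) Zs) Ys)) Xs ! (j div (length Ys * length Zs)) ! (j mod (length Ys * length Zs))"
      by (rule concat_uniform(2)) (use j li in auto)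
    then show "?l ! j = adiag Xs Ys Zs j"
      using nth[OF index_less(2)[OF j]] index_less(1)[OF j] by (simp add: adiag_def index_simps)
  qed
  finally show ?thesis .
qed

lemma lun_AE: "lun AE Xs = dg (ten_list C [unt C] Xs) Xs (\<lambda>j. lun C (Xs ! j))"
  and run_AE: "run AE Xs = dg (ten_list C Xs [unt C]) Xs (\<lambda>j. run C (Xs ! j))"
  by (auto simp: additive_envelope_def diag_AE intro!: dg_cong)

text \<open>In mixed radix this swaps two digits: the index of the pair \<open>(a, b)\<close> for
  sizes \<open>x, y\<close> becomes the index of \<open>(b, a)\<close> for sizes
  \<open>y, x\<close>.\<close>

definition flip :: "nat \<Rightarrow> nat \<Rightarrow> nat \<Rightarrow> nat" where
  "flip x y j = (j mod y) * x + j div y"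

lemma flip_less: "j < x * y \<Longrightarrow> flip x y j < y * x"
  unfolding flip_def using index_less[of j x y] by (simp add: index_pair)

lemma flip_iff:
  assumes "i < y * x" "j < x * y"
  shows "i = flip x y j \<longleftrightarrow> j = flip y x i"
proof -
  have *: "flip y x (flip x y j) = j" if "j < x * y" for x y j
    using index_less[OF that] by (simp add: flip_def)
  show ?thesis using *[OF assms(1)] *[OF assms(2)] by metis
qed

lemma brd_AE:
  "brd AE Xs Ys = mono (ten_list C Xs Ys) (ten_list C Ys Xs) (flip (length Xs) (length Ys))
    (\<lambda>j. brd C (Xs ! (j div length Ys)) (Ys ! (j mod length Ys)))"
proof -
  have e: "i = flip (length Xs) (length Ys) j \<longleftrightarrow> i div length Xs = j mod length Ys \<and> i mod length Xs = j div length Ys"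
    if "j < length Xs * length Ys" for i j
    unfolding flip_def by (rule index_unique) (rule index_less[OF that])
  show ?thesis
    unfolding mono_def by (auto simp: additive_envelope_def zeroM_eq e intro!: mk_arrow_eqI)
qed

lemma AE_simps:
  "tenO AE = ten_list C" "unt AE = [unt C]" "zeroM AE Xs Ys = mk_arrow Xs Ys (\<lambda>i j. 0)"
  "mk_arrow Xs Ys F \<oplus>\<^sub>m\<^bsub>AE\<^esub> mk_arrow Xs Ys G = mk_arrow Xs Ys (\<lambda>i j. F i j + G i j)"
  "c *\<^sub>m\<^bsub>AE\<^esub> mk_arrow Xs Ys F = mk_arrow Xs Ys (\<lambda>i j. c *\<^sub>m F i j)"
  by (auto simp: additive_envelope_def zeroM_eq addM_eq intro!: mk_arrow_eqI)

lemma mor_cmp: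
  assumes "Xs \<in> Obj AE" "Ys \<in> Obj AE" "Zs \<in> Obj AE" "mor Xs Ys F" "mor Ys Zs G"
  shows "mor Xs Zs (\<lambda>i j. \<Sum>l<length Ys. G i l \<cdot> F l j)"
  unfolding mor_def
proof (intro allI impI Hom_sum)
  fix i j l assume "i < length Zs" "j < length Xs" "l \<in> {..<length Ys}"
  then show "G i l \<cdot> F l j \<in> Hom C (Xs ! j) (Zs ! i)"
    using assms Obj_nth by (intro cmp_in[of _ "Ys ! l"]) (auto simp: mor_def)
qed (use assms Obj_nth in auto)

lemma AE_category: "category AE"
proof (unfold_locales, goal_cases)
  case 1 then show ?case by (auto simp: idm_AE intro!: dg_Hom idm_in Obj_nth)
next
  case (2 X Y Z f g)
  then show ?case by (auto simp: Hom_AE[of _ X Y] Hom_AE[of _ Y Z] cmp_AE intro: mor_cmp)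
next
  case (3 X Y f)
  then obtain F where F: "f = mk_arrow X Y F" "mor X Y F" by (auto simp: Hom_AE)
  show ?case unfolding F idm_AE
    by (subst dg_cmp_left) (use F(2) 3 Obj_nth in \<open>auto intro!: mk_arrow_eqI idm_left[of "X ! _"] simp: mor_def\<close>)
next
  case (4 X Y f)
  then obtain F where F: "f = mk_arrow X Y F" "mor X Y F" by (auto simp: Hom_AE)
  show ?case unfolding F idm_AE
    by (subst dg_cmp_right) (use F(2) 4 Obj_nth in \<open>auto intro!: mk_arrow_eqI idm_right[of _ "Y ! _"] simp: mor_def\<close>)
next
  case (5 W X Y Z f g h)
  then obtain F G H where *: "f = mk_arrow W X F" "mor W X F" "g = mk_arrow X Y G" "mor X Y G" "h = mk_arrow Y Z H" "mor Y Z H"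
    by (auto simp: Hom_AE)
  show ?case unfolding * cmp_AE
  proof (rule mk_arrow_eqI)
    fix i j assume ij: "i < length Z" "j < length W"
    have "(\<Sum>l<length X. (\<Sum>m<length Y. H i m \<cdot> G m l) \<cdot> F l j) = (\<Sum>l<length X. \<Sum>m<length Y. H i m \<cdot> (G m l \<cdot> F l j))"
      unfolding cmp_sum_l
    proof (intro sum.cong refl)
      fix l m assume "l \<in> {..<length X}" "m \<in> {..<length Y}"
      then show "(H i m \<cdot> G m l) \<cdot> F l j = H i m \<cdot> (G m l \<cdot> F l j)"
        using * ij 5(1-4) Obj_nth by (intro cmp_assoc[of "W ! j" "X ! l" "Y ! m" "Z ! i"]) (auto simp: mor_def)
    qed
    also have "\<dots> = (\<Sum>m<length Y. H i m \<cdot> (\<Sum>l<length X. G m l \<cdot> F l j))"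
      unfolding cmp_sum_r by (rule sum.swap)
    finally show "(\<Sum>l<length X. (\<Sum>m<length Y. H i m \<cdot> G m l) \<cdot> F l j) = (\<Sum>m<length Y. H i m \<cdot> (\<Sum>l<length X. G m l \<cdot> F l j))" .
  qed
qed

lemma ten_Obj: "Xs \<in> Obj AE \<Longrightarrow> Ys \<in> Obj AE \<Longrightarrow> ten_list C Xs Ys \<in> Obj AE"
  using ten_list_Obj unfolding Obj_AE by blast

lemma unt_Obj: "[unt C] \<in> Obj AE"
  by (simp add: Obj_AE unt_in)

lemma ten_nth_Obj:
  "Xs \<in> Obj AE \<Longrightarrow> Ys \<in> Obj AE \<Longrightarrow> j < length Xs * length Ys \<Longrightarrow> Xs ! (j div length Ys) \<in> Obj C \<and> Ys ! (j mod length Ys) \<in> Obj C"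
  using Obj_nth index_less by blast

lemma adiag_iso:
  assumes "Xs \<in> Obj AE" "Ys \<in> Obj AE" "Zs \<in> Obj AE" "j < length Xs * length Ys * length Zs"
  shows "is_iso C (ten_list C (ten_list C Xs Ys) Zs ! j) (ten_list C Xs (ten_list C Ys Zs) ! j) (adiag Xs Ys Zs j)"
proof -
  note l = index_less[OF assms(4)] index_less[OF index_less(1)[OF assms(4)]]
  have j: "j < length Xs * (length Ys * length Zs)" using assms(4) by (simp add: mult.assoc)
  note l' = index_less[OF j]
  show ?thesis unfolding adiag_def
    using asc_iso[of "Xs ! (j div length Zs div length Ys)" "Ys ! ((j div length Zs) mod length Ys)" "Zs ! (j mod length Zs)"]
      assms l l' j Obj_nth by (simp add: index_simps)
qed

lemma asc_AE_iso:
  assumes "Xs \<in> Obj AE" "Ys \<in> Obj AE" "Zs \<in> Obj AE"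
  shows "is_iso AE (ten_list C (ten_list C Xs Ys) Zs) (ten_list C Xs (ten_list C Ys Zs)) (asc AE Xs Ys Zs)"
  unfolding asc_AE by (rule dg_iso) (use assms ten_Obj adiag_iso in \<open>auto simp: mult.assoc\<close>)

text \<open>Every axiom is checked entry by entry and reduces to the same axiom of \<open>C\<close>,
  applied to the summands that are selected by the digits of the row and column indices.\<close>

lemma AE_symmetric_monoidal: "symmetric_monoidal_category AE"
proof (intro symmetric_monoidal_category.intro AE_category, unfold_locales, goal_cases)
  case 1 then show ?case by (simp add: AE_simps Obj_AE unt_in)
next
  case 2 then show ?case by (simp add: AE_simps ten_Obj)
next
  case (3 X Y X' Y' f f')
  then obtain F F' where *: "f = mk_arrow X Y F" "mor X Y F" "f' = mk_arrow X' Y' F'" "mor X' Y' F'" by (auto simp: Hom_AE)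
  show ?case unfolding * AE_simps ten_AE Hom_AE_mk mor_def
  proof (intro allI impI)
    fix i j assume i: "i < length (ten_list C Y Y')" and j: "j < length (ten_list C X X')"
    then have ij: "i < length Y * length Y'" "j < length X * length X'" by simp_all
    show "F (i div length Y') (j div length X') \<otimes>\<^sub>m F' (i mod length Y') (j mod length X') \<in> Hom C (ten_list C X X' ! j) (ten_list C Y Y' ! i)"
      using *(2,4) ij index_less[OF ij(1)] index_less[OF ij(2)] 3(1-4) Obj_nth
      by (simp add: mor_def tenM_in)
  qed
next
  case (4 X Y)
  show ?case unfolding idm_AE AE_simps
    by (subst dg_ten) (use 4 ten_nth_Obj in \<open>auto intro!: dg_cong simp: tenM_idm\<close>)
next
  case (5 X Y Z X' Y' Z' f g f' g')
  then obtain F G F' G' where *: "f = mk_arrow X Y F" "mor X Y F" "f' = mk_arrow X' Y' F'" "mor X' Y' F'"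
     "g = mk_arrow Y Z G" "mor Y Z G" "g' = mk_arrow Y' Z' G'" "mor Y' Z' G'" by (auto simp: Hom_AE)
  show ?case unfolding * cmp_AE ten_AE
  proof (rule mk_arrow_eqI)
    fix i j assume "i < length (ten_list C Z Z')" "j < length (ten_list C X X')"
    then have ij: "i < length Z * length Z'" "j < length X * length X'" by simp_all
    note l = index_less[OF ij(1)] index_less[OF ij(2)]
    let ?i = "i div length Z'" and ?i' = "i mod length Z'" and ?j = "j div length X'" and ?j' = "j mod length X'"
    have "(\<Sum>l<length Y. G ?i l \<cdot> F l ?j) \<otimes>\<^sub>m (\<Sum>l<length Y'. G' ?i' l \<cdot> F' l ?j')
      = (\<Sum>a<length Y. \<Sum>b<length Y'. (G ?i a \<otimes>\<^sub>m G' ?i' b) \<cdot> (F a ?j \<otimes>\<^sub>m F' b ?j'))"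
      unfolding ten_sum_l unfolding ten_sum_r
    proof (intro sum.cong refl)
      fix a b assume "a \<in> {..<length Y}" "b \<in> {..<length Y'}"
      then show "(G ?i a \<cdot> F a ?j) \<otimes>\<^sub>m (G' ?i' b \<cdot> F' b ?j') = (G ?i a \<otimes>\<^sub>m G' ?i' b) \<cdot> (F a ?j \<otimes>\<^sub>m F' b ?j')"
        using * l 5(1-6) Obj_nth
        by (intro tenM_cmp[of "X ! ?j" "Y ! a" "Z ! ?i" "X' ! ?j'" "Y' ! b" "Z' ! ?i'"]) (auto simp: mor_def)
    qed
    also have "\<dots> = (\<Sum>l<length (ten_list C Y Y'). (G ?i (l div length Y') \<otimes>\<^sub>m G' ?i' (l mod length Y'))
        \<cdot> (F (l div length Y') ?j \<otimes>\<^sub>m F' (l mod length Y') ?j'))"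
      unfolding ten_list_length sum_index by (intro sum.cong refl) simp
    finally show "(\<Sum>l<length Y. G ?i l \<cdot> F l ?j) \<otimes>\<^sub>m (\<Sum>l<length Y'. G' ?i' l \<cdot> F' l ?j') = \<dots>" .
  qed
next
  case 6 then show ?case by (simp add: AE_simps asc_AE_iso)
next
  case (7 X Y Z X' Y' Z' f g h)
  then obtain F G H where *: "f = mk_arrow X X' F" "mor X X' F" "g = mk_arrow Y Y' G" "mor Y Y' G" "h = mk_arrow Z Z' H" "mor Z Z' H"
    by (auto simp: Hom_AE)
  show ?case unfolding * ten_AE asc_AE
  proof (subst dg_cmp_left, (simp add: mult.assoc; fail), subst dg_cmp_right, (simp add: mult.assoc; fail), rule mk_arrow_eqI)
    fix i j assume "i < length (ten_list C X' (ten_list C Y' Z'))" "j < length (ten_list C (ten_list C X Y) Z)"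
    then have ij: "i < length X' * length Y' * length Z'" "j < length X * length Y * length Z" by (simp_all add: mult.assoc)
    note l = index_less[OF ij(1)] index_less[OF ij(2)] index_less[OF index_less(1)[OF ij(1)]] index_less[OF index_less(1)[OF ij(2)]]
    have "asc C (X' ! (i div length Z' div length Y')) (Y' ! ((i div length Z') mod length Y')) (Z' ! (i mod length Z')) \<cdot>
      ((F (i div length Z' div length Y') (j div length Z div length Y) \<otimes>\<^sub>m G ((i div length Z') mod length Y') ((j div length Z) mod length Y))
         \<otimes>\<^sub>m H (i mod length Z') (j mod length Z))
      = (F (i div length Z' div length Y') (j div length Z div length Y) \<otimes>\<^sub>m (G ((i div length Z') mod length Y') ((j div length Z) mod length Y)
         \<otimes>\<^sub>m H (i mod length Z') (j mod length Z))) \<cdot>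
        asc C (X ! (j div length Z div length Y)) (Y ! ((j div length Z) mod length Y)) (Z ! (j mod length Z))"
      using * l 7(1-6) Obj_nth by (intro asc_nat) (auto simp: mor_def)
    then show "adiag X' Y' Z' i \<cdot> ((F (i div length Z' div length Y') (j div length Z div length Y) \<otimes>\<^sub>m
         G ((i div length Z') mod length Y') ((j div length Z) mod length Y)) \<otimes>\<^sub>m H (i mod length Z') (j mod length Z))
      = (F (i div length (ten_list C Y' Z')) (j div length (ten_list C Y Z)) \<otimes>\<^sub>m
         (G (i mod length (ten_list C Y' Z') div length Z') (j mod length (ten_list C Y Z) div length Z) \<otimes>\<^sub>m
          H (i mod length (ten_list C Y' Z') mod length Z') (j mod length (ten_list C Y Z) mod length Z))) \<cdot> adiag X Y Z j"
      by (simp add: adiag_def index_simps)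
  qed
next
  case (8 X)
  then show ?case unfolding AE_simps lun_AE
    by (intro dg_iso ten_Obj unt_Obj) (use Obj_nth lun_iso in auto)
next
  case (9 X Y f)
  then obtain F where F: "f = mk_arrow X Y F" "mor X Y F" by (auto simp: Hom_AE)
  show ?case unfolding F AE_simps lun_AE idm_AE
    by (subst (2) dg_def, subst ten_AE, subst dg_cmp_left, simp, subst dg_cmp_right, simp, rule mk_arrow_eqI)
      (use F(2) 9 Obj_nth in \<open>auto simp: mor_def intro!: lun_nat\<close>)
next
  case (10 X)
  then show ?case unfolding AE_simps run_AE
    by (intro dg_iso ten_Obj unt_Obj) (use Obj_nth run_iso in auto)
next
  case (11 X Y f)
  then obtain F where F: "f = mk_arrow X Y F" "mor X Y F" by (auto simp: Hom_AE)
  show ?case unfolding F AE_simps run_AE idm_AE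
    by (subst (2) dg_def, subst ten_AE, subst dg_cmp_left, simp, subst dg_cmp_right, simp, rule mk_arrow_eqI)
      (use F(2) 11 Obj_nth in \<open>auto simp: mor_def intro!: run_nat\<close>)
next
  case (12 W X Y Z)
  show ?case unfolding AE_simps asc_AE idm_AE
    apply (subst dg_ten, simp, simp add: mult.assoc)
    apply (subst dg_ten, simp add: mult.assoc, simp)
    apply (subst dg_dg, simp add: mult.assoc, simp add: mult.assoc)
    apply (subst dg_dg, simp add: mult.assoc, simp add: mult.assoc)
    apply (subst dg_dg, simp add: mult.assoc, simp add: mult.assoc)
    apply (rule dg_cong)
    subgoal for j
    proof -
      assume "j < length (ten_list C (ten_list C (ten_list C W X) Y) Z)"
      then have j: "j < length W * length X * length Y * length Z" by simp
      have j': "j < length W * (length X * length Y * length Z)" using j by (simp add: mult.assoc)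
      note l = index_less[OF j] index_less[OF index_less(1)[OF j]] index_less[OF index_less(1)[OF index_less(1)[OF j]]]
        index_less[OF j', unfolded index_simps]
      \<comment> \<open>Two further groupings of the four digits: in the pentagon \<open>asc\<close>
        also occurs with a product in its last and in its middle argument.\<close>
      have "j < (length W * length X) * (length Y * length Z)" "j div length Z < length W * (length X * length Y)"
        using j l(1) by (simp_all add: mult.assoc)
      note m = index_less(2)[OF this(1)] index_less(2)[OF this(2)]
      show ?thesis unfolding adiag_def
        using l m 12 pentagon Obj_nth by (simp add: index_simps)
    qed
    done
next
  case (13 X Y)
  show ?case unfolding AE_simps asc_AE idm_AE lun_AE run_AE
    apply (subst dg_ten, simp, simp)
    apply (subst dg_ten, simp, simp)
    apply (subst dg_dg, simp, simp)
    apply (rule dg_cong)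
    subgoal for j
      using 13 index_less[of j "length X" "length Y"] Obj_nth triangle by (simp add: adiag_def)
    done
next
  case (14 X Y)
  show ?case unfolding brd_AE AE_simps mono_def Hom_AE_mk mor_def
  proof (intro allI impI)
    fix i j assume "i < length (ten_list C Y X)" "j < length (ten_list C X Y)"
    then have ij: "i < length Y * length X" "j < length X * length Y" by simp_all
    note l = index_less[OF ij(1)] index_less[OF ij(2)]
    show "(if i = flip (length X) (length Y) j then brd C (X ! (j div length Y)) (Y ! (j mod length Y)) else 0)
      \<in> Hom C (ten_list C X Y ! j) (ten_list C Y X ! i)"
      using ij l 14 Obj_nth brd_in by (auto simp: flip_def tenO_in)
  qed
next
  case (15 X Y X' Y' f g)
  then obtain F G where *: "f = mk_arrow X X' F" "mor X X' F" "g = mk_arrow Y Y' G" "mor Y Y' G" by (auto simp: Hom_AE)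
  show ?case unfolding * ten_AE brd_AE
  proof (subst mono_cmp_left[where \<rho> = "flip (length Y') (length X')"])
    show "\<And>i l. i < length (ten_list C Y' X') \<Longrightarrow> l < length (ten_list C X' Y') \<Longrightarrow> (i = flip (length X') (length Y') l) = (l = flip (length Y') (length X') i)"
      using flip_iff by simp
    show "\<And>i. i < length (ten_list C Y' X') \<Longrightarrow> flip (length Y') (length X') i < length (ten_list C X' Y')"
      using flip_less by simp
    show "mk_arrow (ten_list C X Y) (ten_list C Y' X')
       (\<lambda>i j. brd C (X' ! (flip (length Y') (length X') i div length Y')) (Y' ! (flip (length Y') (length X') i mod length Y')) \<cdot>
         (F (flip (length Y') (length X') i div length Y') (j div length Y) \<otimes>\<^sub>m G (flip (length Y') (length X') i mod length Y') (j mod length Y)))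
      = mk_arrow (ten_list C Y X) (ten_list C Y' X') (\<lambda>i j. G (i div length X') (j div length X) \<otimes>\<^sub>m F (i mod length X') (j mod length X))
        \<cdot>\<^bsub>AE\<^esub> mono (ten_list C X Y) (ten_list C Y X) (flip (length X) (length Y)) (\<lambda>j. brd C (X ! (j div length Y)) (Y ! (j mod length Y)))"
    proof (subst mono_cmp_right)
      show "\<And>j. j < length (ten_list C X Y) \<Longrightarrow> flip (length X) (length Y) j < length (ten_list C Y X)" using flip_less by simp
      show "mk_arrow (ten_list C X Y) (ten_list C Y' X')
       (\<lambda>i j. brd C (X' ! (flip (length Y') (length X') i div length Y')) (Y' ! (flip (length Y') (length X') i mod length Y')) \<cdot>
         (F (flip (length Y') (length X') i div length Y') (j div length Y) \<otimes>\<^sub>m G (flip (length Y') (length X') i mod length Y') (j mod length Y)))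
       = mk_arrow (ten_list C X Y) (ten_list C Y' X')
       (\<lambda>i j. (G (i div length X') (flip (length X) (length Y) j div length X) \<otimes>\<^sub>m F (i mod length X') (flip (length X) (length Y) j mod length X)) \<cdot>
          brd C (X ! (j div length Y)) (Y ! (j mod length Y)))"
      proof (rule mk_arrow_eqI)
        fix i j assume "i < length (ten_list C Y' X')" "j < length (ten_list C X Y)"
        then have ij: "i < length Y' * length X'" "j < length X * length Y" by simp_all
        note l = index_less[OF ij(1)] index_less[OF ij(2)]
        show "brd C (X' ! (flip (length Y') (length X') i div length Y')) (Y' ! (flip (length Y') (length X') i mod length Y')) \<cdot>
         (F (flip (length Y') (length X') i div length Y') (j div length Y) \<otimes>\<^sub>m G (flip (length Y') (length X') i mod length Y') (j mod length Y))
         = (G (i div length X') (flip (length X) (length Y) j div length X) \<otimes>\<^sub>m F (i mod length X') (flip (length X) (length Y) j mod length X)) \<cdot>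
          brd C (X ! (j div length Y)) (Y ! (j mod length Y))"
          using l * 15(1-4) Obj_nth by (simp add: flip_def mor_def brd_nat)
      qed
    qed
  qed
next
  case (16 X Y)
  show ?case unfolding brd_AE AE_simps idm_AE dg_mono
    apply (subst mono_cmp, simp add: flip_less)
    apply (rule mono_eqI)
    subgoal for j
    proof -
      assume "j < length (ten_list C X Y)"
      then have j: "j < length X * length Y" by simp
      note l = index_less[OF j]
      show ?thesis using l j 16 Obj_nth brd_sym by (simp add: flip_def)
    qed
    done
next
  case (17 X Y Z)
  let ?x = "length X" and ?y = "length Y" and ?z = "length Z"
  have f1: "flip ?x (?y * ?z) j < ?y * (?z * ?x)" if "j < ?x * (?y * ?z)" for j
    using flip_less[OF that] by (simp add: mult.assoc)
  have f2: "flip ?x ?y (j div ?z) * ?z + j mod ?z < ?y * (?x * ?z)" if "j < ?x * (?y * ?z)" for j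
  proof -
    have "j < ?x * ?y * ?z" using that by (simp add: mult.assoc)
    then have "flip ?x ?y (j div ?z) * ?z + j mod ?z < (?y * ?x) * ?z"
      by (intro index_pair flip_less index_less)
    then show ?thesis by (simp add: mult.assoc)
  qed
  show ?case unfolding AE_simps asc_AE idm_AE brd_AE dg_mono
    apply (subst mono_cmp, simp add: f1 mult.assoc)
    apply (subst mono_cmp, simp add: mult.assoc)
    apply (subst mono_ten, simp add: flip_less)
    apply (subst mono_ten, simp)
    apply (subst mono_cmp, simp add: mult.assoc)
    apply (subst mono_cmp, simp add: f2 mult.assoc)
    apply (rule mono_eqI)
    subgoal for j
    proof -
      assume "j < length (ten_list C (ten_list C X Y) Z)"
      then have j: "j < ?x * ?y * ?z" by simp
      have j': "j < ?x * (?y * ?z)" using j by (simp add: mult.assoc)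
      \<comment> \<open>The column index \<open>j\<close> belongs to the summand with digits
        \<open>a\<close>, \<open>b\<close>, \<open>c\<close>; all rearranged indices of the hexagon
        are rewritten in these digits.\<close>
      define a b c where "a = j div ?z div ?y" and "b = j div ?z mod ?y" and "c = j mod ?z"
      have abc: "a < ?x" "b < ?y" "c < ?z"
        unfolding a_def b_def c_def using index_less[OF j] index_less[OF index_less(1)[OF j]] by auto
      have d: "j div ?z = a * ?y + b" unfolding a_def b_def by simp
      have c: "j mod ?z = c" by (simp only: c_def)
      have bz: "b * ?z + c < ?y * ?z" by (intro index_pair abc)
      have m: "j mod (?y * ?z) = b * ?z + c"
      proof -
        have "j mod (?y * ?z) div ?z = b" "j mod (?y * ?z) mod ?z = c" using abc by (simp_all add: index_simps d c)
        then show ?thesis using div_mult_mod_eq[of "j mod (?y * ?z)" ?z] by simp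
      qed
      have v: "j div (?y * ?z) = a" using abc by (simp add: index_simps d)
      have F: "flip ?x (?y * ?z) j = (b * ?z + c) * ?x + a"
        by (simp add: flip_def m v)
      have G: "flip ?x ?y (a * ?y + b) = b * ?x + a" using abc by (simp add: flip_def)
      have K: "flip ?x ?z (a * ?z + c) = c * ?x + a" using abc by (simp add: flip_def)
      have az: "a * ?z + c < ?x * ?z" by (intro index_pair abc)
      have q: "((b * ?x + a) * ?z + c) div (?x * ?z) = b" "((b * ?x + a) * ?z + c) mod (?x * ?z) = a * ?z + c"
      proof -
        have "(b * ?x + a) * ?z + c = b * (?x * ?z) + (a * ?z + c)" by (simp add: algebra_simps)
        then show "((b * ?x + a) * ?z + c) div (?x * ?z) = b" "((b * ?x + a) * ?z + c) mod (?x * ?z) = a * ?z + c"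
          using az by (simp_all only: index_pair_simps)
      qed
      have o: "X ! a \<in> Obj C" "Y ! b \<in> Obj C" "Z ! c \<in> Obj C" using 17 abc Obj_nth by auto
      have N: "b * (?z * ?x) + (c * ?x + a) = (b * ?z + c) * ?x + a" by (simp add: algebra_simps)
      have A: "adiag Y Z X ((b * ?z + c) * ?x + a) = asc C (Y ! b) (Z ! c) (X ! a)"
        "adiag X Y Z j = asc C (X ! a) (Y ! b) (Z ! c)"
        "adiag Y X Z ((b * ?x + a) * ?z + c) = asc C (Y ! b) (X ! a) (Z ! c)"
        using abc by (simp_all add: adiag_def d c)
      show ?thesis
        using hexagon[OF o] abc bz az
        by (simp add: F G K d c m v q A N)
    qed
    done
qed

end

section \<open>Linear structure and direct sums of the additive envelope\<close>

context enriched_category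
begin

lemma mor_add: "Xs \<in> Obj AE \<Longrightarrow> Ys \<in> Obj AE \<Longrightarrow> mor Xs Ys F \<Longrightarrow> mor Xs Ys G \<Longrightarrow> mor Xs Ys (\<lambda>i j. F i j + G i j)"
  unfolding mor_def using Obj_nth by (auto intro!: Hom_add)

lemma mor_scale: "Xs \<in> Obj AE \<Longrightarrow> Ys \<in> Obj AE \<Longrightarrow> mor Xs Ys F \<Longrightarrow> mor Xs Ys (\<lambda>i j. c *\<^sub>m F i j)"
  unfolding mor_def using Obj_nth by (auto intro!: smul_in)

lemma mor_zero: "Xs \<in> Obj AE \<Longrightarrow> Ys \<in> Obj AE \<Longrightarrow> mor Xs Ys (\<lambda>i j. 0)"
  unfolding mor_def using Obj_nth by auto

lemma AE_linear: "linear_category AE"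
proof (intro linear_category.intro AE_category, unfold_locales, goal_cases)
  case 1 then show ?case by (simp add: AE_simps mor_zero)
next
  case (2 X Y f g) then show ?case by (auto simp: Hom_AE[of _ X Y] AE_simps intro: mor_add)
next
  case (3 X Y f a) then show ?case by (auto simp: Hom_AE[of _ X Y] AE_simps intro: mor_scale)
next
  case (4 X Y f g h) then show ?case by (auto simp: Hom_AE[of _ X Y] AE_simps add.assoc)
next
  case (5 X Y f g) then show ?case by (auto simp: Hom_AE[of _ X Y] AE_simps add.commute)
next
  case (6 X Y f) then show ?case by (auto simp: Hom_AE[of _ X Y] AE_simps)
next
  case (7 X Y f)
  then obtain F where F: "f = mk_arrow X Y F" "mor X Y F" by (auto simp: Hom_AE)
  have neg: "((- 1) *\<^sub>m g) + g = 0" if "A \<in> Obj C" "B \<in> Obj C" "g \<in> Hom C A B" for A B g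
  proof -
    have "(- 1 + 1) *\<^sub>m g = (- 1) *\<^sub>m g + 1 *\<^sub>m g"
      using smul_add_left[OF that, of "- 1" 1] by (simp add: addM_eq)
    moreover have "0 *\<^sub>m g = 0"
    proof -
      have "(0 + 0) *\<^sub>m g = 0 *\<^sub>m g + 0 *\<^sub>m g" using smul_add_left[OF that, of 0 0] by (simp add: addM_eq)
      then show ?thesis by simp
    qed
    ultimately show ?thesis using smul_one[OF that] by simp
  qed
  have "mk_arrow X Y (\<lambda>i j. (- 1) *\<^sub>m F i j) \<oplus>\<^sub>m\<^bsub>AE\<^esub> f = zeroM AE X Y"
    unfolding F(1) AE_simps
    by (rule mk_arrow_eqI, rule neg[of "X ! _" "Y ! _"]) (use 7 F Obj_nth in \<open>auto simp: mor_def\<close>)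
  moreover have "mk_arrow X Y (\<lambda>i j. (- 1) *\<^sub>m F i j) \<in> Hom AE X Y" using 7 F(2) by (simp add: mor_scale)
  ultimately show ?case by blast
next
  case (8 X Y f)
  then obtain F where F: "f = mk_arrow X Y F" "mor X Y F" by (auto simp: Hom_AE)
  show ?case unfolding F AE_simps
    by (rule mk_arrow_eqI, rule smul_one[of "X ! _" "Y ! _"]) (use 8 F Obj_nth in \<open>auto simp: mor_def\<close>)
next
  case (9 X Y f a b)
  then obtain F where F: "f = mk_arrow X Y F" "mor X Y F" by (auto simp: Hom_AE)
  show ?case unfolding F AE_simps
    by (rule mk_arrow_eqI, rule smul_smul[of "X ! _" "Y ! _"]) (use 9 F Obj_nth in \<open>auto simp: mor_def\<close>)
next
  case (10 X Y f a b)
  then obtain F where F: "f = mk_arrow X Y F" "mor X Y F" by (auto simp: Hom_AE)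
  show ?case unfolding F AE_simps
    by (rule mk_arrow_eqI, rule smul_add_left[of "X ! _" "Y ! _", unfolded addM_eq]) (use 10 F Obj_nth in \<open>auto simp: mor_def\<close>)
next
  case (11 X Y f g a)
  then show ?case by (auto simp: Hom_AE[of _ X Y] AE_simps scale_add_r)
next
  case (12 X Y Z f g g')
  then show ?case by (auto simp: Hom_AE[of _ X Y] Hom_AE[of _ Y Z] AE_simps cmp_AE cmp_add_l sum.distrib)
next
  case (13 X Y Z f f' g)
  then show ?case by (auto simp: Hom_AE[of _ X Y] Hom_AE[of _ Y Z] AE_simps cmp_AE cmp_add_r sum.distrib)
next
  case (14 X Y Z f g a)
  then show ?case by (auto simp: Hom_AE[of _ X Y] Hom_AE[of _ Y Z] AE_simps cmp_AE scale_cmp_l scale_sum_r)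
next
  case (15 X Y Z f g a)
  then show ?case by (auto simp: Hom_AE[of _ X Y] Hom_AE[of _ Y Z] AE_simps cmp_AE scale_cmp_r scale_sum_r)
qed

lemma AE_zero_object: "zero_object AE []"
proof -
  have "\<exists>!f. f \<in> Hom AE [] X" "\<exists>!f. f \<in> Hom AE X []" for X
  proof -
    show "\<exists>!f. f \<in> Hom AE [] X"
      by (rule ex1I[of _ "mk_arrow [] X (\<lambda>_ _. 0)"]) (auto simp: mor_def Hom_AE[of _ "[]" X] intro!: mk_arrow_eqI)
    show "\<exists>!f. f \<in> Hom AE X []"
      by (rule ex1I[of _ "mk_arrow X [] (\<lambda>_ _. 0)"]) (auto simp: mor_def Hom_AE[of _ X "[]"] intro!: mk_arrow_eqI)
  qed
  then show ?thesis by (simp add: zero_object_def Obj_AE)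
qed

lemma sum_if_eq: "(\<Sum>l<(n::nat). if l = a then f l else (0::'m)) = (if a < n then f a else 0)"
  by (subst sum.delta) simp_all

text \<open>Block inclusions and projections exhibit concatenation as direct sum. Finite dimension
  and duals are later carried from one-element lists to all lists by passing from \<open>Xs\<close>
  to \<open>[X] @ Xs\<close>.\<close>

lemma AE_direct_sum:
  assumes X: "X \<in> Obj AE" and Y: "Y \<in> Obj AE"
  shows "is_direct_sum AE [X, Y] (X @ Y)"
proof -
  let ?x = "length X" and ?Z = "X @ Y"
  have Z: "?Z \<in> Obj AE" using X Y by (simp add: Obj_AE)
  define i0 where "i0 = mk_arrow X ?Z (\<lambda>i j. if i = j then idm C (X ! j) else 0)"
  define i1 where "i1 = mk_arrow Y ?Z (\<lambda>i j. if i = ?x + j then idm C (Y ! j) else 0)"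
  define p0 where "p0 = mk_arrow ?Z X (\<lambda>i j. if i = j then idm C (X ! i) else 0)"
  define p1 where "p1 = mk_arrow ?Z Y (\<lambda>i j. if j = ?x + i then idm C (Y ! i) else 0)"
  have id: "idm C A \<cdot> idm C A = idm C A" if "A \<in> Obj C" for A
    by (rule idm_left) (use that idm_in in auto)
  have H: "i0 \<in> Hom AE X ?Z" "i1 \<in> Hom AE Y ?Z" "p0 \<in> Hom AE ?Z X" "p1 \<in> Hom AE ?Z Y"
    unfolding i0_def i1_def p0_def p1_def Hom_AE_mk mor_def using X Y Z Obj_nth idm_in
    by (auto simp: nth_append)
  have c: "p0 \<cdot>\<^bsub>AE\<^esub> i0 = idm AE X" "p1 \<cdot>\<^bsub>AE\<^esub> i1 = idm AE Y" "p1 \<cdot>\<^bsub>AE\<^esub> i0 = zeroM AE X Y" "p0 \<cdot>\<^bsub>AE\<^esub> i1 = zeroM AE Y X"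
    unfolding i0_def i1_def p0_def p1_def cmp_AE AE_simps idm_AE dg_def
    using id X Y Obj_nth
    by (auto intro!: mk_arrow_eqI sum.neutral simp: if_distrib[of "\<lambda>x. _ \<cdot> x"] cong: if_cong)
  have "i0 \<cdot>\<^bsub>AE\<^esub> p0 \<oplus>\<^sub>m\<^bsub>AE\<^esub> i1 \<cdot>\<^bsub>AE\<^esub> p1 = idm AE ?Z"
    unfolding i0_def i1_def p0_def p1_def cmp_AE AE_simps idm_AE dg_def
  proof (rule mk_arrow_eqI)
    fix i j assume "i < length ?Z" "j < length ?Z"
    then have ij: "i < ?x + length Y" "j < ?x + length Y" by simp_all
    have 1: "(\<Sum>l<?x. (if i = l then idm C (X ! l) else 0) \<cdot> (if l = j then idm C (X ! l) else 0)) = (if i = j \<and> j < ?x then idm C (X ! j) else 0)"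
    proof -
      have "(\<Sum>l<?x. (if i = l then idm C (X ! l) else 0) \<cdot> (if l = j then idm C (X ! l) else 0))
        = (\<Sum>l<?x. if l = j then (if i = j then idm C (X ! j) else 0) else 0)"
        by (intro sum.cong refl) (use id X Obj_nth in auto)
      then show ?thesis unfolding sum_if_eq by simp
    qed
    have 2: "(\<Sum>l<length Y. (if i = ?x + l then idm C (Y ! l) else 0) \<cdot> (if j = ?x + l then idm C (Y ! l) else 0)) = (if i = j \<and> ?x \<le> j then idm C (Y ! (j - ?x)) else 0)"
    proof -
      have "(\<Sum>l<length Y. (if i = ?x + l then idm C (Y ! l) else 0) \<cdot> (if j = ?x + l then idm C (Y ! l) else 0))
        = (\<Sum>l<length Y. if l = j - ?x then (if i = j \<and> ?x \<le> j then idm C (Y ! (j - ?x)) else 0) else 0)"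
        by (intro sum.cong refl) (use id Y Obj_nth in auto)
      then show ?thesis unfolding sum_if_eq using ij by auto
    qed
    show "(\<Sum>l<?x. (if i = l then idm C (X ! l) else 0) \<cdot> (if l = j then idm C (X ! l) else 0))
      + (\<Sum>l<length Y. (if i = ?x + l then idm C (Y ! l) else 0) \<cdot> (if j = ?x + l then idm C (Y ! l) else 0))
      = (if i = j then idm C (?Z ! j) else 0)"
      unfolding 1 2 using ij by (auto simp: nth_append)
  qed
  moreover have "i1 \<cdot>\<^bsub>AE\<^esub> p1 \<oplus>\<^sub>m\<^bsub>AE\<^esub> zeroM AE ?Z ?Z = i1 \<cdot>\<^bsub>AE\<^esub> p1"
    unfolding i1_def p1_def cmp_AE AE_simps by simp
  ultimately have s: "hom_sum AE ?Z ?Z [i0 \<cdot>\<^bsub>AE\<^esub> p0, i1 \<cdot>\<^bsub>AE\<^esub> p1] = idm AE ?Z"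
    by (simp add: hom_sum_def)
  have two: "j = 0 \<or> j = 1" if "j < length [X, Y]" for j using that by auto
  have u: "[0..<length [X, Y]] = [0, 1]" by (simp add: upt_rec)
  let ?i = "\<lambda>j::nat. if j = 0 then i0 else i1" and ?p = "\<lambda>j::nat. if j = 0 then p0 else p1"
  have "?i j \<in> Hom AE ([X, Y] ! j) ?Z \<and> ?p j \<in> Hom AE ?Z ([X, Y] ! j)" if "j < length [X, Y]" for j
    using two[OF that] H by auto
  moreover have "?p l \<cdot>\<^bsub>AE\<^esub> ?i j = (if j = l then idm AE ([X, Y] ! j) else zeroM AE ([X, Y] ! j) ([X, Y] ! l))"
    if "j < length [X, Y]" "l < length [X, Y]" for j l
    using two[OF that(1)] two[OF that(2)] c by auto
  moreover have "hom_sum AE ?Z ?Z (map (\<lambda>j. ?i j \<cdot>\<^bsub>AE\<^esub> ?p j) [0..<length [X, Y]]) = idm AE ?Z"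
    unfolding u using s by simp
  moreover have "set [X, Y] \<subseteq> Obj AE" using X Y by simp
  ultimately show ?thesis unfolding is_direct_sum_def using Z
    by (intro conjI exI[of _ ?i] exI[of _ ?p] allI impI) simp_all
qed

lemma AE_additive: "additive_category AE"
  by (intro additive_category.intro AE_linear, unfold_locales) (use AE_zero_object AE_direct_sum in blast)+

lemma AE_tensor: "tensor_category AE"
proof (intro tensor_category.intro AE_symmetric_monoidal AE_additive, unfold_locales, goal_cases)
  case (1 X Y X' Y' f g h) then show ?case by (auto simp: Hom_AE[of _ X Y] Hom_AE[of _ X' Y'] AE_simps ten_AE ten_add_l)
next
  case (2 X Y X' Y' f g h) then show ?case by (auto simp: Hom_AE[of _ X Y] Hom_AE[of _ X' Y'] AE_simps ten_AE ten_add_r)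
next
  case (3 X Y X' Y' f g) then show ?case by (auto simp: Hom_AE[of _ X Y] Hom_AE[of _ X' Y'] AE_simps ten_AE scale_ten_l)
next
  case (4 X Y X' Y' f g) then show ?case by (auto simp: Hom_AE[of _ X Y] Hom_AE[of _ X' Y'] AE_simps ten_AE scale_ten_r)
qed

lemma AE_typed: "typed_tensor_category AE src tgt"
proof -
  interpret A: tensor_category AE by (rule AE_tensor)
  show ?thesis
    by unfold_locales (auto simp: Hom_AE, auto simp: additive_envelope_def diag_arrow_def)
qed

text \<open>A morphism with a nonzero entry \<open>x\<close> in position \<open>(i, j)\<close> is multiplied by the matrix whose only
  entry is \<open>y\<close> in position \<open>(j, i)\<close>; the powers of the product have the powers of \<open>yx\<close> on the diagonal.\<close>

lemma AE_semiprime: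
  assumes "semiprime C"
  shows "semiprime AE"
  unfolding semiprime_def
proof (intro ballI impI)
  fix X Y f assume X: "X \<in> Obj AE" and Y: "Y \<in> Obj AE" and f: "f \<in> Hom AE X Y" and nz: "f \<noteq> zeroM AE X Y"
  obtain F where F: "f = mk_arrow X Y F" "mor X Y F" using f Hom_AE by blast
  obtain i j where ij: "i < length Y" "j < length X" "F i j \<noteq> 0"
    using nz unfolding F AE_simps by (metis mk_arrow_eqI)
  have o: "X ! j \<in> Obj C" "Y ! i \<in> Obj C" using ij X Y Obj_nth by auto
  have "F i j \<in> Hom C (X ! j) (Y ! i)" using F(2) ij by (simp add: mor_def)
  then obtain y where y: "y \<in> Hom C (Y ! i) (X ! j)" and nn: "\<And>n. cpow C (X ! j) (y \<cdot> F i j) n \<noteq> 0"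
    using assms o ij(3) unfolding semiprime_def zeroM_eq by blast
  let ?y = "mk_arrow Y X (\<lambda>a b. if a = j \<and> b = i then y else 0)"
  have yH: "?y \<in> Hom AE Y X" using y X Y Obj_nth by (auto simp: mor_def)
  have yx: "?y \<cdot>\<^bsub>AE\<^esub> f = mk_arrow X X (\<lambda>a b. if a = j then y \<cdot> F i b else 0)"
    unfolding F cmp_AE
  proof (rule mk_arrow_eqI)
    fix a b
    have "(\<Sum>l<length Y. (if a = j \<and> l = i then y else 0) \<cdot> F l b) = (\<Sum>l<length Y. if l = i then (if a = j then y \<cdot> F i b else 0) else 0)"
      by (rule sum.cong) auto
    then show "(\<Sum>l<length Y. (if a = j \<and> l = i then y else 0) \<cdot> F l b) = (if a = j then y \<cdot> F i b else 0)"
      using ij by simp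
  qed
  have pow: "\<exists>G. cpow AE X (?y \<cdot>\<^bsub>AE\<^esub> f) n = mk_arrow X X G \<and> (\<forall>l<length X. G l j = (if l = j then cpow C (X ! j) (y \<cdot> F i j) n else 0))" for n
  proof (induction n)
    case 0
    show ?case
      by (rule exI[of _ "\<lambda>a b. if a = b then idm C (X ! b) else 0"]) (simp add: idm_AE dg_def)
  next
    case (Suc n)
    then obtain G where G: "cpow AE X (?y \<cdot>\<^bsub>AE\<^esub> f) n = mk_arrow X X G"
      "\<forall>l<length X. G l j = (if l = j then cpow C (X ! j) (y \<cdot> F i j) n else 0)" by blast
    let ?G = "\<lambda>a b. \<Sum>l<length X. (if a = j then y \<cdot> F i l else 0) \<cdot> G l b"
    have "cpow AE X (?y \<cdot>\<^bsub>AE\<^esub> f) (Suc n) = mk_arrow X X ?G"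
    proof -
      have "cpow AE X (?y \<cdot>\<^bsub>AE\<^esub> f) (Suc n) = (?y \<cdot>\<^bsub>AE\<^esub> f) \<cdot>\<^bsub>AE\<^esub> mk_arrow X X G" using G(1) by simp
      then show ?thesis unfolding yx cmp_AE .
    qed
    moreover have "?G a j = (if a = j then cpow C (X ! j) (y \<cdot> F i j) (Suc n) else 0)" for a
    proof -
      have "?G a j = (\<Sum>l<length X. if l = j then (if a = j then (y \<cdot> F i j) \<cdot> cpow C (X ! j) (y \<cdot> F i j) n else 0) else 0)"
        by (rule sum.cong) (use G(2) in auto)
      then show ?thesis using ij by simp
    qed
    ultimately show ?case by blast
  qed
  show "\<exists>y\<in>Hom AE Y X. \<forall>n. cpow AE X (y \<cdot>\<^bsub>AE\<^esub> f) n \<noteq> zeroM AE X X"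
  proof (intro bexI[OF _ yH] allI notI)
    fix n assume z: "cpow AE X (?y \<cdot>\<^bsub>AE\<^esub> f) n = zeroM AE X X"
    obtain G where G: "cpow AE X (?y \<cdot>\<^bsub>AE\<^esub> f) n = mk_arrow X X G" "G j j = cpow C (X ! j) (y \<cdot> F i j) n"
      using pow[of n] ij by auto
    have "G j j = 0" by (rule mk_arrow_eqD[of X X G "\<lambda>_ _. 0"]) (use G z ij in \<open>simp_all add: AE_simps\<close>)
    then show False using G(2) nn by simp
  qed
qed

end

section \<open>Direct sums: finiteness and duals\<close>

context typed_linear_category
begin

lemma hom_sum_cmp_right:
  assumes "arr h" "cd h = X" "Y \<in> Obj C" "\<And>f. f \<in> set fs \<Longrightarrow> arr f \<and> dm f = X \<and> cd f = Y"
  shows "hom_sum C X Y fs \<cdot> h = hom_sum C (dm h) Y (map (\<lambda>f. f \<cdot> h) fs)"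
  using assms(4)
proof (induction fs)
  case (Cons f fs)
  have X: "X \<in> Obj C" using assms by auto
  have "arr (hom_sum C X Y fs) \<and> dm (hom_sum C X Y fs) = X \<and> cd (hom_sum C X Y fs) = Y"
    by (rule hom_sum_typ[OF X assms(3)]) (use Cons.prems in auto)
  then show ?case using Cons assms by (simp add: hom_sum_Cons)
qed (use assms in \<open>auto simp: hom_sum_Nil\<close>)

lemma hom_sum_cmp_left:
  assumes "arr h" "dm h = Y" "X \<in> Obj C" "\<And>f. f \<in> set fs \<Longrightarrow> arr f \<and> dm f = X \<and> cd f = Y"
  shows "h \<cdot> hom_sum C X Y fs = hom_sum C X (cd h) (map (\<lambda>f. h \<cdot> f) fs)"
  using assms(4)
proof (induction fs)
  case (Cons f fs)
  have Y: "Y \<in> Obj C" using assms by auto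
  have "arr (hom_sum C X Y fs) \<and> dm (hom_sum C X Y fs) = X \<and> cd (hom_sum C X Y fs) = Y"
    by (rule hom_sum_typ[OF assms(3) Y]) (use Cons.prems in auto)
  then show ?case using Cons assms by (simp add: hom_sum_Cons)
qed (use assms in \<open>auto simp: hom_sum_Nil\<close>)

definition spanned :: "'o \<Rightarrow> 'o \<Rightarrow> 'm list \<Rightarrow> 'm \<Rightarrow> bool" where
  "spanned X Y bs f \<longleftrightarrow> (\<exists>cs. length cs = length bs \<and> f = hom_sum C X Y (map2 (scaleM C) cs bs))"

lemma spanned_cmp:
  assumes "\<And>b. b \<in> set bs \<Longrightarrow> arr b \<and> dm b = X \<and> cd b = Y" "spanned X Y bs f" "X \<in> Obj C" "Y \<in> Obj C"
  shows "arr h \<Longrightarrow> cd h = X \<Longrightarrow> spanned (dm h) Y (map (\<lambda>b. b \<cdot> h) bs) (f \<cdot> h)"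
    and "arr k \<Longrightarrow> dm k = Y \<Longrightarrow> spanned X (cd k) (map (\<lambda>b. k \<cdot> b) bs) (k \<cdot> f)"
proof -
  obtain cs where cs: "length cs = length bs" "f = hom_sum C X Y (map2 (scaleM C) cs bs)"
    using assms(2) by (auto simp: spanned_def)
  have t: "arr g \<and> dm g = X \<and> cd g = Y" if "g \<in> set (map2 (scaleM C) cs bs)" for g
    using that assms(1) by (auto dest!: set_zip_rightD)
  show "spanned (dm h) Y (map (\<lambda>b. b \<cdot> h) bs) (f \<cdot> h)" if h: "arr h" "cd h = X"
  proof -
    have "map (\<lambda>f. f \<cdot> h) (map2 (scaleM C) cs bs) = map2 (scaleM C) cs (map (\<lambda>b. b \<cdot> h) bs)"
      using cs(1) assms(1) h by (auto intro!: nth_equalityI)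
    moreover have "f \<cdot> h = hom_sum C (dm h) Y (map (\<lambda>f. f \<cdot> h) (map2 (scaleM C) cs bs))"
      unfolding cs(2) by (rule hom_sum_cmp_right[OF h assms(4)]) (rule t)
    ultimately show ?thesis unfolding spanned_def using cs(1) by (metis length_map)
  qed
  show "spanned X (cd k) (map (\<lambda>b. k \<cdot> b) bs) (k \<cdot> f)" if k: "arr k" "dm k = Y"
  proof -
    have "map (\<lambda>f. k \<cdot> f) (map2 (scaleM C) cs bs) = map2 (scaleM C) cs (map (\<lambda>b. k \<cdot> b) bs)"
      using cs(1) assms(1) k by (auto intro!: nth_equalityI)
    moreover have "k \<cdot> f = hom_sum C X (cd k) (map (\<lambda>f. k \<cdot> f) (map2 (scaleM C) cs bs))"
      unfolding cs(2) by (rule hom_sum_cmp_left[OF k assms(3)]) (rule t)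
    ultimately show ?thesis unfolding spanned_def using cs(1) by (metis length_map)
  qed
qed

lemma spanned_add:
  assumes "\<And>b. b \<in> set bs \<union> set bs' \<Longrightarrow> arr b \<and> dm b = X \<and> cd b = Y" "spanned X Y bs f" "spanned X Y bs' g" "X \<in> Obj C" "Y \<in> Obj C"
  shows "spanned X Y (bs @ bs') (f \<oplus>\<^sub>m g)"
proof -
  obtain cs cs' where cs: "length cs = length bs" "f = hom_sum C X Y (map2 (scaleM C) cs bs)"
    "length cs' = length bs'" "g = hom_sum C X Y (map2 (scaleM C) cs' bs')"
    using assms(2,3) by (auto simp: spanned_def)
  have "hom_sum C X Y (map2 (scaleM C) cs bs @ map2 (scaleM C) cs' bs') = f \<oplus>\<^sub>m g"
    unfolding cs(2,4) by (rule hom_sum_append[OF assms(4,5)]) (use assms(1) in \<open>auto dest!: set_zip_rightD\<close>)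
  then show ?thesis unfolding spanned_def using cs(1,3) by (intro exI[of _ "cs @ cs'"]) simp
qed

lemma finite_dim_hom_iff:
  assumes "X \<in> Obj C" "Y \<in> Obj C"
  shows "finite_dim_hom C X Y \<longleftrightarrow> (\<exists>bs. (\<forall>b\<in>set bs. arr b \<and> dm b = X \<and> cd b = Y) \<and>
    (\<forall>f. arr f \<longrightarrow> dm f = X \<longrightarrow> cd f = Y \<longrightarrow> spanned X Y bs f))"
  unfolding finite_dim_hom_def spanned_def subset_iff using Hom_iff[OF assms] by (intro ex_cong1) auto

lemma direct_sum2:
  assumes "is_direct_sum C [X, Y] Z"
  obtains i0 i1 p0 p1 where "X \<in> Obj C" "Y \<in> Obj C" "Z \<in> Obj C"
    "arr i0" "dm i0 = X" "cd i0 = Z" "arr i1" "dm i1 = Y" "cd i1 = Z"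
    "arr p0" "dm p0 = Z" "cd p0 = X" "arr p1" "dm p1 = Z" "cd p1 = Y"
    "p0 \<cdot> i0 = idm C X" "p1 \<cdot> i1 = idm C Y" "p0 \<cdot> i1 = zeroM C Y X" "p1 \<cdot> i0 = zeroM C X Y"
    "i0 \<cdot> p0 \<oplus>\<^sub>m i1 \<cdot> p1 = idm C Z"
proof -
  obtain i p where o: "set [X, Y] \<subseteq> Obj C" "Z \<in> Obj C"
    and ip: "\<And>j. j < length [X, Y] \<Longrightarrow> i j \<in> Hom C ([X, Y] ! j) Z \<and> p j \<in> Hom C Z ([X, Y] ! j)"
    and d: "\<And>j l. j < length [X, Y] \<Longrightarrow> l < length [X, Y] \<Longrightarrow> p l \<cdot> i j = (if j = l then idm C ([X, Y] ! j) else zeroM C ([X, Y] ! j) ([X, Y] ! l))"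
    and s: "hom_sum C Z Z (map (\<lambda>j. i j \<cdot> p j) [0..<length [X, Y]]) = idm C Z"
    using assms unfolding is_direct_sum_def by blast
  have XY: "X \<in> Obj C" "Y \<in> Obj C" using o by auto
  have t: "arr (i 0)" "dm (i 0) = X" "cd (i 0) = Z" "arr (i 1)" "dm (i 1) = Y" "cd (i 1) = Z"
    "arr (p 0)" "dm (p 0) = Z" "cd (p 0) = X" "arr (p 1)" "dm (p 1) = Z" "cd (p 1) = Y"
    using ip[of 0] ip[of 1] XY o(2) by (auto simp: Hom_iff)
  have u: "[0..<length [X, Y]] = [0, 1]" by (simp add: upt_rec)
  have "i 0 \<cdot> p 0 \<oplus>\<^sub>m i 1 \<cdot> p 1 = idm C Z"
    using s t o(2) unfolding u by (simp add: hom_sum_Cons hom_sum_Nil)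
  moreover have "p 0 \<cdot> i 0 = idm C X" "p 1 \<cdot> i 1 = idm C Y" "p 0 \<cdot> i 1 = zeroM C Y X" "p 1 \<cdot> i 0 = zeroM C X Y"
    using d[of 0 0] d[of 1 1] d[of 1 0] d[of 0 1] by simp_all
  ultimately show thesis using that[of "i 0" "i 1" "p 0" "p 1"] XY o(2) t by blast
qed

text \<open>Inserting \<open>i0 \<cdot> p0 \<oplus>\<^sub>m i1 \<cdot> p1\<close> for the identity
  of \<open>Z\<close> splits a morphism into two components, and spanning lists for the components
  combine.\<close>

lemma finite_dim_direct_sum:
  assumes ds: "is_direct_sum C [X, Y] Z" and W: "W \<in> Obj C"
  shows "finite_dim_hom C X W \<Longrightarrow> finite_dim_hom C Y W \<Longrightarrow> finite_dim_hom C Z W"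
    and "finite_dim_hom C W X \<Longrightarrow> finite_dim_hom C W Y \<Longrightarrow> finite_dim_hom C W Z"
proof -
  obtain i0 i1 p0 p1 where [simp]: "X \<in> Obj C" "Y \<in> Obj C" "Z \<in> Obj C"
    "arr i0" "dm i0 = X" "cd i0 = Z" "arr i1" "dm i1 = Y" "cd i1 = Z"
    "arr p0" "dm p0 = Z" "cd p0 = X" "arr p1" "dm p1 = Z" "cd p1 = Y"
    and s: "i0 \<cdot> p0 \<oplus>\<^sub>m i1 \<cdot> p1 = idm C Z"
    using direct_sum2[OF ds] by metis
  note [simp] = W
  show "finite_dim_hom C Z W" if h: "finite_dim_hom C X W" "finite_dim_hom C Y W"
  proof -
    obtain b0 where b0: "\<And>b. b \<in> set b0 \<Longrightarrow> arr b \<and> dm b = X \<and> cd b = W" "\<And>f. arr f \<Longrightarrow> dm f = X \<Longrightarrow> cd f = W \<Longrightarrow> spanned X W b0 f"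
      using h(1) by (auto simp: finite_dim_hom_iff)
    obtain b1 where b1: "\<And>b. b \<in> set b1 \<Longrightarrow> arr b \<and> dm b = Y \<and> cd b = W" "\<And>f. arr f \<Longrightarrow> dm f = Y \<Longrightarrow> cd f = W \<Longrightarrow> spanned Y W b1 f"
      using h(2) by (auto simp: finite_dim_hom_iff)
    let ?b = "map (\<lambda>b. b \<cdot> p0) b0 @ map (\<lambda>b. b \<cdot> p1) b1"
    have t: "arr b \<and> dm b = Z \<and> cd b = W" if "b \<in> set (map (\<lambda>b. b \<cdot> p0) b0) \<union> set (map (\<lambda>b. b \<cdot> p1) b1)" for b
      using that b0(1) b1(1) by auto
    have "spanned Z W ?b f" if [simp]: "arr f" "dm f = Z" "cd f = W" for f
    proof -
      have "f = f \<cdot> (i0 \<cdot> p0 \<oplus>\<^sub>m i1 \<cdot> p1)" by (simp add: s del: cmp_add)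
      also have "\<dots> = (f \<cdot> i0) \<cdot> p0 \<oplus>\<^sub>m (f \<cdot> i1) \<cdot> p1" by simp
      finally have f: "f = (f \<cdot> i0) \<cdot> p0 \<oplus>\<^sub>m (f \<cdot> i1) \<cdot> p1" .
      have "spanned Z W (map (\<lambda>b. b \<cdot> p0) b0) ((f \<cdot> i0) \<cdot> p0)"
        using spanned_cmp(1)[OF b0(1) b0(2)[of "f \<cdot> i0"], of p0] by simp
      moreover have "spanned Z W (map (\<lambda>b. b \<cdot> p1) b1) ((f \<cdot> i1) \<cdot> p1)"
        using spanned_cmp(1)[OF b1(1) b1(2)[of "f \<cdot> i1"], of p1] by simp
      ultimately show ?thesis by (subst f) (rule spanned_add[OF t], auto)
    qed
    then show ?thesis using t by (subst finite_dim_hom_iff) (auto intro!: exI[of _ ?b])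
  qed
  show "finite_dim_hom C W Z" if h: "finite_dim_hom C W X" "finite_dim_hom C W Y"
  proof -
    obtain b0 where b0: "\<And>b. b \<in> set b0 \<Longrightarrow> arr b \<and> dm b = W \<and> cd b = X" "\<And>f. arr f \<Longrightarrow> dm f = W \<Longrightarrow> cd f = X \<Longrightarrow> spanned W X b0 f"
      using h(1) by (auto simp: finite_dim_hom_iff)
    obtain b1 where b1: "\<And>b. b \<in> set b1 \<Longrightarrow> arr b \<and> dm b = W \<and> cd b = Y" "\<And>f. arr f \<Longrightarrow> dm f = W \<Longrightarrow> cd f = Y \<Longrightarrow> spanned W Y b1 f"
      using h(2) by (auto simp: finite_dim_hom_iff)
    let ?b = "map (\<lambda>b. i0 \<cdot> b) b0 @ map (\<lambda>b. i1 \<cdot> b) b1"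
    have t: "arr b \<and> dm b = W \<and> cd b = Z" if "b \<in> set (map (\<lambda>b. i0 \<cdot> b) b0) \<union> set (map (\<lambda>b. i1 \<cdot> b) b1)" for b
      using that b0(1) b1(1) by auto
    have "spanned W Z ?b f" if [simp]: "arr f" "dm f = W" "cd f = Z" for f
    proof -
      have "f = (i0 \<cdot> p0 \<oplus>\<^sub>m i1 \<cdot> p1) \<cdot> f" by (simp add: s del: cmp_add)
      also have "\<dots> = i0 \<cdot> (p0 \<cdot> f) \<oplus>\<^sub>m i1 \<cdot> (p1 \<cdot> f)" by simp
      finally have f: "f = i0 \<cdot> (p0 \<cdot> f) \<oplus>\<^sub>m i1 \<cdot> (p1 \<cdot> f)" .
      have "spanned W Z (map (\<lambda>b. i0 \<cdot> b) b0) (i0 \<cdot> (p0 \<cdot> f))"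
        using spanned_cmp(2)[OF b0(1) b0(2)[of "p0 \<cdot> f"], of i0] by simp
      moreover have "spanned W Z (map (\<lambda>b. i1 \<cdot> b) b1) (i1 \<cdot> (p1 \<cdot> f))"
        using spanned_cmp(2)[OF b1(1) b1(2)[of "p1 \<cdot> f"], of i1] by simp
      ultimately show ?thesis by (subst f) (rule spanned_add[OF t], auto)
    qed
    then show ?thesis using t by (subst finite_dim_hom_iff) (auto intro!: exI[of _ ?b])
  qed
qed

end

section \<open>Duals of direct sums\<close>

context typed_tensor_category
begin

lemma ten_zero [simp]:
  "arr f \<Longrightarrow> X \<in> Obj C \<Longrightarrow> Y \<in> Obj C \<Longrightarrow> zeroM C X Y \<otimes>\<^sub>m f = zeroM C (X \<otimes>\<^sub>o dm f) (Y \<otimes>\<^sub>o cd f)"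
  "arr f \<Longrightarrow> X \<in> Obj C \<Longrightarrow> Y \<in> Obj C \<Longrightarrow> f \<otimes>\<^sub>m zeroM C X Y = zeroM C (dm f \<otimes>\<^sub>o X) (cd f \<otimes>\<^sub>o Y)"
  using ten_smul[of "zeroM C X Y" f 0] by auto

text \<open>A zigzag composite for \<open>Z\<close> whose coevaluation comes from the dual pair
  \<open>X, D\<close> and whose evaluation \<open>e3\<close> may come from another one. The
  condition \<open>eq\<close> says what this evaluation does to the first pair, and the result
  factors through \<open>k\<close>. It is used with \<open>k\<close> a projection for matching
  summands, with \<open>k\<close> zero for different ones, and for idempotents in
  \<open>S_rigid\<close>.\<close>

lemma snake_left:
  assumes dp: "dual_pair X D ev co"
    and [simp]: "arr i" "dm i = X" "cd i = Z" "arr j" "dm j = D" "cd j = D2" "arr q" "dm q = D2" "cd q = D3"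
      "arr p" "dm p = Z" "cd p = X3" "arr e3" "dm e3 = D3 \<otimes>\<^sub>o X3" "cd e3 = I" "arr k" "dm k = Z" "cd k = X"
    and eq: "e3 \<cdot> ((q \<cdot> j) \<otimes>\<^sub>m p) = ev \<cdot> (idm C D \<otimes>\<^sub>m k)"
  shows "run C Z \<cdot> ((idm C Z \<otimes>\<^sub>m (e3 \<cdot> (q \<otimes>\<^sub>m p))) \<cdot> (asc C Z D2 Z \<cdot> ((((i \<otimes>\<^sub>m j) \<cdot> co) \<otimes>\<^sub>m idm C Z) \<cdot> iv (lun C Z)))) = i \<cdot> k"
proof -
  note [simp] = dual_pairD(1-8)[OF dp]
  have [simp]: "Z \<in> Obj C" "D2 \<in> Obj C" "D3 \<in> Obj C" "X3 \<in> Obj C"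
    using arr_Obj[OF \<open>arr i\<close>] arr_Obj[OF \<open>arr j\<close>] arr_Obj[OF \<open>arr q\<close>] arr_Obj[OF \<open>arr p\<close>] by simp_all
  let ?r = "(co \<otimes>\<^sub>m idm C Z) \<cdot> iv (lun C Z)"
  have "run C Z \<cdot> ((idm C Z \<otimes>\<^sub>m (e3 \<cdot> (q \<otimes>\<^sub>m p))) \<cdot> (asc C Z D2 Z \<cdot> ((((i \<otimes>\<^sub>m j) \<cdot> co) \<otimes>\<^sub>m idm C Z) \<cdot> iv (lun C Z))))
    = run C Z \<cdot> ((idm C Z \<otimes>\<^sub>m (e3 \<cdot> (q \<otimes>\<^sub>m p))) \<cdot> ((asc C Z D2 Z \<cdot> ((i \<otimes>\<^sub>m j) \<otimes>\<^sub>m idm C Z)) \<cdot> ?r))"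
    by (simp add: ten_idr)
  also have "asc C Z D2 Z \<cdot> ((i \<otimes>\<^sub>m j) \<otimes>\<^sub>m idm C Z) = (i \<otimes>\<^sub>m (j \<otimes>\<^sub>m idm C Z)) \<cdot> asc C X D Z"
    by (subst asc_nat') auto
  also have "(idm C Z \<otimes>\<^sub>m (e3 \<cdot> (q \<otimes>\<^sub>m p))) \<cdot> (((i \<otimes>\<^sub>m (j \<otimes>\<^sub>m idm C Z)) \<cdot> asc C X D Z) \<cdot> ?r)
    = (i \<otimes>\<^sub>m (e3 \<cdot> ((q \<cdot> j) \<otimes>\<^sub>m p))) \<cdot> (asc C X D Z \<cdot> ?r)"
    by (simp add: ten_cmp_ext ten_cmp)
  also have "i \<otimes>\<^sub>m (e3 \<cdot> ((q \<cdot> j) \<otimes>\<^sub>m p)) = (i \<otimes>\<^sub>m idm C I) \<cdot> ((idm C X \<otimes>\<^sub>m ev) \<cdot> (idm C X \<otimes>\<^sub>m (idm C D \<otimes>\<^sub>m k)))"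
    unfolding eq by (simp add: ten_cmp)
  also have "run C Z \<cdot> (((i \<otimes>\<^sub>m idm C I) \<cdot> ((idm C X \<otimes>\<^sub>m ev) \<cdot> (idm C X \<otimes>\<^sub>m (idm C D \<otimes>\<^sub>m k)))) \<cdot> (asc C X D Z \<cdot> ?r))
    = (run C Z \<cdot> (i \<otimes>\<^sub>m idm C I)) \<cdot> ((idm C X \<otimes>\<^sub>m ev) \<cdot> (((idm C X \<otimes>\<^sub>m (idm C D \<otimes>\<^sub>m k)) \<cdot> asc C X D Z) \<cdot> ?r))"
    by simp
  also have "run C Z \<cdot> (i \<otimes>\<^sub>m idm C I) = i \<cdot> run C X" by (subst run_nat') auto
  also have "(idm C X \<otimes>\<^sub>m (idm C D \<otimes>\<^sub>m k)) \<cdot> asc C X D Z = asc C X D X \<cdot> (idm C (X \<otimes>\<^sub>o D) \<otimes>\<^sub>m k)"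
    using asc_nat'[of "idm C X" "idm C D" k X D X] by simp
  also have "(asc C X D X \<cdot> (idm C (X \<otimes>\<^sub>o D) \<otimes>\<^sub>m k)) \<cdot> ?r = asc C X D X \<cdot> ((co \<otimes>\<^sub>m idm C X) \<cdot> ((idm C I \<otimes>\<^sub>m k) \<cdot> iv (lun C Z)))"
    by (simp add: ten_cmp_ext)
  also have "(idm C I \<otimes>\<^sub>m k) \<cdot> iv (lun C Z) = iv (lun C X) \<cdot> k"
  proof -
    have "lun C X \<cdot> ((idm C I \<otimes>\<^sub>m k) \<cdot> iv (lun C Z)) = (lun C X \<cdot> (idm C I \<otimes>\<^sub>m k)) \<cdot> iv (lun C Z)" by simp
    also have "\<dots> = k" by (subst lun_nat') auto
    finally show ?thesis by (intro iso_move) auto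
  qed
  also have "(i \<cdot> run C X) \<cdot> ((idm C X \<otimes>\<^sub>m ev) \<cdot> (asc C X D X \<cdot> ((co \<otimes>\<^sub>m idm C X) \<cdot> (iv (lun C X) \<cdot> k))))
    = i \<cdot> ((run C X \<cdot> ((idm C X \<otimes>\<^sub>m ev) \<cdot> (asc C X D X \<cdot> ((co \<otimes>\<^sub>m idm C X) \<cdot> iv (lun C X))))) \<cdot> k)"
    by simp
  also have "\<dots> = i \<cdot> k" by (simp add: dual_pairD(9)[OF dp])
  finally show ?thesis .
qed

text \<open>The counterpart for the second zigzag identity: \<open>k\<close> now lives on the side
  of the duals, and the inverse associator takes the place of the associator.\<close>

lemma snake_right:
  assumes dp: "dual_pair X D ev co"
    and [simp]: "arr i" "dm i = X" "cd i = Z" "arr j" "dm j = D" "cd j = D2" "arr q" "dm q = D2" "cd q = D3"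
      "arr p" "dm p = Z" "cd p = X3" "arr e3" "dm e3 = D3 \<otimes>\<^sub>o X3" "cd e3 = I" "arr k" "dm k = D2" "cd k = D"
    and eq: "e3 \<cdot> (q \<otimes>\<^sub>m (p \<cdot> i)) = ev \<cdot> (k \<otimes>\<^sub>m idm C X)"
  shows "lun C D2 \<cdot> (((e3 \<cdot> (q \<otimes>\<^sub>m p)) \<otimes>\<^sub>m idm C D2) \<cdot> (iv (asc C D2 Z D2) \<cdot> ((idm C D2 \<otimes>\<^sub>m ((i \<otimes>\<^sub>m j) \<cdot> co)) \<cdot> iv (run C D2)))) = j \<cdot> k"
proof -
  note [simp] = dual_pairD(1-8)[OF dp]
  have [simp]: "Z \<in> Obj C" "D2 \<in> Obj C" "D3 \<in> Obj C" "X3 \<in> Obj C"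
    using arr_Obj[OF \<open>arr i\<close>] arr_Obj[OF \<open>arr j\<close>] arr_Obj[OF \<open>arr q\<close>] arr_Obj[OF \<open>arr p\<close>] by simp_all
  let ?r = "(idm C D2 \<otimes>\<^sub>m co) \<cdot> iv (run C D2)"
  have "lun C D2 \<cdot> (((e3 \<cdot> (q \<otimes>\<^sub>m p)) \<otimes>\<^sub>m idm C D2) \<cdot> (iv (asc C D2 Z D2) \<cdot> ((idm C D2 \<otimes>\<^sub>m ((i \<otimes>\<^sub>m j) \<cdot> co)) \<cdot> iv (run C D2))))
    = lun C D2 \<cdot> (((e3 \<cdot> (q \<otimes>\<^sub>m p)) \<otimes>\<^sub>m idm C D2) \<cdot> ((iv (asc C D2 Z D2) \<cdot> (idm C D2 \<otimes>\<^sub>m (i \<otimes>\<^sub>m j))) \<cdot> ?r))"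
    by (simp add: ten_idl)
  also have "iv (asc C D2 Z D2) \<cdot> (idm C D2 \<otimes>\<^sub>m (i \<otimes>\<^sub>m j)) = ((idm C D2 \<otimes>\<^sub>m i) \<otimes>\<^sub>m j) \<cdot> iv (asc C D2 X D)"
    using asc_nat_inv[of "idm C D2" i j D2 X D] by simp
  also have "((e3 \<cdot> (q \<otimes>\<^sub>m p)) \<otimes>\<^sub>m idm C D2) \<cdot> ((((idm C D2 \<otimes>\<^sub>m i) \<otimes>\<^sub>m j) \<cdot> iv (asc C D2 X D)) \<cdot> ?r)
    = ((e3 \<cdot> (q \<otimes>\<^sub>m (p \<cdot> i))) \<otimes>\<^sub>m j) \<cdot> (iv (asc C D2 X D) \<cdot> ?r)"
    by (simp add: ten_cmp_ext ten_cmp)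
  also have "(e3 \<cdot> (q \<otimes>\<^sub>m (p \<cdot> i))) \<otimes>\<^sub>m j = (idm C I \<otimes>\<^sub>m j) \<cdot> ((ev \<otimes>\<^sub>m idm C D) \<cdot> ((k \<otimes>\<^sub>m idm C X) \<otimes>\<^sub>m idm C D))"
    unfolding eq by (simp add: ten_cmp)
  also have "lun C D2 \<cdot> (((idm C I \<otimes>\<^sub>m j) \<cdot> ((ev \<otimes>\<^sub>m idm C D) \<cdot> ((k \<otimes>\<^sub>m idm C X) \<otimes>\<^sub>m idm C D))) \<cdot> (iv (asc C D2 X D) \<cdot> ?r))
    = (lun C D2 \<cdot> (idm C I \<otimes>\<^sub>m j)) \<cdot> ((ev \<otimes>\<^sub>m idm C D) \<cdot> ((((k \<otimes>\<^sub>m idm C X) \<otimes>\<^sub>m idm C D) \<cdot> iv (asc C D2 X D)) \<cdot> ?r))"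
    by simp
  also have "lun C D2 \<cdot> (idm C I \<otimes>\<^sub>m j) = j \<cdot> lun C D" by (subst lun_nat') auto
  also have "((k \<otimes>\<^sub>m idm C X) \<otimes>\<^sub>m idm C D) \<cdot> iv (asc C D2 X D) = iv (asc C D X D) \<cdot> (k \<otimes>\<^sub>m idm C (X \<otimes>\<^sub>o D))"
    using asc_nat_inv[of k "idm C X" "idm C D" D2 X D] by simp
  also have "(iv (asc C D X D) \<cdot> (k \<otimes>\<^sub>m idm C (X \<otimes>\<^sub>o D))) \<cdot> ?r = iv (asc C D X D) \<cdot> ((idm C D \<otimes>\<^sub>m co) \<cdot> ((k \<otimes>\<^sub>m idm C I) \<cdot> iv (run C D2)))"
    by (simp add: ten_cmp_ext)
  also have "(k \<otimes>\<^sub>m idm C I) \<cdot> iv (run C D2) = iv (run C D) \<cdot> k"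
  proof -
    have "run C D \<cdot> ((k \<otimes>\<^sub>m idm C I) \<cdot> iv (run C D2)) = (run C D \<cdot> (k \<otimes>\<^sub>m idm C I)) \<cdot> iv (run C D2)" by simp
    also have "\<dots> = k" by (subst run_nat') auto
    finally show ?thesis by (intro iso_move) auto
  qed
  also have "(j \<cdot> lun C D) \<cdot> ((ev \<otimes>\<^sub>m idm C D) \<cdot> (iv (asc C D X D) \<cdot> ((idm C D \<otimes>\<^sub>m co) \<cdot> (iv (run C D) \<cdot> k))))
    = j \<cdot> ((lun C D \<cdot> ((ev \<otimes>\<^sub>m idm C D) \<cdot> (iv (asc C D X D) \<cdot> ((idm C D \<otimes>\<^sub>m co) \<cdot> iv (run C D))))) \<cdot> k)"
    by simp
  also have "\<dots> = j \<cdot> k" by (simp add: dual_pairD(10)[OF dp])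
  finally show ?thesis .
qed

lemma dual_direct_sum:
  assumes Z: "is_direct_sum C [X, Y] Z" and D: "is_direct_sum C [X', Y'] Z'"
    and X: "dual_pair X X' ev0 co0" and Y: "dual_pair Y Y' ev1 co1"
  shows "\<exists>ev co. dual_pair Z Z' ev co"
proof -
  note [simp] = dual_pairD(1-8)[OF X] dual_pairD(1-8)[OF Y]
  obtain i0 i1 p0 p1 where t [simp]: "X \<in> Obj C" "Y \<in> Obj C" "Z \<in> Obj C"
    "arr i0" "dm i0 = X" "cd i0 = Z" "arr i1" "dm i1 = Y" "cd i1 = Z"
    "arr p0" "dm p0 = Z" "cd p0 = X" "arr p1" "dm p1 = Z" "cd p1 = Y"
    and ip: "p0 \<cdot> i0 = idm C X" "p1 \<cdot> i1 = idm C Y" "p0 \<cdot> i1 = zeroM C Y X" "p1 \<cdot> i0 = zeroM C X Y"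
    "i0 \<cdot> p0 \<oplus>\<^sub>m i1 \<cdot> p1 = idm C Z" using direct_sum2[OF Z] by metis
  obtain j0 j1 q0 q1 where t' [simp]: "X' \<in> Obj C" "Y' \<in> Obj C" "Z' \<in> Obj C"
    "arr j0" "dm j0 = X'" "cd j0 = Z'" "arr j1" "dm j1 = Y'" "cd j1 = Z'"
    "arr q0" "dm q0 = Z'" "cd q0 = X'" "arr q1" "dm q1 = Z'" "cd q1 = Y'"
    and jq: "q0 \<cdot> j0 = idm C X'" "q1 \<cdot> j1 = idm C Y'" "q0 \<cdot> j1 = zeroM C Y' X'" "q1 \<cdot> j0 = zeroM C X' Y'"
    "j0 \<cdot> q0 \<oplus>\<^sub>m j1 \<cdot> q1 = idm C Z'" using direct_sum2[OF D] by metis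
  let ?e0 = "ev0 \<cdot> (q0 \<otimes>\<^sub>m p0)" and ?e1 = "ev1 \<cdot> (q1 \<otimes>\<^sub>m p1)"
  let ?c0 = "(i0 \<otimes>\<^sub>m j0) \<cdot> co0" and ?c1 = "(i1 \<otimes>\<^sub>m j1) \<cdot> co1"
  let ?L = "\<lambda>e c. run C Z \<cdot> ((idm C Z \<otimes>\<^sub>m e) \<cdot> (asc C Z Z' Z \<cdot> ((c \<otimes>\<^sub>m idm C Z) \<cdot> iv (lun C Z))))"
  let ?R = "\<lambda>e c. lun C Z' \<cdot> ((e \<otimes>\<^sub>m idm C Z') \<cdot> (iv (asc C Z' Z Z') \<cdot> ((idm C Z' \<otimes>\<^sub>m c) \<cdot> iv (run C Z'))))"
  \<comment> \<open>Of the four combinations of evaluation and coevaluation, the mixed ones vanish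
    because \<open>q0 \<cdot> j1\<close> and \<open>q1 \<cdot> j0\<close> are zero; the others give
    the two projections that add up to the identity.\<close>
  have "?L ?e0 ?c0 = i0 \<cdot> p0" "?L ?e1 ?c1 = i1 \<cdot> p1" "?L ?e0 ?c1 = i1 \<cdot> zeroM C Z Y" "?L ?e1 ?c0 = i0 \<cdot> zeroM C Z X"
    by (rule snake_left[OF X] snake_left[OF Y]; simp add: jq)+
  then have L: "?L ?e0 ?c0 = i0 \<cdot> p0" "?L ?e1 ?c1 = i1 \<cdot> p1" "?L ?e0 ?c1 = zeroM C Z Z" "?L ?e1 ?c0 = zeroM C Z Z" by simp_all
  have "?R ?e0 ?c0 = j0 \<cdot> q0" "?R ?e1 ?c1 = j1 \<cdot> q1" "?R ?e0 ?c1 = j1 \<cdot> zeroM C Z' Y'" "?R ?e1 ?c0 = j0 \<cdot> zeroM C Z' X'"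
    by (rule snake_right[OF X] snake_right[OF Y]; simp add: ip)+
  then have R: "?R ?e0 ?c0 = j0 \<cdot> q0" "?R ?e1 ?c1 = j1 \<cdot> q1" "?R ?e0 ?c1 = zeroM C Z' Z'" "?R ?e1 ?c0 = zeroM C Z' Z'" by simp_all
  have addL: "?L (e \<oplus>\<^sub>m e') (c \<oplus>\<^sub>m c') = (?L e c \<oplus>\<^sub>m ?L e c') \<oplus>\<^sub>m (?L e' c \<oplus>\<^sub>m ?L e' c')"
    and addR: "?R (e \<oplus>\<^sub>m e') (c \<oplus>\<^sub>m c') = (?R e c \<oplus>\<^sub>m ?R e c') \<oplus>\<^sub>m (?R e' c \<oplus>\<^sub>m ?R e' c')"
    if "arr e" "dm e = Z' \<otimes>\<^sub>o Z" "cd e = I" "arr e'" "dm e' = Z' \<otimes>\<^sub>o Z" "cd e' = I"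
      "arr c" "dm c = I" "cd c = Z \<otimes>\<^sub>o Z'" "arr c'" "dm c' = I" "cd c' = Z \<otimes>\<^sub>o Z'" for e e' c c'
    using that by (simp_all add: ten_add add_ac')
  have "dual_pair Z Z' (?e0 \<oplus>\<^sub>m ?e1) (?c0 \<oplus>\<^sub>m ?c1)"
    unfolding dual_pair_def
  proof (intro conjI)
    show "?L (?e0 \<oplus>\<^sub>m ?e1) (?c0 \<oplus>\<^sub>m ?c1) = idm C Z"
      by (subst addL) (simp_all only: L, simp_all add: ip)
    show "?R (?e0 \<oplus>\<^sub>m ?e1) (?c0 \<oplus>\<^sub>m ?c1) = idm C Z'"
      by (subst addR) (simp_all only: R, simp_all add: jq)
  qed simp_all
  then show ?thesis by blast
qed

lemma dual_zero_object:
  assumes "zero_object C Z"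
  shows "\<exists>ev co. dual_pair Z Z ev co"
proof -
  have Z [simp]: "Z \<in> Obj C" using assms by (simp add: zero_object_def)
  have u: "f = g" if "arr f" "arr g" "dm f = Z" "dm g = Z" "cd f = cd g" for f g
  proof -
    have "f \<in> Hom C Z (cd f)" "g \<in> Hom C Z (cd f)" using that by (simp_all add: Hom_iff)
    then show ?thesis using assms that(1) unfolding zero_object_def by (metis arr_Obj(2))
  qed
  have "dual_pair Z Z (zeroM C (Z \<otimes>\<^sub>o Z) I) (zeroM C I (Z \<otimes>\<^sub>o Z))"
    unfolding dual_pair_def by (intro conjI u) simp_all
  then show ?thesis by blast
qed

end

lemma is_dual_linearization:
  assumes "symmetric_monoidal_category E" "X \<in> Obj E" "is_dual E X D"
  shows "is_dual (linearization E :: ('o, 'm \<Rightarrow>\<^sub>0 'k::field, 'k) tensor_category) X D"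
  by (rule is_dual_functor[where \<Phi> = "\<lambda>X. X" and \<phi> = "\<lambda>_ _ f. pm_single f 1", OF assms(1)
        symmetric_monoidal_category.linearization_symmetric_monoidal[OF assms(1)] _ _ _ _ _ _ _ _ _ _ assms(2,3)]) simp_all

lemma finite_dim_linearization:
  assumes "finite (Hom E X Y)"
  shows "finite_dim_hom (linearization E :: ('o, 'm \<Rightarrow>\<^sub>0 'k::field, 'k) tensor_category) X Y"
proof -
  obtain fs where fs: "set fs = Hom E X Y" "distinct fs" using finite_distinct_list[OF assms] by blast
  let ?L = "linearization E :: ('o, 'm \<Rightarrow>\<^sub>0 'k, 'k) tensor_category"
  have hs: "hom_sum ?L X Y vs = sum_list vs" for vs
    by (induction vs) (simp_all add: hom_sum_def)
  show ?thesis unfolding finite_dim_hom_def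
  proof (intro exI[of _ "map (\<lambda>f. pm_single f 1) fs"] conjI ballI)
    fix v assume "v \<in> Hom ?L X Y"
    then have k: "pm_keys v \<subseteq> set fs" using fs by simp
    have "v = (\<Sum>f\<in>pm_keys v. pm_single f (pm_lookup v f))" by (rule poly_mapping_sum_single)
    also have "\<dots> = (\<Sum>f\<in>set fs. pm_single f (pm_lookup v f))"
      by (rule sum.mono_neutral_left) (use k in \<open>auto simp: in_keys_iff\<close>)
    also have "\<dots> = sum_list (map (\<lambda>f. pm_single f (pm_lookup v f)) fs)"
      by (rule sum_list_distinct_conv_sum_set[OF fs(2), symmetric])
    also have "map (\<lambda>f. pm_single f (pm_lookup v f)) fs = map2 (scaleM ?L) (map (pm_lookup v) fs) (map (\<lambda>f. pm_single f 1) fs)"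
      by (simp add: zip_map_map zip_same_conv_map)
    finally show "\<exists>cs. length cs = length (map (\<lambda>f. pm_single f 1) fs) \<and> v = hom_sum ?L X Y (map2 (scaleM ?L) cs (map (\<lambda>f. pm_single f 1) fs))"
      unfolding hs by (intro exI[of _ "map (pm_lookup v) fs"] conjI) (simp, assumption)
  qed (use fs in auto)
qed

context enriched_category
begin

text \<open>Sending \<open>X\<close> to \<open>[X]\<close> is strict monoidal, because a product of
  one-element lists is again a one-element list.\<close>

lemma is_dual_AE_single:
  assumes "X \<in> Obj C" "is_dual C X D"
  shows "is_dual AE [X] [D]"
proof (rule is_dual_functor[where \<Phi> = "\<lambda>X. [X]" and \<phi> = "\<lambda>X Y f. mk_arrow [X] [Y] (\<lambda>_ _. f)", OF symmetric_monoidal_category_axioms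
        AE_symmetric_monoidal _ _ _ _ _ _ _ _ _ _ assms])
  show "mk_arrow [X \<otimes>\<^sub>o X'] [Y \<otimes>\<^sub>o Y'] (\<lambda>_ _. f \<otimes>\<^sub>m g) = mk_arrow [X] [Y] (\<lambda>_ _. f) \<otimes>\<^sub>m\<^bsub>AE\<^esub> mk_arrow [X'] [Y'] (\<lambda>_ _. g)" for X X' Y Y' f g
    unfolding ten_AE by (simp add: ten_list_def)
qed (auto simp: AE_simps Obj_AE mor_def idm_AE dg_def cmp_AE asc_AE lun_AE run_AE ten_list_def adiag_def intro!: mk_arrow_eqI)

lemma AE_rigid:
  assumes "\<And>X. X \<in> Obj C \<Longrightarrow> \<exists>D. is_dual C X D" "Xs \<in> Obj AE"
  shows "\<exists>D. is_dual AE Xs D"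
proof -
  interpret A: typed_tensor_category AE src tgt by (rule AE_typed)
  show ?thesis using assms(2)
  proof (induction Xs)
    case Nil
    then show ?case using A.dual_zero_object[OF AE_zero_object] A.is_dual_iff by blast
  next
    case (Cons X Xs)
    have o: "X \<in> Obj C" "Xs \<in> Obj AE" "[X] \<in> Obj AE" using Cons.prems by (auto simp: Obj_AE)
    obtain D where D: "is_dual C X D" using assms(1) o by blast
    obtain Ds where Ds: "is_dual AE Xs Ds" using Cons.IH o by blast
    have DO: "[D] \<in> Obj AE" "Ds \<in> Obj AE" using D Ds unfolding is_dual_def by (auto simp: Obj_AE)
    obtain e c where dp: "A.dual_pair [X] [D] e c" using is_dual_AE_single[OF o(1) D] A.is_dual_iff o by blast
    obtain e' c' where dp': "A.dual_pair Xs Ds e' c'" using Ds A.is_dual_iff o by blast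
    have "\<exists>ev co. A.dual_pair ([X] @ Xs) ([D] @ Ds) ev co"
      by (rule A.dual_direct_sum[OF AE_direct_sum AE_direct_sum dp dp']) (rule o DO)+
    then show ?case using A.is_dual_iff[OF Cons.prems] by auto
  qed
qed

lemma AE_finite_dim:
  assumes fd: "\<And>X Y. X \<in> Obj C \<Longrightarrow> Y \<in> Obj C \<Longrightarrow> finite_dim_hom C X Y" and o: "Xs \<in> Obj AE" "Ys \<in> Obj AE"
  shows "finite_dim_hom AE Xs Ys"
proof -
  interpret A: typed_tensor_category AE src tgt by (rule AE_typed)
  have hs: "hom_sum AE [X] [Y] (map (\<lambda>f. mk_arrow [X] [Y] (\<lambda>_ _. f)) fs) = mk_arrow [X] [Y] (\<lambda>_ _. hom_sum C X Y fs)" for X Y fs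
    by (induction fs) (simp_all add: hom_sum_def AE_simps zeroM_eq addM_eq)
  have single: "finite_dim_hom AE [X] [Y]" if XY: "X \<in> Obj C" "Y \<in> Obj C" for X Y
  proof -
    obtain bs where bs: "set bs \<subseteq> Hom C X Y"
      "\<And>f. f \<in> Hom C X Y \<Longrightarrow> \<exists>cs. length cs = length bs \<and> f = hom_sum C X Y (map2 (scaleM C) cs bs)"
      using fd[OF XY] unfolding finite_dim_hom_def by blast
    let ?m = "\<lambda>f. mk_arrow [X] [Y] (\<lambda>_ _. f)"
    have m: "map2 (scaleM AE) cs (map ?m bs) = map ?m (map2 (scaleM C) cs bs)" for cs
      by (simp add: zip_map2 case_prod_beta AE_simps)
    show ?thesis unfolding finite_dim_hom_def
    proof (intro exI[of _ "map ?m bs"] conjI ballI)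
      fix f' assume "f' \<in> Hom AE [X] [Y]"
      then obtain F where F: "f' = mk_arrow [X] [Y] F" "mor [X] [Y] F" using Hom_AE by blast
      have f: "f' = ?m (F 0 0)" unfolding F(1) by (rule mk_arrow_eqI) simp
      have "F 0 0 \<in> Hom C X Y" using F(2) by (simp add: mor_def)
      then obtain cs where "length cs = length bs" "F 0 0 = hom_sum C X Y (map2 (scaleM C) cs bs)" using bs(2) by blast
      then show "\<exists>cs. length cs = length (map ?m bs) \<and> f' = hom_sum AE [X] [Y] (map2 (scaleM AE) cs (map ?m bs))"
        unfolding m hs f by auto
    qed (use bs(1) in \<open>auto simp: mor_def\<close>)
  qed
  have nil: "finite_dim_hom AE [] Zs" "finite_dim_hom AE Zs []" for Zs
  proof -
    have "f = zeroM AE [] Zs" if "f \<in> Hom AE [] Zs" for f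
      using that unfolding Hom_AE AE_simps by (auto intro!: mk_arrow_eqI)
    then show "finite_dim_hom AE [] Zs" by (auto simp: finite_dim_hom_def hom_sum_def intro!: exI[of _ "[]"])
    have "f = zeroM AE Zs []" if "f \<in> Hom AE Zs []" for f
      using that unfolding Hom_AE AE_simps by (auto intro!: mk_arrow_eqI)
    then show "finite_dim_hom AE Zs []" by (auto simp: finite_dim_hom_def hom_sum_def intro!: exI[of _ "[]"])
  qed
  have left: "finite_dim_hom AE Xs [Y]" if Y: "Y \<in> Obj C" and "Xs \<in> Obj AE" for Xs Y
    using that(2)
  proof (induction Xs)
    case (Cons X Xs)
    have o: "X \<in> Obj C" "Xs \<in> Obj AE" "[X] \<in> Obj AE" "[Y] \<in> Obj AE" using Cons.prems Y by (auto simp: Obj_AE)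
    have "finite_dim_hom AE ([X] @ Xs) [Y]"
      by (rule A.finite_dim_direct_sum(1)[OF AE_direct_sum]) (rule o single Y Cons.IH)+
    then show ?case by simp
  qed (rule nil)
  show ?thesis using o(2)
  proof (induction Ys)
    case (Cons Y Ys)
    have o': "Y \<in> Obj C" "Ys \<in> Obj AE" "[Y] \<in> Obj AE" using Cons.prems by (auto simp: Obj_AE)
    have "finite_dim_hom AE Xs ([Y] @ Ys)"
      by (rule A.finite_dim_direct_sum(2)[OF AE_direct_sum]) (rule o' o(1) left Cons.IH)+
    then show ?case by simp
  qed (rule nil)
qed

end

section \<open>Splitting a central idempotent\<close>

text \<open>The construction of \<open>chi_category\<close> for an arbitrary base category and an
  arbitrary family \<open>u\<close> in place of the action of the character idempotent. By
  \<open>chi_category_eq\<close> it specializes to \<open>chi_category\<close>, so the theory of the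
  summand can be developed without characters.\<close>

definition summand_category :: "('o, 'm, 's, 'x) tensor_category_scheme \<Rightarrow> ('o \<Rightarrow> 'm)
    \<Rightarrow> ('o \<times> 'm, 'm, 's) tensor_category" where
  "summand_category C u =
     (let K = karoubi_envelope C;
          act = (\<lambda>(X, e). u X \<cdot>\<^bsub>C\<^esub> e)
      in K\<lparr>Obj := {X \<in> Obj K. act X = idm K X},
           unt := (fst (unt K), act (unt K)),
           lun := (\<lambda>X. lun K X \<cdot>\<^bsub>K\<^esub> (act (unt K) \<otimes>\<^sub>m\<^bsub>K\<^esub> idm K X)),
           run := (\<lambda>X. run K X \<cdot>\<^bsub>K\<^esub> (idm K X \<otimes>\<^sub>m\<^bsub>K\<^esub> act (unt K)))\<rparr>)"

text \<open>The family \<open>u\<close> is an idempotent natural endomorphism of the identity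
  functor. The rules \<open>u_ten\<close> let it move between tensor factors; through the left
  unitor it becomes multiplication by the idempotent endomorphism \<open>u I\<close> of the
  unit.\<close>

locale central_idempotent = typed_tensor_category C dm cd
  for C :: "('o, 'm, 's::field, 'x) tensor_category_scheme" (structure) and dm cd +
  fixes u :: "'o \<Rightarrow> 'm"
  assumes u_in: "X \<in> Obj C \<Longrightarrow> u X \<in> Hom C X X"
    and u_idem: "X \<in> Obj C \<Longrightarrow> u X \<cdot> u X = u X"
    and u_nat: "arr f \<Longrightarrow> u (cd f) \<cdot> f = f \<cdot> u (dm f)"
    and u_ten: "X \<in> Obj C \<Longrightarrow> Y \<in> Obj C \<Longrightarrow> u (X \<otimes>\<^sub>o Y) = u X \<otimes>\<^sub>m idm C Y"
      "X \<in> Obj C \<Longrightarrow> Y \<in> Obj C \<Longrightarrow> u (X \<otimes>\<^sub>o Y) = idm C X \<otimes>\<^sub>m u Y"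
begin

abbreviation "S \<equiv> summand_category C u"

lemma u_typ [simp]: "X \<in> Obj C \<Longrightarrow> arr (u X)" "X \<in> Obj C \<Longrightarrow> dm (u X) = X" "X \<in> Obj C \<Longrightarrow> cd (u X) = X"
  using u_in Hom_iff by blast+

text \<open>Absorption of \<open>u X\<close> on the right of \<open>e\<close> follows by naturality
  and is part of \<open>obD\<close>.\<close>

definition ob :: "'o \<Rightarrow> 'm \<Rightarrow> bool" where
  "ob X e \<longleftrightarrow> arr e \<and> dm e = X \<and> cd e = X \<and> e \<cdot> e = e \<and> u X \<cdot> e = e"

lemma obD:
  assumes "ob X e"
  shows "X \<in> Obj C" "arr e" "dm e = X" "cd e = X" "e \<cdot> e = e" "u X \<cdot> e = e" "e \<cdot> u X = e"
    and "arr r \<Longrightarrow> cd r = X \<Longrightarrow> e \<cdot> (e \<cdot> r) = e \<cdot> r" "arr r \<Longrightarrow> cd r = X \<Longrightarrow> u X \<cdot> (e \<cdot> r) = e \<cdot> r"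
proof -
  show t: "arr e" "dm e = X" "cd e = X" "e \<cdot> e = e" "u X \<cdot> e = e" using assms by (auto simp: ob_def)
  show X: "X \<in> Obj C" using t arr_Obj(1)[of e] by simp
  show "e \<cdot> u X = e" using u_nat[of e] t by simp
  show "arr r \<Longrightarrow> cd r = X \<Longrightarrow> e \<cdot> (e \<cdot> r) = e \<cdot> r" by (rule cmp_ext) (use t in auto)
  show "arr r \<Longrightarrow> cd r = X \<Longrightarrow> u X \<cdot> (e \<cdot> r) = e \<cdot> r" by (rule cmp_ext) (use t X in auto)
qed

lemma S_Obj: "(X, e) \<in> Obj S \<longleftrightarrow> ob X e"
  by (auto simp: summand_category_def karoubi_envelope_def Let_def ob_def Hom_iff)

lemma S_ObjE:
  assumes "A \<in> Obj S"
  obtains X e where "A = (X, e)" "ob X e"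
  using assms S_Obj by (cases A) auto

text \<open>The single equation with idempotents on both sides is split into two one-sided
  absorption rules, which the simplifier can use.\<close>

lemma S_Hom:
  assumes "ob X e" "ob Y e'"
  shows "f \<in> Hom S (X, e) (Y, e') \<longleftrightarrow> arr f \<and> dm f = X \<and> cd f = Y \<and> e' \<cdot> f = f \<and> f \<cdot> e = f"
proof -
  note [simp] = obD[OF assms(1)] obD[OF assms(2)]
  have *: "e' \<cdot> f = f \<and> f \<cdot> e = f" if [simp]: "arr f" "dm f = X" "cd f = Y" and eq: "e' \<cdot> (f \<cdot> e) = f"
  proof
    have "e' \<cdot> (e' \<cdot> (f \<cdot> e)) = e' \<cdot> (f \<cdot> e)" by simp
    then show "e' \<cdot> f = f" unfolding eq .
    have "(e' \<cdot> (f \<cdot> e)) \<cdot> e = e' \<cdot> (f \<cdot> e)" by simp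
    then show "f \<cdot> e = f" unfolding eq .
  qed
  have "f \<in> Hom S (X, e) (Y, e') \<longleftrightarrow> f \<in> Hom C X Y \<and> e' \<cdot> f \<cdot> e = f"
    by (simp add: summand_category_def karoubi_envelope_def Let_def)
  then show ?thesis using * by (auto simp: Hom_iff)
qed

lemma S_simps [simp]:
  "idm S (X, e) = e" "cmp S = cmp C" "tenO S (X, e) (Y, e') = (X \<otimes>\<^sub>o Y, e \<otimes>\<^sub>m e')" "tenM S = tenM C"
  "asc S (X, e) (Y, e') (Z, e'') = asc C X Y Z \<cdot> ((e \<otimes>\<^sub>m e') \<otimes>\<^sub>m e'')"
  "brd S (X, e) (Y, e') = brd C X Y \<cdot> (e \<otimes>\<^sub>m e')"
  "zeroM S (X, e) (Y, e') = zeroM C X Y" "addM S = addM C" "scaleM S = scaleM C"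
  by (simp_all add: summand_category_def karoubi_envelope_def Let_def)

lemma S_unt [simp]: "unt S = (I, u I)"
  by (simp add: summand_category_def karoubi_envelope_def Let_def)

lemma S_lun_run [simp]:
  assumes "ob X e"
  shows "lun S (X, e) = lun C X \<cdot> (u I \<otimes>\<^sub>m e)" "run S (X, e) = run C X \<cdot> (e \<otimes>\<^sub>m u I)"
  using obD[OF assms] by (simp_all add: summand_category_def karoubi_envelope_def Let_def ten_cmp)

lemma ob_unt [simp]: "ob I (u I)"
  by (simp add: ob_def u_idem)

lemma ob_ten [simp]:
  assumes "ob X e" "ob Y e'"
  shows "ob (X \<otimes>\<^sub>o Y) (e \<otimes>\<^sub>m e')"
  using obD[OF assms(1)] obD[OF assms(2)] by (simp add: ob_def ten_cmp u_ten(1))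

text \<open>The factor \<open>u X\<close> is moved to the other tensor factor by
  \<open>u_ten\<close> and is absorbed by \<open>e\<close> there. This makes \<open>(I, u I)\<close>
  a unit for the summand although \<open>u I\<close> differs from the identity in general.\<close>

lemma u_absorb:
  assumes "X \<in> Obj C" "ob Y e"
  shows "u X \<otimes>\<^sub>m e = idm C X \<otimes>\<^sub>m e" "e \<otimes>\<^sub>m u X = e \<otimes>\<^sub>m idm C X"
proof -
  note [simp] = obD[OF assms(2)] assms(1)
  have "u X \<otimes>\<^sub>m e = (u X \<otimes>\<^sub>m idm C Y) \<cdot> (idm C X \<otimes>\<^sub>m e)" by (simp add: ten_cmp)
  also have "\<dots> = (idm C X \<otimes>\<^sub>m u Y) \<cdot> (idm C X \<otimes>\<^sub>m e)" using u_ten[of X Y] by simp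
  finally show "u X \<otimes>\<^sub>m e = idm C X \<otimes>\<^sub>m e" by (simp add: ten_cmp)
  have "e \<otimes>\<^sub>m u X = (idm C Y \<otimes>\<^sub>m u X) \<cdot> (e \<otimes>\<^sub>m idm C X)" by (simp add: ten_cmp)
  also have "\<dots> = (u Y \<otimes>\<^sub>m idm C X) \<cdot> (e \<otimes>\<^sub>m idm C X)" using u_ten[of Y X] by simp
  finally show "e \<otimes>\<^sub>m u X = e \<otimes>\<^sub>m idm C X" by (simp add: ten_cmp)
qed

lemma S_category: "category S"
proof (unfold_locales, goal_cases)
  case (1 A) then show ?case by (auto elim!: S_ObjE simp: S_Hom obD)
next
  case (2 A B D f g)
  obtain X a Y b Z c where [simp]: "A = (X, a)" "B = (Y, b)" "D = (Z, c)" and o: "ob X a" "ob Y b" "ob Z c"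
    using 2(1-3) by (elim S_ObjE) blast
  have f: "arr f" "dm f = X" "cd f = Y" "f \<cdot> a = f" and g: "arr g" "dm g = Y" "cd g = Z" "c \<cdot> g = g"
    using 2(4,5) S_Hom o by auto
  have "c \<cdot> (g \<cdot> f) = (c \<cdot> g) \<cdot> f" using f(1-3) g(1-3) obD[OF o(3)] by simp
  then show ?case using f g S_Hom[OF o(1,3)] obD[OF o(1)] by simp
next
  case (3 A B f) then show ?case by (auto elim!: S_ObjE simp: S_Hom)
next
  case (4 A B f) then show ?case by (auto elim!: S_ObjE simp: S_Hom)
next
  case (5 A B D F f g h) then show ?case by (auto elim!: S_ObjE simp: S_Hom)
qed

text \<open>A morphism \<open>f\<close> of \<open>C\<close> that intertwines two idempotents \<open>p\<close> and \<open>q\<close> becomes the morphism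
  \<open>f p = q f\<close> between the summands; the structure morphisms of \<open>S\<close> are all of this form.\<close>

lemma intertwine_cmp:
  assumes "f \<cdot> p = q \<cdot> f" "p \<cdot> p = p" "arr f" "arr g" "arr p" "arr q" "cd p = dm f" "dm p = dm f" "cd f = dm q" "cd q = dm g"
  shows "(g \<cdot> q) \<cdot> (f \<cdot> p) = (g \<cdot> f) \<cdot> p"
proof -
  have "dm q = cd q" using assms(1,9) by (metis cd_cmp)
  then have "(g \<cdot> q) \<cdot> (f \<cdot> p) = g \<cdot> ((q \<cdot> f) \<cdot> p)" using assms(3-) by simp
  also have "\<dots> = g \<cdot> (f \<cdot> (p \<cdot> p))" unfolding assms(1)[symmetric] using assms(3-) by simp
  finally show ?thesis unfolding assms(2) using assms(3-) \<open>dm q = cd q\<close> by simp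
qed

text \<open>An isomorphism of \<open>C\<close> that intertwines \<open>p\<close> and
  \<open>q\<close> restricts to the summands. Its inverse intertwines \<open>q\<close> and
  \<open>p\<close>, so \<open>p \<cdot> iv f\<close> equals \<open>iv f \<cdot> q\<close> and is a
  morphism in the opposite direction.\<close>

lemma S_inverse:
  assumes "ob A p" "ob B q" "iso f" "dm f = A" "cd f = B" "f \<cdot> p = q \<cdot> f"
  shows "inverse_arrows S (A, p) (B, q) (f \<cdot> p) (p \<cdot> iv f)"
proof -
  note [simp] = obD[OF assms(1)] obD[OF assms(2)] assms(3-5)
  have 1: "q \<cdot> (f \<cdot> p) = f \<cdot> p"
  proof -
    have "q \<cdot> (f \<cdot> p) = q \<cdot> (q \<cdot> f)" unfolding assms(6) ..
    also have "\<dots> = f \<cdot> p" unfolding assms(6) by simp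
    finally show ?thesis .
  qed
  have pf: "iv f \<cdot> q = p \<cdot> iv f"
  proof -
    have "p = iv f \<cdot> (f \<cdot> p)" by simp
    also have "\<dots> = iv f \<cdot> (q \<cdot> f)" unfolding assms(6) ..
    finally have "p \<cdot> iv f = (iv f \<cdot> (q \<cdot> f)) \<cdot> iv f" by simp
    then show ?thesis by simp
  qed
  have 2: "p \<cdot> (iv f \<cdot> q) = p \<cdot> iv f" unfolding pf by simp
  have 3: "f \<cdot> (p \<cdot> (p \<cdot> iv f)) = q"
  proof -
    have "f \<cdot> (p \<cdot> (p \<cdot> iv f)) = (f \<cdot> p) \<cdot> iv f" by simp
    then show ?thesis unfolding assms(6) by simp
  qed
  show ?thesis unfolding inverse_arrows_def S_Hom[OF assms(1,2)] S_Hom[OF assms(2,1)]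
    using 1 2 3 by simp
qed

lemma S_iso: "ob A p \<Longrightarrow> ob B q \<Longrightarrow> iso f \<Longrightarrow> dm f = A \<Longrightarrow> cd f = B \<Longrightarrow> f \<cdot> p = q \<cdot> f \<Longrightarrow> is_iso S (A, p) (B, q) (f \<cdot> p)"
  unfolding is_iso_def using S_inverse by blast

lemma intertwine:
  assumes "ob X e" "ob Y e'" "ob Z e''"
  shows "asc C X Y Z \<cdot> ((e \<otimes>\<^sub>m e') \<otimes>\<^sub>m e'') = (e \<otimes>\<^sub>m (e' \<otimes>\<^sub>m e'')) \<cdot> asc C X Y Z"
    and "lun C X \<cdot> (u I \<otimes>\<^sub>m e) = e \<cdot> lun C X" and "run C X \<cdot> (e \<otimes>\<^sub>m u I) = e \<cdot> run C X"
    and "brd C X Y \<cdot> (e \<otimes>\<^sub>m e') = (e' \<otimes>\<^sub>m e) \<cdot> brd C X Y"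
  using asc_nat'[of e e' e''] lun_nat'[of e X] run_nat'[of e X] brd_nat'[of e e'] obD[OF assms(1)] obD[OF assms(2)] obD[OF assms(3)]
  by (simp_all add: u_absorb[OF unt_in assms(1)])

text \<open>In the coherence axioms all idempotents of a composite are collected by
  \<open>intertwine_cmp\<close> into a single one at the right end, and the corresponding axiom of
  \<open>C\<close> remains. For naturality, the morphisms of \<open>S\<close> absorb the
  idempotents.\<close>

lemma S_symmetric_monoidal: "symmetric_monoidal_category S"
proof (intro symmetric_monoidal_category.intro S_category, unfold_locales, goal_cases)
  case 1 show ?case by (simp add: S_Obj)
next
  case 2 then show ?case by (auto elim!: S_ObjE simp: S_Obj)
next
  case 3 then show ?case by (auto elim!: S_ObjE simp: S_Hom ten_cmp obD)
next
  case 4 then show ?case by (auto elim!: S_ObjE)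
next
  case 5 then show ?case by (auto elim!: S_ObjE simp: S_Hom ten_cmp)
next
  case (6 A B D)
  obtain X a Y b Z c where [simp]: "A = (X, a)" "B = (Y, b)" "D = (Z, c)" and o: "ob X a" "ob Y b" "ob Z c"
    using 6 by (elim S_ObjE) blast
  show ?case unfolding S_simps \<open>A = _\<close> \<open>B = _\<close> \<open>D = _\<close>
    by (rule S_iso) (use o intertwine[OF o] obD in simp_all)
next
  case (7 A B D A' B' D' f g h)
  obtain X a Y b Z c where [simp]: "A = (X, a)" "B = (Y, b)" "D = (Z, c)" and o: "ob X a" "ob Y b" "ob Z c"
    using 7(1-3) by (elim S_ObjE) blast
  obtain X' a' Y' b' Z' c' where [simp]: "A' = (X', a')" "B' = (Y', b')" "D' = (Z', c')" and o': "ob X' a'" "ob Y' b'" "ob Z' c'"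
    using 7(4-6) by (elim S_ObjE) blast
  have t [simp]: "arr f" "dm f = X" "cd f = X'" "a' \<cdot> f = f" "f \<cdot> a = f" "arr g" "dm g = Y" "cd g = Y'" "b' \<cdot> g = g" "g \<cdot> b = g"
    "arr h" "dm h = Z" "cd h = Z'" "c' \<cdot> h = h" "h \<cdot> c = h" using 7(7-9) o o' by (auto simp: S_Hom)
  note [simp] = obD(1-4)[OF o(1)] obD(1-4)[OF o(2)] obD(1-4)[OF o(3)] obD(1-4)[OF o'(1)] obD(1-4)[OF o'(2)] obD(1-4)[OF o'(3)]
  have "(asc C X' Y' Z' \<cdot> ((a' \<otimes>\<^sub>m b') \<otimes>\<^sub>m c')) \<cdot> ((f \<otimes>\<^sub>m g) \<otimes>\<^sub>m h) = asc C X' Y' Z' \<cdot> ((f \<otimes>\<^sub>m g) \<otimes>\<^sub>m h)"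
    by (simp add: ten_cmp)
  also have "\<dots> = asc C X' Y' Z' \<cdot> (((f \<otimes>\<^sub>m g) \<otimes>\<^sub>m h) \<cdot> ((a \<otimes>\<^sub>m b) \<otimes>\<^sub>m c))" by (simp add: ten_cmp)
  also have "\<dots> = (asc C X' Y' Z' \<cdot> ((f \<otimes>\<^sub>m g) \<otimes>\<^sub>m h)) \<cdot> ((a \<otimes>\<^sub>m b) \<otimes>\<^sub>m c)" by simp
  also have "asc C X' Y' Z' \<cdot> ((f \<otimes>\<^sub>m g) \<otimes>\<^sub>m h) = (f \<otimes>\<^sub>m (g \<otimes>\<^sub>m h)) \<cdot> asc C X Y Z"
    using asc_nat'[of f g h] by simp
  finally show ?case by simp
next
  case (8 A)
  then obtain X a where [simp]: "A = (X, a)" and o: "ob X a" by (elim S_ObjE) blast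
  show ?case unfolding \<open>A = _\<close> S_lun_run[OF o] S_simps S_unt
    by (rule S_iso) (use o intertwine(2)[OF o o o] obD in simp_all)
next
  case (9 A B f)
  obtain X a Y b where [simp]: "A = (X, a)" "B = (Y, b)" and o: "ob X a" "ob Y b" using 9(1,2) by (elim S_ObjE) blast
  have [simp]: "arr f" "dm f = X" "cd f = Y" "b \<cdot> f = f" "f \<cdot> a = f" using 9(3) o by (auto simp: S_Hom)
  note [simp] = obD(1-4)[OF o(1)] obD(1-4)[OF o(2)]
  have "(lun C Y \<cdot> (u I \<otimes>\<^sub>m b)) \<cdot> (u I \<otimes>\<^sub>m f) = lun C Y \<cdot> ((idm C I \<otimes>\<^sub>m f) \<cdot> (u I \<otimes>\<^sub>m a))"
    by (simp add: ten_cmp u_idem)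
  also have "\<dots> = (lun C Y \<cdot> (idm C I \<otimes>\<^sub>m f)) \<cdot> (u I \<otimes>\<^sub>m a)" by simp
  also have "\<dots> = (f \<cdot> lun C X) \<cdot> (u I \<otimes>\<^sub>m a)" using lun_nat'[of f Y] by simp
  finally show ?case using o by simp
next
  case (10 A)
  then obtain X a where [simp]: "A = (X, a)" and o: "ob X a" by (elim S_ObjE) blast
  show ?case unfolding \<open>A = _\<close> S_lun_run[OF o] S_simps S_unt
    by (rule S_iso) (use o intertwine(3)[OF o o o] obD in simp_all)
next
  case (11 A B f)
  obtain X a Y b where [simp]: "A = (X, a)" "B = (Y, b)" and o: "ob X a" "ob Y b" using 11(1,2) by (elim S_ObjE) blast
  have [simp]: "arr f" "dm f = X" "cd f = Y" "b \<cdot> f = f" "f \<cdot> a = f" using 11(3) o by (auto simp: S_Hom)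
  note [simp] = obD(1-4)[OF o(1)] obD(1-4)[OF o(2)]
  have "(run C Y \<cdot> (b \<otimes>\<^sub>m u I)) \<cdot> (f \<otimes>\<^sub>m u I) = run C Y \<cdot> ((f \<otimes>\<^sub>m idm C I) \<cdot> (a \<otimes>\<^sub>m u I))"
    by (simp add: ten_cmp u_idem)
  also have "\<dots> = (run C Y \<cdot> (f \<otimes>\<^sub>m idm C I)) \<cdot> (a \<otimes>\<^sub>m u I)" by simp
  also have "\<dots> = (f \<cdot> run C X) \<cdot> (a \<otimes>\<^sub>m u I)" using run_nat'[of f Y] by simp
  finally show ?case using o by simp
next
  case (12 A B D F)
  obtain W w X x Y y Z z where [simp]: "A = (W, w)" "B = (X, x)" "D = (Y, y)" "F = (Z, z)"
    and o: "ob W w" "ob X x" "ob Y y" "ob Z z" using 12 by (elim S_ObjE) blast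
  note [simp] = obD[OF o(1)] obD[OF o(2)] obD[OF o(3)] obD[OF o(4)]
  let ?P = "((w \<otimes>\<^sub>m x) \<otimes>\<^sub>m y) \<otimes>\<^sub>m z"
  have L: "(asc C W X (Y \<otimes>\<^sub>o Z) \<cdot> ((w \<otimes>\<^sub>m x) \<otimes>\<^sub>m (y \<otimes>\<^sub>m z))) \<cdot> (asc C (W \<otimes>\<^sub>o X) Y Z \<cdot> ?P)
    = (asc C W X (Y \<otimes>\<^sub>o Z) \<cdot> asc C (W \<otimes>\<^sub>o X) Y Z) \<cdot> ?P"
    by (rule intertwine_cmp) (use intertwine(1)[OF ob_ten[OF o(1,2)] o(3,4)] in \<open>simp_all add: ten_cmp\<close>)
  have 1: "w \<otimes>\<^sub>m (asc C X Y Z \<cdot> ((x \<otimes>\<^sub>m y) \<otimes>\<^sub>m z)) = (idm C W \<otimes>\<^sub>m asc C X Y Z) \<cdot> (w \<otimes>\<^sub>m ((x \<otimes>\<^sub>m y) \<otimes>\<^sub>m z))"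
    "(asc C W X Y \<cdot> ((w \<otimes>\<^sub>m x) \<otimes>\<^sub>m y)) \<otimes>\<^sub>m z = (asc C W X Y \<otimes>\<^sub>m idm C Z) \<cdot> ?P"
    by (simp_all add: ten_cmp)
  have 2: "((idm C W \<otimes>\<^sub>m asc C X Y Z) \<cdot> (w \<otimes>\<^sub>m ((x \<otimes>\<^sub>m y) \<otimes>\<^sub>m z))) \<cdot> (asc C W (X \<otimes>\<^sub>o Y) Z \<cdot> ((w \<otimes>\<^sub>m (x \<otimes>\<^sub>m y)) \<otimes>\<^sub>m z))
    = ((idm C W \<otimes>\<^sub>m asc C X Y Z) \<cdot> asc C W (X \<otimes>\<^sub>o Y) Z) \<cdot> ((w \<otimes>\<^sub>m (x \<otimes>\<^sub>m y)) \<otimes>\<^sub>m z)"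
    by (rule intertwine_cmp) (use intertwine(1)[OF o(1) ob_ten[OF o(2,3)] o(4)] in \<open>simp_all add: ten_cmp\<close>)
  have 3: "(((idm C W \<otimes>\<^sub>m asc C X Y Z) \<cdot> asc C W (X \<otimes>\<^sub>o Y) Z) \<cdot> ((w \<otimes>\<^sub>m (x \<otimes>\<^sub>m y)) \<otimes>\<^sub>m z)) \<cdot> ((asc C W X Y \<otimes>\<^sub>m idm C Z) \<cdot> ?P)
    = (((idm C W \<otimes>\<^sub>m asc C X Y Z) \<cdot> asc C W (X \<otimes>\<^sub>o Y) Z) \<cdot> (asc C W X Y \<otimes>\<^sub>m idm C Z)) \<cdot> ?P"
    by (rule intertwine_cmp) (use intertwine(1)[OF o(1,2,3)] in \<open>simp_all add: ten_cmp\<close>)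
  show ?case unfolding S_simps \<open>A = _\<close> \<open>B = _\<close> \<open>D = _\<close> \<open>F = _\<close> unfolding L 1 2 3
    by (simp only: pentagon[OF obD(1)[OF o(1)] obD(1)[OF o(2)] obD(1)[OF o(3)] obD(1)[OF o(4)]])
next
  case (13 A B)
  obtain X a Y b where [simp]: "A = (X, a)" "B = (Y, b)" and o: "ob X a" "ob Y b" using 13(1,2) by (elim S_ObjE) blast
  note [simp] = obD[OF o(1)] obD[OF o(2)]
  have 1: "a \<otimes>\<^sub>m (lun C Y \<cdot> (u I \<otimes>\<^sub>m b)) = (idm C X \<otimes>\<^sub>m lun C Y) \<cdot> (a \<otimes>\<^sub>m (u I \<otimes>\<^sub>m b))"
    "(run C X \<cdot> (a \<otimes>\<^sub>m u I)) \<otimes>\<^sub>m b = (run C X \<otimes>\<^sub>m idm C Y) \<cdot> ((a \<otimes>\<^sub>m u I) \<otimes>\<^sub>m b)"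
    by (simp_all add: ten_cmp)
  have 2: "((idm C X \<otimes>\<^sub>m lun C Y) \<cdot> (a \<otimes>\<^sub>m (u I \<otimes>\<^sub>m b))) \<cdot> (asc C X I Y \<cdot> ((a \<otimes>\<^sub>m u I) \<otimes>\<^sub>m b))
    = ((idm C X \<otimes>\<^sub>m lun C Y) \<cdot> asc C X I Y) \<cdot> ((a \<otimes>\<^sub>m u I) \<otimes>\<^sub>m b)"
    by (rule intertwine_cmp) (use intertwine(1)[OF o(1) ob_unt o(2)] in \<open>simp_all add: ten_cmp u_idem\<close>)
  show ?case unfolding S_simps S_unt \<open>A = _\<close> \<open>B = _\<close> S_lun_run[OF o(1)] S_lun_run[OF o(2)] unfolding 1 2
    by (simp only: triangle[OF obD(1)[OF o(1)] obD(1)[OF o(2)]])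
next
  case (14 A B)
  obtain X a Y b where [simp]: "A = (X, a)" "B = (Y, b)" and o: "ob X a" "ob Y b" using 14(1,2) by (elim S_ObjE) blast
  note [simp] = obD[OF o(1)] obD[OF o(2)]
  have "(b \<otimes>\<^sub>m a) \<cdot> (brd C X Y \<cdot> (a \<otimes>\<^sub>m b)) = ((b \<otimes>\<^sub>m a) \<cdot> brd C X Y) \<cdot> (a \<otimes>\<^sub>m b)" by simp
  also have "\<dots> = brd C X Y \<cdot> (a \<otimes>\<^sub>m b)" unfolding intertwine(4)[OF o(1,2) o(1), symmetric] by (simp add: ten_cmp)
  finally show ?case using S_Hom[OF ob_ten[OF o] ob_ten[OF o(2,1)]] by (simp add: ten_cmp)
next
  case (15 A B A' B' f g)
  obtain X a Y b where [simp]: "A = (X, a)" "B = (Y, b)" and o: "ob X a" "ob Y b" using 15(1,2) by (elim S_ObjE) blast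
  obtain X' a' Y' b' where [simp]: "A' = (X', a')" "B' = (Y', b')" and o': "ob X' a'" "ob Y' b'" using 15(3,4) by (elim S_ObjE) blast
  have t [simp]: "arr f" "dm f = X" "cd f = X'" "a' \<cdot> f = f" "f \<cdot> a = f" "arr g" "dm g = Y" "cd g = Y'" "b' \<cdot> g = g" "g \<cdot> b = g"
    using 15(5,6) o o' by (auto simp: S_Hom)
  note [simp] = obD(1-4)[OF o(1)] obD(1-4)[OF o(2)] obD(1-4)[OF o'(1)] obD(1-4)[OF o'(2)]
  have "(brd C X' Y' \<cdot> (a' \<otimes>\<^sub>m b')) \<cdot> (f \<otimes>\<^sub>m g) = (brd C X' Y' \<cdot> (f \<otimes>\<^sub>m g)) \<cdot> (a \<otimes>\<^sub>m b)"
    by (simp add: ten_cmp)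
  also have "brd C X' Y' \<cdot> (f \<otimes>\<^sub>m g) = (g \<otimes>\<^sub>m f) \<cdot> brd C X Y" using brd_nat'[of f g] by simp
  finally show ?case by simp
next
  case (16 A B)
  obtain X a Y b where [simp]: "A = (X, a)" "B = (Y, b)" and o: "ob X a" "ob Y b" using 16(1,2) by (elim S_ObjE) blast
  note [simp] = obD[OF o(1)] obD[OF o(2)]
  have "(brd C Y X \<cdot> (b \<otimes>\<^sub>m a)) \<cdot> (brd C X Y \<cdot> (a \<otimes>\<^sub>m b)) = (brd C Y X \<cdot> brd C X Y) \<cdot> (a \<otimes>\<^sub>m b)"
    by (rule intertwine_cmp) (use intertwine(4)[OF o(1,2) o(1)] in \<open>simp_all add: ten_cmp\<close>)
  then show ?case using brd_sym[of X Y] by simp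
next
  case (17 A B D)
  obtain X x Y y Z z where [simp]: "A = (X, x)" "B = (Y, y)" "D = (Z, z)" and o: "ob X x" "ob Y y" "ob Z z"
    using 17 by (elim S_ObjE) blast
  note [simp] = obD[OF o(1)] obD[OF o(2)] obD[OF o(3)]
  let ?P = "(x \<otimes>\<^sub>m y) \<otimes>\<^sub>m z"
  have L1: "(asc C Y Z X \<cdot> ((y \<otimes>\<^sub>m z) \<otimes>\<^sub>m x)) \<cdot> (brd C X (Y \<otimes>\<^sub>o Z) \<cdot> (x \<otimes>\<^sub>m (y \<otimes>\<^sub>m z))) = (asc C Y Z X \<cdot> brd C X (Y \<otimes>\<^sub>o Z)) \<cdot> (x \<otimes>\<^sub>m (y \<otimes>\<^sub>m z))"
    by (rule intertwine_cmp) (use intertwine(4)[OF o(1) ob_ten[OF o(2,3)] o(1)] in \<open>simp_all add: ten_cmp\<close>)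
  have L2: "((asc C Y Z X \<cdot> brd C X (Y \<otimes>\<^sub>o Z)) \<cdot> (x \<otimes>\<^sub>m (y \<otimes>\<^sub>m z))) \<cdot> (asc C X Y Z \<cdot> ?P) = ((asc C Y Z X \<cdot> brd C X (Y \<otimes>\<^sub>o Z)) \<cdot> asc C X Y Z) \<cdot> ?P"
    by (rule intertwine_cmp) (use intertwine(1)[OF o] in \<open>simp_all add: ten_cmp\<close>)
  have 1: "y \<otimes>\<^sub>m (brd C X Z \<cdot> (x \<otimes>\<^sub>m z)) = (idm C Y \<otimes>\<^sub>m brd C X Z) \<cdot> (y \<otimes>\<^sub>m (x \<otimes>\<^sub>m z))"
    "(brd C X Y \<cdot> (x \<otimes>\<^sub>m y)) \<otimes>\<^sub>m z = (brd C X Y \<otimes>\<^sub>m idm C Z) \<cdot> ?P"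
    by (simp_all add: ten_cmp)
  have 2: "((idm C Y \<otimes>\<^sub>m brd C X Z) \<cdot> (y \<otimes>\<^sub>m (x \<otimes>\<^sub>m z))) \<cdot> (asc C Y X Z \<cdot> ((y \<otimes>\<^sub>m x) \<otimes>\<^sub>m z)) = ((idm C Y \<otimes>\<^sub>m brd C X Z) \<cdot> asc C Y X Z) \<cdot> ((y \<otimes>\<^sub>m x) \<otimes>\<^sub>m z)"
    by (rule intertwine_cmp) (use intertwine(1)[OF o(2,1,3)] in \<open>simp_all add: ten_cmp\<close>)
  have 3: "(((idm C Y \<otimes>\<^sub>m brd C X Z) \<cdot> asc C Y X Z) \<cdot> ((y \<otimes>\<^sub>m x) \<otimes>\<^sub>m z)) \<cdot> ((brd C X Y \<otimes>\<^sub>m idm C Z) \<cdot> ?P)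
    = (((idm C Y \<otimes>\<^sub>m brd C X Z) \<cdot> asc C Y X Z) \<cdot> (brd C X Y \<otimes>\<^sub>m idm C Z)) \<cdot> ?P"
    by (rule intertwine_cmp) (use intertwine(4)[OF o(1,2) o(1)] in \<open>simp_all add: ten_cmp\<close>)
  show ?case unfolding S_simps \<open>A = _\<close> \<open>B = _\<close> \<open>D = _\<close> unfolding L1 L2 1 2 3
    by (simp only: hexagon[OF obD(1)[OF o(1)] obD(1)[OF o(2)] obD(1)[OF o(3)]])
qed

lemma S_linear: "linear_category S"
proof (intro linear_category.intro S_category, unfold_locales, goal_cases)
  case (7 A B f)
  obtain X a Y b where [simp]: "A = (X, a)" "B = (Y, b)" and o: "ob X a" "ob Y b" using 7(1,2) by (elim S_ObjE) blast
  have f [simp]: "arr f" "dm f = X" "cd f = Y" "b \<cdot> f = f" "f \<cdot> a = f" using 7(3) o by (auto simp: S_Hom)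
  note [simp] = obD(1-4)[OF o(1)] obD(1-4)[OF o(2)]
  have "(- 1) *\<^sub>m f \<oplus>\<^sub>m f = zeroM C X Y"
    using sub_self[of f] add_comm'[of "(- 1) *\<^sub>m f" f] by (simp add: sub_def)
  moreover have "(- 1) *\<^sub>m f \<in> Hom S (X, a) (Y, b)" using S_Hom[OF o] by simp
  ultimately show ?case by auto
qed (auto elim!: S_ObjE simp: S_Hom obD add_assoc' smul_add_left' intro: add_comm')

lemma S_zero_object: "X \<in> Obj C \<Longrightarrow> zero_object S (X, zeroM C X X)"
proof -
  assume X [simp]: "X \<in> Obj C"
  have o: "ob X (zeroM C X X)" by (simp add: ob_def)
  have "(\<exists>!f. f \<in> Hom S (X, zeroM C X X) (Y, b)) \<and> (\<exists>!f. f \<in> Hom S (Y, b) (X, zeroM C X X))" if b: "ob Y b" for Y b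
  proof -
    note [simp] = obD(1-4)[OF b]
    show ?thesis
      by (intro conjI ex1I[of _ "zeroM C X Y"] ex1I[of _ "zeroM C Y X"]) (auto simp: S_Hom[OF o b] S_Hom[OF b o])
  qed
  note unique = this
  show ?thesis unfolding zero_object_def
  proof (intro conjI ballI)
    show "(X, zeroM C X X) \<in> Obj S" using o S_Obj by blast
    fix A assume "A \<in> Obj S"
    then obtain Y b where A: "A = (Y, b)" "ob Y b" by (elim S_ObjE)
    show "\<exists>!f. f \<in> Hom S (X, zeroM C X X) A" "\<exists>!f. f \<in> Hom S A (X, zeroM C X X)"
      using unique[OF A(2)] unfolding A(1) by blast+
  qed
qed

lemma S_direct_sum:
  assumes a: "ob X a" and b: "ob Y b"
  shows "\<exists>Z. is_direct_sum S [(X, a), (Y, b)] Z"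
proof -
  note [simp] = obD[OF a] obD[OF b]
  obtain Z where Z: "is_direct_sum C [X, Y] Z" using direct_sum_ex[of X Y] by auto
  obtain i0 i1 p0 p1 where [simp]: "Z \<in> Obj C"
    "arr i0" "dm i0 = X" "cd i0 = Z" "arr i1" "dm i1 = Y" "cd i1 = Z"
    "arr p0" "dm p0 = Z" "cd p0 = X" "arr p1" "dm p1 = Z" "cd p1 = Y"
    and ip: "p0 \<cdot> i0 = idm C X" "p1 \<cdot> i1 = idm C Y" "p0 \<cdot> i1 = zeroM C Y X" "p1 \<cdot> i0 = zeroM C X Y"
    using direct_sum2[OF Z] by metis
  have ipr: "p0 \<cdot> (i0 \<cdot> r) = r" "p1 \<cdot> (i0 \<cdot> r) = zeroM C (dm r) Y" if "arr r" "cd r = X" for r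
    using cmp_ext[OF ip(1), of r] cmp_ext[OF ip(4), of r] that by simp_all
  have ipr': "p1 \<cdot> (i1 \<cdot> r) = r" "p0 \<cdot> (i1 \<cdot> r) = zeroM C (dm r) X" if "arr r" "cd r = Y" for r
    using cmp_ext[OF ip(2), of r] cmp_ext[OF ip(3), of r] that by simp_all
  \<comment> \<open>The idempotent on \<open>Z\<close> acts as \<open>a\<close> on the first summand
    and as \<open>b\<close> on the second.\<close>
  let ?e = "i0 \<cdot> (a \<cdot> p0) \<oplus>\<^sub>m i1 \<cdot> (b \<cdot> p1)"
  have ux: "u Z \<cdot> (i0 \<cdot> (a \<cdot> p0)) = i0 \<cdot> (a \<cdot> p0)" "u Z \<cdot> (i1 \<cdot> (b \<cdot> p1)) = i1 \<cdot> (b \<cdot> p1)"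
  proof -
    have "u Z \<cdot> (i0 \<cdot> (a \<cdot> p0)) = (u Z \<cdot> i0) \<cdot> (a \<cdot> p0)" by simp
    also have "\<dots> = (i0 \<cdot> u X) \<cdot> (a \<cdot> p0)" using u_nat[of i0] by simp
    finally show "u Z \<cdot> (i0 \<cdot> (a \<cdot> p0)) = i0 \<cdot> (a \<cdot> p0)" by simp
    have "u Z \<cdot> (i1 \<cdot> (b \<cdot> p1)) = (u Z \<cdot> i1) \<cdot> (b \<cdot> p1)" by simp
    also have "\<dots> = (i1 \<cdot> u Y) \<cdot> (b \<cdot> p1)" using u_nat[of i1] by simp
    finally show "u Z \<cdot> (i1 \<cdot> (b \<cdot> p1)) = i1 \<cdot> (b \<cdot> p1)" by simp
  qed
  have e: "ob Z ?e" by (simp add: ob_def ux ipr ipr')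
  have H: "i0 \<cdot> a \<in> Hom S (X, a) (Z, ?e)" "i1 \<cdot> b \<in> Hom S (Y, b) (Z, ?e)" "a \<cdot> p0 \<in> Hom S (Z, ?e) (X, a)" "b \<cdot> p1 \<in> Hom S (Z, ?e) (Y, b)"
    by (simp_all add: S_Hom[OF a e] S_Hom[OF b e] S_Hom[OF e a] S_Hom[OF e b] ipr ipr' ip)
  let ?i = "\<lambda>j::nat. if j = 0 then i0 \<cdot> a else i1 \<cdot> b" and ?p = "\<lambda>j::nat. if j = 0 then a \<cdot> p0 else b \<cdot> p1"
  let ?L = "[(X, a), (Y, b)]"
  have two: "j = 0 \<or> j = 1" if "j < length ?L" for j using that by auto
  have u2: "[0..<length ?L] = [0, 1]" by (simp add: upt_rec)
  have "?i j \<in> Hom S (?L ! j) (Z, ?e) \<and> ?p j \<in> Hom S (Z, ?e) (?L ! j)" if "j < length ?L" for j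
    using two[OF that] H by auto
  moreover have "?p l \<cdot>\<^bsub>S\<^esub> ?i j = (if j = l then idm S (?L ! j) else zeroM S (?L ! j) (?L ! l))"
    if "j < length ?L" "l < length ?L" for j l
    using two[OF that(1)] two[OF that(2)] by (auto simp: ipr ipr')
  moreover have "hom_sum S (Z, ?e) (Z, ?e) (map (\<lambda>j. ?i j \<cdot>\<^bsub>S\<^esub> ?p j) [0..<length ?L]) = idm S (Z, ?e)"
    unfolding u2 by (simp add: hom_sum_def)
  moreover have "set ?L \<subseteq> Obj S" using a b by (simp add: S_Obj)
  ultimately have "is_direct_sum S ?L (Z, ?e)" unfolding is_direct_sum_def using e S_Obj
    by (intro conjI exI[of _ ?i] exI[of _ ?p] allI impI) simp_all
  then show ?thesis by blast
qed

lemma S_additive: "additive_category S"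
proof (intro additive_category.intro S_linear, unfold_locales, goal_cases)
  case 1 then show ?case using S_zero_object[OF unt_in] by blast
next
  case 2 then show ?case using S_direct_sum by (auto elim!: S_ObjE)
qed

lemma S_tensor: "tensor_category S"
  by (intro tensor_category.intro S_symmetric_monoidal S_additive, unfold_locales)
    (auto elim!: S_ObjE simp: S_Hom ten_add ten_smul)

end

section \<open>Kernels, cokernels and duals in the summand\<close>

context central_idempotent
begin

text \<open>All kernels constructed below are split. With a retraction \<open>r\<close> of
  \<open>i\<close>, the only candidate for the factorization of \<open>t\<close> is
  \<open>r \<cdot> t\<close>, and the premise on \<open>t\<close> says that it works.\<close>

lemma S_kernel:
  assumes a: "ob X a" and b: "ob Y b" and k: "ob K k" and f: "f \<in> Hom S (X, a) (Y, b)" and i: "i \<in> Hom S (K, k) (X, a)"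
    and fi: "f \<cdot> i = zeroM C K Y" and r: "r \<in> Hom S (X, a) (K, k)" "r \<cdot> i = k"
    and t: "\<And>t. arr t \<Longrightarrow> cd t = X \<Longrightarrow> a \<cdot> t = t \<Longrightarrow> f \<cdot> t = zeroM C (dm t) Y \<Longrightarrow> i \<cdot> (r \<cdot> t) = t"
  shows "is_kernel S (X, a) (Y, b) f (K, k) i"
proof -
  note [simp] = obD(1-5)[OF a] obD(1-5)[OF b] obD(1-5)[OF k]
  have [simp]: "arr f" "dm f = X" "cd f = Y" "arr i" "dm i = K" "cd i = X" "arr r" "dm r = X" "cd r = K" "k \<cdot> r = r"
    using f i r by (simp_all add: S_Hom[OF a b] S_Hom[OF k a] S_Hom[OF a k])
  have kr: "k \<cdot> (r \<cdot> t) = r \<cdot> t" if "arr t" "cd t = X" for t by (rule cmp_ext) (use that in auto)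
  have "\<exists>!v. v \<in> Hom S (T, c) (K, k) \<and> i \<cdot> v = t" if c: "ob T c" and tT: "t \<in> Hom S (T, c) (X, a)" and z: "f \<cdot> t = zeroM C T Y" for T c t
  proof (rule ex1I[of _ "r \<cdot> t"])
    have t1 [simp]: "arr t" "dm t = T" "cd t = X" "a \<cdot> t = t" "t \<cdot> c = t" using tT by (simp_all add: S_Hom[OF c a])
    note [simp] = obD(1-4)[OF c]
    show "r \<cdot> t \<in> Hom S (T, c) (K, k) \<and> i \<cdot> (r \<cdot> t) = t" using t[OF t1(1,3,4)] z by (simp add: S_Hom[OF c k] kr)
    fix v assume v: "v \<in> Hom S (T, c) (K, k) \<and> i \<cdot> v = t"
    then have [simp]: "arr v" "dm v = T" "cd v = K" "k \<cdot> v = v" by (simp_all add: S_Hom[OF c k])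
    have "r \<cdot> t = r \<cdot> (i \<cdot> v)" using v by simp
    also have "\<dots> = k \<cdot> v" by (rule cmp_ext[OF r(2)]) simp_all
    finally show "v = r \<cdot> t" by simp
  qed
  then have "\<forall>A\<in>Obj S. \<forall>t\<in>Hom S A (X, a). f \<cdot>\<^bsub>S\<^esub> t = zeroM S A (Y, b) \<longrightarrow> (\<exists>!v. v \<in> Hom S A (K, k) \<and> i \<cdot>\<^bsub>S\<^esub> v = t)"
    by (clarsimp elim!: S_ObjE)
  then show ?thesis unfolding is_kernel_def using i fi k by (simp add: S_Obj)
qed

lemma S_cokernel:
  assumes a: "ob X a" and b: "ob Y b" and k: "ob K k" and f: "f \<in> Hom S (Y, b) (X, a)" and i: "i \<in> Hom S (X, a) (K, k)"
    and fi: "i \<cdot> f = zeroM C Y K" and r: "r \<in> Hom S (K, k) (X, a)" "i \<cdot> r = k"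
    and t: "\<And>t. arr t \<Longrightarrow> dm t = X \<Longrightarrow> t \<cdot> a = t \<Longrightarrow> t \<cdot> f = zeroM C Y (cd t) \<Longrightarrow> t \<cdot> (r \<cdot> i) = t"
  shows "is_cokernel S (Y, b) (X, a) f (K, k) i"
proof -
  note [simp] = obD(1-5)[OF a] obD(1-5)[OF b] obD(1-5)[OF k]
  have [simp]: "arr f" "dm f = Y" "cd f = X" "arr i" "dm i = X" "cd i = K" "arr r" "dm r = K" "cd r = X" "r \<cdot> k = r"
    using f i r by (simp_all add: S_Hom[OF b a] S_Hom[OF k a] S_Hom[OF a k])
  have "\<exists>!v. v \<in> Hom S (K, k) (T, c) \<and> v \<cdot> i = t" if c: "ob T c" and tT: "t \<in> Hom S (X, a) (T, c)" and z: "t \<cdot> f = zeroM C Y T" for T c t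
  proof (rule ex1I[of _ "t \<cdot> r"])
    have t1 [simp]: "arr t" "dm t = X" "cd t = T" "t \<cdot> a = t" "c \<cdot> t = t" using tT by (simp_all add: S_Hom[OF a c])
    note [simp] = obD(1-4)[OF c]
    have "c \<cdot> (t \<cdot> r) = t \<cdot> r" by (rule cmp_ext) simp_all
    then show "t \<cdot> r \<in> Hom S (K, k) (T, c) \<and> (t \<cdot> r) \<cdot> i = t" using t[OF t1(1,2,4)] z by (simp add: S_Hom[OF k c])
    fix v assume v: "v \<in> Hom S (K, k) (T, c) \<and> v \<cdot> i = t"
    then have [simp]: "arr v" "dm v = K" "cd v = T" "v \<cdot> k = v" by (simp_all add: S_Hom[OF k c])
    have "t \<cdot> r = (v \<cdot> i) \<cdot> r" using v by simp
    also have "\<dots> = v \<cdot> (i \<cdot> r)" by simp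
    finally show "v = t \<cdot> r" unfolding r(2) by simp
  qed
  then have "\<forall>A\<in>Obj S. \<forall>t\<in>Hom S (X, a) A. t \<cdot>\<^bsub>S\<^esub> f = zeroM S (Y, b) A \<longrightarrow> (\<exists>!v. v \<in> Hom S (K, k) A \<and> v \<cdot>\<^bsub>S\<^esub> i = t)"
    by (clarsimp elim!: S_ObjE)
  then show ?thesis unfolding is_cokernel_def using i fi k by (simp add: S_Obj)
qed

lemma ob_sub:
  assumes "ob X e" "arr f" "dm f = X" "cd f = X" "f \<cdot> f = f" "e \<cdot> f = f" "f \<cdot> e = f"
  shows "ob X f" "ob X (e \<ominus>\<^sub>m f)"
proof -
  note [simp] = obD[OF assms(1)] assms(2-)
  have uf: "u X \<cdot> f = f"
  proof -
    have "u X \<cdot> f = u X \<cdot> (e \<cdot> f)" by simp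
    also have "\<dots> = e \<cdot> f" by (rule obD(9)[OF assms(1)]) simp_all
    finally show ?thesis by simp
  qed
  then show "ob X f" by (simp add: ob_def)
  show "ob X (e \<ominus>\<^sub>m f)" by (simp add: ob_def uf)
qed

text \<open>Cutting a quasi-inverse from \<open>C\<close> down by the idempotents on both sides
  keeps it a quasi-inverse, since \<open>f\<close> absorbs them.\<close>

lemma S_quasi_inverse:
  assumes "regular C" "ob X a" "ob Y b" "f \<in> Hom S (X, a) (Y, b)"
  obtains g where "g \<in> Hom S (Y, b) (X, a)" "f \<cdot> (g \<cdot> f) = f"
proof -
  note [simp] = obD[OF assms(2)] obD[OF assms(3)]
  have f [simp]: "arr f" "dm f = X" "cd f = Y" "b \<cdot> f = f" "f \<cdot> a = f" using assms(4) by (simp_all add: S_Hom[OF assms(2,3)])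
  have fa: "f \<cdot> (a \<cdot> r) = f \<cdot> r" if "arr r" "cd r = X" for r by (rule cmp_ext) (use that in auto)
  have "f \<in> Hom C X Y" by (simp add: Hom_iff)
  then obtain y where "y \<in> Hom C Y X" "f \<cdot> (y \<cdot> f) = f" using assms(1) unfolding regular_def using obD(1)[OF assms(2)] obD(1)[OF assms(3)] by blast
  then have y [simp]: "arr y" "dm y = Y" "cd y = X" "f \<cdot> (y \<cdot> f) = f" by (simp_all add: Hom_iff)
  show thesis
    by (rule that[of "a \<cdot> (y \<cdot> b)"]) (simp_all add: S_Hom[OF assms(3,2)] fa)
qed

text \<open>With a quasi-inverse \<open>g\<close> of \<open>f\<close>, both
  \<open>g \<cdot> f\<close> and \<open>f \<cdot> g\<close> are idempotent, and their complements
  give the kernel and the cokernel. If \<open>f\<close> is a monomorphism, cancelling it in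
  \<open>f \<cdot> (g \<cdot> f) = f\<close> shows that it is split, hence the kernel of the
  complement of \<open>f \<cdot> g\<close>; epimorphisms are treated dually.\<close>

lemma S_abelian:
  assumes "regular C"
  shows "abelian_category S"
proof (intro abelian_category.intro S_additive, unfold_locales)
  fix A B f assume "A \<in> Obj S" "B \<in> Obj S" and f: "f \<in> Hom S A B"
  then obtain X a Y b where AB: "A = (X, a)" "B = (Y, b)" and o: "ob X a" "ob Y b" by (elim S_ObjE) blast
  note [simp] = obD[OF o(1)] obD[OF o(2)]
  have f' [simp]: "arr f" "dm f = X" "cd f = Y" "b \<cdot> f = f" "f \<cdot> a = f" using f by (simp_all add: AB S_Hom[OF o])
  obtain g where g: "g \<in> Hom S (Y, b) (X, a)" "f \<cdot> (g \<cdot> f) = f"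
    using S_quasi_inverse[OF assms o] f unfolding AB by blast
  then have g' [simp]: "arr g" "dm g = Y" "cd g = X" "a \<cdot> g = g" "g \<cdot> b = g" "f \<cdot> (g \<cdot> f) = f" by (simp_all add: S_Hom[OF o(2,1)])
  have ag: "a \<cdot> (g \<cdot> r) = g \<cdot> r" if "arr r" "cd r = Y" for r by (rule cmp_ext) (use that in auto)
  have bf: "b \<cdot> (f \<cdot> r) = f \<cdot> r" if "arr r" "cd r = X" for r by (rule cmp_ext) (use that in auto)
  have k: "ob X (a \<ominus>\<^sub>m g \<cdot> f)" by (rule ob_sub(2)[OF o(1)]) (simp_all add: ag)
  have c: "ob Y (b \<ominus>\<^sub>m f \<cdot> g)" by (rule ob_sub(2)[OF o(2)]) (simp_all add: bf, simp flip: cmp_cmp)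
  have "is_kernel S (X, a) (Y, b) f (X, a \<ominus>\<^sub>m g \<cdot> f) (a \<ominus>\<^sub>m g \<cdot> f)"
    by (rule S_kernel[OF o k f[unfolded AB], where r = "a \<ominus>\<^sub>m g \<cdot> f"]) (simp_all add: S_Hom[OF k o(1)] S_Hom[OF o(1) k] obD(5)[OF k] ag)
  then show "\<exists>K i. is_kernel S A B f K i" unfolding AB by blast
  have "is_cokernel S (X, a) (Y, b) f (Y, b \<ominus>\<^sub>m f \<cdot> g) (b \<ominus>\<^sub>m f \<cdot> g)"
  proof (rule S_cokernel[OF o(2,1) c f[unfolded AB], where r = "b \<ominus>\<^sub>m f \<cdot> g"])
    show "b \<ominus>\<^sub>m f \<cdot> g \<in> Hom S (Y, b) (Y, b \<ominus>\<^sub>m f \<cdot> g)" "b \<ominus>\<^sub>m f \<cdot> g \<in> Hom S (Y, b \<ominus>\<^sub>m f \<cdot> g) (Y, b)"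
      "(b \<ominus>\<^sub>m f \<cdot> g) \<cdot> (b \<ominus>\<^sub>m f \<cdot> g) = b \<ominus>\<^sub>m f \<cdot> g"
      unfolding S_Hom[OF o(2) c] S_Hom[OF c o(2)] obD(5)[OF c] by (simp_all add: bf)
    show "(b \<ominus>\<^sub>m f \<cdot> g) \<cdot> f = zeroM C X Y" by simp
    fix t assume [simp]: "arr t" "dm t = Y" "t \<cdot> b = t" and z: "t \<cdot> f = zeroM C X (cd t)"
    have "t \<cdot> (f \<cdot> g) = (t \<cdot> f) \<cdot> g" by simp
    also have "\<dots> = zeroM C Y (cd t)" unfolding z by simp
    finally show "t \<cdot> ((b \<ominus>\<^sub>m f \<cdot> g) \<cdot> (b \<ominus>\<^sub>m f \<cdot> g)) = t" unfolding obD(5)[OF c] by simp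
  qed
  then show "\<exists>Q p. is_cokernel S A B f Q p" unfolding AB by blast
next
  fix A B f assume AO: "A \<in> Obj S" and "B \<in> Obj S" and m: "is_mono S A B f"
  then obtain X a Y b where AB: "A = (X, a)" "B = (Y, b)" and o: "ob X a" "ob Y b" by (elim S_ObjE) blast
  have f: "f \<in> Hom S A B" using m unfolding is_mono_def by blast
  note [simp] = obD[OF o(1)] obD[OF o(2)]
  have f' [simp]: "arr f" "dm f = X" "cd f = Y" "b \<cdot> f = f" "f \<cdot> a = f" using f by (simp_all add: AB S_Hom[OF o])
  obtain g where g: "g \<in> Hom S (Y, b) (X, a)" "f \<cdot> (g \<cdot> f) = f"
    using S_quasi_inverse[OF assms o] f unfolding AB by blast
  then have g' [simp]: "arr g" "dm g = Y" "cd g = X" "a \<cdot> g = g" "g \<cdot> b = g" "f \<cdot> (g \<cdot> f) = f" by (simp_all add: S_Hom[OF o(2,1)])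
  have bf: "b \<cdot> (f \<cdot> r) = f \<cdot> r" if "arr r" "cd r = X" for r by (rule cmp_ext) (use that in auto)
  have ag: "a \<cdot> (g \<cdot> r) = g \<cdot> r" if "arr r" "cd r = Y" for r by (rule cmp_ext) (use that in auto)
  have "g \<cdot> f \<in> Hom S A A" "a \<in> Hom S A A" "f \<cdot>\<^bsub>S\<^esub> (g \<cdot> f) = f \<cdot>\<^bsub>S\<^esub> a" by (simp_all add: AB S_Hom[OF o(1,1)] ag)
  then have gf: "g \<cdot> f = a" using m AO unfolding is_mono_def by blast
  have h: "b \<ominus>\<^sub>m f \<cdot> g \<in> Hom S (Y, b) (Y, b)" by (simp add: S_Hom[OF o(2,2)] bf)
  have "is_kernel S (Y, b) (Y, b) (b \<ominus>\<^sub>m f \<cdot> g) (X, a) f"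
  proof (rule S_kernel[OF o(2,2,1) h f[unfolded AB] _ g(1) gf])
    show "(b \<ominus>\<^sub>m f \<cdot> g) \<cdot> f = zeroM C X Y" by (simp add: gf)
    fix t assume t [simp]: "arr t" "cd t = Y" "b \<cdot> t = t" and z: "(b \<ominus>\<^sub>m f \<cdot> g) \<cdot> t = zeroM C (dm t) Y"
    have "t \<ominus>\<^sub>m f \<cdot> (g \<cdot> t) = zeroM C (dm t) Y" using z by simp
    from sub_eq_zero[OF this] show "f \<cdot> (g \<cdot> t) = t" by simp
  qed
  then show "\<exists>Z\<in>Obj S. \<exists>g\<in>Hom S B Z. is_kernel S B Z g A f" unfolding AB using h S_Obj o by blast
next
  fix A B f assume "A \<in> Obj S" and BO: "B \<in> Obj S" and m: "is_epi S A B f"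
  then obtain X a Y b where AB: "A = (X, a)" "B = (Y, b)" and o: "ob X a" "ob Y b" by (elim S_ObjE) blast
  have f: "f \<in> Hom S A B" using m unfolding is_epi_def by blast
  note [simp] = obD[OF o(1)] obD[OF o(2)]
  have f' [simp]: "arr f" "dm f = X" "cd f = Y" "b \<cdot> f = f" "f \<cdot> a = f" using f by (simp_all add: AB S_Hom[OF o])
  obtain g where g: "g \<in> Hom S (Y, b) (X, a)" "f \<cdot> (g \<cdot> f) = f"
    using S_quasi_inverse[OF assms o] f unfolding AB by blast
  then have g' [simp]: "arr g" "dm g = Y" "cd g = X" "a \<cdot> g = g" "g \<cdot> b = g" "f \<cdot> (g \<cdot> f) = f" by (simp_all add: S_Hom[OF o(2,1)])
  have bf: "b \<cdot> (f \<cdot> r) = f \<cdot> r" if "arr r" "cd r = X" for r by (rule cmp_ext) (use that in auto)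
  have ag: "a \<cdot> (g \<cdot> r) = g \<cdot> r" if "arr r" "cd r = Y" for r by (rule cmp_ext) (use that in auto)
  have "f \<cdot> g \<in> Hom S B B" "b \<in> Hom S B B" "(f \<cdot> g) \<cdot>\<^bsub>S\<^esub> f = b \<cdot>\<^bsub>S\<^esub> f" by (simp_all add: AB S_Hom[OF o(2,2)] bf)
  then have gf: "f \<cdot> g = b" using m BO unfolding is_epi_def by blast
  have h: "a \<ominus>\<^sub>m g \<cdot> f \<in> Hom S (X, a) (X, a)" by (simp add: S_Hom[OF o(1,1)] ag)
  have "is_cokernel S (X, a) (X, a) (a \<ominus>\<^sub>m g \<cdot> f) (Y, b) f"
  proof (rule S_cokernel[OF o(1,1,2) h f[unfolded AB] _ g(1) gf])
    show "f \<cdot> (a \<ominus>\<^sub>m g \<cdot> f) = zeroM C X Y" by simp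
    fix t assume t [simp]: "arr t" "dm t = X" "t \<cdot> a = t" and z: "t \<cdot> (a \<ominus>\<^sub>m g \<cdot> f) = zeroM C X (cd t)"
    have "t \<ominus>\<^sub>m t \<cdot> (g \<cdot> f) = zeroM C X (cd t)" using z by simp
    from sub_eq_zero[OF this] show "t \<cdot> (g \<cdot> f) = t" by simp
  qed
  then show "\<exists>Z\<in>Obj S. \<exists>g\<in>Hom S Z A. is_cokernel S Z A g B f" unfolding AB using h S_Obj o by blast
qed

text \<open>The dual of \<open>(X, a)\<close> is \<open>(D, h)\<close>, where \<open>h\<close> is
  the transpose of \<open>a\<close>, with the evaluation and coevaluation of \<open>X\<close> cut
  down by \<open>h\<close> and \<open>a\<close>. As morphisms into \<open>D\<close> are determined
  under the evaluation, \<open>h\<close> inherits from \<open>a\<close> that it is idempotent and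
  fixed by \<open>u\<close>.\<close>

lemma S_rigid:
  assumes a: "ob X a" and d: "\<exists>D. is_dual C X D"
  shows "\<exists>D. is_dual S (X, a) D"
proof -
  interpret S: tensor_category S by (rule S_tensor)
  note [simp] = obD[OF a]
  obtain D ev co where dp: "dual_pair X D ev co" using d is_dual_iff[of X] by auto
  note [simp] = dual_pairD(1-8)[OF dp]
  obtain h where h [simp]: "arr h" "dm h = D" "cd h = D" and eva: "ev \<cdot> (idm C D \<otimes>\<^sub>m a) = ev \<cdot> (h \<otimes>\<^sub>m idm C X)"
    using transpose_ex[OF dp dp, of a] by auto
  \<comment> \<open>Under the evaluation, a factor \<open>a\<close> on the right can be exchanged
    for a factor \<open>h\<close> on the left.\<close>
  have evr: "ev \<cdot> (v \<otimes>\<^sub>m (a \<cdot> w)) = ev \<cdot> ((h \<cdot> v) \<otimes>\<^sub>m w)" if [simp]: "arr v" "cd v = D" "arr w" "cd w = X" for v w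
  proof -
    have "ev \<cdot> ((idm C D \<otimes>\<^sub>m a) \<cdot> (v \<otimes>\<^sub>m w)) = (ev \<cdot> (h \<otimes>\<^sub>m idm C X)) \<cdot> (v \<otimes>\<^sub>m w)" by (rule cmp_ext[OF eva]) simp_all
    then show ?thesis by (simp add: ten_cmp)
  qed
  have hh: "h \<cdot> h = h"
  proof (rule dual_ev_faithful[OF dp])
    have "ev \<cdot> ((h \<cdot> h) \<otimes>\<^sub>m idm C X) = ev \<cdot> (h \<otimes>\<^sub>m a)" using evr[of h "idm C X"] by simp
    also have "\<dots> = ev \<cdot> (idm C D \<otimes>\<^sub>m (a \<cdot> a))" using evr[of "idm C D" a] by (simp del: obD(5)[OF a])
    finally show "ev \<cdot> ((h \<cdot> h) \<otimes>\<^sub>m idm C X) = ev \<cdot> (h \<otimes>\<^sub>m idm C X)" using evr[of "idm C D" "idm C X"] by simp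
  qed simp_all
  have uh: "u D \<cdot> h = h"
  proof (rule dual_ev_faithful[OF dp])
    have "ev \<cdot> ((u D \<cdot> h) \<otimes>\<^sub>m idm C X) = ev \<cdot> ((h \<cdot> u D) \<otimes>\<^sub>m idm C X)" using u_nat[of h] by simp
    also have "\<dots> = ev \<cdot> (u D \<otimes>\<^sub>m a)" using evr[of "u D" "idm C X"] by simp
    also have "u D \<otimes>\<^sub>m a = idm C D \<otimes>\<^sub>m a" by (rule u_absorb(1)[OF _ a]) simp
    finally show "ev \<cdot> ((u D \<cdot> h) \<otimes>\<^sub>m idm C X) = ev \<cdot> (h \<otimes>\<^sub>m idm C X)" unfolding eva .
  qed simp_all
  have o: "ob D h" by (simp add: ob_def hh uh)
  note [simp] = obD(5-9)[OF o]
  let ?ev = "ev \<cdot> (h \<otimes>\<^sub>m a)" and ?co = "(a \<otimes>\<^sub>m h) \<cdot> co"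
  have evH: "?ev \<in> Hom S (D \<otimes>\<^sub>o X, h \<otimes>\<^sub>m a) (I, u I)"
  proof -
    have "u I \<cdot> ?ev = ?ev \<cdot> u (D \<otimes>\<^sub>o X)" using u_nat[of ?ev] by simp
    then show ?thesis using S_Hom[OF ob_ten[OF o a] ob_unt] by (simp add: u_ten(1) ten_cmp)
  qed
  have coH: "?co \<in> Hom S (I, u I) (X \<otimes>\<^sub>o D, a \<otimes>\<^sub>m h)"
  proof -
    have "?co \<cdot> u I = u (X \<otimes>\<^sub>o D) \<cdot> ?co" using u_nat[of ?co] by simp
    then show ?thesis using S_Hom[OF ob_unt ob_ten[OF a o]] by (simp add: u_ten(1) ten_cmp_ext)
  qed
  have inv0: "inv_arrow S (A, p) (B, q) (f \<cdot> p) = p \<cdot> iv f"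
    if "ob A p" "ob B q" "iso f" "dm f = A" "cd f = B" "f \<cdot> p = q \<cdot> f" for A B p q f
    by (rule S.inv_arrow_eq) (use S_inverse that S_Obj in auto)
  have inv: "inv_arrow S (I \<otimes>\<^sub>o X, u I \<otimes>\<^sub>m a) (X, a) (lun C X \<cdot> (u I \<otimes>\<^sub>m a)) = (u I \<otimes>\<^sub>m a) \<cdot> iv (lun C X)"
    by (rule inv0) (rule intertwine(2)[OF a a a] ob_ten ob_unt a | simp)+
  have inv': "inv_arrow S (D \<otimes>\<^sub>o I, h \<otimes>\<^sub>m u I) (D, h) (run C D \<cdot> (h \<otimes>\<^sub>m u I)) = (h \<otimes>\<^sub>m u I) \<cdot> iv (run C D)"
    by (rule inv0) (rule intertwine(3)[OF o o o] ob_ten ob_unt o | simp)+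
  have inv'': "inv_arrow S ((D \<otimes>\<^sub>o X) \<otimes>\<^sub>o D, (h \<otimes>\<^sub>m a) \<otimes>\<^sub>m h) (D \<otimes>\<^sub>o (X \<otimes>\<^sub>o D), h \<otimes>\<^sub>m (a \<otimes>\<^sub>m h)) (asc C D X D \<cdot> ((h \<otimes>\<^sub>m a) \<otimes>\<^sub>m h))
      = ((h \<otimes>\<^sub>m a) \<otimes>\<^sub>m h) \<cdot> iv (asc C D X D)"
    by (rule inv0) (rule intertwine(1)[OF o a o] ob_ten o a | simp)+
  define E where "E = ev \<cdot> (h \<otimes>\<^sub>m a)"
  define K where "K = (a \<otimes>\<^sub>m h) \<cdot> co"
  have E [simp]: "arr E" "dm E = D \<otimes>\<^sub>o X" "cd E = I" "u I \<cdot> E = E" "E \<cdot> (h \<otimes>\<^sub>m a) = E"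
    using evH S_Hom[OF ob_ten[OF o a] ob_unt] by (simp_all add: E_def)
  have K [simp]: "arr K" "dm K = I" "cd K = X \<otimes>\<^sub>o D" "K \<cdot> u I = K" "(a \<otimes>\<^sub>m h) \<cdot> K = K"
    using coH S_Hom[OF ob_unt ob_ten[OF a o]] by (simp_all add: K_def)
  have 1: "run S (X, a) \<cdot> (a \<otimes>\<^sub>m E) \<cdot> asc S (X, a) (D, h) (X, a) \<cdot> (K \<otimes>\<^sub>m a) \<cdot> inv_arrow S (I \<otimes>\<^sub>o X, u I \<otimes>\<^sub>m a) (X, a) (lun S (X, a)) = a"
  proof -
    have "run S (X, a) \<cdot> (a \<otimes>\<^sub>m E) \<cdot> asc S (X, a) (D, h) (X, a) \<cdot> (K \<otimes>\<^sub>m a) \<cdot> inv_arrow S (I \<otimes>\<^sub>o X, u I \<otimes>\<^sub>m a) (X, a) (lun S (X, a))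
      = run C X \<cdot> ((a \<otimes>\<^sub>m E) \<cdot> (asc C X D X \<cdot> ((K \<otimes>\<^sub>m a) \<cdot> iv (lun C X))))"
      unfolding S_lun_run[OF a] inv S_simps by (simp add: ten_cmp_ext)
    also have "\<dots> = run C X \<cdot> (((a \<otimes>\<^sub>m idm C I) \<cdot> (idm C X \<otimes>\<^sub>m E)) \<cdot> (asc C X D X \<cdot> (((K \<otimes>\<^sub>m idm C X) \<cdot> (idm C I \<otimes>\<^sub>m a)) \<cdot> iv (lun C X))))"
    proof -
      have "a \<otimes>\<^sub>m E = (a \<otimes>\<^sub>m idm C I) \<cdot> (idm C X \<otimes>\<^sub>m E)" "K \<otimes>\<^sub>m a = (K \<otimes>\<^sub>m idm C X) \<cdot> (idm C I \<otimes>\<^sub>m a)"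
        by (simp_all add: ten_cmp)
      then show ?thesis by (simp only:)
    qed
    also have "run C X \<cdot> (((a \<otimes>\<^sub>m idm C I) \<cdot> (idm C X \<otimes>\<^sub>m E)) \<cdot> (asc C X D X \<cdot> (((K \<otimes>\<^sub>m idm C X) \<cdot> (idm C I \<otimes>\<^sub>m a)) \<cdot> iv (lun C X))))
      = (run C X \<cdot> (a \<otimes>\<^sub>m idm C I)) \<cdot> ((idm C X \<otimes>\<^sub>m E) \<cdot> (asc C X D X \<cdot> ((K \<otimes>\<^sub>m idm C X) \<cdot> ((idm C I \<otimes>\<^sub>m a) \<cdot> iv (lun C X)))))"
      by simp
    also have "run C X \<cdot> (a \<otimes>\<^sub>m idm C I) = a \<cdot> run C X" using run_nat'[of a X] by simp
    also have "(idm C I \<otimes>\<^sub>m a) \<cdot> iv (lun C X) = iv (lun C X) \<cdot> a"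
    proof -
      have "lun C X \<cdot> ((idm C I \<otimes>\<^sub>m a) \<cdot> iv (lun C X)) = (lun C X \<cdot> (idm C I \<otimes>\<^sub>m a)) \<cdot> iv (lun C X)" by simp
      also have "\<dots> = a" using lun_nat'[of a X] by simp
      finally show ?thesis by (intro iso_move) simp_all
    qed
    also have "(a \<cdot> run C X) \<cdot> ((idm C X \<otimes>\<^sub>m E) \<cdot> (asc C X D X \<cdot> ((K \<otimes>\<^sub>m idm C X) \<cdot> (iv (lun C X) \<cdot> a))))
      = (a \<cdot> (run C X \<cdot> ((idm C X \<otimes>\<^sub>m E) \<cdot> (asc C X D X \<cdot> ((K \<otimes>\<^sub>m idm C X) \<cdot> iv (lun C X)))))) \<cdot> a" by simp
    \<comment> \<open>The zigzag of \<open>snake_left\<close> with one dual pair in both roles: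
      \<open>a\<close> and \<open>h\<close> take the places of the inclusions and of the
      projections, and \<open>k = a\<close>.\<close>
    also have "run C X \<cdot> ((idm C X \<otimes>\<^sub>m E) \<cdot> (asc C X D X \<cdot> ((K \<otimes>\<^sub>m idm C X) \<cdot> iv (lun C X)))) = a \<cdot> a"
      unfolding E_def K_def by (rule snake_left[OF dp]) (simp_all, simp_all add: evr[of h "idm C X", simplified] eva)
    finally show ?thesis by simp
  qed
  have 2: "lun S (D, h) \<cdot> (E \<otimes>\<^sub>m h) \<cdot> inv_arrow S ((D \<otimes>\<^sub>o X) \<otimes>\<^sub>o D, (h \<otimes>\<^sub>m a) \<otimes>\<^sub>m h) (D \<otimes>\<^sub>o (X \<otimes>\<^sub>o D), h \<otimes>\<^sub>m (a \<otimes>\<^sub>m h)) (asc S (D, h) (X, a) (D, h))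
     \<cdot> (h \<otimes>\<^sub>m K) \<cdot> inv_arrow S (D \<otimes>\<^sub>o I, h \<otimes>\<^sub>m u I) (D, h) (run S (D, h)) = h"
  proof -
    have "lun S (D, h) \<cdot> (E \<otimes>\<^sub>m h) \<cdot> inv_arrow S ((D \<otimes>\<^sub>o X) \<otimes>\<^sub>o D, (h \<otimes>\<^sub>m a) \<otimes>\<^sub>m h) (D \<otimes>\<^sub>o (X \<otimes>\<^sub>o D), h \<otimes>\<^sub>m (a \<otimes>\<^sub>m h)) (asc S (D, h) (X, a) (D, h))
       \<cdot> (h \<otimes>\<^sub>m K) \<cdot> inv_arrow S (D \<otimes>\<^sub>o I, h \<otimes>\<^sub>m u I) (D, h) (run S (D, h))
      = lun C D \<cdot> ((E \<otimes>\<^sub>m h) \<cdot> (iv (asc C D X D) \<cdot> ((h \<otimes>\<^sub>m K) \<cdot> iv (run C D))))"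
      unfolding S_lun_run[OF o] S_simps inv' inv'' by (simp add: ten_cmp_ext)
    also have "\<dots> = lun C D \<cdot> (((idm C I \<otimes>\<^sub>m h) \<cdot> (E \<otimes>\<^sub>m idm C D)) \<cdot> (iv (asc C D X D) \<cdot> (((idm C D \<otimes>\<^sub>m K) \<cdot> (h \<otimes>\<^sub>m idm C I)) \<cdot> iv (run C D))))"
    proof -
      have "E \<otimes>\<^sub>m h = (idm C I \<otimes>\<^sub>m h) \<cdot> (E \<otimes>\<^sub>m idm C D)" "h \<otimes>\<^sub>m K = (idm C D \<otimes>\<^sub>m K) \<cdot> (h \<otimes>\<^sub>m idm C I)"
        by (simp_all add: ten_cmp)
      then show ?thesis by (simp only:)
    qed
    also have "lun C D \<cdot> (((idm C I \<otimes>\<^sub>m h) \<cdot> (E \<otimes>\<^sub>m idm C D)) \<cdot> (iv (asc C D X D) \<cdot> (((idm C D \<otimes>\<^sub>m K) \<cdot> (h \<otimes>\<^sub>m idm C I)) \<cdot> iv (run C D))))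
      = (lun C D \<cdot> (idm C I \<otimes>\<^sub>m h)) \<cdot> ((E \<otimes>\<^sub>m idm C D) \<cdot> (iv (asc C D X D) \<cdot> ((idm C D \<otimes>\<^sub>m K) \<cdot> ((h \<otimes>\<^sub>m idm C I) \<cdot> iv (run C D)))))"
      by simp
    also have "lun C D \<cdot> (idm C I \<otimes>\<^sub>m h) = h \<cdot> lun C D" using lun_nat'[of h D] by simp
    also have "(h \<otimes>\<^sub>m idm C I) \<cdot> iv (run C D) = iv (run C D) \<cdot> h"
    proof -
      have "run C D \<cdot> ((h \<otimes>\<^sub>m idm C I) \<cdot> iv (run C D)) = (run C D \<cdot> (h \<otimes>\<^sub>m idm C I)) \<cdot> iv (run C D)" by simp
      also have "\<dots> = h" using run_nat'[of h D] by simp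
      finally show ?thesis by (intro iso_move) simp_all
    qed
    also have "(h \<cdot> lun C D) \<cdot> ((E \<otimes>\<^sub>m idm C D) \<cdot> (iv (asc C D X D) \<cdot> ((idm C D \<otimes>\<^sub>m K) \<cdot> (iv (run C D) \<cdot> h))))
      = (h \<cdot> (lun C D \<cdot> ((E \<otimes>\<^sub>m idm C D) \<cdot> (iv (asc C D X D) \<cdot> ((idm C D \<otimes>\<^sub>m K) \<cdot> iv (run C D)))))) \<cdot> h" by simp
    also have "lun C D \<cdot> ((E \<otimes>\<^sub>m idm C D) \<cdot> (iv (asc C D X D) \<cdot> ((idm C D \<otimes>\<^sub>m K) \<cdot> iv (run C D)))) = h \<cdot> h"
      unfolding E_def K_def by (rule snake_right[OF dp]) (simp_all, simp_all add: evr[of h "idm C X", simplified] eva)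
    finally show ?thesis by simp
  qed
  have "is_dual S (X, a) (D, h)" unfolding is_dual_def
    using evH[folded E_def] coH[folded K_def] 1 2 o S_Obj unfolding S_simps S_unt by blast
  then show ?thesis by blast
qed

end

section \<open>Decomposition into primitive idempotents\<close>

context typed_linear_category
begin

definition primitive :: "'o \<Rightarrow> 'm \<Rightarrow> bool" where
  "primitive X e \<longleftrightarrow> e \<noteq> zeroM C X X \<and>
     (\<forall>f. endo X f \<longrightarrow> f \<cdot> f = f \<longrightarrow> e \<cdot> f = f \<longrightarrow> f \<cdot> e = f \<longrightarrow> f = zeroM C X X \<or> f = e)"

text \<open>Members of the two lists annihilate each other: \<open>a\<close> absorbs
  \<open>f\<close> on the right and \<open>b\<close> absorbs \<open>g\<close> on the left, so the
  vanishing product of \<open>f\<close> and \<open>g\<close> can be inserted between them.\<close>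

lemma orth_append:
  assumes e: "endo X e" and f: "endo X f" "e \<cdot> f = f" "f \<cdot> e = f" and g: "endo X g" "e \<cdot> g = g" "g \<cdot> e = g"
    and z: "f \<cdot> g = zeroM C X X" "g \<cdot> f = zeroM C X X" and o: "orth X f fs" "orth X g gs"
  shows "orth X e (fs @ gs)"
proof -
  note t [simp] = endoD[OF e] endoD[OF f(1)] endoD[OF g(1)]
  have F: "endo X a \<and> a \<noteq> zeroM C X X \<and> a \<cdot> a = a \<and> f \<cdot> a = a \<and> a \<cdot> f = a" if "a \<in> set fs" for a using o(1) that by (auto simp: orth_def)
  have G: "endo X a \<and> a \<noteq> zeroM C X X \<and> a \<cdot> a = a \<and> g \<cdot> a = a \<and> a \<cdot> g = a" if "a \<in> set gs" for a using o(2) that by (auto simp: orth_def)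
  have absorb: "e \<cdot> a = a \<and> a \<cdot> e = a" if "endo X a" "h \<cdot> a = a" "a \<cdot> h = a" "endo X h" "e \<cdot> h = h" "h \<cdot> e = h" for a h
  proof
    note [simp] = endoD[OF that(1)] endoD[OF that(4)]
    have "e \<cdot> (h \<cdot> a) = h \<cdot> a" by (rule cmp_ext[OF that(5)]) simp_all
    then show "e \<cdot> a = a" unfolding that(2) .
    have "(a \<cdot> h) \<cdot> e = a \<cdot> (h \<cdot> e)" by simp
    then show "a \<cdot> e = a" unfolding that(3,6) .
  qed
  have kill: "a \<cdot> b = zeroM C X X" if "endo X a" "endo X b" "a \<cdot> h = a" "k \<cdot> b = b" "h \<cdot> k = zeroM C X X" "endo X h" "endo X k" for a b h k
  proof -
    note [simp] = endoD[OF that(1)] endoD[OF that(2)] endoD[OF that(6)] endoD[OF that(7)]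
    have "a \<cdot> b = (a \<cdot> h) \<cdot> (k \<cdot> b)" unfolding that(3,4) ..
    also have "\<dots> = a \<cdot> ((h \<cdot> k) \<cdot> b)" by simp
    finally show ?thesis unfolding that(5) by simp
  qed
  show ?thesis unfolding orth_def
  proof (intro conjI ballI)
    fix a assume "a \<in> set (fs @ gs)"
    then have "endo X a \<and> a \<noteq> zeroM C X X \<and> a \<cdot> a = a \<and> e \<cdot> a = a \<and> a \<cdot> e = a"
      using F[of a] G[of a] absorb[of a f] absorb[of a g] f g by (metis Un_iff set_append)
    then show "endo X a" "a \<noteq> zeroM C X X" "a \<cdot> a = a" "e \<cdot> a = a" "a \<cdot> e = a" by blast+
  next
    show "sorted_wrt (\<lambda>e e'. e \<cdot> e' = zeroM C X X \<and> e' \<cdot> e = zeroM C X X) (fs @ gs)"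
      unfolding sorted_wrt_append
    proof (intro conjI ballI)
      fix a b assume a: "a \<in> set fs" and b: "b \<in> set gs"
      show "a \<cdot> b = zeroM C X X" by (rule kill[of a b f g]) (use F[OF a] G[OF b] f g z in auto)
      show "b \<cdot> a = zeroM C X X" by (rule kill[of b a g f]) (use F[OF a] G[OF b] f g z in auto)
    qed (use o in \<open>auto simp: orth_def\<close>)
  qed
qed

lemma idempotent_complement:
  assumes "endo X e" "e \<cdot> e = e" "endo X f" "f \<cdot> f = f" "e \<cdot> f = f" "f \<cdot> e = f"
  shows "endo X (e \<ominus>\<^sub>m f)" "(e \<ominus>\<^sub>m f) \<cdot> (e \<ominus>\<^sub>m f) = e \<ominus>\<^sub>m f" "e \<cdot> (e \<ominus>\<^sub>m f) = e \<ominus>\<^sub>m f" "(e \<ominus>\<^sub>m f) \<cdot> e = e \<ominus>\<^sub>m f"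
    "f \<cdot> (e \<ominus>\<^sub>m f) = zeroM C X X" "(e \<ominus>\<^sub>m f) \<cdot> f = zeroM C X X" "f \<oplus>\<^sub>m (e \<ominus>\<^sub>m f) = e"
  using endoD[OF assms(1)] endoD[OF assms(3)] assms by (simp_all add: endo_def)

lemma orth_single:
  "endo X e \<Longrightarrow> e \<cdot> e = e \<Longrightarrow> e \<noteq> zeroM C X X \<Longrightarrow> orth X e [e]"
  by (simp add: orth_def)

text \<open>Induction on a bound for the length of orthogonal families below \<open>e\<close>, which
  exists by \<open>orth_bound\<close>. If \<open>e\<close> is the orthogonal sum of nonzero
  \<open>f\<close> and \<open>g\<close>, adjoining \<open>g\<close> to a family below
  \<open>f\<close> gives a longer family below \<open>e\<close>; so the bound for \<open>f\<close>
  is smaller by one, and likewise for \<open>g\<close>.\<close>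

theorem primitive_decomposition:
  assumes fd: "finite_dim_hom C X X" and X: "X \<in> Obj C" and e: "endo X e" "e \<cdot> e = e"
  obtains es where "orth X e es" "\<And>f. f \<in> set es \<Longrightarrow> primitive X f" "hom_sum C X X es = e"
proof -
  obtain N where N: "\<And>g es. orth X g es \<Longrightarrow> length es \<le> N" using orth_bound[OF fd X] by blast
  have main: "\<exists>es. orth X e es \<and> (\<forall>f\<in>set es. primitive X f) \<and> hom_sum C X X es = e"
    if "endo X e" "e \<cdot> e = e" "\<And>es. orth X e es \<Longrightarrow> length es \<le> n" for n e
    using that
  proof (induction n arbitrary: e)
    case 0
    have "e = zeroM C X X"
    proof (rule ccontr)
      assume "e \<noteq> zeroM C X X"
      from 0(3)[OF orth_single[OF 0(1,2) this]] show False by simp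
    qed
    then show ?case by (intro exI[of _ "[]"]) (simp add: orth_def hom_sum_Nil)
  next
    case (Suc n)
    note E = endoD[OF Suc.prems(1)]
    consider "e = zeroM C X X" | "primitive X e" | "e \<noteq> zeroM C X X" "\<not> primitive X e" by blast
    then show ?case
    proof cases
      case 1 then show ?thesis by (intro exI[of _ "[]"]) (simp add: orth_def hom_sum_Nil)
    next
      case 2
      then have "orth X e [e]" using orth_single Suc.prems by (auto simp: primitive_def)
      then show ?thesis using 2 E by (intro exI[of _ "[e]"]) (simp add: hom_sum_Cons hom_sum_Nil)
    next
      case 3
      then obtain f where f: "endo X f" "f \<cdot> f = f" "e \<cdot> f = f" "f \<cdot> e = f" "f \<noteq> zeroM C X X" "f \<noteq> e"
        unfolding primitive_def by blast
      define g where "g = e \<ominus>\<^sub>m f"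
      note g = idempotent_complement[OF Suc.prems(1,2) f(1-4), folded g_def]
      have g0: "g \<noteq> zeroM C X X"
        using sub_eq_zero[of e f X X] f(6) E endoD[OF f(1)] unfolding g_def by auto
      have "length es \<le> n" if "orth X f es" for es
        using Suc.prems(3)[OF orth_append[OF Suc.prems(1) f(1,3,4) g(1,3,4) g(5,6) that orth_single[OF g(1,2) g0]]] by simp
      from Suc.IH[OF f(1,2) this] obtain fs where fs: "orth X f fs" "\<forall>f\<in>set fs. primitive X f" "hom_sum C X X fs = f" by blast
      have "length es \<le> n" if "orth X g es" for es
        using Suc.prems(3)[OF orth_append[OF Suc.prems(1) f(1,3,4) g(1,3,4) g(5,6) orth_single[OF f(1,2,5)] that]] by simp
      from Suc.IH[OF g(1,2) this] obtain gs where gs: "orth X g gs" "\<forall>f\<in>set gs. primitive X f" "hom_sum C X X gs = g" by blast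
      have "hom_sum C X X (fs @ gs) = hom_sum C X X fs \<oplus>\<^sub>m hom_sum C X X gs"
        by (rule hom_sum_append[OF X X]) (use fs(1) gs(1) in \<open>auto simp: orth_def endo_def\<close>)
      then show ?thesis using orth_append[OF Suc.prems(1) f(1,3,4) g(1,3,4) g(5,6) fs(1) gs(1)] fs(2,3) gs(2,3) g(7)
        by (intro exI[of _ "fs @ gs"]) auto
    qed
  qed
  have "\<exists>es. orth X e es \<and> (\<forall>f\<in>set es. primitive X f) \<and> hom_sum C X X es = e"
    by (rule main[OF e, of N]) (rule N)
  then show thesis by (elim exE conjE, intro that) simp_all
qed

end

section \<open>Semisimplicity of the summand\<close>

context central_idempotent
begin

lemma S_finite_dim:
  assumes fd: "finite_dim_hom C X Y" and a: "ob X a" and b: "ob Y b"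
  shows "finite_dim_hom S (X, a) (Y, b)"
proof -
  note [simp] = obD[OF a] obD[OF b]
  obtain bs where bs: "\<And>f. f \<in> set bs \<Longrightarrow> arr f \<and> dm f = X \<and> cd f = Y" "\<And>f. arr f \<Longrightarrow> dm f = X \<Longrightarrow> cd f = Y \<Longrightarrow> spanned X Y bs f"
    using fd by (auto simp: finite_dim_hom_iff)
  have hs: "hom_sum S (X, a) (Y, b) = hom_sum C X Y" unfolding hom_sum_def by (intro ext) simp
  let ?b = "map (\<lambda>f. b \<cdot> f) (map (\<lambda>f. f \<cdot> a) bs)"
  have "\<exists>cs. length cs = length ?b \<and> f = hom_sum C X Y (map2 (scaleM C) cs ?b)"
    if f: "arr f" "dm f = X" "cd f = Y" "b \<cdot> f = f" "f \<cdot> a = f" for f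
  proof -
    have 1: "spanned X Y (map (\<lambda>f. f \<cdot> a) bs) (f \<cdot> a)"
      using spanned_cmp(1)[OF bs(1) bs(2)[OF f(1-3)], of a] by simp
    have t: "arr g \<and> dm g = X \<and> cd g = Y" if "g \<in> set (map (\<lambda>f. f \<cdot> a) bs)" for g
      using that bs(1) by auto
    have "spanned X (cd b) ?b (b \<cdot> (f \<cdot> a))"
      by (rule spanned_cmp(2)[OF t 1]) simp_all
    then show ?thesis unfolding f spanned_def by simp
  qed
  then show ?thesis unfolding finite_dim_hom_def hs S_simps using bs(1)
    by (intro exI[of _ ?b] conjI ballI) (auto simp: S_Hom[OF a b])
qed

lemma S_zero_object_iff:
  assumes "ob X e"
  shows "zero_object S (X, e) \<longleftrightarrow> e = zeroM C X X"
proof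
  note [simp] = obD[OF assms]
  assume "zero_object S (X, e)"
  then have "\<exists>!f. f \<in> Hom S (X, e) (X, e)" unfolding zero_object_def by blast
  moreover have "e \<in> Hom S (X, e) (X, e)" "zeroM C X X \<in> Hom S (X, e) (X, e)" by (simp_all add: S_Hom[OF assms assms])
  ultimately show "e = zeroM C X X" by blast
next
  assume "e = zeroM C X X"
  then show "zero_object S (X, e)" using S_zero_object obD(1)[OF assms] by simp
qed

text \<open>A monomorphism \<open>i\<close> into \<open>(X, e)\<close> is split by a quasi-inverse
  \<open>g\<close>, and \<open>i \<cdot> g\<close> is an idempotent below \<open>e\<close>. By
  primitivity it is zero, which makes the source a zero object, or it is \<open>e\<close>, which
  makes \<open>i\<close> invertible.\<close>

lemma S_simple:
  assumes reg: "regular C" and e: "ob X e" and p: "primitive X e"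
  shows "simple_object S (X, e)"
proof -
  note [simp] = obD[OF e]
  have "zero_object S (Y, b) \<or> is_iso S (Y, b) (X, e) i" if b: "ob Y b" and m: "is_mono S (Y, b) (X, e) i" for Y b i
  proof -
    note [simp] = obD[OF b]
    have i: "i \<in> Hom S (Y, b) (X, e)" using m unfolding is_mono_def by blast
    then have [simp]: "arr i" "dm i = Y" "cd i = X" "e \<cdot> i = i" "i \<cdot> b = i" by (simp_all add: S_Hom[OF b e])
    obtain g where g: "g \<in> Hom S (X, e) (Y, b)" "i \<cdot> (g \<cdot> i) = i" using S_quasi_inverse[OF reg b e i] by blast
    then have [simp]: "arr g" "dm g = X" "cd g = Y" "b \<cdot> g = g" "g \<cdot> e = g" by (simp_all add: S_Hom[OF e b])
    have bg: "b \<cdot> (g \<cdot> i) = g \<cdot> i" "e \<cdot> (i \<cdot> g) = i \<cdot> g" by (rule cmp_ext; simp)+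
    have "g \<cdot> i \<in> Hom S (Y, b) (Y, b)" "b \<in> Hom S (Y, b) (Y, b)" "i \<cdot>\<^bsub>S\<^esub> (g \<cdot> i) = i \<cdot>\<^bsub>S\<^esub> b"
      using g(2) by (simp_all add: S_Hom[OF b b] bg)
    then have gi: "g \<cdot> i = b" using m S_Obj b unfolding is_mono_def by blast
    have igi: "(i \<cdot> g) \<cdot> (i \<cdot> g) = i \<cdot> g"
    proof -
      have "(i \<cdot> g) \<cdot> (i \<cdot> g) = (i \<cdot> (g \<cdot> i)) \<cdot> g" by simp
      then show ?thesis unfolding g(2) .
    qed
    have "i \<cdot> g = zeroM C X X \<or> i \<cdot> g = e"
      using p igi bg(2) unfolding primitive_def endo_def by simp
    then show ?thesis
    proof
      assume z: "i \<cdot> g = zeroM C X X"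
      have "b = b \<cdot> b" by simp
      also have "\<dots> = g \<cdot> ((i \<cdot> g) \<cdot> i)" unfolding gi[symmetric] by simp
      also have "\<dots> = zeroM C Y Y" unfolding z by simp
      finally show ?thesis using S_zero_object_iff[OF b] by blast
    next
      assume "i \<cdot> g = e"
      then have "inverse_arrows S (Y, b) (X, e) i g" using gi i g by (simp add: inverse_arrows_def)
      then show ?thesis unfolding is_iso_def by blast
    qed
  qed
  moreover have "\<not> zero_object S (X, e)" using p S_zero_object_iff[OF e] by (simp add: primitive_def)
  ultimately show ?thesis unfolding simple_object_def using S_Obj e by (metis S_ObjE)
qed

lemma ob_orth: "ob X e \<Longrightarrow> orth X e es \<Longrightarrow> f \<in> set es \<Longrightarrow> ob X f"
  by (rule ob_sub(1)) (auto simp: orth_def endo_def)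

text \<open>Each \<open>es ! j\<close> serves both as the inclusion of its summand and as the
  projection onto it.\<close>

lemma S_decomposition:
  assumes e: "ob X e" and es: "orth X e es" "hom_sum C X X es = e"
  shows "is_direct_sum S (map (Pair X) es) (X, e)"
proof -
  note [simp] = obD[OF e]
  let ?L = "map (Pair X) es"
  have o: "ob X (es ! j)" "e \<cdot> es ! j = es ! j" "es ! j \<cdot> e = es ! j" if "j < length es" for j
    using ob_orth[OF e es(1)] es(1) that by (auto simp: orth_def)
  have d: "es ! l \<cdot> es ! j = (if j = l then es ! j else zeroM C X X)" if "j < length es" "l < length es" for j l
  proof (cases "j = l")
    case True then show ?thesis using obD(5)[OF o(1)[OF that(1)]] by simp
  next
    case False then show ?thesis using es(1) that unfolding orth_def sorted_wrt_iff_nth_less by (metis linorder_neqE_nat)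
  qed
  have "map (\<lambda>j. es ! j \<cdot> es ! j) [0..<length es] = es"
    by (rule nth_equalityI) (use d in auto)
  then have s: "hom_sum S (X, e) (X, e) (map (\<lambda>j. es ! j \<cdot>\<^bsub>S\<^esub> es ! j) [0..<length ?L]) = idm S (X, e)"
    using es(2) by (simp add: hom_sum_def)
  have H: "es ! j \<in> Hom S (?L ! j) (X, e) \<and> es ! j \<in> Hom S (X, e) (?L ! j)" if "j < length ?L" for j
    using that o[of j] obD(2-5)[OF o(1)[of j]] S_Hom[OF o(1)[of j] e] S_Hom[OF e o(1)[of j]] by simp
  have d': "es ! l \<cdot>\<^bsub>S\<^esub> es ! j = (if j = l then idm S (?L ! j) else zeroM S (?L ! j) (?L ! l))" if "j < length ?L" "l < length ?L" for j l
    using d[of j l] that by simp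
  have "set ?L \<subseteq> Obj S" using ob_orth[OF e es(1)] by (auto simp: S_Obj)
  then show ?thesis unfolding is_direct_sum_def using e S_Obj s H d'
    by (intro conjI exI[of _ "\<lambda>j. es ! j"] allI impI) blast+
qed

text \<open>An orthogonal splitting of \<open>e\<close> gives a short exact sequence with
  \<open>(X, g)\<close> as subobject and \<open>(X, f)\<close> as quotient, in the form that the
  rule \<open>finite_length.extend\<close> takes.\<close>

lemma S_split:
  assumes e: "ob X e" and f: "ob X f" and g: "ob X g" and efg: "f \<oplus>\<^sub>m g = e" and z: "f \<cdot> g = zeroM C X X" "g \<cdot> f = zeroM C X X"
  shows "is_kernel S (X, e) (X, f) f (X, g) g" and "is_cokernel S (X, g) (X, e) g (X, f) f"
proof -
  note [simp] = obD[OF e] obD[OF f] obD[OF g]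
  have ef: "e \<cdot> f = f" "f \<cdot> e = f" "e \<cdot> g = g" "g \<cdot> e = g" unfolding efg[symmetric] by (simp_all add: z)
  have H: "f \<in> Hom S (X, e) (X, f)" "g \<in> Hom S (X, g) (X, e)" "g \<in> Hom S (X, e) (X, g)" "f \<in> Hom S (X, f) (X, e)"
    by (simp_all add: S_Hom[OF e f] S_Hom[OF g e] S_Hom[OF e g] S_Hom[OF f e] ef)
  show "is_kernel S (X, e) (X, f) f (X, g) g"
  proof (rule S_kernel[OF e f g H(1,2) z(1) H(3)])
    fix t assume [simp]: "arr t" "cd t = X" and t: "e \<cdot> t = t" "f \<cdot> t = zeroM C (dm t) X"
    have "t = f \<cdot> t \<oplus>\<^sub>m g \<cdot> t" using t(1) unfolding efg[symmetric] by simp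
    also have "\<dots> = g \<cdot> t" unfolding t(2) by simp
    finally show "g \<cdot> (g \<cdot> t) = t" by simp
  qed simp
  show "is_cokernel S (X, g) (X, e) g (X, f) f"
  proof (rule S_cokernel[OF e g f H(2,1) z(1) H(4)])
    fix t assume [simp]: "arr t" "dm t = X" and t: "t \<cdot> e = t" "t \<cdot> g = zeroM C X (cd t)"
    have "t = t \<cdot> f \<oplus>\<^sub>m t \<cdot> g" using t(1) unfolding efg[symmetric] by simp
    also have "\<dots> = t \<cdot> f" unfolding t(2) by simp
    finally show "t \<cdot> (f \<cdot> f) = t" by simp
  qed simp
qed

text \<open>The first primitive idempotent of the list gives the simple quotient, and the remaining
  ones decompose its complement, to which the induction hypothesis applies.\<close>

lemma S_finite_length:
  assumes reg: "regular C" and "ob X e" "orth X e es" "\<And>f. f \<in> set es \<Longrightarrow> primitive X f" "hom_sum C X X es = e"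
  shows "finite_length S (X, e)"
  using assms(2-)
proof (induction es arbitrary: e)
  case Nil
  then have "zero_object S (X, e)" using S_zero_object_iff by (simp add: hom_sum_Nil)
  then show ?case by (rule finite_length.zero)
next
  case (Cons f fs)
  note [simp] = obD[OF Cons.prems(1)]
  have f: "ob X f" using ob_orth[OF Cons.prems(1,2)] by simp
  note [simp] = obD[OF f]
  have ef: "e \<cdot> f = f" "f \<cdot> e = f" using Cons.prems(2) by (auto simp: orth_def)
  define g where "g = e \<ominus>\<^sub>m f"
  have ee: "endo X e" "endo X f" by (simp_all add: endo_def)
  note g = idempotent_complement[OF ee(1) _ ee(2) _ ef, folded g_def, simplified]
  have g': "ob X g" unfolding g_def by (rule ob_sub(2)[OF Cons.prems(1)]) (simp_all add: ef)
  note [simp] = obD[OF g']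
  have a: "arr (hom_sum C X X fs)" "dm (hom_sum C X X fs) = X" "cd (hom_sum C X X fs) = X"
    using hom_sum_typ[of X X fs] Cons.prems(2) by (auto simp: orth_def endo_def)
  have "hom_sum C X X fs \<oplus>\<^sub>m f = g \<oplus>\<^sub>m f"
    using Cons.prems(4) a add_comm'[of f "hom_sum C X X fs"] unfolding g_def by (simp add: hom_sum_Cons)
  then have s: "hom_sum C X X fs = g" by (rule add_cancel) (simp_all add: a)
  have "g \<cdot> b = b \<and> b \<cdot> g = b" if b: "b \<in> set fs" for b
  proof -
    have [simp]: "arr b" "dm b = X" "cd b = X" "e \<cdot> b = b" "b \<cdot> e = b" "f \<cdot> b = zeroM C X X" "b \<cdot> f = zeroM C X X"
      using Cons.prems(2) b by (auto simp: orth_def endo_def)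
    show ?thesis unfolding g_def by simp
  qed
  then have "orth X g fs" using Cons.prems(2) by (auto simp: orth_def)
  then have "finite_length S (X, g)" by (rule Cons.IH[OF g']) (use Cons.prems s in auto)
  moreover have "simple_object S (X, f)" by (rule S_simple[OF reg f]) (use Cons.prems in auto)
  moreover have "f \<oplus>\<^sub>m g = e" by (simp add: g_def)
  ultimately show ?case
    using S_split[OF Cons.prems(1) f g'] g S_Obj Cons.prems(1) by (blast intro: finite_length.extend)
qed

text \<open>The premise \<open>unit\<close> expresses the condition on the unit in terms of
  \<open>C\<close>: endomorphisms of \<open>(I, u I)\<close> satisfy
  \<open>u I \<cdot> f = f\<close>, hence are multiples of \<open>u I\<close>, and the multiples are
  distinct because \<open>u I\<close> is nonzero.\<close>

theorem S_pre_tannakian: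
  assumes reg: "regular C" and fd: "\<And>X Y. X \<in> Obj C \<Longrightarrow> Y \<in> Obj C \<Longrightarrow> finite_dim_hom C X Y"
    and dual: "\<And>X. X \<in> Obj C \<Longrightarrow> \<exists>D. is_dual C X D"
    and unit: "u I \<noteq> zeroM C I I" "\<And>f. f \<in> Hom C I I \<Longrightarrow> \<exists>c. u I \<cdot> f = c *\<^sub>m u I"
  shows "pre_tannakian_category S \<and> semisimple S"
proof
  have dec: "\<exists>es. orth X e es \<and> (\<forall>f\<in>set es. primitive X f) \<and> hom_sum C X X es = e" if e: "ob X e" for X e
  proof -
    have "endo X e" using obD[OF e] by (simp add: endo_def)
    from primitive_decomposition[OF fd[OF obD(1)[OF e] obD(1)[OF e]] obD(1)[OF e] this obD(5)[OF e]]
    obtain es where "orth X e es" "\<And>f. f \<in> set es \<Longrightarrow> primitive X f" "hom_sum C X X es = e" by blast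
    then show ?thesis by blast
  qed
  have inj: "inj (\<lambda>c. c *\<^sub>m u I)"
  proof (rule injI, rule ccontr)
    fix c d assume eq: "c *\<^sub>m u I = d *\<^sub>m u I" and "c \<noteq> d"
    have "(c - d) *\<^sub>m u I = c *\<^sub>m u I \<oplus>\<^sub>m (- d) *\<^sub>m u I" using smul_add_left'[of "u I" c "- d"] by simp
    also have "\<dots> = (d + - d) *\<^sub>m u I" unfolding eq by (rule smul_add_left'[symmetric]) simp
    finally have "inverse (c - d) *\<^sub>m ((c - d) *\<^sub>m u I) = zeroM C I I" by simp
    then show False using unit(1) \<open>c \<noteq> d\<close> by simp
  qed
  have img: "range (\<lambda>c. c *\<^sub>m u I) = Hom S (I, u I) (I, u I)"
  proof (intro equalityI subsetI)
    fix f assume "f \<in> Hom S (I, u I) (I, u I)"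
    then have f: "f \<in> Hom C I I" "u I \<cdot> f = f" by (simp_all add: S_Hom[OF ob_unt ob_unt] Hom_iff)
    then show "f \<in> range (\<lambda>c. c *\<^sub>m u I)" using unit(2)[OF f(1)] by auto
  qed (auto simp: S_Hom[OF ob_unt ob_unt] u_idem)
  show "pre_tannakian_category S"
  proof (intro pre_tannakian_category.intro S_tensor S_abelian reg, unfold_locales)
    show "finite_length S A" if "A \<in> Obj S" for A
      using that by (elim S_ObjE) (use dec S_finite_length[OF reg] in blast)
    show "finite_dim_hom S A B" if "A \<in> Obj S" "B \<in> Obj S" for A B
      using that by (elim S_ObjE) (use S_finite_dim fd obD(1) in blast)
    show "\<exists>D. is_dual S A D" if "A \<in> Obj S" for A
      using that by (elim S_ObjE) (use S_rigid dual obD(1) in blast)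
    show "bij_betw (\<lambda>a. a *\<^sub>m\<^bsub>S\<^esub> idm S (unt S)) UNIV (Hom S (unt S) (unt S))"
      using inj img by (simp add: bij_betw_def)
  qed
  show "semisimple S" unfolding semisimple_def
  proof
    fix A assume "A \<in> Obj S"
    then obtain X e where A: "A = (X, e)" and e: "ob X e" by (elim S_ObjE)
    obtain es where es: "orth X e es" "\<And>f. f \<in> set es \<Longrightarrow> primitive X f" "hom_sum C X X es = e" using dec[OF e] by blast
    have "\<forall>B\<in>set (map (Pair X) es). simple_object S B"
      using S_simple[OF reg ob_orth[OF e es(1)] es(2)] by auto
    then show "\<exists>Ss. (\<forall>B\<in>set Ss. simple_object S B) \<and> is_direct_sum S Ss A"
      unfolding A using S_decomposition[OF e es(1,3)] by blast
  qed
qed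

end

section \<open>The idempotent of a character\<close>

context enriched_category
begin

text \<open>The matrices in question are diagonal, so every condition is one on single entries;
  tensor products pick the entry of one digit of the index.\<close>

lemma AE_central_idempotent:
  assumes U: "\<And>X. X \<in> Obj C \<Longrightarrow> U X \<in> Hom C X X" "\<And>X. X \<in> Obj C \<Longrightarrow> U X \<cdot> U X = U X"
      "\<And>X Y f. X \<in> Obj C \<Longrightarrow> Y \<in> Obj C \<Longrightarrow> f \<in> Hom C X Y \<Longrightarrow> U Y \<cdot> f = f \<cdot> U X"
      "\<And>X Y. X \<in> Obj C \<Longrightarrow> Y \<in> Obj C \<Longrightarrow> U (X \<otimes>\<^sub>o Y) = U X \<otimes>\<^sub>m idm C Y"
      "\<And>X Y. X \<in> Obj C \<Longrightarrow> Y \<in> Obj C \<Longrightarrow> U (X \<otimes>\<^sub>o Y) = idm C X \<otimes>\<^sub>m U Y"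
  shows "central_idempotent AE src tgt (\<lambda>Xs. diag_arrow C Xs Xs (map U Xs))"
proof -
  interpret A: typed_tensor_category AE src tgt by (rule AE_typed)
  have d: "diag_arrow C Xs Xs (map U Xs) = dg Xs Xs (\<lambda>j. U (Xs ! j))" for Xs
    unfolding diag_AE by (rule dg_cong) simp
  show ?thesis
  proof (intro central_idempotent.intro AE_typed, unfold_locales, unfold d)
    fix X assume X: "X \<in> Obj AE"
    show "dg X X (\<lambda>j. U (X ! j)) \<in> Hom AE X X"
      by (rule dg_Hom[OF X X]) (use U(1) X Obj_nth in auto)
    show "dg X X (\<lambda>j. U (X ! j)) \<cdot>\<^bsub>AE\<^esub> dg X X (\<lambda>j. U (X ! j)) = dg X X (\<lambda>j. U (X ! j))"
      by (subst dg_dg) (use U(2) X Obj_nth in \<open>auto intro: dg_cong\<close>)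
    fix Y assume Y: "Y \<in> Obj AE"
    have l: "ten_list C X Y ! j = X ! (j div length Y) \<otimes>\<^sub>o Y ! (j mod length Y)" "X ! (j div length Y) \<in> Obj C" "Y ! (j mod length Y) \<in> Obj C"
      if "j < length (ten_list C X Y)" for j
    proof -
      have j: "j < length X * length Y" using that by simp
      show "ten_list C X Y ! j = X ! (j div length Y) \<otimes>\<^sub>o Y ! (j mod length Y)" using j by simp
      show "X ! (j div length Y) \<in> Obj C" "Y ! (j mod length Y) \<in> Obj C"
        using Obj_nth[OF X index_less(1)[OF j]] Obj_nth[OF Y index_less(2)[OF j]] by auto
    qed
    show "dg (X \<otimes>\<^sub>o\<^bsub>AE\<^esub> Y) (X \<otimes>\<^sub>o\<^bsub>AE\<^esub> Y) (\<lambda>j. U ((X \<otimes>\<^sub>o\<^bsub>AE\<^esub> Y) ! j)) = dg X X (\<lambda>j. U (X ! j)) \<otimes>\<^sub>m\<^bsub>AE\<^esub> idm AE Y"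
      unfolding idm_AE AE_simps dg_ten[OF refl refl] by (rule dg_cong) (simp only: l U(4))
    show "dg (X \<otimes>\<^sub>o\<^bsub>AE\<^esub> Y) (X \<otimes>\<^sub>o\<^bsub>AE\<^esub> Y) (\<lambda>j. U ((X \<otimes>\<^sub>o\<^bsub>AE\<^esub> Y) ! j)) = idm AE X \<otimes>\<^sub>m\<^bsub>AE\<^esub> dg Y Y (\<lambda>j. U (Y ! j))"
      unfolding idm_AE AE_simps dg_ten[OF refl refl] by (rule dg_cong) (simp only: l U(5))
  next
    fix f assume "A.arr f"
    then have o: "src f \<in> Obj AE" "tgt f \<in> Obj AE" and "f \<in> Hom AE (src f) (tgt f)"
      unfolding A.arr_def by blast+
    then obtain F where F: "f = mk_arrow (src f) (tgt f) F" "mor (src f) (tgt f) F" using Hom_AE by blast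
    have "dg (tgt f) (tgt f) (\<lambda>j. U (tgt f ! j)) \<cdot>\<^bsub>AE\<^esub> mk_arrow (src f) (tgt f) F = mk_arrow (src f) (tgt f) F \<cdot>\<^bsub>AE\<^esub> dg (src f) (src f) (\<lambda>j. U (src f ! j))"
      by (subst dg_cmp_left, simp, subst dg_cmp_right, simp, rule mk_arrow_eqI)
        (use F(2) o U(3) Obj_nth in \<open>auto simp: mor_def\<close>)
    then show "dg (tgt f) (tgt f) (\<lambda>j. U (tgt f ! j)) \<cdot>\<^bsub>AE\<^esub> f = f \<cdot>\<^bsub>AE\<^esub> dg (src f) (src f) (\<lambda>j. U (src f ! j))"
      using F(1) by simp
  qed
qed

end

lemma chi_category_eq:
  "chi_category E \<chi> = summand_category (additive_envelope (linearization E))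
     (\<lambda>Xs. diag_arrow (linearization E) Xs Xs
       (map (\<lambda>X. \<Sum>a\<in>UNIV. pm_single (a *\<^sub>m\<^bsub>E\<^esub> idm E X) (pm_lookup (chi_idem \<chi>) a)) Xs))"
  by (simp add: chi_category_def summand_category_def envelope_def monoid_algebra_act_def Let_def)

locale character =
  fixes \<chi> :: "'f::{field,finite} \<Rightarrow> 'k::field_char_0"
  assumes char: "is_character \<chi>"
begin

definition r :: "'f \<Rightarrow> 'k" where "r = pm_lookup (chi_idem \<chi>)"

lemma q_eq: "(of_nat (card (UNIV :: 'f set)) - 1 :: 'k) = of_nat (card (UNIV - {0 :: 'f}))"
  by (simp add: card_Diff_singleton_if Suc_leI card_gt_0_iff of_nat_diff)

lemma q_nonzero: "(of_nat (card (UNIV :: 'f set)) - 1 :: 'k) \<noteq> 0"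
proof -
  have "(1 :: 'f) \<in> UNIV - {0}" by simp
  then have "card (UNIV - {0 :: 'f}) \<noteq> 0" by (metis card_eq_0_iff empty_iff finite_Diff finite)
  then show ?thesis unfolding q_eq by simp
qed

lemma chi_nonzero: "a \<noteq> 0 \<Longrightarrow> \<chi> a \<noteq> 0"
  and chi_mult: "a \<noteq> 0 \<Longrightarrow> b \<noteq> 0 \<Longrightarrow> \<chi> (a * b) = \<chi> a * \<chi> b"
  using char by (auto simp: is_character_def)

lemma r_zero: "r 0 = - (if \<forall>a. a \<noteq> 0 \<longrightarrow> \<chi> a = 1 then 1 else 0)"
  by (simp add: r_def chi_idem_def lookup_add lookup_sum lookup_single when_def)

lemma r_nonzero:
  assumes "a \<noteq> 0"
  shows "r a = 1 / (of_nat (card (UNIV :: 'f set)) - 1 :: 'k) * inverse (\<chi> a)"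
proof -
  have "(\<Sum>b\<in>UNIV - {0}. pm_lookup (pm_single b (1 / (of_nat (card (UNIV :: 'f set)) - 1 :: 'k) * inverse (\<chi> b))) a) = (\<Sum>b\<in>UNIV - {0}. if b = a then 1 / (of_nat (card (UNIV :: 'f set)) - 1 :: 'k) * inverse (\<chi> b) else 0)"
    by (rule sum.cong) (auto simp: lookup_single when_def)
  also have "\<dots> = 1 / (of_nat (card (UNIV :: 'f set)) - 1 :: 'k) * inverse (\<chi> a)" using assms by simp
  finally show ?thesis using assms unfolding r_def chi_idem_def lookup_add lookup_sum by (simp add: lookup_single when_def)
qed

text \<open>For nonzero \<open>a\<close> this is the multiplicativity of \<chi>. At
  \<open>a = 0\<close> it holds because the coefficient vanishes unless \<chi> is trivial. It says
  that the basis vector of \<open>b\<close> acts on the idempotent by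
  \<open>\<chi> b\<close>.\<close>

lemma r_mult: "b \<noteq> 0 \<Longrightarrow> r a = \<chi> b * r (a * b)"
proof (cases "a = 0")
  case False
  assume b: "b \<noteq> 0"
  then show ?thesis using False by (simp add: r_nonzero chi_mult chi_nonzero)
qed (auto simp: r_zero)

lemma sum_shift: "b \<noteq> 0 \<Longrightarrow> (\<Sum>a\<in>UNIV. f (a * b)) = (\<Sum>a\<in>(UNIV :: 'f set). (f a :: 'b::comm_monoid_add))"
  by (rule sum.reindex_bij_betw[of "\<lambda>a. a * b" UNIV UNIV f], rule bij_betwI[of _ _ _ "\<lambda>a. a / b"]) simp_all

text \<open>For trivial \<chi> the coefficient at \<open>0\<close> is chosen to cancel the others.
  For nontrivial \<chi> the substitution of \<open>a * b\<close> for \<open>a\<close> multiplies the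
  sum by \<open>\<chi> b\<close>, which differs from 1 for a suitable \<open>b\<close>. The
  vanishing means that the basis vector of \<open>0\<close> annihilates the idempotent.\<close>

lemma r_sum: "(\<Sum>a\<in>UNIV. r a) = 0"
proof (cases "\<forall>a. a \<noteq> 0 \<longrightarrow> \<chi> a = 1")
  case True
  have "(\<Sum>a\<in>UNIV. r a) = r 0 + (\<Sum>a\<in>UNIV - {0}. r a)" by (simp add: sum.remove)
  also have "(\<Sum>a\<in>UNIV - {0}. r a) = (\<Sum>a\<in>UNIV - {0 :: 'f}. 1 / (of_nat (card (UNIV :: 'f set)) - 1 :: 'k))" by (rule sum.cong) (use True in \<open>auto simp: r_nonzero\<close>)
  also have "\<dots> = (of_nat (card (UNIV :: 'f set)) - 1 :: 'k) * (1 / (of_nat (card (UNIV :: 'f set)) - 1 :: 'k))" unfolding q_eq by simp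
  also have "\<dots> = 1" using q_nonzero by simp
  finally show ?thesis using True by (simp add: r_zero)
next
  case False
  then obtain b where b: "b \<noteq> 0" "\<chi> b \<noteq> 1" by blast
  have "(\<Sum>a\<in>UNIV. r a) = (\<Sum>a\<in>UNIV. \<chi> b * r (a * b))" by (rule sum.cong[OF refl], rule r_mult[OF b(1)])
  also have "\<dots> = \<chi> b * (\<Sum>a\<in>UNIV. r (a * b))" by (simp add: sum_distrib_left)
  also have "(\<Sum>a\<in>UNIV. r (a * b)) = (\<Sum>a\<in>UNIV. r a)" by (rule sum_shift[OF b(1)])
  finally have "(\<chi> b - 1) * (\<Sum>a\<in>UNIV. r a) = 0" by (simp add: left_diff_distrib)
  then show ?thesis using b(2) by simp
qed

text \<open>The value of \<chi>, extended by zero, on its own idempotent; it is the factor by which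
  the idempotent multiplies itself in \<open>U_idem\<close>.\<close>

lemma r_chi_sum: "(\<Sum>a\<in>UNIV - {0}. r a * \<chi> a) = 1"
proof -
  have "(\<Sum>a\<in>UNIV - {0}. r a * \<chi> a) = (\<Sum>a\<in>UNIV - {0 :: 'f}. 1 / (of_nat (card (UNIV :: 'f set)) - 1 :: 'k))" by (rule sum.cong) (auto simp: r_nonzero chi_nonzero)
  also have "\<dots> = (of_nat (card (UNIV :: 'f set)) - 1 :: 'k) * (1 / (of_nat (card (UNIV :: 'f set)) - 1 :: 'k))" unfolding q_eq by simp
  finally show ?thesis using q_nonzero by simp
qed

end

section \<open>The character idempotent in the linearization\<close>

locale linearized_character = pre_tannakian_category C + character \<chi>
  for C :: "('o, 'm, 'f::{field,finite}, 'x) tensor_category_scheme" (structure) and \<chi> :: "'f \<Rightarrow> 'k::field_char_0" +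
  assumes ss: "semisimple C"
begin

abbreviation L :: "('o, 'm \<Rightarrow>\<^sub>0 'k, 'k) tensor_category" where "L \<equiv> linearization C"

text \<open>The image of the idempotent of \<chi> under the ring map from the monoid algebra of the
  field to the endomorphisms of \<open>X\<close> in the linearization.\<close>

definition U :: "'o \<Rightarrow> ('m \<Rightarrow>\<^sub>0 'k)" where
  "U X = (\<Sum>a\<in>UNIV. pm_single (a *\<^sub>m idm C X) (r a))"

sublocale L: enriched_category L
  by (rule linearization_enriched)

lemma bilin_sum:
  "bilin_ext op (\<Sum>a\<in>A. f a) (w :: 'm \<Rightarrow>\<^sub>0 'k) = (\<Sum>a\<in>A. bilin_ext op (f a) w)"
  "bilin_ext op w (\<Sum>a\<in>A. f a) = (\<Sum>a\<in>A. bilin_ext op (w :: 'm \<Rightarrow>\<^sub>0 'k) (f a))"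
  by (induction A rule: infinite_finite_induct) (simp_all add: bilin_add)

lemma scalar_cmp: "X \<in> Obj C \<Longrightarrow> Y \<in> Obj C \<Longrightarrow> f \<in> Hom C X Y \<Longrightarrow> (a *\<^sub>m idm C Y) \<cdot> f = a *\<^sub>m f"
  and cmp_scalar: "X \<in> Obj C \<Longrightarrow> Y \<in> Obj C \<Longrightarrow> f \<in> Hom C X Y \<Longrightarrow> f \<cdot> (a *\<^sub>m idm C X) = a *\<^sub>m f"
  using cmp_smul_left[of X Y Y f "idm C Y" a] cmp_smul_right[of X X Y "idm C X" f a] idm_in idm_left[of X Y f] idm_right[of X Y f] by auto

lemma U_Hom: "X \<in> Obj C \<Longrightarrow> U X \<in> Hom L X X"
  unfolding U_def by (rule L.Hom_sum) (auto intro: smul_in idm_in)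

lemma U_nat:
  assumes "X \<in> Obj C" "Y \<in> Obj C" "f \<in> Hom L X Y"
  shows "U Y \<cdot>\<^bsub>L\<^esub> f = f \<cdot>\<^bsub>L\<^esub> U X"
  unfolding linearization_simps
  by (rule lin_ext[where F = "bilin_ext (cmp C) (U Y)" and G = "\<lambda>f. bilin_ext (cmp C) f (U X)"])
    (use assms in \<open>auto simp: bilin_add U_def bilin_sum sum.distrib subset_iff scalar_cmp[of X Y] cmp_scalar[of X Y] mult.commute intro!: sum.cong\<close>)

text \<open>The idempotent spans a one-dimensional module over the monoid algebra: nonzero
  \<open>b\<close> acts by \<open>\<chi> b\<close> through \<open>r_mult\<close>, and
  \<open>0\<close> acts as zero through \<open>r_sum\<close>.\<close>

lemma U_scalar:
  assumes "X \<in> Obj C"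
  shows "U X \<cdot>\<^bsub>L\<^esub> pm_single (b *\<^sub>m idm C X) c = (if b = 0 then 0 else (c * \<chi> b) *\<^sub>m\<^bsub>L\<^esub> U X)"
proof -
  have "U X \<cdot>\<^bsub>L\<^esub> pm_single (b *\<^sub>m idm C X) c = (\<Sum>a\<in>UNIV. pm_single ((a * b) *\<^sub>m idm C X) (r a * c))"
    by (simp add: U_def bilin_sum scalar_cmp[of X X] smul_in idm_in smul_smul[of X X] assms)
  also have "\<dots> = (if b = 0 then 0 else (c * \<chi> b) *\<^sub>m\<^bsub>L\<^esub> U X)"
  proof (cases "b = 0")
    case True
    \<comment> \<open>For \<open>b = 0\<close> all basis vectors coincide, so the coefficients are
      added up.\<close>
    have "(\<Sum>a\<in>UNIV. pm_single ((a * b) *\<^sub>m idm C X) (r a * c)) = pm_single (0 *\<^sub>m idm C X) (\<Sum>a\<in>UNIV. r a * c)"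
      unfolding True by (rule poly_mapping_eqI) (simp add: lookup_sum lookup_single when_def)
    also have "(\<Sum>a\<in>UNIV. r a * c) = 0" using r_sum by (simp flip: sum_distrib_right)
    finally show ?thesis using True by simp
  next
    case False
    have "(\<Sum>a\<in>UNIV. pm_single ((a * b) *\<^sub>m idm C X) (r a * c)) = (\<Sum>a\<in>UNIV. pm_single ((a * b) *\<^sub>m idm C X) (c * \<chi> b * r (a * b)))"
      by (rule sum.cong[OF refl], subst r_mult[OF False]) (simp add: mult_ac)
    also have "\<dots> = (\<Sum>a\<in>UNIV. pm_single (a *\<^sub>m idm C X) (c * \<chi> b * r a))"
      by (rule sum_shift[OF False])
    also have "\<dots> = (c * \<chi> b) *\<^sub>m\<^bsub>L\<^esub> U X"
      unfolding U_def linearization_simps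
      by (rule poly_mapping_eqI, unfold lookup_scale lookup_sum lookup_single when_def sum_distrib_left, rule sum.cong) simp_all
    finally show ?thesis using False by simp
  qed
  finally show ?thesis .
qed

lemma scale_sum_left: "(\<Sum>a\<in>A. g a *\<^sub>m\<^bsub>L\<^esub> v) = (\<Sum>a\<in>A. g a) *\<^sub>m\<^bsub>L\<^esub> v"
  by (rule poly_mapping_eqI) (simp add: lookup_sum lookup_scale sum_distrib_right)

lemma U_idem:
  assumes "X \<in> Obj C"
  shows "U X \<cdot>\<^bsub>L\<^esub> U X = U X"
proof -
  have "U X \<cdot>\<^bsub>L\<^esub> U X = (\<Sum>b\<in>UNIV. U X \<cdot>\<^bsub>L\<^esub> pm_single (b *\<^sub>m idm C X) (r b))"
    unfolding linearization_simps by (subst (2) U_def) (rule bilin_sum(2))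
  also have "\<dots> = (\<Sum>b\<in>UNIV - {0}. (r b * \<chi> b) *\<^sub>m\<^bsub>L\<^esub> U X)"
    unfolding U_scalar[OF assms] by (rule sum.mono_neutral_cong_right) auto
  also have "\<dots> = (\<Sum>b\<in>UNIV - {0}. r b * \<chi> b) *\<^sub>m\<^bsub>L\<^esub> U X" by (rule scale_sum_left)
  also have "\<dots> = U X" unfolding r_chi_sum by (rule poly_mapping_eqI) (simp add: lookup_scale)
  finally show ?thesis .
qed

lemma U_ten:
  assumes "X \<in> Obj C" "Y \<in> Obj C"
  shows "U (X \<otimes>\<^sub>o Y) = U X \<otimes>\<^sub>m\<^bsub>L\<^esub> idm L Y" "U (X \<otimes>\<^sub>o Y) = idm L X \<otimes>\<^sub>m\<^bsub>L\<^esub> U Y"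
proof -
  have "(a *\<^sub>m idm C X) \<otimes>\<^sub>m idm C Y = a *\<^sub>m idm C (X \<otimes>\<^sub>o Y)" "idm C X \<otimes>\<^sub>m (a *\<^sub>m idm C Y) = a *\<^sub>m idm C (X \<otimes>\<^sub>o Y)" for a
    using tenM_smul_left[of X X Y Y "idm C X" "idm C Y" a] tenM_smul_right[of X X Y Y "idm C X" "idm C Y" a] assms idm_in tenM_idm by auto
  then show "U (X \<otimes>\<^sub>o Y) = U X \<otimes>\<^sub>m\<^bsub>L\<^esub> idm L Y" "U (X \<otimes>\<^sub>o Y) = idm L X \<otimes>\<^sub>m\<^bsub>L\<^esub> U Y"
    by (simp_all add: U_def bilin_sum)
qed

text \<open>As the endomorphisms of the unit of \<open>C\<close> are scalars, those of the unit of
  the linearization form the monoid algebra of the field, where \<open>U_scalar\<close> determines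
  all products with the idempotent.\<close>

lemma U_end_unit:
  assumes v: "v \<in> Hom L (unt C) (unt C)"
  shows "\<exists>c. U (unt C) \<cdot>\<^bsub>L\<^esub> v = c *\<^sub>m\<^bsub>L\<^esub> U (unt C)"
proof -
  let ?U = "U (unt C)"
  have ex: "\<exists>c. ?U \<cdot>\<^bsub>L\<^esub> pm_single x (pm_lookup v x) = c *\<^sub>m\<^bsub>L\<^esub> ?U" if "x \<in> pm_keys v" for x
  proof -
    have "x \<in> Hom C (unt C) (unt C)" using v that by auto
    then obtain a where x: "x = a *\<^sub>m idm C (unt C)" using end_unit unfolding bij_betw_def by blast
    have z: "0 = 0 *\<^sub>m\<^bsub>L\<^esub> ?U" by (rule poly_mapping_eqI) (simp add: lookup_scale)
    show ?thesis unfolding x U_scalar[OF unt_in] using z by (cases "a = 0") auto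
  qed
  then obtain c where c: "\<And>x. x \<in> pm_keys v \<Longrightarrow> ?U \<cdot>\<^bsub>L\<^esub> pm_single x (pm_lookup v x) = c x *\<^sub>m\<^bsub>L\<^esub> ?U" by metis
  have "?U \<cdot>\<^bsub>L\<^esub> v = (\<Sum>x\<in>pm_keys v. ?U \<cdot>\<^bsub>L\<^esub> pm_single x (pm_lookup v x))"
    unfolding linearization_simps by (subst (1) poly_mapping_sum_single[of v]) (rule bilin_sum(2))
  also have "\<dots> = (\<Sum>x\<in>pm_keys v. c x *\<^sub>m\<^bsub>L\<^esub> ?U)" by (rule sum.cong) (use c in auto)
  finally show ?thesis unfolding scale_sum_left by blast
qed

text \<open>The coefficient of the identity is \<open>r 1\<close>, which is nonzero. No other term
  contributes to it, because distinct scalars give distinct endomorphisms of the unit.\<close>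

lemma U_unit_nonzero: "U (unt C) \<noteq> 0"
proof
  have inj: "a *\<^sub>m idm C (unt C) = 1 *\<^sub>m idm C (unt C) \<longleftrightarrow> a = 1" for a
    using end_unit unfolding bij_betw_def inj_def by blast
  assume "U (unt C) = 0"
  then have "0 = pm_lookup (U (unt C)) (1 *\<^sub>m idm C (unt C))" by simp
  also have "\<dots> = (\<Sum>a\<in>UNIV. if a = 1 then r a else 0)"
    unfolding U_def lookup_sum lookup_single when_def inj ..
  also have "\<dots> = r 1" by simp
  also have "\<dots> \<noteq> 0" using q_nonzero chi_nonzero[of 1] by (simp add: r_nonzero)
  finally show False by simp
qed

theorem chi_category_pre_tannakian:
  "pre_tannakian_category (chi_category C \<chi>) \<and> semisimple (chi_category C \<chi>)"
proof -
  let ?u = "\<lambda>Xs. diag_arrow L Xs Xs (map U Xs)"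
  interpret A: central_idempotent L.AE src tgt ?u
  proof (rule L.AE_central_idempotent)
    fix X Y assume "X \<in> Obj L" "Y \<in> Obj L"
    then have X: "X \<in> Obj C" and Y: "Y \<in> Obj C" by simp_all
    show "U X \<in> Hom L X X" "U X \<cdot>\<^bsub>L\<^esub> U X = U X" using U_Hom[OF X] U_idem[OF X] .
    show "U Y \<cdot>\<^bsub>L\<^esub> f = f \<cdot>\<^bsub>L\<^esub> U X" if "f \<in> Hom L X Y" for f by (rule U_nat[OF X Y that])
    show "U (X \<otimes>\<^sub>o\<^bsub>L\<^esub> Y) = U X \<otimes>\<^sub>m\<^bsub>L\<^esub> idm L Y" "U (X \<otimes>\<^sub>o\<^bsub>L\<^esub> Y) = idm L X \<otimes>\<^sub>m\<^bsub>L\<^esub> U Y"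
      using U_ten[OF X Y] unfolding linearization_simps(2) .
  qed
  have fin: "finite (UNIV :: 'f set)" by simp
  have fdL: "finite_dim_hom L X Y" if "X \<in> Obj L" "Y \<in> Obj L" for X Y
    by (rule finite_dim_linearization, rule finite_Hom[OF fin]) (use that in simp_all)
  have fd: "finite_dim_hom L.AE Xs Ys" if "Xs \<in> Obj L.AE" "Ys \<in> Obj L.AE" for Xs Ys
    by (rule L.AE_finite_dim[OF fdL that])
  have rigidL: "\<exists>D. is_dual L X D" if "X \<in> Obj L" for X
    using is_dual_linearization[OF symmetric_monoidal_category_axioms] rigid that by (metis linearization_simps(1))
  have reg: "regular L.AE"
    by (rule A.semiprime_imp_regular[OF L.AE_semiprime[OF linearization_semiprime[OF fin ss]] fd])
  have u1: "?u (unt L.AE) = mk_arrow [unt C] [unt C] (\<lambda>_ _. U (unt C))"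
    by (auto simp: L.AE_simps diag_arrow_def intro!: mk_arrow_eqI)
  have "pre_tannakian_category A.S \<and> semisimple A.S"
  proof (rule A.S_pre_tannakian[OF reg fd])
    show "\<exists>D. is_dual L.AE Xs D" if "Xs \<in> Obj L.AE" for Xs by (rule L.AE_rigid[OF rigidL that])
    show "?u (unt L.AE) \<noteq> zeroM L.AE (unt L.AE) (unt L.AE)"
      unfolding u1 using U_unit_nonzero by (auto simp: L.AE_simps dest!: mk_arrow_eqD[of _ _ _ _ 0 0])
    fix f assume "f \<in> Hom L.AE (unt L.AE) (unt L.AE)"
    then obtain F where F: "f = mk_arrow [unt C] [unt C] F" "L.mor [unt C] [unt C] F"
      using L.Hom_AE by (auto simp: L.AE_simps)
    then obtain c where c: "U (unt C) \<cdot>\<^bsub>L\<^esub> F 0 0 = c *\<^sub>m\<^bsub>L\<^esub> U (unt C)" using U_end_unit[of "F 0 0"] by (auto simp: L.mor_def)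
    have "?u (unt L.AE) \<cdot>\<^bsub>L.AE\<^esub> f = c *\<^sub>m\<^bsub>L.AE\<^esub> ?u (unt L.AE)"
      unfolding u1 unfolding F(1) L.cmp_AE L.AE_simps by (rule mk_arrow_eqI) (use c in simp)
    then show "\<exists>c. ?u (unt L.AE) \<cdot>\<^bsub>L.AE\<^esub> f = c *\<^sub>m\<^bsub>L.AE\<^esub> ?u (unt L.AE)" by blast
  qed
  moreover have "chi_category C \<chi> = A.S"
    unfolding chi_category_eq U_def[abs_def] r_def ..
  ultimately show ?thesis by simp
qed

end

theorem theorem1p4:
  fixes E :: "('o, 'm, 'f::{field,finite}) tensor_category"
    and \<chi> :: "'f \<Rightarrow> 'k::{alg_closed_field,field_char_0}"
  assumes "pre_tannakian_category E"
    and "semisimple E"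
    and "is_character \<chi>"
  shows "pre_tannakian_category (chi_category E \<chi>) \<and> semisimple (chi_category E \<chi>)"
  by (rule linearized_character.chi_category_pre_tannakian)
    (intro linearized_character.intro character.intro linearized_character_axioms.intro assms)

end
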